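(* Let $p,q$ be positive integers and $G\in L^{\infty}_{q\times p}$, and let $H:H^2_p\to K^2_q$, $Hf=P_-(Gf)$, be the Hankel operator of $G$. Assume: (C1) $H$ has finite rank; (C2) no maximizing vector of $H$ belongs to $SH^2_p$, and the linear span of the maximizing vectors of $H$ has dimension $p$. Let $\mathcal M_0$ be a finite dimensional subspace of $H^2_p$ with $S^*\mathcal M_0\subset\mathcal M_0$, and define recursively $\mathcal M_k=\ker S^*\oplus S\mathcal M_{k-1}$ for $k\ge 1$. Let $F$ be the unique optimal solution of the Nehari problem for $G$, and for each $k\ge1$ let $F_k$ be the central optimal solution of the $\mathcal M_k$-restricted Nehari problem for $G$. Then $G-F$ is a rational matrix function belonging to $L^\infty_{q\times p}$, and for $k$ sufficiently large the same holds for $G-F_k$. Furthermore $\|F_k-F\|_\infty\to 0$ as $k\to\infty$. More precisely, if $0<r<1$ is such that all poles in the open unit disc $\mathbb D$ of the co-analytic part $G_-$ of $G$ (a rational function by (C1)) lie in $\mathbb D_r=\{\lambda:|\lambda|<r\}$, then there is $L>0$ such that $\|F_k-F\|_\infty<Lr^k$ for all $k$ large enough.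
   Context: $L^2_{q\times p}$, $H^2_{q\times p}$, $L^\infty_{q\times p}$, $H^\infty_{q\times p}$ denote $q\times p$ matrices with entries in $L^2$ of the unit circle $\mathbb T$, in the Hardy space $H^2$, in $L^\infty(\mathbb T)$, in $H^\infty$; $K^2=L^2\ominus H^2$ and $K^2_{q\times p}$ is defined entrywise; $L^2_p=L^2_{p\times1}$, etc. Every $\Phi\in L^2_{q\times p}$ decomposes uniquely as $\Phi=\Phi_++\Phi_-$ with $\Phi_+\in H^2_{q\times p}$ (analytic part) and $\Phi_-\in K^2_{q\times p}$ (co-analytic part). $P_-$ is the orthogonal projection of $L^2_q$ onto $K^2_q$; $S$ is the forward shift (multiplication by $z$) on $H^2_p$. A maximizing vector of a bounded operator $T$ is a nonzero $h$ with $\|Th\|=\|T\|\,\|h\|$. $E:\mathbb C^p\to H^2_p$ maps $u$ to the constant function $u$; $\Pi:K^2_q\to\mathbb C^q$, $\Pi f=\frac1{2\pi}\int_0^{2\pi}e^{it}f(e^{it})\,dt$ (the Fourier coefficient of $e^{-it}$). The Nehari problem for $G$: minimize $\|G-F\|_\infty$ over $F\in H^\infty_{q\times p}$; a minimizer is an optimal solution (under (C1),(C2) it is unique). For a closed subspace $\mathcal M\subset H^2_p$ with $S^*\mathcal M\subset\mathcal M$ and $\ker S^*\subset\mathcal M$: $\Phi\in L^2_{q\times p}$ has finite $\mathcal M$-norm if $h\mapsto\Phi h$ is a bounded operator from $\mathcal M$ into $L^2_q$, and $\|\Phi\|_{\mathcal M}$ is its norm. The $\mathcal M$-restricted Nehari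 problem asks to minimize $\|G-F\|_{\mathcal M}$ over $F\in H^2_{q\times p}$ of finite $\mathcal M$-norm. Put $\gamma_{\mathcal M}=\|H|_{\mathcal M}\|$, let $P_{\mathcal M}$ be the orthogonal projection onto $\mathcal M$, $R_{\mathcal M}$ the orthogonal projection of $H^2_p$ onto $S^*\mathcal M$, $Q_{\mathcal M}=SR_{\mathcal M}$, $D_{\mathcal M}=(\gamma_{\mathcal M}^2I-P_{\mathcal M}H^*HP_{\mathcal M})^{1/2}$. Let $\omega=\begin{bmatrix}\omega_1\\ \omega_2\end{bmatrix}:H^2_p\to\mathbb C^q\oplus H^2_p$ be the partial isometry with initial space $\overline{\operatorname{Im}D_{\mathcal M}Q_{\mathcal M}}$ determined by $\omega(D_{\mathcal M}Q_{\mathcal M}h)=(\Pi HR_{\mathcal M}h,\;D_{\mathcal M}R_{\mathcal M}h)$ for $h\in H^2_p$ and $\omega=0$ on $\ker Q_{\mathcal M}^*D_{\mathcal M}$. The central optimal solution of the $\mathcal M$-restricted Nehari problem is $F_{\mathcal M}=G-\Phi_{\mathcal M}$, where $\Phi_{\mathcal M}\in L^2_{q\times p}$ has co-analytic part $G_-$ and analytic part $\Phi_{\mathcal M,+}(\lambda)=\omega_1(I-\lambda\omega_2)^{-1}D_{\mathcal M}E$, $\lambda\in\mathbb D$ (it is the optimal solution corresponding to the central interpolant of relaxed commutant lifting theory). *)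

theory Defs
  imports "HOL-Complex_Analysis.Complex_Analysis" "HOL-Probability.Essential_Supremum"
    "HOL-Computational_Algebra.Polynomial"
begin

definition circ :: "real measure" where
  "circ = lebesgue_on {0..2*pi}"

definition fc :: "(real \<Rightarrow> complex) \<Rightarrow> int \<Rightarrow> complex" where
  "fc f n = (1 / (2*pi)) * integral\<^sup>L circ (\<lambda>t. f t * exp (- \<i> * of_int n * of_real t))"

definition fcm :: "(real \<Rightarrow> complex^'p^'q) \<Rightarrow> int \<Rightarrow> complex^'p^'q" where
  "fcm G n = (\<chi> i j. fc (\<lambda>t. G t $ i $ j) n)"

definition L2m :: "(real \<Rightarrow> complex^'p^'q) \<Rightarrow> bool" where
  "L2m G \<longleftrightarrow> (\<forall>i j. (\<lambda>t. G t $ i $ j) \<in> borel_measurable circ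
      \<and> integrable circ (\<lambda>t. (cmod (G t $ i $ j))^2))"

definition mnorm :: "complex^'p^'q \<Rightarrow> real" where
  "mnorm A = onorm (\<lambda>x. A *v x)"

definition supnorm :: "(real \<Rightarrow> complex^'p^'q) \<Rightarrow> ereal" where
  "supnorm G = esssup circ (\<lambda>t. ereal (mnorm (G t)))"

definition Linf :: "(real \<Rightarrow> complex^'p^'q) \<Rightarrow> bool" where
  "Linf G \<longleftrightarrow> (\<forall>i j. (\<lambda>t. G t $ i $ j) \<in> borel_measurable circ) \<and> supnorm G < \<infinity>"

definition Hinf :: "(real \<Rightarrow> complex^'p^'q) \<Rightarrow> bool" where
  "Hinf F \<longleftrightarrow> Linf F \<and> (\<forall>n<0. fcm F n = 0)"

definition nehari_optimal :: "(real \<Rightarrow> complex^'p^'q) \<Rightarrow> (real \<Rightarrow> complex^'p^'q) \<Rightarrow> bool" where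
  "nehari_optimal G F \<longleftrightarrow> Hinf F \<and>
     (\<forall>F'. Hinf F' \<longrightarrow> supnorm (\<lambda>t. G t - F t) \<le> supnorm (\<lambda>t. G t - F' t))"

definition rational_on_circle :: "(real \<Rightarrow> complex^'p^'q) \<Rightarrow> bool" where
  "rational_on_circle \<Phi> \<longleftrightarrow> (\<exists>(N :: complex poly^'p^'q) d. d \<noteq> 0 \<and>
      (AE t in circ. \<forall>i j. \<Phi> t $ i $ j = poly (N $ i $ j) (cis t) / poly d (cis t)))"

definition coanalytic_rep :: "(real \<Rightarrow> complex^'p^'q) \<Rightarrow> complex poly^'p^'q \<Rightarrow> complex poly \<Rightarrow> bool" where
  "coanalytic_rep G N d \<longleftrightarrow> (\<forall>z. cmod z = 1 \<longrightarrow> poly d z \<noteq> 0) \<and>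
     (\<forall>n i j. fc (\<lambda>t. poly (N $ i $ j) (cis t) / poly d (cis t)) n =
              (if n < 0 then fc (\<lambda>t. G t $ i $ j) n else 0))"

definition poles_in :: "(real \<Rightarrow> complex^'p^'q) \<Rightarrow> real \<Rightarrow> bool" where
  "poles_in G r \<longleftrightarrow> (\<forall>N d. coanalytic_rep G N d \<longrightarrow>
     (\<forall>i j z. cmod z < 1 \<longrightarrow> is_pole (\<lambda>w. poly (N $ i $ j) w / poly d w) z \<longrightarrow> cmod z < r))"

text \<open>H^2_n is identified (unitarily, via Fourier coefficients) with square summable sequences
  h :: nat => C^n (h k = coefficient of e^{ikt}); K^2_n with sequences g :: nat => C^n
  (g k = coefficient of e^{-i(k+1)t}).\<close>

type_synonym 'n seq = "nat \<Rightarrow> complex^'n"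

definition l2 :: "'n::finite seq set" where
  "l2 = {f. summable (\<lambda>n. (norm (f n))^2)}"

definition vip :: "complex^'n::finite \<Rightarrow> complex^'n \<Rightarrow> complex" where
  "vip x y = (\<Sum>i\<in>UNIV. x $ i * cnj (y $ i))"

definition ip :: "'n::finite seq \<Rightarrow> 'n seq \<Rightarrow> complex" where
  "ip f g = (\<Sum>n. vip (f n) (g n))"

definition nrm :: "'n::finite seq \<Rightarrow> real" where
  "nrm f = sqrt (\<Sum>n. (norm (f n))^2)"

definition sadd :: "'n::finite seq \<Rightarrow> 'n seq \<Rightarrow> 'n seq" where
  "sadd f g = (\<lambda>n. f n + g n)"

definition ssub :: "'n::finite seq \<Rightarrow> 'n seq \<Rightarrow> 'n seq" where
  "ssub f g = (\<lambda>n. f n - g n)"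

definition zs :: "'n::finite seq" where
  "zs = (\<lambda>n. 0)"

definition smult :: "complex \<Rightarrow> 'n::finite seq \<Rightarrow> 'n seq" where
  "smult c f = (\<lambda>n. c *s f n)"

definition cspan :: "'n::finite seq set \<Rightarrow> 'n seq set" where
  "cspan B = {f. \<exists>A c. finite A \<and> A \<subseteq> B \<and> f = (\<lambda>n. \<Sum>b\<in>A. c b *s b n)}"

definition cindep :: "'n::finite seq set \<Rightarrow> bool" where
  "cindep B \<longleftrightarrow> (\<forall>A c. finite A \<and> A \<subseteq> B \<and> (\<lambda>n. \<Sum>b\<in>A. c b *s b n) = (\<lambda>n. 0)
        \<longrightarrow> (\<forall>b\<in>A. c b = 0))"

definition span_dim :: "'n::finite seq set \<Rightarrow> nat \<Rightarrow> bool" where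
  "span_dim A k \<longleftrightarrow> (\<exists>B. B \<subseteq> A \<and> finite B \<and> card B = k \<and> cindep B \<and> A \<subseteq> cspan B)"

definition fin_dim_subspace :: "'n::finite seq set \<Rightarrow> bool" where
  "fin_dim_subspace M \<longleftrightarrow> (\<exists>B. finite B \<and> B \<subseteq> l2 \<and> M = cspan B)"

definition shift :: "'n::finite seq \<Rightarrow> 'n seq" where
  "shift h = (\<lambda>n. if n = 0 then 0 else h (n - 1))"

definition bshift :: "'n::finite seq \<Rightarrow> 'n seq" where
  "bshift h = (\<lambda>n. h (Suc n))"

definition Eop :: "complex^'n::finite \<Rightarrow> 'n seq" where
  "Eop u = (\<lambda>n. if n = 0 then u else 0)"

primrec Mseq :: "'n::finite seq set \<Rightarrow> nat \<Rightarrow> 'n seq set" where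
  "Mseq M0 0 = M0"
| "Mseq M0 (Suc k) = {sadd (Eop u) (shift m) | u m. m \<in> Mseq M0 k}"

definition is_bounded_op :: "('a::finite seq \<Rightarrow> 'b::finite seq) \<Rightarrow> bool" where
  "is_bounded_op T \<longleftrightarrow> (\<forall>f\<in>l2. T f \<in> l2) \<and> (\<forall>f\<in>l2. \<forall>g\<in>l2. T (sadd f g) = sadd (T f) (T g))
     \<and> (\<forall>c. \<forall>f\<in>l2. T (smult c f) = smult c (T f)) \<and> (\<exists>C. \<forall>f\<in>l2. nrm (T f) \<le> C * nrm f)"

definition opnorm_on :: "('a::finite seq \<Rightarrow> 'b::finite seq) \<Rightarrow> 'a seq set \<Rightarrow> real" where
  "opnorm_on T A = Sup {nrm (T f) / nrm f | f. f \<in> A \<and> f \<noteq> zs}"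

definition adj :: "('a::finite seq \<Rightarrow> 'b::finite seq) \<Rightarrow> 'b seq \<Rightarrow> 'a seq" where
  "adj T g = (if g \<in> l2 then (THE f. f \<in> l2 \<and> (\<forall>h\<in>l2. ip (T h) g = ip h f)) else zs)"

definition proj :: "'n::finite seq set \<Rightarrow> 'n seq \<Rightarrow> 'n seq" where
  "proj M f = (if f \<in> l2 then (THE g. g \<in> M \<and> (\<forall>m\<in>M. ip (ssub f g) m = 0)) else zs)"

definition psqrt :: "('n::finite seq \<Rightarrow> 'n seq) \<Rightarrow> 'n seq \<Rightarrow> 'n seq" where
  "psqrt T = (THE R. is_bounded_op R \<and> (\<forall>f. f \<notin> l2 \<longrightarrow> R f = zs)
      \<and> (\<forall>f\<in>l2. ip (R f) f \<in> \<real> \<and> Re (ip (R f) f) \<ge> 0) \<and> (\<forall>f\<in>l2. R (R f) = T f))"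

text \<open>H h = P_-(G h) in Fourier coordinates: (Hh)_k = sum_m G^(-(k+1)-m) h_m.\<close>
definition hank :: "(real \<Rightarrow> complex^'p^'q) \<Rightarrow> 'p::finite seq \<Rightarrow> 'q::finite seq" where
  "hank G h = (\<lambda>k. \<Sum>m. fcm G (- int k - 1 - int m) *v h m)"

definition maximizing :: "(real \<Rightarrow> complex^'p^'q) \<Rightarrow> 'p::finite seq \<Rightarrow> bool" where
  "maximizing G h \<longleftrightarrow> h \<in> l2 \<and> h \<noteq> zs \<and>
     nrm ((hank G :: 'p seq \<Rightarrow> 'q::finite seq) h) = opnorm_on (hank G :: 'p seq \<Rightarrow> 'q seq) l2 * nrm h"

definition gammaM :: "(real \<Rightarrow> complex^'p^'q::finite) \<Rightarrow> 'p::finite seq set \<Rightarrow> real" where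
  "gammaM G M = opnorm_on (hank G :: 'p seq \<Rightarrow> 'q seq) M"

definition RM :: "'p::finite seq set \<Rightarrow> 'p seq \<Rightarrow> 'p seq" where
  "RM M = proj (bshift ` M)"

definition QM :: "'p::finite seq set \<Rightarrow> 'p seq \<Rightarrow> 'p seq" where
  "QM M = (\<lambda>h. shift (RM M h))"

definition DM :: "(real \<Rightarrow> complex^'p^'q::finite) \<Rightarrow> 'p::finite seq set \<Rightarrow> 'p seq \<Rightarrow> 'p seq" where
  "DM G M = psqrt (\<lambda>f. ssub (smult (of_real ((gammaM G M)^2)) f)
      (proj M (adj (hank G :: 'p seq \<Rightarrow> 'q seq) (hank G (proj M f)))))"

text \<open>The partial isometry omega = (omega1, omega2) : H^2_p -> C^q (+) H^2_p.\<close>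
definition omega :: "(real \<Rightarrow> complex^'p^'q::finite) \<Rightarrow> 'p::finite seq set \<Rightarrow> 'p seq \<Rightarrow> (complex^'q) \<times> 'p seq" where
  "omega G M = (THE w. (\<forall>g. g \<notin> l2 \<longrightarrow> w g = (0, zs))
     \<and> (\<forall>g\<in>l2. snd (w g) \<in> l2)
     \<and> (\<forall>f\<in>l2. \<forall>g\<in>l2. w (sadd f g) = (fst (w f) + fst (w g), sadd (snd (w f)) (snd (w g))))
     \<and> (\<forall>c. \<forall>f\<in>l2. w (smult c f) = (c *s fst (w f), smult c (snd (w f))))
     \<and> (\<exists>C. \<forall>g\<in>l2. (norm (fst (w g)))^2 + (nrm (snd (w g)))^2 \<le> C^2 * (nrm g)^2)
     \<and> (\<forall>h\<in>l2. w (DM G M (QM M h)) = (hank G (RM M h) 0, DM G M (RM M h)))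
     \<and> (\<forall>g\<in>l2. adj (QM M) (DM G M g) = zs \<longrightarrow> w g = (0, zs)))"

definition resol :: "(real \<Rightarrow> complex^'p^'q::finite) \<Rightarrow> 'p::finite seq set \<Rightarrow> complex \<Rightarrow> complex^'p \<Rightarrow> 'p seq" where
  "resol G M la u = (THE x. x \<in> l2 \<and>
      ssub x (smult la (snd (omega G M x :: (complex^'q) \<times> 'p seq))) = DM G M (Eop u))"

definition Phiplus :: "(real \<Rightarrow> complex^'p^'q::finite) \<Rightarrow> 'p::finite seq set \<Rightarrow> complex \<Rightarrow> complex^'p^'q" where
  "Phiplus G M la = (\<chi> i j. fst (omega G M (resol G M la (axis j 1))) $ i)"

text \<open>Phi is (a representative of) Phi_M = G_- + Phi_{M,+} on the circle, i.e. Phi = G - F_M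
  for the central optimal solution F_M of the M-restricted Nehari problem: its Fourier
  coefficients are those of G for negative indices and the Taylor coefficients at 0 of
  Phi_{M,+} for nonnegative ones.\<close>
definition central_sol :: "(real \<Rightarrow> complex^'p^'q::finite) \<Rightarrow> 'p::finite seq set \<Rightarrow> (real \<Rightarrow> complex^'p^'q) \<Rightarrow> bool" where
  "central_sol G M \<Phi> \<longleftrightarrow> L2m \<Phi> \<and> (\<forall>n i j. fc (\<lambda>t. \<Phi> t $ i $ j) n =
      (if n < 0 then fc (\<lambda>t. G t $ i $ j) n
       else (deriv ^^ nat n) (\<lambda>z. Phiplus G M z $ i $ j) 0 / fact (nat n)))"

end

theory Submission
  imports Defs "HOL-Library.Function_Algebras" "HOL-Computational_Algebra.Fundamental_Theorem_Algebra"
begin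

text \<open>
  In Fourier coordinates $H$ is a block Hankel operator whose kernel decays like $r^n$.
  Condition (C2) says that the eigenspace of $H^*H$ for $\gamma^2 = \|H\|^2$ consists of vectors $V u$
  with $(V u)(0) = u$, $u \in \mathbf C^p$. The form $q(h) = \gamma^2\|h\|^2 - \|Hh\|^2$ satisfies
  $q(Sh) = q(h) + |(Hh)_0|^2$. If $V u$ vanished at $\mu$, $|\mu| \le 1$, then $V u = (S - \mu)x$ and this
  identity would give $q(Sx) = 0$, against (C2); so $V$ is invertible on the closed disc.
  The optimal error is $\Phi_0 = (H V)\,V^{-1}$: comparison of Fourier coefficients
  shows that $|(H V u)(t)| = \gamma\,|(V u)(t)|$ on the circle, and an integral of squares gives uniqueness.

  The central solution of the restricted problem has the same shape $\Phi_k = (H V_k)\,V_k^{-1}$, where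
  $V_k u = u + S x_k$ and $x_k \in S^*\mathcal M_k = \mathcal M_{k-1}$ solves
  $(\gamma_k^2 - P S^*H^*H S P)\,x_k = P S^*H^*H u$ with $P$ the projection onto $\mathcal M_{k-1}$.
  Since $\|HSh\|^2 \le \theta\,\|h\|^2$ for some $\theta < \gamma^2$ by (C1) and (C2), these equations are uniformly
  well conditioned, and $I - P$ is $O(r^k)$ on sequences that decay like $r^n$. Hence
  $V_k - V = O(r^k)$ in $\ell^1$, which bounds $\Phi_k - \Phi_0$ uniformly on the circle.
\<close>

no_notation fps_nth (infixl "$" 75)

section \<open>Square summable sequences and bounded operators\<close>

lemma vip_add_left: "vip (x + y) z = vip x z + vip y z"
  by (simp add: vip_def algebra_simps sum.distrib)

lemma vip_diff_left: "vip (x - y) z = vip x z - vip y z"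
  by (simp add: vip_def algebra_simps sum_subtractf)

lemma vip_scale_left: "vip (c *s x) z = c * vip x z"
  by (simp add: vip_def algebra_simps sum_distrib_left)

lemma vip_cnj: "cnj (vip x y) = vip y x"
  by (simp add: vip_def mult.commute)

lemma vip_self: "vip x x = of_real ((norm x)^2)"
proof -
  have "vip x x = (\<Sum>i\<in>UNIV. of_real ((cmod (x $ i))^2))"
    unfolding vip_def complex_norm_square ..
  then show ?thesis
    by (simp add: norm_vec_def L2_set_def sum_nonneg)
qed

lemma vip_zero [simp]: "vip 0 x = 0" "vip x 0 = 0"
  by (simp_all add: vip_def)

lemma cmod_vip_le: "cmod (vip x y) \<le> norm x * norm y"
proof -
  have "cmod (vip x y) \<le> (\<Sum>i\<in>UNIV. \<bar>cmod (x $ i)\<bar> * \<bar>cmod (y $ i)\<bar>)"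
    unfolding vip_def by (rule order_trans[OF norm_sum]) (simp add: norm_mult)
  also have "\<dots> \<le> norm x * norm y"
    unfolding norm_vec_def by (rule L2_set_mult_ineq)
  finally show ?thesis .
qed

lemma norm_scale_vec: "norm (c *s (x::complex^'n)) = cmod c * norm x"
  by (simp add: norm_vec_def norm_mult L2_set_right_distrib)

lemma zs_eq [simp]: "zs = 0" by (simp add: zs_def fun_eq_iff)
lemma sadd_eq [simp]: "sadd f g = f + g" by (simp add: sadd_def fun_eq_iff)
lemma ssub_eq [simp]: "ssub f g = f - g" by (simp add: ssub_def fun_eq_iff)
lemma smult_apply: "smult c f n = c *s f n" by (simp add: smult_def)

declare plus_fun_apply [simp del] zero_fun_apply [simp del] minus_apply [simp del] uminus_apply [simp del]

lemma sum_seq_apply: "(\<Sum>a\<in>A. f a) n = (\<Sum>a\<in>A. f a n)" for f :: "'a \<Rightarrow> 'n::finite seq"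
  by (induction A rule: infinite_finite_induct) (auto simp: plus_fun_apply zero_fun_apply)

interpretation sv: vector_space "smult :: complex \<Rightarrow> 'n::finite seq \<Rightarrow> 'n seq"
  by standard (auto simp: fun_eq_iff plus_fun_apply smult_apply vector_add_ldistrib vector_sadd_rdistrib)

lemmas seq_apply = plus_fun_apply zero_fun_apply smult_apply sum_seq_apply minus_apply uminus_apply

lemma shift_0 [simp]: "shift h 0 = 0" and shift_Suc [simp]: "shift h (Suc n) = h n"
  by (simp_all add: shift_def)
lemma bshift_apply: "bshift h n = h (Suc n)" by (simp add: bshift_def)
lemma Eop_0 [simp]: "Eop u 0 = u" and Eop_Suc [simp]: "Eop u (Suc n) = 0"
  by (simp_all add: Eop_def)
lemma bshift_shift [simp]: "bshift (shift h) = h" by (simp add: fun_eq_iff bshift_apply)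
lemma bshift_Eop [simp]: "bshift (Eop u) = 0" by (simp add: fun_eq_iff seq_apply bshift_apply)
lemma Eop_shift_bshift: "f = Eop (f 0) + shift (bshift f)"
  by (rule ext, case_tac x) (auto simp: seq_apply bshift_apply)
lemma shift_add: "shift (f + g) = shift f + shift g"
  and shift_diff: "shift (f - g) = shift f - shift g"
  and shift_smult: "shift (smult c f) = smult c (shift f)"
  and shift_zero [simp]: "shift 0 = 0"
  by (rule ext, case_tac x, simp_all add: seq_apply)+
lemma bshift_add: "bshift (f + g) = bshift f + bshift g"
  and bshift_diff: "bshift (f - g) = bshift f - bshift g"
  and bshift_smult: "bshift (smult c f) = smult c (bshift f)"
  and bshift_zero [simp]: "bshift 0 = 0"
  by (rule ext, simp add: seq_apply bshift_apply)+
lemma Eop_add: "Eop (u + v) = Eop u + Eop v"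
  and Eop_scale: "Eop (c *s u) = smult c (Eop u)"
  and Eop_zero [simp]: "Eop 0 = 0"
  by (rule ext, case_tac x, simp_all add: seq_apply)+

lemma l2I: "summable (\<lambda>n. (norm (f n))^2) \<Longrightarrow> f \<in> l2" by (simp add: l2_def)
lemma l2D: "f \<in> l2 \<Longrightarrow> summable (\<lambda>n. (norm (f n))^2)" by (simp add: l2_def)

lemma l2_add [simp, intro]: assumes "f \<in> l2" "g \<in> l2" shows "f + g \<in> l2"
proof (rule l2I, rule summable_comparison_test')
  show "summable (\<lambda>n. 2 * (norm (f n))^2 + 2 * (norm (g n))^2)"
    using assms by (intro summable_add summable_mult) (auto simp: l2_def)
  fix n :: nat
  have "(norm (f n + g n))^2 \<le> (norm (f n) + norm (g n))^2"
    by (simp add: norm_triangle_ineq power_mono)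
  also have "\<dots> \<le> 2 * (norm (f n))^2 + 2 * (norm (g n))^2"
    using sum_squares_bound[of "norm (f n)" "norm (g n)"] by (simp add: power2_sum)
  finally show "norm ((norm ((f + g) n))^2) \<le> 2 * (norm (f n))^2 + 2 * (norm (g n))^2" by (simp add: seq_apply)
qed

lemma l2_smult [simp, intro]: "f \<in> l2 \<Longrightarrow> smult c f \<in> l2"
  unfolding l2_def by (simp add: seq_apply norm_scale_vec power_mult_distrib summable_mult)

lemma l2_zero [simp, intro]: "0 \<in> l2" by (simp add: seq_apply l2_def)

lemma l2_diff [simp, intro]: assumes "f \<in> l2" "g \<in> l2" shows "f - g \<in> l2"
proof -
  have "f - g = f + smult (-1) g" by (simp add: fun_eq_iff seq_apply)
  then show ?thesis using assms by (simp only: l2_add l2_smult)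
qed

lemma l2_sum [intro]: "(\<And>a. a \<in> A \<Longrightarrow> f a \<in> l2) \<Longrightarrow> (\<Sum>a\<in>A. f a) \<in> l2"
  by (induction A rule: infinite_finite_induct) auto

lemma l2_bshift [simp, intro]: "f \<in> l2 \<Longrightarrow> bshift f \<in> l2"
  unfolding l2_def by (simp add: bshift_apply summable_Suc_iff[of "\<lambda>n. (norm (f n))^2"])

lemma l2_shift [simp, intro]: "f \<in> l2 \<Longrightarrow> shift f \<in> l2"
  unfolding l2_def using summable_Suc_iff[of "\<lambda>n. (norm (shift f n))^2"] by simp

lemma l2_Eop [simp, intro]: "Eop u \<in> l2"
  unfolding l2_def using summable_Suc_iff[of "\<lambda>n. (norm (Eop u n))^2"] by simp

lemma l2_pow:
  fixes T :: "'n::finite seq \<Rightarrow> 'n seq"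
  shows "(\<And>f. f \<in> l2 \<Longrightarrow> T f \<in> l2) \<Longrightarrow> f \<in> l2 \<Longrightarrow> (T ^^ n) f \<in> l2"
  by (induction n) auto

lemma ip_abs_summable:
  assumes "f \<in> l2" "g \<in> l2" shows "summable (\<lambda>n. norm (f n) * norm (g n))"
proof (rule summable_comparison_test')
  show "summable (\<lambda>n. (norm (f n))^2 + (norm (g n))^2)"
    using assms by (intro summable_add) (auto simp: l2_def)
  fix n show "norm (norm (f n) * norm (g n)) \<le> (norm (f n))^2 + (norm (g n))^2"
    using sum_squares_bound[of "norm (f n)" "norm (g n)"]
      mult_nonneg_nonneg[OF norm_ge_zero[of "f n"] norm_ge_zero[of "g n"]]
    unfolding real_norm_def abs_mult abs_norm_cancel by linarith
qed

lemma ip_summable: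
  assumes "f \<in> l2" "g \<in> l2" shows "summable (\<lambda>n. vip (f n) (g n))"
  by (rule summable_comparison_test'[OF ip_abs_summable[OF assms]]) (rule cmod_vip_le)

lemma ip_add_left: "f \<in> l2 \<Longrightarrow> g \<in> l2 \<Longrightarrow> h \<in> l2 \<Longrightarrow> ip (f + g) h = ip f h + ip g h"
  unfolding ip_def by (simp add: seq_apply vip_add_left suminf_add ip_summable)

lemma ip_smult_left: "f \<in> l2 \<Longrightarrow> h \<in> l2 \<Longrightarrow> ip (smult c f) h = c * ip f h"
  unfolding ip_def by (simp add: seq_apply vip_scale_left suminf_mult ip_summable)

lemma ip_diff_left: "f \<in> l2 \<Longrightarrow> g \<in> l2 \<Longrightarrow> h \<in> l2 \<Longrightarrow> ip (f - g) h = ip f h - ip g h"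
  unfolding ip_def by (simp add: seq_apply vip_diff_left suminf_diff ip_summable)

lemma ip_cnj: assumes "f \<in> l2" "g \<in> l2" shows "cnj (ip f g) = ip g f"
proof -
  have "(\<lambda>n. vip (f n) (g n)) sums ip f g"
    unfolding ip_def by (rule summable_sums[OF ip_summable[OF assms]])
  then have "(\<lambda>n. cnj (vip (f n) (g n))) sums cnj (ip f g)" by (simp only: sums_cnj)
  then show ?thesis by (simp add: vip_cnj ip_def sums_unique)
qed

lemma ip_add_right: "f \<in> l2 \<Longrightarrow> g \<in> l2 \<Longrightarrow> h \<in> l2 \<Longrightarrow> ip h (f + g) = ip h f + ip h g"
  using ip_cnj[of "f + g" h] by (simp add: ip_add_left ip_cnj)

lemma ip_diff_right: "f \<in> l2 \<Longrightarrow> g \<in> l2 \<Longrightarrow> h \<in> l2 \<Longrightarrow> ip h (f - g) = ip h f - ip h g"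
  using ip_cnj[of "f - g" h] by (simp add: ip_diff_left ip_cnj)

lemma ip_smult_right: "f \<in> l2 \<Longrightarrow> h \<in> l2 \<Longrightarrow> ip h (smult c f) = cnj c * ip h f"
  using ip_cnj[of "smult c f" h] by (simp add: ip_smult_left ip_cnj)

lemma ip_zero [simp]: "ip 0 f = 0" "ip f 0 = 0"
  by (simp_all add: seq_apply ip_def)

lemma ip_sum_left: "(\<And>a. a \<in> A \<Longrightarrow> f a \<in> l2) \<Longrightarrow> h \<in> l2 \<Longrightarrow> ip (\<Sum>a\<in>A. f a) h = (\<Sum>a\<in>A. ip (f a) h)"
proof (induction A rule: infinite_finite_induct)
  case (insert x F)
  have 1: "f x \<in> l2" "sum f F \<in> l2" using insert.prems by (auto intro: l2_sum)
  have 2: "ip (sum f F) h = (\<Sum>a\<in>F. ip (f a) h)" using insert by blast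
  show ?case unfolding sum.insert[OF insert.hyps] ip_add_left[OF 1 insert.prems(2)] 2 ..
qed simp_all

lemma ip_sum_right: "(\<And>a. a \<in> A \<Longrightarrow> f a \<in> l2) \<Longrightarrow> h \<in> l2 \<Longrightarrow> ip h (\<Sum>a\<in>A. f a) = (\<Sum>a\<in>A. ip h (f a))"
proof (induction A rule: infinite_finite_induct)
  case (insert x F)
  have 1: "f x \<in> l2" "sum f F \<in> l2" using insert.prems by (auto intro: l2_sum)
  have 2: "ip h (sum f F) = (\<Sum>a\<in>F. ip h (f a))" using insert by blast
  show ?case unfolding sum.insert[OF insert.hyps] ip_add_right[OF 1 insert.prems(2)] 2 ..
qed simp_all

lemma nrm_nonneg [simp]: "f \<in> l2 \<Longrightarrow> 0 \<le> nrm f"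
  unfolding nrm_def l2_def by (auto intro!: suminf_nonneg)

lemma nrm_sq: "f \<in> l2 \<Longrightarrow> (nrm f)^2 = (\<Sum>n. (norm (f n))^2)"
  unfolding nrm_def by (subst real_sqrt_pow2) (auto simp: l2_def suminf_nonneg)

lemma ip_self: assumes "f \<in> l2" shows "ip f f = of_real ((nrm f)^2)"
  unfolding ip_def nrm_sq[OF assms] vip_self by (rule suminf_of_real[symmetric]) (rule l2D[OF assms])

lemma norm_le_nrm: assumes "f \<in> l2" shows "norm (f n) \<le> nrm f"
proof -
  have "(norm (f n))^2 = (\<Sum>k\<in>{n}. (norm (f k))^2)" by simp
  also have "\<dots> \<le> (nrm f)^2"
    unfolding nrm_sq[OF assms] by (rule sum_le_suminf) (use l2D[OF assms] in auto)
  finally show ?thesis by (rule power2_le_imp_le) (simp add: assms)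
qed

lemma nrm_zero [simp]: "nrm 0 = 0" by (simp add: seq_apply nrm_def)

lemma nrm_zero_iff: assumes "f \<in> l2" shows "nrm f = 0 \<longleftrightarrow> f = 0"
proof
  assume "nrm f = 0"
  then have "f n = 0" for n using norm_le_nrm[OF assms, of n] by simp
  then show "f = 0" by (intro ext) (simp add: seq_apply)
qed simp

lemma nrm_smult: assumes "f \<in> l2" shows "nrm (smult c f) = cmod c * nrm f"
proof -
  have "(\<Sum>n. (norm (smult c f n))^2) = (\<Sum>n. (cmod c)^2 * (norm (f n))^2)"
    by (simp add: seq_apply norm_scale_vec power_mult_distrib)
  also have "\<dots> = (cmod c)^2 * (\<Sum>n. (norm (f n))^2)"
    by (rule suminf_mult[OF l2D[OF assms]])
  finally show ?thesis unfolding nrm_def by (simp add: real_sqrt_mult)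
qed

lemma suminf_norm_mult_le:
  assumes f: "f \<in> l2" and g: "g \<in> l2"
  shows "(\<Sum>n. norm (f n) * norm (g n)) \<le> nrm f * nrm g"
proof (rule suminf_le_const[OF ip_abs_summable[OF f g]])
  fix N
  have "(\<Sum>n<N. norm (f n) * norm (g n)) = (\<Sum>n<N. \<bar>norm (f n)\<bar> * \<bar>norm (g n)\<bar>)" by simp
  also have "\<dots> \<le> L2_set (\<lambda>n. norm (f n)) {..<N} * L2_set (\<lambda>n. norm (g n)) {..<N}"
    by (rule L2_set_mult_ineq)
  also have "\<dots> \<le> nrm f * nrm g"
  proof (rule mult_mono)
    show "L2_set (\<lambda>n. norm (f n)) {..<N} \<le> nrm f" unfolding L2_set_def nrm_def
      by (rule real_sqrt_le_mono, rule sum_le_suminf) (use l2D[OF f] in auto)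
    show "L2_set (\<lambda>n. norm (g n)) {..<N} \<le> nrm g" unfolding L2_set_def nrm_def
      by (rule real_sqrt_le_mono, rule sum_le_suminf) (use l2D[OF g] in auto)
  qed (use f in \<open>auto intro: L2_set_nonneg\<close>)
  finally show "(\<Sum>n<N. norm (f n) * norm (g n)) \<le> nrm f * nrm g" .
qed

lemma cmod_ip_le:
  assumes f: "f \<in> l2" and g: "g \<in> l2" shows "cmod (ip f g) \<le> nrm f * nrm g"
proof -
  have "cmod (ip f g) \<le> (\<Sum>n. norm (f n) * norm (g n))"
    unfolding ip_def by (rule norm_suminf_le[OF cmod_vip_le ip_abs_summable[OF f g]])
  also have "\<dots> \<le> nrm f * nrm g" by (rule suminf_norm_mult_le[OF f g])
  finally show ?thesis .
qed

lemma nrm_add_sq: assumes "f \<in> l2" "g \<in> l2"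
  shows "(nrm (f + g))^2 = (nrm f)^2 + (nrm g)^2 + 2 * Re (ip f g)"
proof -
  have "complex_of_real ((nrm (f + g))^2) = ip (f + g) (f + g)" using assms by (simp add: ip_self l2_add)
  also have "\<dots> = ip f f + ip g g + (ip f g + cnj (ip f g))"
    using assms by (simp add: ip_add_left ip_add_right l2_add ip_cnj)
  finally have "complex_of_real ((nrm (f + g))^2) = of_real ((nrm f)^2 + (nrm g)^2 + 2 * Re (ip f g))"
    using assms by (simp add: ip_self complex_add_cnj)
  then show ?thesis using of_real_eq_iff by blast
qed

lemma l2_uminus [simp, intro]: "f \<in> l2 \<Longrightarrow> - f \<in> l2" by (simp add: seq_apply l2_def)
lemma nrm_uminus [simp]: "nrm (- f) = nrm f" by (simp add: seq_apply nrm_def)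
lemma ip_uminus_right: "f \<in> l2 \<Longrightarrow> h \<in> l2 \<Longrightarrow> ip h (- f) = - ip h f"
  using ip_diff_right[of 0 f h] by simp

lemma nrm_diff_sq: assumes "f \<in> l2" "g \<in> l2"
  shows "(nrm (f - g))^2 = (nrm f)^2 + (nrm g)^2 - 2 * Re (ip f g)"
  using assms nrm_add_sq[of f "- g"] by (simp add: ip_uminus_right)

lemma nrm_triangle: assumes "f \<in> l2" "g \<in> l2" shows "nrm (f + g) \<le> nrm f + nrm g"
proof (rule power2_le_imp_le)
  have "Re (ip f g) \<le> nrm f * nrm g"
    using cmod_ip_le[OF assms] complex_Re_le_cmod order_trans by blast
  then show "(nrm (f + g))^2 \<le> (nrm f + nrm g)^2"
    using assms by (simp add: nrm_add_sq power2_sum)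
qed (use assms in simp)

lemma nrm_triangle_diff: assumes "f \<in> l2" "g \<in> l2" shows "nrm (f - g) \<le> nrm f + nrm g"
  using assms nrm_triangle[of f "- g"] by simp

lemma nrm_sum_le: "(\<And>a. a \<in> A \<Longrightarrow> f a \<in> l2) \<Longrightarrow> nrm (\<Sum>a\<in>A. f a) \<le> (\<Sum>a\<in>A. nrm (f a))"
proof (induction A rule: infinite_finite_induct)
  case (insert x F)
  then have "nrm (f x + sum f F) \<le> nrm (f x) + nrm (sum f F)" by (intro nrm_triangle) auto
  moreover have "nrm (sum f F) \<le> (\<Sum>a\<in>F. nrm (f a))" using insert by blast
  ultimately show ?case unfolding sum.insert[OF insert(1,2)] by linarith
qed auto

lemma ip_ext: assumes "f \<in> l2" "g \<in> l2" "\<And>h. h \<in> l2 \<Longrightarrow> ip h f = ip h g" shows "f = g"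
proof -
  have "ip (f - g) (f - g) = 0" using assms by (simp add: ip_diff_right l2_diff)
  then have "nrm (f - g) = 0" using assms by (simp add: ip_self l2_diff)
  then show ?thesis using assms by (simp add: nrm_zero_iff l2_diff)
qed

lemma ip_shift_left: assumes "f \<in> l2" "g \<in> l2" shows "ip (shift f) g = ip f (bshift g)"
proof -
  have "ip (shift f) g = (\<Sum>n. vip (shift f (Suc n)) (g (Suc n))) + vip (shift f 0) (g 0)"
    unfolding ip_def using ip_summable[OF l2_shift[OF assms(1)] assms(2)] by (subst suminf_split_head) auto
  then show ?thesis by (simp add: ip_def bshift_apply)
qed

lemma nrm_split: assumes "f \<in> l2" shows "(nrm f)^2 = (norm (f 0))^2 + (nrm (bshift f))^2"
  using assms suminf_split_head[OF l2D[OF assms]] by (simp add: nrm_sq bshift_apply)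

lemma nrm_shift: assumes "f \<in> l2" shows "nrm (shift f) = nrm f"
  using nrm_split[OF l2_shift[OF assms]] assms by (simp add: power2_eq_iff_nonneg)

lemma nrm_bshift_le: assumes "f \<in> l2" shows "nrm (bshift f) \<le> nrm f"
  using nrm_split[OF assms] assms by (auto intro: power2_le_imp_le)

lemma nrm_Eop [simp]: "nrm (Eop u) = norm u"
  using nrm_split[of "Eop u"] by (simp add: power2_eq_iff_nonneg)

lemma bopI: 
  assumes "\<And>f. f \<in> l2 \<Longrightarrow> T f \<in> l2" "\<And>f g. f \<in> l2 \<Longrightarrow> g \<in> l2 \<Longrightarrow> T (f + g) = T f + T g"
    "\<And>c f. f \<in> l2 \<Longrightarrow> T (smult c f) = smult c (T f)" "\<And>f. f \<in> l2 \<Longrightarrow> nrm (T f) \<le> C * nrm f"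
  shows "is_bounded_op T"
  unfolding is_bounded_op_def using assms by (intro conjI ballI allI exI[of _ C]) simp_all

lemma bop_l2: "is_bounded_op T \<Longrightarrow> f \<in> l2 \<Longrightarrow> T f \<in> l2" by (auto simp: is_bounded_op_def)
lemma bop_add: "is_bounded_op T \<Longrightarrow> f \<in> l2 \<Longrightarrow> g \<in> l2 \<Longrightarrow> T (f + g) = T f + T g"
  by (auto simp: is_bounded_op_def)
lemma bop_smult: "is_bounded_op T \<Longrightarrow> f \<in> l2 \<Longrightarrow> T (smult c f) = smult c (T f)"
  by (auto simp: is_bounded_op_def)
lemma bop_zero: assumes "is_bounded_op T" shows "T 0 = 0"
  using bop_smult[OF assms l2_zero, of 0] by simp
lemma bop_diff: assumes "is_bounded_op T" "f \<in> l2" "g \<in> l2" shows "T (f - g) = T f - T g"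
proof -
  have e: "f - g = f + smult (-1) g" "T f - T g = T f + smult (-1) (T g)" by (simp_all add: fun_eq_iff)
  show ?thesis unfolding e using assms by (simp only: bop_add bop_smult l2_smult)
qed
lemma bop_sum: assumes "is_bounded_op T" "\<And>a. a \<in> A \<Longrightarrow> f a \<in> l2" 
  shows "T (\<Sum>a\<in>A. f a) = (\<Sum>a\<in>A. T (f a))"
  using assms(2)
proof (induction A rule: infinite_finite_induct)
  case (insert x F)
  have 1: "f x \<in> l2" "sum f F \<in> l2" using insert.prems by (auto intro: l2_sum)
  have 2: "T (sum f F) = (\<Sum>a\<in>F. T (f a))" using insert by blast
  show ?case unfolding sum.insert[OF insert.hyps] bop_add[OF assms(1) 1] 2 ..
qed (auto simp: bop_zero[OF assms(1)])

lemma bop_bound: assumes "is_bounded_op T" obtains C where "C > 0" "\<And>f. f \<in> l2 \<Longrightarrow> nrm (T f) \<le> C * nrm f"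
proof -
  obtain C where C: "\<And>f. f \<in> l2 \<Longrightarrow> nrm (T f) \<le> C * nrm f"
    using assms unfolding is_bounded_op_def by blast
  have "nrm (T f) \<le> (\<bar>C\<bar> + 1) * nrm f" if "f \<in> l2" for f
    using C[OF that] mult_right_mono[OF _ nrm_nonneg[OF that], of C "\<bar>C\<bar> + 1"] by linarith
  then show ?thesis by (intro that[of "\<bar>C\<bar> + 1"]) auto
qed

lemma bop_comp: assumes "is_bounded_op S" "is_bounded_op T" shows "is_bounded_op (\<lambda>f. S (T f))"
proof -
  obtain C where C: "C > 0" "\<And>f. f \<in> l2 \<Longrightarrow> nrm (S f) \<le> C * nrm f" using bop_bound[OF assms(1)] by blast
  obtain D where D: "D > 0" "\<And>f. f \<in> l2 \<Longrightarrow> nrm (T f) \<le> D * nrm f" using bop_bound[OF assms(2)] by blast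
  show ?thesis
  proof (rule bopI[where C = "C * D"])
    fix f :: "'c seq" assume f: "f \<in> l2"
    have "nrm (S (T f)) \<le> C * nrm (T f)" using C(2) bop_l2[OF assms(2) f] .
    also have "\<dots> \<le> C * (D * nrm f)" using C(1) D(2)[OF f] by simp
    finally show "nrm (S (T f)) \<le> C * D * nrm f" by (simp add: algebra_simps)
  qed (simp_all add: bop_add[OF assms(1)] bop_add[OF assms(2)] bop_smult[OF assms(1)] bop_smult[OF assms(2)]
      bop_l2[OF assms(1)] bop_l2[OF assms(2)])
qed

lemma bop_lincomb: assumes "is_bounded_op S" "is_bounded_op T"
  shows "is_bounded_op (\<lambda>f. smult c (S f) - T f)"
proof -
  obtain C where C: "C > 0" "\<And>f. f \<in> l2 \<Longrightarrow> nrm (S f) \<le> C * nrm f" using bop_bound[OF assms(1)] by blast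
  obtain D where D: "D > 0" "\<And>f. f \<in> l2 \<Longrightarrow> nrm (T f) \<le> D * nrm f" using bop_bound[OF assms(2)] by blast
  show ?thesis
  proof (rule bopI[where C = "cmod c * C + D"])
    fix f :: "'a seq" assume f: "f \<in> l2"
    have "nrm (smult c (S f) - T f) \<le> nrm (smult c (S f)) + nrm (T f)"
      using bop_l2[OF assms(1) f] bop_l2[OF assms(2) f] by (intro nrm_triangle_diff) auto
    also have "\<dots> \<le> cmod c * (C * nrm f) + D * nrm f"
      using C(2)[OF f] D(2)[OF f] bop_l2[OF assms(1) f] by (simp add: nrm_smult add_mono mult_left_mono)
    finally show "nrm (smult c (S f) - T f) \<le> (cmod c * C + D) * nrm f" by (simp add: algebra_simps)
  next
    fix c' and f :: "'a seq" assume f: "f \<in> l2"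
    then show "smult c (S (smult c' f)) - T (smult c' f) = smult c' (smult c (S f) - T f)"
      by (simp add: bop_smult[OF assms(1)] bop_smult[OF assms(2)] sv.scale_right_diff_distrib mult.commute)
  qed (simp_all add: bop_add[OF assms(1)] bop_add[OF assms(2)] bop_l2[OF assms(1)] bop_l2[OF assms(2)]
      sv.scale_right_distrib)
qed

lemma bop_id: "is_bounded_op (\<lambda>f. f)" by (rule bopI[where C = 1]) auto

lemma bop_shift: "is_bounded_op shift"
  by (rule bopI[where C = 1]) (auto simp: shift_add shift_smult nrm_shift)

lemma bop_bshift: "is_bounded_op bshift"
  by (rule bopI[where C = 1]) (auto simp: bshift_add bshift_smult nrm_bshift_le)

lemma l2_tendsto_0: assumes "f \<in> l2" shows "f \<longlonglongrightarrow> 0"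
proof -
  have "(\<lambda>n. sqrt ((norm (f n))^2)) \<longlonglongrightarrow> sqrt 0"
    by (intro tendsto_real_sqrt summable_LIMSEQ_zero l2D[OF assms])
  then show ?thesis by (simp add: tendsto_norm_zero_iff)
qed

lemma l2_suminf:
  assumes f: "\<And>n. f n \<in> l2" and s: "summable (\<lambda>n. nrm (f n))"
  shows "(\<lambda>j. \<Sum>n. f n j) \<in> l2" "nrm (\<lambda>j. \<Sum>n. f n j) \<le> (\<Sum>n. nrm (f n))"
proof -
  let ?s = "\<lambda>j. \<Sum>n. f n j" and ?K = "\<Sum>n. nrm (f n)"
  have sj: "summable (\<lambda>n. f n j)" for j
    by (rule summable_comparison_test'[OF s]) (rule norm_le_nrm[OF f])
  have K: "0 \<le> ?K" by (rule suminf_nonneg[OF s]) (simp add: f)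
  have bd: "(\<Sum>j<J. (norm (?s j))^2) \<le> ?K^2" for J
  proof (rule LIMSEQ_le_const2)
    show "(\<lambda>N. \<Sum>j<J. (norm (\<Sum>n<N. f n j))^2) \<longlonglongrightarrow> (\<Sum>j<J. (norm (?s j))^2)"
      by (intro tendsto_sum tendsto_power tendsto_norm summable_LIMSEQ[OF sj])
    have "(\<Sum>j<J. (norm (\<Sum>n<N. f n j))^2) \<le> ?K^2" for N
    proof -
      have l: "(\<Sum>n<N. f n) \<in> l2" using f by auto
      have "(\<Sum>j<J. (norm (\<Sum>n<N. f n j))^2) = (\<Sum>j<J. (norm ((\<Sum>n<N. f n) j))^2)" by (simp add: seq_apply)
      also have "\<dots> \<le> (nrm (\<Sum>n<N. f n))^2"
        unfolding nrm_sq[OF l] by (rule sum_le_suminf[OF l2D[OF l]]) auto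
      also have "\<dots> \<le> (\<Sum>n<N. nrm (f n))^2"
        by (rule power_mono[OF nrm_sum_le]) (auto simp: f l)
      also have "\<dots> \<le> ?K^2"
        by (rule power_mono[OF sum_le_suminf[OF s]]) (auto intro: sum_nonneg simp: f)
      finally show ?thesis .
    qed
    then show "\<exists>N. \<forall>n\<ge>N. (\<Sum>j<J. (norm (\<Sum>i<n. f i j))^2) \<le> ?K^2" by blast
  qed
  show l: "?s \<in> l2"
    by (rule l2I, rule summableI_nonneg_bounded[OF _ bd]) simp
  have "(nrm ?s)^2 \<le> ?K^2"
    unfolding nrm_sq[OF l] by (rule suminf_le_const[OF l2D[OF l] bd])
  then show "nrm ?s \<le> ?K" by (rule power2_le_imp_le[OF _ K])
qed

lemma bop_suminf:
  assumes T: "is_bounded_op T" and f: "\<And>n. f n \<in> l2" and s: "summable (\<lambda>n. nrm (f n))"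
  shows "T (\<lambda>j. \<Sum>n. f n j) j = (\<Sum>n. T (f n) j)" "summable (\<lambda>n. T (f n) j)"
proof -
  obtain C where C: "C > 0" "\<And>f. f \<in> l2 \<Longrightarrow> nrm (T f) \<le> C * nrm f" using bop_bound[OF T] by blast
  have sj: "summable (\<lambda>n. f n j)" for j
    by (rule summable_comparison_test'[OF s]) (rule norm_le_nrm[OF f])
  have "(\<lambda>N. \<Sum>n<N. T (f n) j) \<longlonglongrightarrow> T (\<lambda>j. \<Sum>n. f n j) j"
  proof (rule LIMSEQ_I)
    fix e :: real assume "e > 0"
    then have "e / C > 0" using C by simp
    then obtain N where N: "\<And>n. n \<ge> N \<Longrightarrow> norm (\<Sum>i. nrm (f (i + n))) < e / C"
      using suminf_exist_split[OF _ s] by blast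
    have "norm ((\<Sum>i<n. T (f i) j) - T (\<lambda>j. \<Sum>n. f n j) j) < e" if "n \<ge> N" for n
    proof -
      let ?t = "\<lambda>j. \<Sum>i. f (i + n) j" and ?s = "\<lambda>j. \<Sum>n. f n j"
      have sn: "summable (\<lambda>i. nrm (f (i + n)))" by (subst summable_iff_shift) (rule s)
      have t: "?t \<in> l2" "nrm ?t \<le> (\<Sum>i. nrm (f (i + n)))" using l2_suminf[OF f sn] by auto
      have st: "?s = (\<Sum>i<n. f i) + ?t"
        using suminf_split_initial_segment[OF sj, of _ n]
        by (simp add: fun_eq_iff add.commute[of _ "sum _ _"] seq_apply)
      have "T ?s = (\<Sum>i<n. T (f i)) + T ?t"
        unfolding st using t(1) f by (simp add: bop_add[OF T] l2_sum bop_sum[OF T])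
      then have "norm ((\<Sum>i<n. T (f i) j) - T ?s j) = norm (T ?t j)" by (simp add: seq_apply)
      also have "\<dots> \<le> nrm (T ?t)" by (rule norm_le_nrm[OF bop_l2[OF T t(1)]])
      also have "\<dots> \<le> C * nrm ?t" by (rule C(2)[OF t(1)])
      also have "\<dots> \<le> C * (\<Sum>i. nrm (f (i + n)))" using C(1) t(2) by simp
      also have "\<dots> < e" using N[OF that] C(1) order_trans[OF nrm_nonneg[OF t(1)] t(2)] by (simp add: field_simps)
      finally show ?thesis .
    qed
    then show "\<exists>no. \<forall>n\<ge>no. norm ((\<Sum>n<n. T (f n) j) - T (\<lambda>j. \<Sum>n. f n j) j) < e" by blast
  qed
  then have "(\<lambda>n. T (f n) j) sums T (\<lambda>j. \<Sum>n. f n j) j" by (simp add: sums_def)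
  then show "T (\<lambda>j. \<Sum>n. f n j) j = (\<Sum>n. T (f n) j)" "summable (\<lambda>n. T (f n) j)"
    by (auto simp: sums_iff)
qed

lemma lincomb_seq: "(\<lambda>n. \<Sum>b\<in>A. c b *s b n) = (\<Sum>b\<in>A. smult (c b) b)"
  by (rule ext) (simp add: seq_apply)

lemma cspan_eq_span: "cspan B = sv.span B"
  unfolding cspan_def lincomb_seq sv.span_explicit by blast

lemma cindep_iff: "cindep B \<longleftrightarrow> sv.independent B"
  unfolding cindep_def lincomb_seq sv.dependent_explicit zero_fun_def by blast

lemma adj_eqI:
  assumes "g \<in> l2" "f \<in> l2" "\<And>h. h \<in> l2 \<Longrightarrow> ip (T h) g = ip h f" shows "adj T g = f"
proof -
  have "(THE f. f \<in> l2 \<and> (\<forall>h\<in>l2. ip (T h) g = ip h f)) = f"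
    by (rule the_equality) (use assms ip_ext in auto)
  then show ?thesis using assms(1) by (simp add: adj_def)
qed

section \<open>Polynomials of operators, finite rank spectral theorem, projections\<close>

definition papp :: "('n::finite seq \<Rightarrow> 'n seq) \<Rightarrow> complex poly \<Rightarrow> 'n seq \<Rightarrow> 'n seq" where
  "papp T p f = (\<Sum>i\<le>degree p. smult (coeff p i) ((T ^^ i) f))"

lemma papp_bound: assumes "degree p \<le> n"
  shows "papp T p f = (\<Sum>i\<le>n. smult (coeff p i) ((T ^^ i) f))"
  unfolding papp_def
  by (rule sum.mono_neutral_left) (use assms in \<open>auto simp: coeff_eq_0\<close>)

lemma papp_0 [simp]: "papp T 0 f = 0" by (simp add: papp_def)

lemma papp_pCons: "papp T (pCons a p) f = smult a f + papp T p (T f)"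
proof -
  have "papp T (pCons a p) f = (\<Sum>i\<le>Suc (degree p). smult (coeff (pCons a p) i) ((T ^^ i) f))"
    by (rule papp_bound) (simp add: degree_pCons_le)
  also have "\<dots> = smult a f + papp T p (T f)"
    unfolding sum.atMost_Suc_shift by (simp add: papp_def funpow_swap1)
  finally show ?thesis .
qed

lemma papp_add: "papp T (p + q) f = papp T p f + papp T q f"
proof -
  let ?n = "max (degree p) (degree q)"
  have "degree (p + q) \<le> ?n" by (simp add: degree_add_le_max)
  from papp_bound[OF this] show ?thesis
    by (simp add: papp_bound[of p ?n] papp_bound[of q ?n] sum.distrib sv.scale_left_distrib)
qed

lemma papp_monom: "papp T (monom c n) f = smult c ((T ^^ n) f)"
proof (induction n arbitrary: f)
  case 0
  show ?case by (simp add: monom_0 papp_pCons)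
next
  case (Suc n)
  then show ?case by (simp add: monom_Suc papp_pCons funpow_swap1)
qed

lemma papp_sum: "papp T (\<Sum>i\<in>I. p i) f = (\<Sum>i\<in>I. papp T (p i) f)"
  by (induction I rule: infinite_finite_induct) (simp_all add: papp_add)

lemma papp_smult: "papp T (Polynomial.smult c p) f = smult c (papp T p f)"
  by (induction p arbitrary: f) (simp_all add: papp_pCons sv.scale_right_distrib)

lemma papp_invariant:
  assumes "sv.subspace U" "\<And>f. f \<in> U \<Longrightarrow> T f \<in> U" "f \<in> U" shows "papp T p f \<in> U"
  using assms(3)
proof (induction p arbitrary: f)
  case 0 then show ?case by (simp add: sv.subspace_0[OF assms(1)])
next
  case (pCons a p)
  show ?case unfolding papp_pCons
    by (intro sv.subspace_add[OF assms(1)] sv.subspace_scale[OF assms(1)] pCons assms(2))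
qed

definition lin_on :: "'n::finite seq set \<Rightarrow> ('n seq \<Rightarrow> 'n seq) \<Rightarrow> bool" where
  "lin_on U T \<longleftrightarrow> sv.subspace U \<and> (\<forall>f\<in>U. T f \<in> U) \<and> (\<forall>f\<in>U. \<forall>g\<in>U. T (f + g) = T f + T g)
     \<and> (\<forall>c. \<forall>f\<in>U. T (smult c f) = smult c (T f))"

lemma lin_onD:
  assumes "lin_on U T"
  shows "sv.subspace U" "f \<in> U \<Longrightarrow> T f \<in> U" "f \<in> U \<Longrightarrow> g \<in> U \<Longrightarrow> T (f + g) = T f + T g"
    "f \<in> U \<Longrightarrow> T (smult c f) = smult c (T f)"
  using assms unfolding lin_on_def by blast+

lemma papp_closed: "lin_on U T \<Longrightarrow> f \<in> U \<Longrightarrow> papp T p f \<in> U"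
  by (rule papp_invariant) (auto dest: lin_onD)

lemma papp_commute: assumes L: "lin_on U T" and f: "f \<in> U" shows "T (papp T p f) = papp T p (T f)"
  using f
proof (induction p arbitrary: f)
  case 0
  show ?case using lin_onD(4)[OF L 0, of 0] by simp
next
  case (pCons a p)
  have 1: "smult a f \<in> U" "papp T p (T f) \<in> U"
    using pCons.prems L lin_onD[OF L] papp_closed[OF L] by (auto intro: sv.subspace_scale)
  show ?case
    unfolding papp_pCons lin_onD(3)[OF L 1] lin_onD(4)[OF L pCons.prems]
    using pCons.IH[OF lin_onD(2)[OF L pCons.prems]] by simp
qed

lemma papp_mult: assumes L: "lin_on U T" and f: "f \<in> U"
  shows "papp T (p * q) f = papp T p (papp T q f)"
  using f
proof (induction p arbitrary: f)
  case 0 show ?case by simp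
next
  case (pCons a p)
  have "papp T (pCons a p * q) f = smult a (papp T q f) + papp T (p * q) (T f)"
    by (simp add: mult_pCons_left papp_add papp_smult papp_pCons)
  also have "papp T (p * q) (T f) = papp T p (T (papp T q f))"
    using pCons.IH[OF lin_onD(2)[OF L pCons.prems]] papp_commute[OF L pCons.prems] by simp
  finally show ?case by (simp add: papp_pCons)
qed

lemma annihilator_exists:
  assumes B: "finite B" and f: "\<And>i. (T ^^ i) f \<in> sv.span B"
  shows "\<exists>p. p \<noteq> 0 \<and> papp T p f = 0"
proof (cases "inj_on (\<lambda>i. (T ^^ i) f) {..card B}")
  case False
  then obtain i j where ij: "i \<noteq> j" "(T ^^ i) f = (T ^^ j) f" unfolding inj_on_def by blast
  let ?p = "monom 1 i + monom (-1) j :: complex poly"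
  have "coeff ?p i = 1" using ij(1) by simp
  then have "?p \<noteq> 0" by force
  moreover have "papp T ?p f = 0" using ij(2) by (simp add: papp_add papp_monom)
  ultimately show ?thesis by blast
next
  case True
  let ?v = "\<lambda>i. (T ^^ i) f" and ?I = "{..card B}"
  let ?S = "?v ` ?I"
  have "card ?S = Suc (card B)" using card_image[OF True] by simp
  then have "sv.dependent ?S"
    using sv.independent_span_bound[OF B, of ?S] f by fastforce
  then obtain u where u: "\<exists>v\<in>?S. u v \<noteq> 0" "(\<Sum>v\<in>?S. smult (u v) v) = 0"
    using sv.dependent_finite[of ?S] by auto
  let ?p = "\<Sum>i\<in>?I. monom (u (?v i)) i"
  from u(1) obtain k where k: "k \<in> ?I" "u (?v k) \<noteq> 0" by blast
  have "coeff ?p k = u (?v k)" using k(1) by (simp add: coeff_sum)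
  then have "?p \<noteq> 0" using k(2) by force
  moreover have "papp T ?p f = 0"
    using u(2) unfolding sum.reindex[OF True] by (simp add: papp_sum papp_monom)
  ultimately show ?thesis by blast
qed

lemma eigenvector_exists:
  assumes L: "lin_on U T"
  shows "p \<noteq> 0 \<Longrightarrow> papp T p g = 0 \<Longrightarrow> g \<noteq> 0 \<Longrightarrow> g \<in> U
    \<Longrightarrow> \<exists>q a. papp T q g \<noteq> 0 \<and> T (papp T q g) = smult a (papp T q g)"
proof (induction "degree p" arbitrary: p)
  case 0
  then obtain c where "p = [:c:]" by (metis degree_0_id)
  then have "c = 0 \<or> g = 0" using 0(3) by (simp add: papp_pCons)
  then show ?case using 0 \<open>p = [:c:]\<close> by simp
next
  case (Suc d)
  then obtain a where "poly p a = 0"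
    using fundamental_theorem_of_algebra[of p] constant_degree[of p] by force
  then obtain p' where p': "p = [:- a, 1:] * p'" by (metis dvdE poly_eq_0_iff_dvd)
  have p0: "p' \<noteq> 0" using p' Suc.prems(1) by auto
  let ?e = "papp T p' g"
  show ?case
  proof (cases "?e = 0")
    case True
    have "degree p = Suc (degree p')" unfolding p' using p0 by (subst degree_mult_eq) auto
    then have "d = degree p'" using Suc.hyps(2) by simp
    from Suc.hyps(1)[OF this p0 True Suc.prems(3,4)] show ?thesis .
  next
    case False
    have "papp T [:- a, 1:] ?e = 0"
      using Suc.prems(2) unfolding p' papp_mult[OF L Suc.prems(4)] .
    then have "T ?e = smult a ?e" by (simp add: papp_pCons)
    with False show ?thesis by blast
  qed
qed

lemma subspace_l2: "sv.subspace l2"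
  unfolding sv.subspace_def by auto

lemma lin_on_l2: assumes "is_bounded_op T" shows "lin_on l2 T"
  using bop_l2[OF assms] bop_add[OF assms] bop_smult[OF assms] subspace_l2 by (simp add: lin_on_def)

definition orthonormal :: "'n::finite seq set \<Rightarrow> bool" where
  "orthonormal E \<longleftrightarrow> E \<subseteq> l2 \<and> (\<forall>e\<in>E. \<forall>e'\<in>E. ip e e' = (if e = e' then 1 else 0))"

lemma orthonormal_independent:
  assumes "orthonormal E" "finite E" shows "sv.independent E"
proof
  assume "sv.dependent E"
  then obtain u v where u: "v \<in> E" "u v \<noteq> 0" "(\<Sum>e\<in>E. smult (u e) e) = 0"
    unfolding sv.dependent_finite[OF assms(2)] by blast
  have E: "\<And>e. e \<in> E \<Longrightarrow> e \<in> l2" using assms(1) by (auto simp: orthonormal_def)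
  have "0 = ip (\<Sum>e\<in>E. smult (u e) e) v" by (simp add: u(3))
  also have "\<dots> = (\<Sum>e\<in>E. ip (smult (u e) e) v)"
    by (rule ip_sum_left) (use E u(1) in blast)+
  also have "\<dots> = (\<Sum>e\<in>E. if e = v then u e else 0)"
  proof (rule sum.cong[OF refl])
    fix e assume e: "e \<in> E"
    show "ip (smult (u e) e) v = (if e = v then u e else 0)"
      unfolding ip_smult_left[OF E[OF e] E[OF u(1)]] using assms(1) e u(1) by (simp add: orthonormal_def)
  qed
  also have "\<dots> = u v" using u(1) assms(2) by simp
  finally show False using u(2) by simp
qed

definition specop :: "'n::finite seq set \<Rightarrow> real \<Rightarrow> ('n seq \<Rightarrow> real) \<Rightarrow> 'n seq \<Rightarrow> 'n seq" where
  "specop E c \<phi> f = smult (of_real c) f + (\<Sum>e\<in>E. smult (of_real (\<phi> e - c) * ip f e) e)"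

definition selfadj :: "('n::finite seq \<Rightarrow> 'n seq) \<Rightarrow> bool" where
  "selfadj T \<longleftrightarrow> (\<forall>f\<in>l2. \<forall>g\<in>l2. ip (T f) g = ip f (T g))"

context
  fixes E :: "'n::finite seq set"
  assumes on: "orthonormal E" and fin: "finite E"
begin

lemma on_l2: "e \<in> E \<Longrightarrow> e \<in> l2" using on by (auto simp: orthonormal_def)

lemma on_ip: "e \<in> E \<Longrightarrow> e' \<in> E \<Longrightarrow> ip e e' = (if e = e' then 1 else 0)"
  using on by (auto simp: orthonormal_def)

lemma on_nrm: assumes "e \<in> E" shows "nrm e = 1"
proof -
  have "complex_of_real ((nrm e)^2) = 1" using ip_self[OF on_l2[OF assms]] on_ip[OF assms assms] by simp
  then have "(nrm e)^2 = 1" using of_real_eq_1_iff by blast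
  then show ?thesis using nrm_nonneg[OF on_l2[OF assms]] by (simp add: power2_eq_1_iff)
qed

lemma specop_sum_l2: "(\<Sum>e\<in>E. smult (u e) e) \<in> l2"
  by (intro l2_sum l2_smult on_l2)

lemma specop_l2: "f \<in> l2 \<Longrightarrow> specop E c \<phi> f \<in> l2"
  unfolding specop_def by (intro l2_add l2_smult specop_sum_l2)

lemma ip_sum_on: assumes "e \<in> E" shows "ip (\<Sum>e\<in>E. smult (u e) e) e = u e"
proof -
  have "ip (\<Sum>e\<in>E. smult (u e) e) e = (\<Sum>e'\<in>E. ip (smult (u e') e') e)"
    by (rule ip_sum_left) (use on_l2 assms in blast)+
  also have "\<dots> = (\<Sum>e'\<in>E. if e' = e then u e' else 0)"
  proof (rule sum.cong[OF refl])
    fix e' assume e: "e' \<in> E"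
    show "ip (smult (u e') e') e = (if e' = e then u e' else 0)"
      unfolding ip_smult_left[OF on_l2[OF e] on_l2[OF assms]] on_ip[OF e assms] by simp
  qed
  also have "\<dots> = u e" using assms fin by simp
  finally show ?thesis .
qed

lemma ip_specop: assumes "e \<in> E" "f \<in> l2" shows "ip (specop E c \<phi> f) e = of_real (\<phi> e) * ip f e"
  unfolding specop_def ip_add_left[OF l2_smult[OF assms(2)] specop_sum_l2 on_l2[OF assms(1)]]
    ip_smult_left[OF assms(2) on_l2[OF assms(1)]] ip_sum_on[OF assms(1)]
  by (simp add: algebra_simps)

lemma specop_specop: assumes f: "f \<in> l2"
  shows "specop E c \<phi> (specop E d \<psi> f) = specop E (c * d) (\<lambda>e. \<phi> e * \<psi> e) f"
proof -
  have "specop E c \<phi> (specop E d \<psi> f)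
      = smult (of_real c) (specop E d \<psi> f) + (\<Sum>e\<in>E. smult (of_real (\<phi> e - c) * (of_real (\<psi> e) * ip f e)) e)"
    unfolding specop_def[of E c \<phi>] using ip_specop[OF _ f] by (auto intro!: sum.cong)
  also have "\<dots> = smult (of_real (c * d)) f +
      ((\<Sum>e\<in>E. smult (of_real c * (of_real (\<psi> e - d) * ip f e)) e)
       + (\<Sum>e\<in>E. smult (of_real (\<phi> e - c) * (of_real (\<psi> e) * ip f e)) e))"
    unfolding specop_def[of E d \<psi>] by (simp add: sv.scale_right_distrib sv.scale_sum_right add.assoc)
  also have "\<dots> = specop E (c * d) (\<lambda>e. \<phi> e * \<psi> e) f"
    unfolding specop_def sum.distrib[symmetric] sv.scale_left_distrib[symmetric]
    by (simp add: algebra_simps)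
  finally show ?thesis .
qed

lemma specop_one: "specop E 1 (\<lambda>e. 1) f = f"
  by (simp add: specop_def)

lemma specop_cong: "(\<And>e. e \<in> E \<Longrightarrow> \<phi> e = \<psi> e) \<Longrightarrow> specop E c \<phi> f = specop E c \<psi> f"
  by (simp add: specop_def)

lemma bop_specop: "is_bounded_op (specop E c \<phi>)"
proof (rule bopI[where C = "\<bar>c\<bar> + (\<Sum>e\<in>E. \<bar>\<phi> e - c\<bar>)"])
  fix f :: "'n seq" assume f: "f \<in> l2"
  then show "specop E c \<phi> f \<in> l2" by (rule specop_l2)
  have "nrm (smult (of_real (\<phi> e - c) * ip f e) e) \<le> \<bar>\<phi> e - c\<bar> * nrm f" if "e \<in> E" for e
    using cmod_ip_le[OF f on_l2[OF that]] on_nrm[OF that]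
    by (simp add: nrm_smult[OF on_l2[OF that]] norm_mult mult_left_mono del: of_real_diff)
  then have "nrm (\<Sum>e\<in>E. smult (of_real (\<phi> e - c) * ip f e) e) \<le> (\<Sum>e\<in>E. \<bar>\<phi> e - c\<bar> * nrm f)"
    using on_l2 by (intro order_trans[OF nrm_sum_le] sum_mono) auto
  moreover have "nrm (specop E c \<phi> f) \<le> nrm (smult (of_real c) f) + nrm (\<Sum>e\<in>E. smult (of_real (\<phi> e - c) * ip f e) e)"
    unfolding specop_def by (rule nrm_triangle[OF l2_smult[OF f] specop_sum_l2])
  ultimately show "nrm (specop E c \<phi> f) \<le> (\<bar>c\<bar> + (\<Sum>e\<in>E. \<bar>\<phi> e - c\<bar>)) * nrm f"
    by (simp add: nrm_smult[OF f] algebra_simps sum_distrib_left sum_distrib_right)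
next
  fix f g :: "'n seq" assume "f \<in> l2" "g \<in> l2"
  then show "specop E c \<phi> (f + g) = specop E c \<phi> f + specop E c \<phi> g"
    unfolding specop_def
    by (simp add: ip_add_left on_l2 distrib_left sv.scale_left_distrib sum.distrib sv.scale_right_distrib
        add.assoc add.left_commute cong: sum.cong)
next
  fix k and f :: "'n seq" assume f: "f \<in> l2"
  then show "specop E c \<phi> (smult k f) = smult k (specop E c \<phi> f)"
    unfolding specop_def
    by (simp add: ip_smult_left on_l2 sv.scale_right_distrib sv.scale_sum_right mult.left_commute mult.commute mult.assoc cong: sum.cong)
qed

lemma selfadj_specop: "selfadj (specop E c \<phi>)"
  unfolding selfadj_def
proof (intro ballI)
  fix f g :: "'n seq" assume f: "f \<in> l2" and g: "g \<in> l2"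
  have "ip (specop E c \<phi> f) g = of_real c * ip f g + (\<Sum>e\<in>E. of_real (\<phi> e - c) * ip f e * ip e g)"
    unfolding specop_def using f g
    by (simp add: ip_add_left specop_sum_l2 ip_smult_left ip_sum_left on_l2)
  moreover have "ip f (specop E c \<phi> g) = of_real c * ip f g + (\<Sum>e\<in>E. of_real (\<phi> e - c) * ip f e * ip e g)"
    unfolding specop_def using f g
    by (simp add: ip_add_right specop_sum_l2 ip_smult_right ip_sum_right on_l2 ip_cnj mult.commute mult.left_commute
      cong: sum.cong)
  ultimately show "ip (specop E c \<phi> f) g = ip f (specop E c \<phi> g)" by simp
qed

lemma specop_psd:
  assumes "0 \<le> c" "\<And>e. e \<in> E \<Longrightarrow> 0 \<le> \<phi> e" and f: "f \<in> l2"
  shows "ip (specop E c \<phi> f) f = of_real ((nrm (specop E (sqrt c) (\<lambda>e. sqrt (\<phi> e)) f))^2)"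
proof -
  let ?R = "specop E (sqrt c) (\<lambda>e. sqrt (\<phi> e))"
  have "specop E c \<phi> f = ?R (?R f)"
    unfolding specop_specop[OF f] using assms by (auto intro!: specop_cong)
  then have "ip (specop E c \<phi> f) f = ip (?R f) (?R f)"
    using selfadj_specop f specop_l2[OF f] unfolding selfadj_def by auto
  then show ?thesis using ip_self[OF specop_l2[OF f]] by simp
qed

end

lemma psd_sqrt_eigen:
  assumes R: "is_bounded_op R" and psd: "\<And>f. f \<in> l2 \<Longrightarrow> 0 \<le> Re (ip (R f) f)"
    and x: "x \<in> l2" and s: "0 \<le> s" and RR: "R (R x) = smult (of_real (s^2)) x"
  shows "R x = smult (of_real s) x"
proof -
  define w where "w = R x - smult (of_real s) x"
  have Rx: "R x \<in> l2" and w: "w \<in> l2" using bop_l2[OF R x] x by (auto simp: w_def)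
  have Rw: "R w = smult (- of_real s) w"
    unfolding w_def bop_diff[OF R Rx l2_smult[OF x]] bop_smult[OF R x] RR
    by (simp add: sv.scale_right_diff_distrib power2_eq_square)
  have "w = 0"
  proof (rule ccontr)
    assume "w \<noteq> 0"
    then have wp: "(nrm w)^2 > 0" using nrm_zero_iff[OF w] by simp
    show False
    proof (cases "s = 0")
      case False
      have "ip (R w) w = of_real (- s * (nrm w)^2)"
        unfolding Rw ip_smult_left[OF w w] by (simp add: ip_self[OF w])
      then have "Re (ip (R w) w) = - s * (nrm w)^2" by simp
      then show False using psd[OF w] mult_pos_pos[OF _ wp, of s] False s by simp
    next
      case True
      then have Rx': "R x = w" by (simp add: w_def)
      have Rw0: "R w = 0" using Rw True by simp
      define t where "t = (Re (ip w x) + 1) / (nrm w)^2"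
      have tw: "t * (nrm w)^2 = Re (ip w x) + 1" unfolding t_def using wp by simp
      let ?y = "x - smult (of_real t) w"
      have y: "?y \<in> l2" using x w by auto
      have "R ?y = w"
        unfolding bop_diff[OF R x l2_smult[OF w]] bop_smult[OF R w] Rw0 Rx' by simp
      then have "ip (R ?y) ?y = ip w x - of_real (t * (nrm w)^2)"
        using x w by (simp add: ip_diff_right ip_smult_right ip_self)
      then have "Re (ip (R ?y) ?y) = - 1" using tw by simp
      then show False using psd[OF y] by simp
    qed
  qed
  then show ?thesis by (simp add: w_def)
qed

lemma psqrt_specop:
  assumes on: "orthonormal E" and fin: "finite E" and c: "0 \<le> c" and \<phi>: "\<And>e. e \<in> E \<Longrightarrow> 0 \<le> \<phi> e"
    and T: "\<And>f. f \<in> l2 \<Longrightarrow> T f = specop E c \<phi> f"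
  shows "psqrt T = (\<lambda>f. if f \<in> l2 then specop E (sqrt c) (\<lambda>e. sqrt (\<phi> e)) f else 0)"
  (is "_ = ?R00")
proof -
  define R0 where "R0 = ?R00"
  have R0in: "R0 f = specop E (sqrt c) (\<lambda>e. sqrt (\<phi> e)) f" if "f \<in> l2" for f
    using that unfolding R0_def by (rule if_P)
  have R0out: "R0 f = 0" if "f \<notin> l2" for f
    using that unfolding R0_def by (rule if_not_P)
  let ?R = "specop E (sqrt c) (\<lambda>e. sqrt (\<phi> e))"
  note l2s = specop_l2[OF on fin]
  have RR: "?R (?R f) = specop E c \<phi> f" if "f \<in> l2" for f
    unfolding specop_specop[OF on fin that] using c \<phi> by (auto intro!: specop_cong[OF on fin])
  have ex: "is_bounded_op R0 \<and> (\<forall>f. f \<notin> l2 \<longrightarrow> R0 f = zs)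
      \<and> (\<forall>f\<in>l2. ip (R0 f) f \<in> \<real> \<and> Re (ip (R0 f) f) \<ge> 0) \<and> (\<forall>f\<in>l2. R0 (R0 f) = T f)"
  proof (intro conjI)
    have "is_bounded_op ?R" by (rule bop_specop[OF on fin])
    then show "is_bounded_op R0" unfolding is_bounded_op_def by (simp add: R0in)
    have p: "ip (?R f) f = of_real ((nrm (specop E (sqrt (sqrt c)) (\<lambda>e. sqrt (sqrt (\<phi> e))) f))^2)"
      if "f \<in> l2" for f
      by (rule specop_psd[OF on fin]) (use c \<phi> that in auto)
    show "\<forall>f\<in>l2. ip (R0 f) f \<in> \<real> \<and> Re (ip (R0 f) f) \<ge> 0"
      using p by (simp add: R0in)
    show "\<forall>f\<in>l2. R0 (R0 f) = T f" using RR l2s T by (simp add: R0in)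
  qed (simp add: R0out)
  have un: "R = R0" if R: "is_bounded_op R \<and> (\<forall>f. f \<notin> l2 \<longrightarrow> R f = zs)
      \<and> (\<forall>f\<in>l2. ip (R f) f \<in> \<real> \<and> Re (ip (R f) f) \<ge> 0) \<and> (\<forall>f\<in>l2. R (R f) = T f)" for R
  proof
    fix f
    have b: "is_bounded_op R" and psd: "\<And>f. f \<in> l2 \<Longrightarrow> 0 \<le> Re (ip (R f) f)"
      and TT: "\<And>f. f \<in> l2 \<Longrightarrow> R (R f) = specop E c \<phi> f" using R T by auto
    show "R f = R0 f"
    proof (cases "f \<in> l2")
      case f: True
      let ?s = "\<Sum>e\<in>E. smult (ip f e) e"
      let ?g = "f - ?s"
      have s: "?s \<in> l2" by (rule specop_sum_l2[OF on fin])
      have g: "?g \<in> l2" using f s by auto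
      have ge: "ip ?g e = 0" if "e \<in> E" for e
        using f s on_l2[OF on fin that] ip_sum_on[OF on fin that, of "ip f"] by (simp add: ip_diff_left)
      have "specop E c \<phi> ?g = smult (of_real c) ?g"
        unfolding specop_def using ge by simp
      then have Rg: "R ?g = smult (of_real (sqrt c)) ?g"
        using c by (intro psd_sqrt_eigen[OF b psd g]) (auto simp: TT[OF g])
      have Re: "R e = smult (of_real (sqrt (\<phi> e))) e" if e: "e \<in> E" for e
      proof -
        have "specop E c \<phi> e = smult (of_real c) e + (\<Sum>e'\<in>E. if e' = e then smult (of_real (\<phi> e' - c)) e' else 0)"
          unfolding specop_def using e by (intro arg_cong2[where f = "(+)"] sum.cong) (auto simp: on_ip[OF on fin])
        also have "\<dots> = smult (of_real (\<phi> e)) e"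
          using e fin by (simp add: sv.scale_left_distrib[symmetric] del: of_real_diff flip: of_real_add)
        finally show ?thesis
          using \<phi>[OF e] by (intro psd_sqrt_eigen[OF b psd on_l2[OF on fin e]]) (auto simp: TT[OF on_l2[OF on fin e]])
      qed
      have "R f = R ?g + R ?s" using bop_add[OF b g s] unfolding diff_add_cancel .
      also have "R ?s = (\<Sum>e\<in>E. smult (ip f e * of_real (sqrt (\<phi> e))) e)"
        using on_l2[OF on fin] Re by (simp add: bop_sum[OF b] bop_smult[OF b] cong: sum.cong)
      also have "R ?g + \<dots> = ?R f"
      proof -
        have "(\<Sum>e\<in>E. smult (of_real (sqrt (\<phi> e) - sqrt c) * ip f e) e)
            = (\<Sum>e\<in>E. smult (ip f e * of_real (sqrt (\<phi> e))) e) - smult (of_real (sqrt c)) ?s"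
          unfolding sv.scale_sum_right sum_subtractf[symmetric]
          by (intro sum.cong refl) (simp add: algebra_simps sv.scale_left_diff_distrib)
        then show ?thesis unfolding Rg specop_def by (simp add: sv.scale_right_diff_distrib)
      qed
      finally show ?thesis using f by (simp add: R0in)
    qed (use R R0out in auto)
  qed
  show ?thesis unfolding R0_def[symmetric] psqrt_def by (rule the_equality) (fact ex, fact un)
qed

theorem spectral_finite_rank:
  assumes A: "is_bounded_op A" and sa: "selfadj A" and B: "finite B" and AB: "\<And>f. f \<in> l2 \<Longrightarrow> A f \<in> sv.span B"
  shows "\<exists>E. finite E \<and> orthonormal E \<and>
    (\<forall>f\<in>l2. A f = specop E 0 (\<lambda>e. Re (ip (A e) e)) f) \<and>
    (\<forall>e\<in>E. A e = smult (of_real (Re (ip (A e) e))) e)"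
proof -
  define good where "good E \<longleftrightarrow> finite E \<and> orthonormal E \<and>
     (\<forall>e\<in>E. Re (ip (A e) e) \<noteq> 0 \<and> A e = smult (of_real (Re (ip (A e) e))) e)" for E
  have span: "E \<subseteq> sv.span B" if "good E" for E
  proof
    fix e assume e: "e \<in> E"
    then have l: "e \<in> l2" using that by (auto simp: good_def orthonormal_def)
    let ?a = "of_real (Re (ip (A e) e)) :: complex"
    have "?a \<noteq> 0" "A e = smult ?a e" using that e by (auto simp: good_def)
    then have "e = smult (inverse ?a) (A e)" by (metis sv.scale_scale left_inverse sv.scale_one)
    then show "e \<in> sv.span B" using sv.span_scale[OF AB[OF l], of "inverse ?a"] by metis
  qed
  have "card E \<le> card B" if "good E" for E
    using that span[OF that] sv.independent_span_bound[OF B] orthonormal_independent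
    unfolding good_def by blast
  moreover have "good {}" by (simp add: good_def orthonormal_def)
  ultimately obtain E where E: "good E" and mx: "\<And>E'. good E' \<Longrightarrow> card E' \<le> card E"
    using ex_has_greatest_nat[of good "{}" card "Suc (card B)"] by (auto simp: less_Suc_eq_le)
  have on: "orthonormal E" and fin: "finite E" using E by (auto simp: good_def)
  let ?a = "\<lambda>e. Re (ip (A e) e)"
  let ?S = "specop E 0 ?a"
  define A' where "A' f = smult 1 (A f) - ?S f" for f
  have bA': "is_bounded_op A'"
    unfolding A'_def by (rule bop_lincomb[OF A bop_specop[OF on fin]])
  have sA': "ip (A' f) g = ip f (A' g)" if "f \<in> l2" "g \<in> l2" for f g
    using that sa selfadj_specop[OF on fin, of 0 ?a] bop_l2[OF A] specop_l2[OF on fin]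
    by (simp add: A'_def selfadj_def ip_diff_left ip_diff_right)
  have Ee: "A e = smult (of_real (?a e)) e" "e \<in> l2" if "e \<in> E" for e
    using E that by (auto simp: good_def orthonormal_def)
  have perp: "ip (A' f) e = 0" if "f \<in> l2" "e \<in> E" for f e
  proof -
    have "ip (A f) e = ip f (smult (of_real (?a e)) e)"
      using sa that Ee[OF that(2)] unfolding selfadj_def by metis
    then show ?thesis
      using that Ee(2)[OF that(2)] bop_l2[OF A] specop_l2[OF on fin] ip_specop[OF on fin that(2,1)]
      by (simp add: A'_def ip_diff_left ip_smult_right)
  qed
  have zero: "A' f = 0" if f: "f \<in> l2" for f
  proof (rule ccontr)
    assume nz: "A' f \<noteq> 0"
    let ?g = "A' f"
    note L = lin_on_l2[OF bA']
    have g: "?g \<in> l2" by (rule bop_l2[OF bA' f])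
    have sp: "A' h \<in> sv.span B" if "h \<in> l2" for h
      unfolding A'_def specop_def using span[OF E] AB[OF that]
      by (auto intro!: sv.span_diff sv.span_sum sv.span_scale)
    have "(A' ^^ i) ?g \<in> sv.span B" for i
    proof -
      have "(A' ^^ i) f \<in> l2" by (rule l2_pow[OF bop_l2[OF bA'] f])
      then have "A' ((A' ^^ i) f) \<in> sv.span B" by (rule sp)
      then show ?thesis by (simp add: funpow_swap1)
    qed
    from annihilator_exists[OF B this] obtain p where p: "p \<noteq> 0" "papp A' p ?g = 0" by blast
    from eigenvector_exists[OF L this nz g] obtain q b where
      q: "papp A' q ?g \<noteq> 0" "A' (papp A' q ?g) = smult b (papp A' q ?g)" by blast
    define y where "y = papp A' q f"
    have y: "y \<in> l2" unfolding y_def by (rule papp_closed[OF L f])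
    define e where "e = A' y"
    have ey: "papp A' q ?g = e" unfolding e_def y_def using papp_commute[OF L f] by simp
    have e: "e \<in> l2" "e \<noteq> 0" "A' e = smult b e" using q ey bop_l2[OF bA' y] by (auto simp: e_def)
    have b0: "b \<noteq> 0"
    proof
      assume "b = 0"
      then have "ip e e = 0" using sA'[OF e(1) y] e(3) y sA'[OF y e(1)] unfolding e_def by simp
      then show False using ip_self[OF e(1)] nrm_zero_iff[OF e(1)] e(2) by simp
    qed
    have eE: "ip e e' = 0" if "e' \<in> E" for e' unfolding e_def by (rule perp[OF y that])
    have Ae: "A e = smult b e"
      using e(3) eE by (simp add: A'_def specop_def)
    define n where "n = nrm e"
    have n: "n > 0" unfolding n_def using nrm_nonneg[OF e(1)] nrm_zero_iff[OF e(1)] e(2) by linarith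
    define u where "u = smult (of_real (1/n)) e"
    have u: "u \<in> l2" unfolding u_def using e(1) by auto
    have uu: "ip u u = 1"
    proof -
      have "nrm u = 1" unfolding u_def nrm_smult[OF e(1)] n_def[symmetric] using n by (simp add: norm_divide)
      then show ?thesis by (simp add: ip_self[OF u])
    qed
    have Au: "A u = smult b u" unfolding u_def bop_smult[OF A e(1)] Ae by (simp add: mult.commute)
    have "ip (A u) u = b" unfolding Au ip_smult_left[OF u u] uu by simp
    moreover have "ip (A u) u = cnj b"
    proof -
      have "ip (A u) u = ip u (A u)" using sa u by (simp add: selfadj_def)
      then show ?thesis unfolding Au ip_smult_right[OF u u] uu by simp
    qed
    ultimately have br: "of_real (Re b) = b" by (metis complex_cnj_cancel_iff complex_In_mult_cnj_zero complex_cnj Reals_cnj_iff of_real_Re)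
    have au: "?a u = Re b" using \<open>ip (A u) u = b\<close> by simp
    have uE: "ip u e' = 0" "ip e' u = 0" if "e' \<in> E" for e'
    proof -
      show "ip u e' = 0" unfolding u_def using e(1) Ee(2)[OF that] eE[OF that] by (simp add: ip_smult_left)
      then show "ip e' u = 0" using ip_cnj[OF u Ee(2)[OF that]] by simp
    qed
    have nu: "u \<notin> E" using uE uu by force
    have "orthonormal (insert u E)"
      using on u uu uE nu unfolding orthonormal_def by auto
    moreover have "?a u \<noteq> 0" using br b0 au by force
    ultimately have "good (insert u E)"
      using E Au au br unfolding good_def by simp
    then have "card (insert u E) \<le> card E" by (rule mx)
    then show False using nu fin by simp
  qed
  show ?thesis
  proof (intro exI[of _ E] conjI fin on ballI)
    show "A f = ?S f" if "f \<in> l2" for f using zero[OF that] by (simp add: A'_def)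
    show "A e = smult (of_real (?a e)) e" if "e \<in> E" for e by (rule Ee[OF that])
  qed
qed

definition oproj :: "'n::finite seq set \<Rightarrow> bool" where
  "oproj M \<longleftrightarrow> sv.subspace M \<and> M \<subseteq> l2 \<and> (\<forall>f\<in>l2. \<exists>g\<in>M. \<forall>m\<in>M. ip (f - g) m = 0)"

lemma oproj_unique:
  assumes "oproj M" "f \<in> l2" "g \<in> M" "\<And>m. m \<in> M \<Longrightarrow> ip (f - g) m = 0"
  shows "proj M f = g"
proof -
  have un: "h = g" if "h \<in> M" "\<forall>m\<in>M. ip (f - h) m = 0" for h
  proof -
    have M: "M \<subseteq> l2" "sv.subspace M" using assms(1) by (auto simp: oproj_def)
    have d: "h - g \<in> M" by (rule sv.subspace_diff[OF M(2) that(1) assms(3)])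
    have l: "h \<in> l2" "g \<in> l2" "h - g \<in> l2" using M(1) that(1) assms(3) d by blast+
    have "ip (h - g) (h - g) = ip ((f - g) - (f - h)) (h - g)" by simp
    also have "\<dots> = ip (f - g) (h - g) - ip (f - h) (h - g)"
      by (rule ip_diff_left[OF l2_diff[OF assms(2) l(2)] l2_diff[OF assms(2) l(1)] l(3)])
    also have "\<dots> = 0" using that(2) assms(4) d by simp
    finally show "h = g" using ip_self[OF l(3)] nrm_zero_iff[OF l(3)] by simp
  qed
  have "(THE g. g \<in> M \<and> (\<forall>m\<in>M. ip (ssub f g) m = 0)) = g"
    unfolding ssub_eq
  proof (rule the_equality)
    show "g \<in> M \<and> (\<forall>m\<in>M. ip (f - g) m = 0)" using assms(3,4) by blast
    show "h = g" if "h \<in> M \<and> (\<forall>m\<in>M. ip (f - h) m = 0)" for h using that un by blast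
  qed
  then show ?thesis using assms(2) by (simp add: proj_def)
qed

context
  fixes M :: "'n::finite seq set"
  assumes M: "oproj M"
begin

lemma oproj_sub: "m \<in> M \<Longrightarrow> m \<in> l2" using M by (auto simp: oproj_def)
lemma oproj_subspace: "sv.subspace M" using M by (auto simp: oproj_def)

lemma proj_in: "f \<in> l2 \<Longrightarrow> proj M f \<in> M"
  and proj_perp: "f \<in> l2 \<Longrightarrow> m \<in> M \<Longrightarrow> ip (f - proj M f) m = 0"
proof -
  assume f: "f \<in> l2"
  then obtain g where g: "g \<in> M" "\<And>m. m \<in> M \<Longrightarrow> ip (f - g) m = 0"
    using M unfolding oproj_def by blast
  have "proj M f = g" by (rule oproj_unique[OF M f g])
  then show "proj M f \<in> M" "m \<in> M \<Longrightarrow> ip (f - proj M f) m = 0" using g by auto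
qed

lemma proj_l2: "f \<in> l2 \<Longrightarrow> proj M f \<in> l2"
  by (rule oproj_sub[OF proj_in])

lemma proj_id: "m \<in> M \<Longrightarrow> proj M m = m"
  by (rule oproj_unique[OF M]) (auto simp: oproj_sub)

lemma ip_proj: assumes "f \<in> l2" "g \<in> l2" shows "ip (proj M f) g = ip (proj M f) (proj M g)"
proof -
  have "ip (g - proj M g) (proj M f) = 0" by (rule proj_perp[OF assms(2) proj_in[OF assms(1)]])
  then have "ip (proj M f) (g - proj M g) = 0"
    using ip_cnj[of "g - proj M g" "proj M f"] proj_l2 assms by simp
  then show ?thesis using assms proj_l2 by (simp add: ip_diff_right)
qed

lemma selfadj_proj: "selfadj (proj M)"
  unfolding selfadj_def
proof (intro ballI)
  fix f g :: "'n seq" assume f: "f \<in> l2" and g: "g \<in> l2"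
  have "ip f (proj M g) = cnj (ip (proj M g) f)" using ip_cnj[OF proj_l2[OF g] f] by simp
  also have "\<dots> = cnj (ip (proj M g) (proj M f))" by (simp only: ip_proj[OF g f])
  also have "\<dots> = ip (proj M f) (proj M g)" by (rule ip_cnj[OF proj_l2[OF g] proj_l2[OF f]])
  finally show "ip (proj M f) g = ip f (proj M g)" using ip_proj[OF f g] by simp
qed

lemma nrm_proj_le: assumes "f \<in> l2" shows "nrm (proj M f) \<le> nrm f"
proof (cases "nrm (proj M f) = 0")
  case False
  have p: "nrm (proj M f) > 0" using False nrm_nonneg[OF proj_l2[OF assms]] by simp
  have "of_real ((nrm (proj M f))^2) = ip (proj M f) f"
    using ip_proj[OF assms assms] ip_self[OF proj_l2[OF assms]] by simp
  then have "(nrm (proj M f))^2 = cmod (ip (proj M f) f)"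
    using norm_of_real[of "(nrm (proj M f))^2", where ?'a = complex] by simp
  also have "\<dots> \<le> nrm (proj M f) * nrm f" by (rule cmod_ip_le[OF proj_l2[OF assms] assms])
  finally show ?thesis using p by (simp add: power2_eq_square)
qed (use assms in simp)

lemma bop_proj: "is_bounded_op (proj M)"
proof (rule bopI[where C = 1])
  fix f g :: "'n seq" assume f: "f \<in> l2" and g: "g \<in> l2"
  have e: "f + g - (proj M f + proj M g) = (f - proj M f) + (g - proj M g)" by simp
  show "proj M (f + g) = proj M f + proj M g"
  proof (rule oproj_unique[OF M])
    fix m assume m: "m \<in> M"
    have "ip ((f - proj M f) + (g - proj M g)) m = 0"
      unfolding ip_add_left[OF l2_diff[OF f proj_l2[OF f]] l2_diff[OF g proj_l2[OF g]] oproj_sub[OF m]]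
        proj_perp[OF f m] proj_perp[OF g m] by simp
    then show "ip (f + g - (proj M f + proj M g)) m = 0" unfolding e .
  qed (use f g in \<open>auto intro!: sv.subspace_add oproj_subspace proj_in\<close>)
next
  fix c and f :: "'n seq" assume f: "f \<in> l2"
  have e: "smult c f - smult c (proj M f) = smult c (f - proj M f)" by (simp add: sv.scale_right_diff_distrib)
  show "proj M (smult c f) = smult c (proj M f)"
  proof (rule oproj_unique[OF M])
    fix m assume m: "m \<in> M"
    have "ip (smult c (f - proj M f)) m = 0"
      unfolding ip_smult_left[OF l2_diff[OF f proj_l2[OF f]] oproj_sub[OF m]] proj_perp[OF f m] by simp
    then show "ip (smult c f - smult c (proj M f)) m = 0" unfolding e .
  qed (use f in \<open>auto intro!: sv.subspace_scale oproj_subspace proj_in\<close>)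
qed (simp_all add: nrm_proj_le proj_l2)

end

lemma fin_dim_onb:
  assumes "fin_dim_subspace M"
  obtains E where "finite E" "orthonormal E" "E \<subseteq> M" "oproj M"
    "\<And>f. f \<in> l2 \<Longrightarrow> proj M f = (\<Sum>e\<in>E. smult (ip f e) e)"
proof -
  obtain B where B: "finite B" "B \<subseteq> l2" "M = sv.span B"
    using assms unfolding fin_dim_subspace_def cspan_eq_span by blast
  have Bl: "\<And>b. b \<in> B \<Longrightarrow> b \<in> l2" using B by auto
  define A where "A f = (\<Sum>b\<in>B. smult (ip f b) b)" for f
  have Al: "A f \<in> l2" for f unfolding A_def by (intro l2_sum l2_smult Bl)
  have bA: "is_bounded_op A"
  proof (rule bopI[where C = "\<Sum>b\<in>B. nrm b * nrm b"])
    fix f assume f: "f \<in> (l2 :: 'a seq set)"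
    have "nrm (A f) \<le> (\<Sum>b\<in>B. nrm (smult (ip f b) b))"
      unfolding A_def by (rule nrm_sum_le) (intro l2_smult Bl)
    also have "\<dots> \<le> (\<Sum>b\<in>B. nrm b * nrm b * nrm f)"
    proof (rule sum_mono)
      fix b assume b: "b \<in> B"
      show "nrm (smult (ip f b) b) \<le> nrm b * nrm b * nrm f"
        unfolding nrm_smult[OF Bl[OF b]]
        using mult_right_mono[OF cmod_ip_le[OF f Bl[OF b]] nrm_nonneg[OF Bl[OF b]]]
        by (simp add: mult.commute mult.left_commute)
    qed
    finally show "nrm (A f) \<le> (\<Sum>b\<in>B. nrm b * nrm b) * nrm f" by (simp add: sum_distrib_right)
  qed (simp_all add: Al, simp_all add: A_def ip_add_left ip_smult_left Bl sv.scale_left_distrib sum.distrib sv.scale_sum_right cong: sum.cong)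
  have Aip: "ip (A f) g = (\<Sum>b\<in>B. ip f b * ip b g)" if "f \<in> l2" "g \<in> l2" for f g
    unfolding A_def using that Bl by (simp add: ip_sum_left ip_smult_left)
  have sA: "selfadj A" unfolding selfadj_def
  proof (intro ballI)
    fix f g :: "'a seq" assume f: "f \<in> l2" and g: "g \<in> l2"
    have "ip f (A g) = cnj (ip (A g) f)" using ip_cnj[OF Al f] by simp
    also have "\<dots> = (\<Sum>b\<in>B. ip b g * ip f b)"
      unfolding Aip[OF g f] using f g Bl by (simp add: ip_cnj)
    finally show "ip (A f) g = ip f (A g)" unfolding Aip[OF f g] by (simp add: mult.commute)
  qed
  have ABs: "A f \<in> sv.span B" for f
    unfolding A_def by (intro sv.span_sum sv.span_scale sv.span_base)
  obtain E where E: "finite E" "orthonormal E"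
    and AE: "\<And>f. f \<in> l2 \<Longrightarrow> A f = specop E 0 (\<lambda>e. Re (ip (A e) e)) f"
    and Ae: "\<And>e. e \<in> E \<Longrightarrow> A e = smult (of_real (Re (ip (A e) e))) e"
    using spectral_finite_rank[OF bA sA B(1) ABs] by blast
  have El: "e \<in> l2" if "e \<in> E" for e using that E(2) by (auto simp: orthonormal_def)
  define E' where "E' = {e\<in>E. Re (ip (A e) e) \<noteq> 0}"
  have E': "finite E'" "orthonormal E'" using E by (auto simp: E'_def orthonormal_def)
  have EM: "E' \<subseteq> M"
  proof
    fix e assume e: "e \<in> E'"
    let ?a = "of_real (Re (ip (A e) e)) :: complex"
    have "?a \<noteq> 0" "A e = smult ?a e" using e Ae by (auto simp: E'_def)
    then have "e = smult (inverse ?a) (A e)" by (metis sv.scale_scale left_inverse sv.scale_one)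
    then show "e \<in> M" using sv.span_scale[OF ABs, of "inverse ?a" e] B(3) by metis
  qed
  have AE': "A f = (\<Sum>e\<in>E'. smult (of_real (Re (ip (A e) e)) * ip f e) e)" if "f \<in> l2" for f
    unfolding AE[OF that] specop_def E'_def using E(1) by (auto intro!: sum.mono_neutral_right)
  let ?P = "\<lambda>f. \<Sum>e\<in>E'. smult (ip f e) e"
  have Pl: "?P f \<in> l2" for f by (rule specop_sum_l2[OF E'(2,1)])
  have perp: "ip (f - ?P f) b = 0" if f: "f \<in> l2" and b: "b \<in> B" for f b
  proof -
    define g where "g = f - ?P f"
    have g: "g \<in> l2" unfolding g_def using f Pl by auto
    have "ip g e = 0" if "e \<in> E'" for e
      unfolding g_def using ip_sum_on[OF E'(2,1) that, of "ip f"] f Pl on_l2[OF E'(2,1) that]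
      by (simp add: ip_diff_left)
    then have "A g = 0" unfolding AE'[OF g] by simp
    then have "0 = ip (A g) g" by simp
    also have "\<dots> = (\<Sum>b\<in>B. of_real ((cmod (ip g b))^2))"
      unfolding Aip[OF g g] complex_norm_square by (intro sum.cong refl) (simp add: ip_cnj Bl g)
    finally have "of_real (\<Sum>b\<in>B. (cmod (ip g b))^2) = (0::complex)" unfolding of_real_sum by (rule sym)
    then have "(\<Sum>b\<in>B. (cmod (ip g b))^2) = 0" by (simp only: of_real_eq_0_iff)
    then have "(cmod (ip g b))^2 = 0" using b B(1) by (subst (asm) sum_nonneg_eq_0_iff) auto
    then show ?thesis by (simp add: g_def)
  qed
  have perpM: "ip (f - ?P f) m = 0" if f: "f \<in> l2" and m: "m \<in> M" for f m
  proof -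
    from m B obtain t r where t: "finite t" "t \<subseteq> B" "m = (\<Sum>a\<in>t. smult (r a) a)"
      unfolding sv.span_explicit by blast
    have "ip (f - ?P f) (smult (r a) a) = 0" if "a \<in> t" for a
    proof -
      have a: "a \<in> B" using t that by blast
      show ?thesis unfolding ip_smult_right[OF Bl[OF a] l2_diff[OF f Pl]] perp[OF f a] by simp
    qed
    then have "(\<Sum>a\<in>t. ip (f - ?P f) (smult (r a) a)) = 0" by simp
    moreover have "ip (f - ?P f) (\<Sum>a\<in>t. smult (r a) a) = (\<Sum>a\<in>t. ip (f - ?P f) (smult (r a) a))"
      by (rule ip_sum_right) (use t Bl in blast, rule l2_diff[OF f Pl])
    ultimately show ?thesis unfolding t(3) by simp
  qed
  have Ml: "M \<subseteq> l2" unfolding B(3) using sv.span_minimal[OF B(2) subspace_l2] .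
  have PM: "?P f \<in> M" for f
    using EM unfolding B(3) by (intro sv.span_sum sv.span_scale) auto
  have op: "oproj M" unfolding oproj_def
  proof (intro conjI ballI Ml)
    show "sv.subspace M" unfolding B(3) by (rule sv.subspace_span)
    show "\<exists>g\<in>M. \<forall>m\<in>M. ip (f - g) m = 0" if "f \<in> l2" for f
      by (intro bexI[OF _ PM[of f]] ballI) (rule perpM[OF that])
  qed
  have "proj M f = ?P f" if "f \<in> l2" for f
    by (rule oproj_unique[OF op that PM]) (rule perpM[OF that])
  then show ?thesis by (rule that[OF E' EM op])
qed

section \<open>Fourier coefficients on the circle\<close>

definition ee :: "int \<Rightarrow> real \<Rightarrow> complex" where "ee m t = cis (of_int m * t)"

lemma ee_add: "ee m t * ee n t = ee (m + n) t"
  by (simp add: ee_def cis_mult distrib_right)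
lemma ee_0 [simp]: "ee 0 t = 1" by (simp add: ee_def)
lemma norm_ee [simp]: "cmod (ee m t) = 1" by (simp add: ee_def)
lemma cnj_ee: "cnj (ee m t) = ee (- m) t" by (simp add: ee_def cis_cnj)
lemma ee_nat: "ee (int n) t = cis t ^ n"
  unfolding ee_def Complex.DeMoivre by simp
lemma ee_neg: "ee (- int n) t = inverse (cis t) ^ n"
  unfolding ee_def cis_inverse Complex.DeMoivre by simp

lemma space_circ [simp]: "space circ = {0..2*pi}" by (simp add: circ_def)

lemma finite_measure_circ: "finite_measure circ"
  unfolding circ_def by (rule finite_measure_lebesgue_on) (simp add: lmeasurable_interval)

lemma continuous_measurable_circ:
  fixes f :: "real \<Rightarrow> 'a::{euclidean_space}"
  shows "continuous_on {0..2*pi} f \<Longrightarrow> f \<in> borel_measurable circ"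
  unfolding circ_def by (rule continuous_imp_measurable_on_sets_lebesgue) auto

lemma continuous_integrable_circ:
  fixes f :: "real \<Rightarrow> 'a::{euclidean_space}"
  shows "continuous_on {0..2*pi} f \<Longrightarrow> integrable circ f"
  unfolding circ_def by (rule continuous_imp_integrable_real)

lemma continuous_ee [continuous_intros]: "continuous_on A (ee m)"
  unfolding ee_def by (intro continuous_intros)

lemma measurable_ee [measurable]: "ee m \<in> borel_measurable circ"
  by (rule continuous_measurable_circ[OF continuous_ee])

lemma integrable_times_bounded:
  fixes f g :: "real \<Rightarrow> complex"
  assumes f: "integrable circ f" and g: "g \<in> borel_measurable circ" and b: "AE t in circ. cmod (g t) \<le> C"
  shows "integrable circ (\<lambda>t. f t * g t)"
proof (rule Bochner_Integration.integrable_bound)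
  show "integrable circ (\<lambda>t. of_real C * f t)" using f by simp
  show "(\<lambda>t. f t * g t) \<in> borel_measurable circ" using f g by measurable
  show "AE t in circ. cmod (f t * g t) \<le> cmod (of_real C * f t)"
    using b
  proof eventually_elim
    case (elim t)
    have "cmod (f t) * cmod (g t) \<le> cmod (f t) * C" using elim by (simp add: mult_left_mono)
    also have "\<dots> \<le> cmod (f t) * \<bar>C\<bar>" by (intro mult_left_mono) auto
    finally show ?case by (simp add: norm_mult mult.commute)
  qed
qed

lemma integrable_ee: "integrable circ f \<Longrightarrow> integrable circ (\<lambda>t. f t * ee m t)"
  by (rule integrable_times_bounded[where C = 1]) auto

lemma fc_ee: "fc f n = (1 / (2*pi)) * integral\<^sup>L circ (\<lambda>t. f t * ee (- n) t)"
proof -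
  have "exp (- \<i> * of_int n * of_real t) = ee (- n) t" for t
    by (simp add: ee_def cis_conv_exp mult.assoc)
  then show ?thesis by (simp add: fc_def)
qed

lemma integral_ee: "integral\<^sup>L circ (ee m) = (if m = 0 then 2 * pi else 0)"
proof -
  have "integral\<^sup>L circ (ee m) = integral {0..2*pi} (ee m)"
    unfolding circ_def
    by (rule lebesgue_integral_eq_integral[OF continuous_integrable_circ[unfolded circ_def, OF continuous_ee]]) simp
  also have "\<dots> = (if m = 0 then 2 * pi else 0)"
  proof (cases "m = 0")
    case True
    then have "ee m = (\<lambda>t. 1)" by (simp add: fun_eq_iff)
    then show ?thesis using True by (simp add: scaleR_conv_of_real)
  next
    case False
    define c where "c = \<i> * of_int m"
    have c: "c \<noteq> 0" using False by (simp add: c_def)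
    have ee: "ee m t = exp (c * of_real t)" for t
      by (simp add: ee_def cis_conv_exp c_def mult.assoc)
    have "(ee m has_integral (exp (c * of_real (2*pi)) / c - exp (c * of_real 0) / c)) {0..2*pi}"
    proof (rule fundamental_theorem_of_calculus)
      fix t :: real
      have "((\<lambda>z. exp (c * z) / c) has_field_derivative exp (c * of_real t)) (at (of_real t))"
        using c by (auto intro!: derivative_eq_intros)
      then show "((\<lambda>t. exp (c * of_real t) / c) has_vector_derivative ee m t) (at t within {0..2*pi})"
        unfolding ee by (rule has_vector_derivative_real_field)
    qed simp
    moreover have "exp (c * of_real (2*pi)) = 1"
    proof -
      have "c * of_real (2*pi) = of_int (2 * m) * (of_real pi * \<i>)" by (simp add: c_def)
      then show ?thesis using exp_integer_2pi[of "of_int m"] by (simp add: c_def mult.commute mult.left_commute)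
    qed
    ultimately show ?thesis using False by (simp add: integral_unique)
  qed
  finally show ?thesis .
qed

lemma fc_of_ee: "fc (ee m) n = (if m = n then 1 else 0)"
  unfolding fc_ee ee_add integral_ee by simp

lemma fc_times_ee: "fc (\<lambda>t. f t * ee m t) n = fc f (n - m)"
  unfolding fc_ee mult.assoc ee_add by simp

lemma measurable_cnj: "f \<in> borel_measurable M \<Longrightarrow> (\<lambda>t. cnj (f t)) \<in> borel_measurable M"
  by (erule measurable_compose[OF _ borel_measurable_continuous_onI[OF continuous_on_cnj[OF continuous_on_id]]])

lemma fc_add: "integrable circ f \<Longrightarrow> integrable circ g \<Longrightarrow> fc (\<lambda>t. f t + g t) n = fc f n + fc g n"
  unfolding fc_ee by (simp add: distrib_right integrable_ee distrib_left)
lemma fc_diff: "integrable circ f \<Longrightarrow> integrable circ g \<Longrightarrow> fc (\<lambda>t. f t - g t) n = fc f n - fc g n"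
  unfolding fc_ee by (simp add: left_diff_distrib integrable_ee right_diff_distrib)
lemma fc_cmult: "fc (\<lambda>t. c * f t) n = c * fc f n"
  unfolding fc_ee by (simp add: mult.assoc)
lemma fc_sum: "(\<And>a. a \<in> A \<Longrightarrow> integrable circ (f a)) \<Longrightarrow> fc (\<lambda>t. \<Sum>a\<in>A. f a t) n = (\<Sum>a\<in>A. fc (f a) n)"
  unfolding fc_ee by (simp add: sum_distrib_right sum_distrib_left integrable_ee)
lemma fc_cong_AE:
  assumes "f \<in> borel_measurable circ" "g \<in> borel_measurable circ" "AE t in circ. f t = g t"
  shows "fc f n = fc g n"
proof -
  have "integral\<^sup>L circ (\<lambda>t. f t * ee (- n) t) = integral\<^sup>L circ (\<lambda>t. g t * ee (- n) t)"
    by (rule integral_cong_AE) (use assms in \<open>auto elim: eventually_mono\<close>)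
  then show ?thesis by (simp add: fc_ee)
qed

lemma
  assumes f: "integrable circ f" and c: "summable (\<lambda>k. cmod (c k))"
  shows integrable_series: "integrable circ (\<lambda>t. f t * (\<Sum>k. c k * ee (\<sigma> k) t))"
    and fc_series: "fc (\<lambda>t. f t * (\<Sum>k. c k * ee (\<sigma> k) t)) n = (\<Sum>k. c k * fc f (n - \<sigma> k))"
proof -
  have s: "summable (\<lambda>k. c k * ee (\<sigma> k) t)" for t
    by (rule summable_norm_cancel) (simp add: norm_mult c)
  define g where "g m k t = f t * (c k * ee (\<sigma> k + m) t)" for m k t
  have gs: "(\<Sum>k. g m k t) = f t * (\<Sum>k. c k * ee (\<sigma> k) t) * ee m t" for m t
  proof -
    have "(\<Sum>k. g m k t) = (\<Sum>k. f t * ee m t * (c k * ee (\<sigma> k) t))"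
      by (simp add: g_def ee_add[symmetric] ac_simps)
    also have "\<dots> = f t * ee m t * (\<Sum>k. c k * ee (\<sigma> k) t)" by (rule suminf_mult[OF s])
    finally show ?thesis by (simp add: ac_simps)
  qed
  have gi: "integrable circ (g m k)" for m k
    using integrable_ee[OF f, of "\<sigma> k + m", THEN integrable_mult_right[of "c k"]]
    by (simp add: g_def[abs_def] ac_simps)
  have gn: "cmod (g m k t) = cmod (c k) * cmod (f t)" for m k t by (simp add: g_def norm_mult)
  have a: "AE t in circ. summable (\<lambda>k. cmod (g m k t))" for m
    unfolding gn by (intro AE_I2 summable_mult2 c)
  have b: "summable (\<lambda>k. integral\<^sup>L circ (\<lambda>t. cmod (g m k t)))" for m
    unfolding gn by (simp add: summable_mult2 c)
  show "integrable circ (\<lambda>t. f t * (\<Sum>k. c k * ee (\<sigma> k) t))"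
    using integrable_suminf[OF gi a b, of 0] unfolding gs by simp
  have gk: "integral\<^sup>L circ (g (- n) k) = c k * (2 * pi * fc f (n - \<sigma> k))" for k
  proof -
    have "g (- n) k = (\<lambda>t. c k * (f t * ee (- (n - \<sigma> k)) t))" by (simp add: g_def fun_eq_iff ac_simps)
    then show ?thesis by (simp add: fc_ee)
  qed
  have "integral\<^sup>L circ (\<lambda>t. f t * (\<Sum>k. c k * ee (\<sigma> k) t) * ee (- n) t) = (\<Sum>k. integral\<^sup>L circ (g (- n) k))"
    using integral_suminf[OF gi a b, of "- n"] unfolding gs .
  then have "fc (\<lambda>t. f t * (\<Sum>k. c k * ee (\<sigma> k) t)) n
      = (1 / (2*pi)) * (\<Sum>k. c k * (2 * pi * fc f (n - \<sigma> k)))"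
    unfolding fc_ee[of _ n] gk by simp
  also have "(1 / (2*pi)) * (\<Sum>k. c k * (2 * pi * fc f (n - \<sigma> k))) = (\<Sum>k. (1 / (2*pi)) * (c k * (2 * pi * fc f (n - \<sigma> k))))"
  proof (rule suminf_mult[symmetric])
    have "summable (\<lambda>k. integral\<^sup>L circ (g (- n) k))" by (rule summable_integral[OF gi a b])
    then show "summable (\<lambda>k. c k * (2 * pi * fc f (n - \<sigma> k)))"
      unfolding gk .
  qed
  finally show "fc (\<lambda>t. f t * (\<Sum>k. c k * ee (\<sigma> k) t)) n = (\<Sum>k. c k * fc f (n - \<sigma> k))"
    by simp
qed

lemma integrable_one_circ: "integrable circ (\<lambda>t. 1 :: complex)"
  by (rule continuous_integrable_circ) simp

lemma fc_one: "fc (\<lambda>t. 1) n = (if n = 0 then 1 else 0)"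
proof -
  have "ee 0 = (\<lambda>t. 1)" by (simp add: fun_eq_iff)
  then show ?thesis using fc_of_ee[of 0 n] by auto
qed

lemma fc_series_alone:
  assumes "summable (\<lambda>k. cmod (c k))" "inj \<sigma>"
  shows "integrable circ (\<lambda>t. \<Sum>k. c k * ee (\<sigma> k) t)"
    "fc (\<lambda>t. \<Sum>k. c k * ee (\<sigma> k) t) (\<sigma> j) = c j"
    "n \<notin> range \<sigma> \<Longrightarrow> fc (\<lambda>t. \<Sum>k. c k * ee (\<sigma> k) t) n = 0"
proof -
  show "integrable circ (\<lambda>t. \<Sum>k. c k * ee (\<sigma> k) t)"
    using integrable_series[OF integrable_one_circ assms(1), of \<sigma>] by simp
  have e: "fc (\<lambda>t. \<Sum>k. c k * ee (\<sigma> k) t) n = (\<Sum>k. c k * (if n = \<sigma> k then 1 else 0))" for n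
    using fc_series[OF integrable_one_circ assms(1), of \<sigma> n] by (simp add: fc_one)
  have "(\<Sum>k. c k * (if \<sigma> j = \<sigma> k then 1 else 0)) = (\<Sum>k\<in>{j}. c k * (if \<sigma> j = \<sigma> k then 1 else 0))"
    by (rule suminf_finite) (use assms(2) in \<open>auto simp: inj_def\<close>)
  then show "fc (\<lambda>t. \<Sum>k. c k * ee (\<sigma> k) t) (\<sigma> j) = c j" unfolding e by simp
  assume "n \<notin> range \<sigma>"
  then have "(if n = \<sigma> k then 1 else 0) = (0::complex)" for k by auto
  then show "fc (\<lambda>t. \<Sum>k. c k * ee (\<sigma> k) t) n = 0" unfolding e by simp
qed

lemma continuous_series:
  assumes "summable (\<lambda>k. cmod (c k))" shows "continuous_on A (\<lambda>t. \<Sum>k. c k * ee (\<sigma> k) t)"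
proof (rule uniform_limit_theorem)
  show "uniform_limit A (\<lambda>n t. \<Sum>k<n. c k * ee (\<sigma> k) t) (\<lambda>t. \<Sum>k. c k * ee (\<sigma> k) t) sequentially"
    by (rule Weierstrass_m_test[OF _ assms]) (simp add: norm_mult)
qed (auto intro!: always_eventually continuous_intros)

lemma bessel_partial:
  assumes f: "f \<in> borel_measurable circ" and b: "AE t in circ. cmod (f t) \<le> C" and A: "finite A"
  shows "(\<Sum>n\<in>A. (cmod (fc f n))^2) \<le> (1 / (2*pi)) * integral\<^sup>L circ (\<lambda>t. (cmod (f t))^2)"
proof -
  define s where "s t = (\<Sum>n\<in>A. fc f n * ee n t)" for t
  have cs: "continuous_on {0..2*pi} s" unfolding s_def by (intro continuous_intros)
  have ms: "s \<in> borel_measurable circ" and iS: "integrable circ s"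
    using continuous_measurable_circ[OF cs] continuous_integrable_circ[OF cs] by auto
  have "fc f n * ee n t = ee n t * fc f n" for n t by (simp add: mult.commute)
  have bs: "cmod (s t) \<le> (\<Sum>n\<in>A. cmod (fc f n))" for t
    unfolding s_def by (rule order_trans[OF norm_sum]) (simp add: norm_mult)
  have if': "integrable circ f"
    using integrable_times_bounded[OF integrable_one_circ f b] by simp
  have fcs: "fc s m = fc f m" if "m \<in> A" for m
  proof -
    have "fc s m = (\<Sum>n\<in>A. fc (\<lambda>t. fc f n * ee n t) m)"
      unfolding s_def by (rule fc_sum) (intro integrable_mult_right continuous_integrable_circ continuous_ee)
    also have "\<dots> = (\<Sum>n\<in>A. if n = m then fc f n else 0)"
      by (intro sum.cong refl) (simp add: fc_cmult fc_of_ee)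
    finally show ?thesis using that A by simp
  qed
  have ip: "integral\<^sup>L circ (\<lambda>t. h t * cnj (s t)) = (\<Sum>n\<in>A. cnj (fc f n) * (2 * pi * fc h n))"
    if "integrable circ h" for h
  proof -
    have "integral\<^sup>L circ (\<lambda>t. h t * cnj (s t)) = integral\<^sup>L circ (\<lambda>t. \<Sum>n\<in>A. cnj (fc f n) * (h t * ee (- n) t))"
      by (simp add: s_def sum_distrib_left cnj_ee ac_simps)
    also have "\<dots> = (\<Sum>n\<in>A. integral\<^sup>L circ (\<lambda>t. cnj (fc f n) * (h t * ee (- n) t)))"
      by (rule Bochner_Integration.integral_sum) (intro integrable_mult_right integrable_ee that)
    finally show ?thesis by (simp add: fc_ee)
  qed
  have ifs: "integrable circ (\<lambda>t. f t * cnj (s t))" and iss: "integrable circ (\<lambda>t. s t * cnj (s t))"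
    using bs by (auto intro!: integrable_times_bounded[OF _ measurable_cnj[OF ms]] if' iS AE_I2)
  have iff: "integrable circ (\<lambda>t. f t * cnj (f t))"
    using b by (intro integrable_times_bounded[OF if' measurable_cnj[OF f]]) simp
  have S: "integral\<^sup>L circ (\<lambda>t. s t * cnj (s t)) = of_real (2 * pi * (\<Sum>n\<in>A. (cmod (fc f n))^2))"
    unfolding ip[OF iS] of_real_mult of_real_sum sum_distrib_left complex_norm_square
    by (intro sum.cong refl) (simp add: fcs)
  have F: "integral\<^sup>L circ (\<lambda>t. f t * cnj (s t)) = of_real (2 * pi * (\<Sum>n\<in>A. (cmod (fc f n))^2))"
    unfolding ip[OF if'] of_real_mult of_real_sum sum_distrib_left complex_norm_square
    by (intro sum.cong refl) simp
  have RR: "integral\<^sup>L circ (\<lambda>t. Re (a t) + Re (b t) - 2 * Re (c t))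
      = Re (integral\<^sup>L circ a) + Re (integral\<^sup>L circ b) - 2 * Re (integral\<^sup>L circ c)"
    if "integrable circ a" "integrable circ b" "integrable circ c" for a b c
    using that by (simp add: integral_Re)
  have "0 \<le> integral\<^sup>L circ (\<lambda>t. (cmod (f t - s t))^2)" by simp
  also have "\<dots> = integral\<^sup>L circ (\<lambda>t. Re (f t * cnj (f t)) + Re (s t * cnj (s t)) - 2 * Re (f t * cnj (s t)))"
    unfolding cmod_power2
    by (intro Bochner_Integration.integral_cong refl) (simp add: power2_eq_square algebra_simps)
  also have "\<dots> = Re (integral\<^sup>L circ (\<lambda>t. f t * cnj (f t))) + Re (integral\<^sup>L circ (\<lambda>t. s t * cnj (s t)))
      - 2 * Re (integral\<^sup>L circ (\<lambda>t. f t * cnj (s t)))"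
    by (rule RR[OF iff iss ifs])
  also have "Re (integral\<^sup>L circ (\<lambda>t. f t * cnj (f t))) = integral\<^sup>L circ (\<lambda>t. (cmod (f t))^2)"
    by (simp only: complex_norm_square[symmetric] integral_complex_of_real Re_complex_of_real)
  finally show ?thesis unfolding S F by (simp add: field_simps)
qed

lemma fc_tendsto_0:
  assumes "f \<in> borel_measurable circ" "AE t in circ. cmod (f t) \<le> C"
  shows "(\<lambda>n. fc f (- int n - 1)) \<longlonglongrightarrow> 0"
proof -
  have "summable (\<lambda>n. (cmod (fc f (- int n - 1)))^2)"
  proof (rule summableI_nonneg_bounded)
    fix N
    have "(\<Sum>n<N. (cmod (fc f (- int n - 1)))^2) = (\<Sum>n\<in>(\<lambda>n. - int n - 1) ` {..<N}. (cmod (fc f n))^2)"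
      by (subst sum.reindex) (auto simp: inj_on_def)
    also have "\<dots> \<le> (1 / (2*pi)) * integral\<^sup>L circ (\<lambda>t. (cmod (f t))^2)"
      by (rule bessel_partial[OF assms]) simp
    finally show "(\<Sum>n<N. (cmod (fc f (- int n - 1)))^2) \<le> (1 / (2*pi)) * integral\<^sup>L circ (\<lambda>t. (cmod (f t))^2)" .
  qed simp
  then have "(\<lambda>n. sqrt ((cmod (fc f (- int n - 1)))^2)) \<longlonglongrightarrow> sqrt 0"
    by (intro tendsto_real_sqrt summable_LIMSEQ_zero)
  then show ?thesis by (simp add: tendsto_norm_zero_iff)
qed

definition multiplier :: "(real \<Rightarrow> complex) \<Rightarrow> bool" where
  "multiplier g \<longleftrightarrow> g \<in> borel_measurable circ \<and> (\<exists>C. \<forall>t. cmod (g t) \<le> C) \<and>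
     (\<forall>h. integrable circ h \<longrightarrow> (\<forall>n. fc h n = 0) \<longrightarrow> (\<forall>n. fc (\<lambda>t. h t * g t) n = 0))"

lemma multiplier_integrable: "multiplier g \<Longrightarrow> integrable circ h \<Longrightarrow> integrable circ (\<lambda>t. h t * g t)"
  unfolding multiplier_def by (elim conjE exE, rule integrable_times_bounded) (auto intro!: AE_I2)

lemma multiplier_add: assumes "multiplier f" "multiplier g" shows "multiplier (\<lambda>t. f t + g t)"
proof -
  obtain C D where "\<forall>t. cmod (f t) \<le> C" "\<forall>t. cmod (g t) \<le> D" using assms by (auto simp: multiplier_def)
  then have "\<forall>t. cmod (f t + g t) \<le> C + D" by (meson add_mono norm_triangle_ineq order_trans)
  moreover have "fc (\<lambda>t. h t * (f t + g t)) n = 0" if "integrable circ h" "\<forall>n. fc h n = 0" for h n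
    using that assms fc_add[OF multiplier_integrable[OF assms(1) that(1)] multiplier_integrable[OF assms(2) that(1)], of n]
    by (simp add: distrib_left multiplier_def)
  ultimately show ?thesis using assms unfolding multiplier_def by (auto intro: borel_measurable_add)
qed

lemma multiplier_mult: assumes "multiplier f" "multiplier g" shows "multiplier (\<lambda>t. f t * g t)"
proof -
  obtain C D where C: "\<forall>t. cmod (f t) \<le> C" and D: "\<forall>t. cmod (g t) \<le> D" using assms by (auto simp: multiplier_def)
  have "0 \<le> C" using C norm_ge_zero order_trans by blast
  then have "\<forall>t. cmod (f t * g t) \<le> C * D" using C D by (simp add: norm_mult mult_mono)
  moreover have "fc (\<lambda>t. h t * (f t * g t)) n = 0" if h: "integrable circ h" "\<forall>n. fc h n = 0" for h n
  proof -
    have "\<forall>n. fc (\<lambda>t. h t * f t) n = 0" using assms(1) h by (simp add: multiplier_def)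
    then have "\<forall>n. fc (\<lambda>t. h t * f t * g t) n = 0"
      using assms(2) multiplier_integrable[OF assms(1) h(1)] unfolding multiplier_def by blast
    then show ?thesis by (simp add: mult.assoc)
  qed
  ultimately show ?thesis using assms unfolding multiplier_def by (auto intro: borel_measurable_times)
qed

lemma multiplier_const: "multiplier (\<lambda>t. c)"
  unfolding multiplier_def using fc_cmult[of c] by (auto simp: mult.commute)

lemma multiplier_ee: "multiplier (ee m)"
  unfolding multiplier_def by (auto simp: fc_times_ee intro!: exI[of _ 1])

lemma multiplier_polynomial:
  assumes "real_polynomial_function p" shows "multiplier (\<lambda>t. of_real (p (cis t)))"
  using assms
proof (induction p rule: real_polynomial_function.induct)
  case (linear f)
  have e: "complex_of_real (f (cis t)) = of_real (f 1) * ((ee 1 t + ee (-1) t) * of_real (1/2))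
      + of_real (f \<i>) * ((ee 1 t + (- 1) * ee (-1) t) * (1 / (2 * \<i>)))" for t
  proof -
    have "cis t = cos t *\<^sub>R 1 + sin t *\<^sub>R \<i>" by (simp add: cis.ctr complex_eq_iff)
    then have "f (cis t) = cos t * f 1 + sin t * f \<i>"
      using linear_add[OF bounded_linear.linear[OF linear]] linear_cmul[OF bounded_linear.linear[OF linear]] by simp
    moreover have "(ee 1 t + ee (-1) t) * of_real (1/2) = of_real (cos t)"
      by (simp add: ee_def complex_eq_iff)
    moreover have "(ee 1 t + (- 1) * ee (-1) t) * (1 / (2 * \<i>)) = of_real (sin t)"
      by (simp add: ee_def complex_eq_iff Re_divide Im_divide)
    ultimately show ?thesis by simp
  qed
  show ?case unfolding e by (intro multiplier_add multiplier_mult multiplier_const multiplier_ee)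
next
  case (const c) then show ?case by (rule multiplier_const)
next
  case (add f g) then show ?case by (simp add: multiplier_add)
next
  case (mult f g) then show ?case by (simp add: multiplier_mult)
qed

lemma integral_continuous_zero:
  assumes h: "integrable circ h" "\<And>n. fc h n = 0" and g: "continuous_on UNIV (g :: complex \<Rightarrow> real)"
  shows "integral\<^sup>L circ (\<lambda>t. h t * of_real (g (cis t))) = 0"
proof (rule ccontr)
  assume nz: "\<not> ?thesis"
  let ?I = "integral\<^sup>L circ (\<lambda>t. h t * of_real (g (cis t)))" and ?N = "integral\<^sup>L circ (\<lambda>t. cmod (h t))"
  have N: "0 \<le> ?N" by simp
  define e where "e = cmod ?I / (?N + 1)"
  have N1: "?N + 1 > 0" using N by linarith
  have e: "e > 0" unfolding e_def using nz N1 by (intro divide_pos_pos) simp_all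
  have "compact (sphere (0::complex) 1)" "continuous_on (sphere 0 1) g" using g continuous_on_subset by auto
  then obtain p where p: "real_polynomial_function p" "\<And>x. x \<in> sphere 0 1 \<Longrightarrow> \<bar>g x - p x\<bar> < e"
    using Stone_Weierstrass_real_polynomial_function[OF _ _ e] by blast
  have mp: "multiplier (\<lambda>t. of_real (p (cis t)))" by (rule multiplier_polynomial[OF p(1)])
  have "fc (\<lambda>t. h t * of_real (p (cis t))) 0 = 0" using mp h unfolding multiplier_def by blast
  then have 0: "integral\<^sup>L circ (\<lambda>t. h t * of_real (p (cis t))) = 0" by (simp add: fc_ee)
  have ip: "integrable circ (\<lambda>t. h t * of_real (p (cis t)))" by (rule multiplier_integrable[OF mp h(1)])
  have cg: "continuous_on A (\<lambda>t. complex_of_real (g (cis t)))" for A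
    by (intro continuous_intros continuous_on_compose2[OF g]) auto
  have "bounded ((\<lambda>t. complex_of_real (g (cis t))) ` {0..2*pi})"
    by (intro compact_imp_bounded compact_continuous_image cg) simp
  then obtain C where C: "\<And>t. t \<in> {0..2*pi} \<Longrightarrow> cmod (complex_of_real (g (cis t))) \<le> C"
    unfolding bounded_iff by blast
  have ig: "integrable circ (\<lambda>t. h t * of_real (g (cis t)))"
    by (rule integrable_times_bounded[OF h(1) continuous_measurable_circ[OF cg], of C])
       (use C in \<open>auto intro!: AE_I2\<close>)
  have "?I = integral\<^sup>L circ (\<lambda>t. h t * of_real (g (cis t)) - h t * of_real (p (cis t)))"
    using 0 ig ip by simp
  then have "cmod ?I \<le> integral\<^sup>L circ (\<lambda>t. cmod (h t * of_real (g (cis t)) - h t * of_real (p (cis t))))"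
    by (simp only: integral_norm_bound)
  also have "\<dots> \<le> integral\<^sup>L circ (\<lambda>t. e * cmod (h t))"
  proof (rule integral_mono)
    fix t
    have "cmod (h t * of_real (g (cis t)) - h t * of_real (p (cis t))) = cmod (h t) * \<bar>g (cis t) - p (cis t)\<bar>"
      by (simp flip: right_diff_distrib of_real_diff add: norm_mult)
    also have "\<dots> \<le> cmod (h t) * e" using p(2)[of "cis t"] by (intro mult_left_mono) auto
    finally show "cmod (h t * of_real (g (cis t)) - h t * of_real (p (cis t))) \<le> e * cmod (h t)"
      by (simp add: mult.commute)
  qed (use ig ip h in auto)
  also have "\<dots> = e * ?N" by simp
  also have "\<dots> < e * (?N + 1)" using e by simp
  also have "\<dots> = cmod ?I" 
  proof -
    have "x / d * d = x" if "d > 0" for x d :: real using that by simp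
    then show ?thesis unfolding e_def using N1 .
  qed
  finally show False by simp
qed

lemma integral_compact_zero:
  assumes h: "integrable circ h" "\<And>n. fc h n = 0" and K: "compact K" "K \<subseteq> {0..2*pi}" "0 \<notin> K \<or> 2*pi \<in> K" "2*pi \<notin> K \<or> 0 \<in> K"
  shows "integral\<^sup>L circ (\<lambda>t. indicator K t *\<^sub>R h t) = 0"
proof (cases "K = {}")
  case False
  define C where "C = cis ` K"
  have C: "compact C" unfolding C_def by (intro compact_continuous_image continuous_intros K)
  have C0: "C \<noteq> {}" using False by (simp add: C_def)
  define g where "g m z = max 0 (1 - real m * infdist z C)" for m z
  have g: "continuous_on UNIV (g m)" for m unfolding g_def by (intro continuous_intros)
  have gb: "\<bar>g m z\<bar> \<le> 1" for m z unfolding g_def using infdist_nonneg[of z C] by (auto simp: max_def)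
  have mem: "cis t \<in> C \<longleftrightarrow> t \<in> K" if t: "t \<in> {0..2*pi}" for t
  proof
    assume "cis t \<in> C"
    then obtain s where s: "s \<in> K" "cis t = cis s" by (auto simp: C_def)
    have s2: "s \<in> {0..2*pi}" using s K by auto
    from s(2) have "sin t = sin s \<and> cos t = cos s" by (simp add: complex_eq_iff)
    then obtain n where n: "t = s + 2 * pi * of_int n" using sin_cos_eq_iff[of t s] by (auto simp: mult.commute mult.left_commute)
    have "\<bar>2 * pi * of_int n\<bar> \<le> 2 * pi" using n s2 t by auto
    then have "\<bar>of_int n :: real\<bar> \<le> 1" by (simp add: abs_mult)
    then have "n = 0 \<or> n = 1 \<or> n = -1" by linarith
    then show "t \<in> K"
    proof (elim disjE)
      assume "n = 0" then show ?thesis using n s by simp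
    next
      assume "n = 1"
      then have "t = s + 2 * pi" using n by simp
      then have "s = 0" "t = 2 * pi" using s2 t by auto
      then show ?thesis using s K by auto
    next
      assume "n = -1"
      then have "t = s - 2 * pi" using n by simp
      then have "t = 0" "s = 2 * pi" using s2 t by auto
      then show ?thesis using s K by auto
    qed
  qed (auto simp: C_def)
  have lim: "(\<lambda>m. g m (cis t)) \<longlonglongrightarrow> indicator K t" if t: "t \<in> {0..2*pi}" for t
  proof (cases "t \<in> K")
    case True
    then have "infdist (cis t) C = 0" using mem[OF t] by simp
    then show ?thesis using True by (simp add: g_def)
  next
    case False
    then have "infdist (cis t) C > 0"
      using mem[OF t] C C0 infdist_pos_not_in_closed[of C "cis t"] compact_imp_closed by blast
    then obtain N where N: "real N * infdist (cis t) C > 1" using reals_Archimedean3 by blast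
    have "eventually (\<lambda>m. g m (cis t) = 0) sequentially"
      using eventually_ge_at_top[of N]
    proof eventually_elim
      case (elim m)
      have "real N * infdist (cis t) C \<le> real m * infdist (cis t) C"
        using elim by (intro mult_right_mono infdist_nonneg) auto
      then show ?case using N by (simp add: g_def)
    qed
    then show ?thesis using False by (simp add: tendsto_eventually)
  qed
  have mh: "h \<in> borel_measurable circ" using h by auto
  have cg: "continuous_on A (\<lambda>t. complex_of_real (g m (cis t)))" for A m
    by (intro continuous_intros continuous_on_compose2[OF g]) auto
  have Km: "K \<in> sets circ"
    using K compact_imp_closed[OF K(1)] unfolding circ_def by (simp add: sets_restrict_space_iff lmeasurable_compact fmeasurableD)
  have "(\<lambda>m. integral\<^sup>L circ (\<lambda>t. h t * of_real (g m (cis t)))) \<longlonglongrightarrow> integral\<^sup>L circ (\<lambda>t. indicator K t *\<^sub>R h t)"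
  proof (rule integral_dominated_convergence)
    show "(\<lambda>t. indicator K t *\<^sub>R h t) \<in> borel_measurable circ" using mh Km by measurable
    show "(\<lambda>t. h t * of_real (g m (cis t))) \<in> borel_measurable circ" for m
      using mh continuous_measurable_circ[OF cg[of _ m]] by measurable
    show "integrable circ (\<lambda>t. cmod (h t))" using h by simp
    show "AE t in circ. (\<lambda>m. h t * of_real (g m (cis t))) \<longlonglongrightarrow> indicator K t *\<^sub>R h t"
    proof (rule AE_I2)
      fix t assume "t \<in> space circ"
      then have "(\<lambda>m. h t * of_real (g m (cis t))) \<longlonglongrightarrow> h t * of_real (indicator K t)"
        by (intro tendsto_intros lim) simp
      then show "(\<lambda>m. h t * of_real (g m (cis t))) \<longlonglongrightarrow> indicator K t *\<^sub>R h t"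
        by (simp add: scaleR_conv_of_real mult.commute)
    qed
    show "AE t in circ. cmod (h t * of_real (g m (cis t))) \<le> cmod (h t)" for m
      using gb[of m] by (intro AE_I2) (simp add: norm_mult mult_left_le)
  qed
  then show ?thesis using integral_continuous_zero[OF h g] by (simp add: LIMSEQ_const_iff)
qed simp

theorem fc_zero_imp_AE:
  assumes h: "integrable circ h" "\<And>n. fc h n = 0"
  shows "AE t in circ. h t = 0"
proof (rule sigma_finite_measure.density_zero[OF finite_measure.axioms(1)[OF finite_measure_circ] h(1)])
  have compact0: "integral\<^sup>L circ (\<lambda>t. indicator K t *\<^sub>R h t) = 0" if K: "compact K" "K \<subseteq> {0..2*pi}" for K
  proof -
    define K' where "K' = (if 0 \<in> K \<or> 2*pi \<in> K then insert 0 (insert (2*pi) K) else K)"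
    have "integral\<^sup>L circ (\<lambda>t. indicator K' t *\<^sub>R h t) = 0"
      by (rule integral_compact_zero[OF h]) (use K in \<open>auto simp: K'_def\<close>)
    moreover have "integral\<^sup>L circ (\<lambda>t. indicator K' t *\<^sub>R h t) = integral\<^sup>L circ (\<lambda>t. indicator K t *\<^sub>R h t)"
    proof (rule integral_cong_AE)
      have "compact K'" using K by (auto simp: K'_def)
      then have m: "K \<in> sets circ" "K' \<in> sets circ"
        using K unfolding circ_def by (auto simp: sets_restrict_space_iff lmeasurable_compact fmeasurableD K'_def)
      show "(\<lambda>t. indicator K' t *\<^sub>R h t) \<in> borel_measurable circ" "(\<lambda>t. indicator K t *\<^sub>R h t) \<in> borel_measurable circ"
        using h(1) m by measurable
      have "AE t in lebesgue. t \<notin> {0, 2 * pi}"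
        by (rule AE_I'[of "{0, 2 * pi}"]) auto
      then have "AE t in circ. t \<notin> {0, 2 * pi}" unfolding circ_def by (subst AE_restrict_space_iff) auto
      then show "AE t in circ. indicator K' t *\<^sub>R h t = indicator K t *\<^sub>R h t"
        by eventually_elim (auto simp: K'_def indicator_def)
    qed
    ultimately show ?thesis by simp
  qed
  fix S assume S: "S \<in> sets circ"
  then have Sl: "S \<in> sets lebesgue" "S \<subseteq> {0..2*pi}" unfolding circ_def by (auto simp: sets_restrict_space_iff)
  obtain C T where CT: "fsigma C" "T \<in> null_sets lebesgue" "C \<union> T = S" "disjnt C T"
    using lebesgue_set_almost_fsigma[OF Sl(1)] .
  then obtain F :: "nat \<Rightarrow> real set" where F: "range F \<subseteq> Collect compact" "C = \<Union>(range F)"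
    unfolding fsigma_Union_compact by blast
  define K where "K n = (\<Union>i\<le>n. F i)" for n
  have K: "compact (K n)" "K n \<subseteq> {0..2*pi}" for n
    using F CT(3) Sl(2) unfolding K_def by (auto intro!: compact_UN)
  have Km: "K n \<in> sets circ" for n
    using K[of n] unfolding circ_def by (auto simp: sets_restrict_space_iff lmeasurable_compact fmeasurableD)
  have "(\<lambda>n. integral\<^sup>L circ (\<lambda>t. indicator (K n) t *\<^sub>R h t)) \<longlonglongrightarrow> integral\<^sup>L circ (\<lambda>t. indicator S t *\<^sub>R h t)"
  proof (rule integral_dominated_convergence)
    show "(\<lambda>t. indicator S t *\<^sub>R h t) \<in> borel_measurable circ" using h(1) S by measurable
    show "(\<lambda>t. indicator (K n) t *\<^sub>R h t) \<in> borel_measurable circ" for n using h(1) Km by measurable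
    show "integrable circ (\<lambda>t. cmod (h t))" using h by simp
    have "AE t in lebesgue. t \<notin> T"
      using CT(2) by (intro AE_I'[of T]) auto
    then have "AE t in circ. t \<notin> T" unfolding circ_def by (subst AE_restrict_space_iff) auto
    then show "AE t in circ. (\<lambda>n. indicator (K n) t *\<^sub>R h t) \<longlonglongrightarrow> indicator S t *\<^sub>R h t"
    proof eventually_elim
      case (elim t)
      have "eventually (\<lambda>n. indicator (K n) t = (indicator S t :: real)) sequentially"
      proof (cases "t \<in> S")
        case True
        then obtain i where "t \<in> F i" using elim CT F by auto
        then have "t \<in> K n" if "n \<ge> i" for n using that by (auto simp: K_def)
        then show ?thesis using True by (auto simp: eventually_sequentially intro!: exI[of _ i])
      next
        case False
        then have "t \<notin> K n" for n using F CT by (auto simp: K_def)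
        then show ?thesis using False by simp
      qed
      then show ?case by (intro tendsto_eventually) (auto elim: eventually_mono)
    qed
    show "AE t in circ. cmod (indicator (K n) t *\<^sub>R h t) \<le> cmod (h t)" for n
      by (intro AE_I2) (simp add: indicator_def)
  qed
  then have "integral\<^sup>L circ (\<lambda>t. indicator S t *\<^sub>R h t) = 0"
    using compact0[OF K] by (simp add: LIMSEQ_const_iff)
  then show "set_lebesgue_integral circ S h = 0" by (simp add: set_lebesgue_integral_def)
qed

corollary fc_eq_imp_AE_eq:
  assumes "integrable circ f" "integrable circ g" "\<And>n. fc f n = fc g n"
  shows "AE t in circ. f t = g t"
  using fc_zero_imp_AE[of "\<lambda>t. f t - g t"] assms by (simp add: fc_diff)

section \<open>Co-analytic series and Kronecker's theorem\<close>

lemma bshift_pow: "(bshift ^^ i) f n = f (n + i)"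
  by (induction i arbitrary: f n) (simp_all add: funpow_swap1 bshift_apply)

lemma shift_pow_Eop: "(shift ^^ m) (Eop u) l = (if l = m then u else 0)"
proof (induction m arbitrary: l)
  case 0 show ?case by (simp add: Eop_def)
next
  case (Suc m)
  then show ?case by (cases l) simp_all
qed

lemma papp_bshift_apply: "papp bshift p f n = (\<Sum>i\<le>degree p. coeff p i *s f (n + i))"
  by (simp add: papp_def seq_apply bshift_pow)

lemma lin_on_bshift: "lin_on UNIV bshift"
  unfolding lin_on_def by (simp add: bshift_add bshift_smult)

lemmas papp_bshift_mult = papp_mult[OF lin_on_bshift UNIV_I]

lemma papp_linear_factor: "papp bshift [:- a, 1:] f n = f (Suc n) - a *s f n"
  by (simp add: papp_pCons seq_apply bshift_apply)

lemma root_factor: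
  assumes "poly p a = (0::complex)" "p \<noteq> 0"
  obtains p' where "p = [:- a, 1:] * p'" "p' \<noteq> 0" "degree p = Suc (degree p')"
proof -
  obtain p' where p': "p = [:- a, 1:] * p'" using assms(1) by (metis dvdE poly_eq_0_iff_dvd)
  have "p' \<noteq> 0" using p' assms by auto
  moreover have "degree p = Suc (degree p')" unfolding p' using \<open>p' \<noteq> 0\<close> by (subst degree_mult_eq) auto
  ultimately show ?thesis using that p' by blast
qed

lemma decay_step:
  assumes h: "\<And>n. norm (f (Suc n) - a *s f n :: complex^'n) \<le> C * \<rho> ^ n" and a: "cmod a < \<rho>"
  shows "\<exists>C'. \<forall>n. norm (f n) \<le> C' * \<rho> ^ n"
proof -
  define D where "D = norm (f 0) + C / (\<rho> - cmod a)"
  have C: "0 \<le> C" using order_trans[OF norm_ge_zero h[of 0]] by simp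
  have \<rho>: "0 \<le> \<rho>" using a norm_ge_zero[of a] by linarith
  have D: "norm (f 0) \<le> D" using C a by (simp add: D_def)
  have "C / (\<rho> - cmod a) * (\<rho> - cmod a) = C" using a by simp
  then have DC: "C \<le> D * (\<rho> - cmod a)"
    using mult_nonneg_nonneg[of "norm (f 0)" "\<rho> - cmod a"] a by (simp add: D_def distrib_right)
  have "norm (f n) \<le> D * \<rho> ^ n" for n
  proof (induction n)
    case (Suc n)
    have "norm (f (Suc n)) \<le> norm (f (Suc n) - a *s f n) + norm (a *s f n)"
      using norm_triangle_ineq[of "f (Suc n) - a *s f n" "a *s f n"] by simp
    also have "\<dots> \<le> C * \<rho> ^ n + cmod a * (D * \<rho> ^ n)"
      unfolding norm_scale_vec using h Suc by (intro add_mono mult_left_mono) auto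
    also have "\<dots> = (C + cmod a * D) * \<rho> ^ n" by (simp add: algebra_simps)
    also have "\<dots> \<le> (D * \<rho>) * \<rho> ^ n"
      using DC \<rho> by (intro mult_right_mono) (auto simp: algebra_simps)
    finally show ?case by simp
  qed (use D in simp)
  then show ?thesis by blast
qed

lemma decay_annihilated:
  assumes \<rho>: "0 < \<rho>"
  shows "p \<noteq> 0 \<Longrightarrow> papp bshift p f = 0 \<Longrightarrow> (\<And>a. poly p a = 0 \<Longrightarrow> cmod a < \<rho>)
    \<Longrightarrow> \<exists>C. \<forall>n. norm (f n) \<le> C * \<rho> ^ n"
proof (induction "degree p" arbitrary: p f)
  case 0
  obtain c where c: "p = [:c:]" using degree_0_id[of p] 0(1) by metis
  have "f = 0" using 0 c by (simp add: papp_pCons)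
  then show ?case by (intro exI[of _ 0]) (simp add: seq_apply)
next
  case (Suc d)
  then obtain a where a: "poly p a = 0"
    using fundamental_theorem_of_algebra[of p] constant_degree[of p] by force
  from root_factor[OF a Suc.prems(1)] obtain p' where
    p': "p = [:- a, 1:] * p'" "p' \<noteq> 0" "degree p = Suc (degree p')" .
  let ?h = "papp bshift [:- a, 1:] f"
  have "papp bshift (p' * [:- a, 1:]) f = 0" using Suc.prems(2) p'(1) by (simp add: mult.commute)
  then have "papp bshift p' ?h = 0" unfolding papp_bshift_mult .
  moreover have "d = degree p'" using Suc.hyps(2) p'(3) by simp
  moreover have "cmod b < \<rho>" if "poly p' b = 0" for b using Suc.prems(3)[of b] p'(1) that by simp
  ultimately obtain C where "\<forall>n. norm (?h n) \<le> C * \<rho> ^ n" using Suc.hyps(1) p'(2) by blast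
  then have "norm (f (Suc n) - a *s f n) \<le> C * \<rho> ^ n" for n by (simp only: papp_linear_factor)
  from decay_step[OF this Suc.prems(3)[OF a]] show ?case .
qed

definition annihilates :: "complex poly \<Rightarrow> 'n::finite seq set \<Rightarrow> bool" where
  "annihilates p F \<longleftrightarrow> p \<noteq> 0 \<and> (\<forall>f\<in>F. papp bshift p f = 0)"

definition min_annihilator :: "complex poly \<Rightarrow> 'n::finite seq set \<Rightarrow> bool" where
  "min_annihilator p F \<longleftrightarrow> annihilates p F \<and> (\<forall>q. annihilates q F \<longrightarrow> degree p \<le> degree q)"

lemma min_annihilator_exists: "annihilates p F \<Longrightarrow> \<exists>d. min_annihilator d F"
  unfolding min_annihilator_def using ex_has_least_nat[of "\<lambda>p. annihilates p F" p degree] by blast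

lemma papp_bshift_zero: "papp bshift r 0 = 0"
  by (rule ext) (simp add: papp_bshift_apply seq_apply)

lemma annihilates_prod:
  assumes "finite J" "\<And>j. j \<in> J \<Longrightarrow> \<exists>p. p \<noteq> 0 \<and> papp bshift p (g j) = 0"
  shows "\<exists>p. annihilates p (g ` J)"
  using assms
proof (induction J rule: finite_induct)
  case empty
  show ?case by (intro exI[of _ 1]) (simp add: annihilates_def)
next
  case (insert j J)
  have "\<exists>p. annihilates p (g ` J)" by (rule insert.IH) (rule insert.prems, simp)
  then obtain p where p: "annihilates p (g ` J)" ..
  obtain q where q: "q \<noteq> 0" "papp bshift q (g j) = 0" using insert.prems[of j] by blast
  have "papp bshift (p * q) (g j) = 0" unfolding papp_bshift_mult q papp_bshift_zero ..
  moreover have "papp bshift (p * q) f = 0" if "f \<in> g ` J" for f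
  proof -
    have "papp bshift p f = 0" using p that by (auto simp: annihilates_def)
    then show ?thesis unfolding mult.commute[of p q] papp_bshift_mult by (simp only: papp_bshift_zero)
  qed
  ultimately have "annihilates (p * q) (g ` insert j J)" using p q by (auto simp: annihilates_def)
  then show ?case by blast
qed

lemma min_annihilator_roots:
  assumes m: "min_annihilator p F" and F: "\<And>f. f \<in> F \<Longrightarrow> f \<longlonglongrightarrow> 0" and a: "poly p a = 0"
  shows "cmod a < 1"
proof (rule ccontr)
  assume "\<not> cmod a < 1"
  then have a1: "1 \<le> cmod a" by simp
  have p0: "p \<noteq> 0" using m by (simp add: min_annihilator_def annihilates_def)
  from root_factor[OF a p0] obtain p' where
    p': "p = [:- a, 1:] * p'" "p' \<noteq> 0" "degree p = Suc (degree p')" .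
  have "papp bshift p' f = 0" if f: "f \<in> F" for f
  proof
    fix m
    let ?h = "papp bshift p' f"
    have hz: "papp bshift [:- a, 1:] ?h = 0"
    proof -
      have "papp bshift p f = 0" using m f by (simp add: min_annihilator_def annihilates_def)
      then show ?thesis unfolding p'(1) papp_bshift_mult .
    qed
    then have "?h (Suc n) - a *s ?h n = 0" for n
      unfolding papp_linear_factor[symmetric] hz by (simp add: seq_apply)
    then have st: "norm (?h (Suc n)) = cmod a * norm (?h n)" for n by (simp flip: norm_scale_vec)
    have ge: "norm (?h m) \<le> norm (?h (k + m))" for k
    proof (induction k)
      case (Suc k)
      then show ?case unfolding add_Suc st using mult_right_mono[OF a1, of "norm (?h (k + m))"] by simp
    qed simp
    have sc: "(\<lambda>n. coeff p' i *s f (n + i)) \<longlonglongrightarrow> 0" for i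
    proof -
      have "(\<lambda>n. norm (f (n + i))) \<longlonglongrightarrow> 0"
        using LIMSEQ_ignore_initial_segment[OF F[OF f], of i] tendsto_norm_zero by blast
      then have "(\<lambda>n. cmod (coeff p' i) * norm (f (n + i))) \<longlonglongrightarrow> 0" by (rule tendsto_mult_right_zero)
      then show ?thesis by (subst tendsto_norm_zero_iff[symmetric]) (simp add: norm_scale_vec)
    qed
    have "?h \<longlonglongrightarrow> 0"
      unfolding papp_bshift_apply[abs_def] by (intro tendsto_null_sum sc)
    then have "(\<lambda>k. norm (?h (k + m))) \<longlonglongrightarrow> 0"
      using LIMSEQ_ignore_initial_segment[of ?h 0 m] tendsto_norm_zero by blast
    then have "norm (?h m) \<le> 0" using ge by (intro LIMSEQ_le_const) auto
    then show "?h m = 0 m" by (simp add: seq_apply)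
  qed
  then have "annihilates p' F" using p'(2) by (simp add: annihilates_def)
  then have "degree p \<le> degree p'" using m unfolding min_annihilator_def by blast
  then show False using p'(3) by simp
qed

lemma roots_radius:
  assumes "p \<noteq> (0 :: complex poly)" "\<And>a. poly p a = 0 \<Longrightarrow> cmod a < R" "0 < R"
  shows "\<exists>\<rho>. 0 < \<rho> \<and> \<rho> < R \<and> (\<forall>a. poly p a = 0 \<longrightarrow> cmod a < \<rho>)"
proof -
  let ?S = "insert 0 (cmod ` {a. poly p a = 0})"
  define M where "M = Max ?S"
  have fin: "finite ?S" using poly_roots_finite[OF assms(1)] by simp
  have "M \<in> ?S" unfolding M_def by (rule Max_in[OF fin]) simp
  then have lt: "M < R" using assms(2,3) by auto
  have ge: "s \<le> M" if "s \<in> ?S" for s unfolding M_def using fin that by (rule Max_ge)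
  have M0: "0 \<le> M" by (rule ge) simp
  have "cmod a < (M + R) / 2" if "poly p a = 0" for a
  proof -
    have "cmod a \<le> M" by (rule ge) (use that in simp)
    then show ?thesis using lt by simp
  qed
  moreover have "0 < (M + R) / 2" "(M + R) / 2 < R" using lt M0 assms(3) by simp_all
  ultimately show ?thesis by blast
qed

definition summ :: "'n::finite seq \<Rightarrow> bool" where "summ f \<longleftrightarrow> summable (\<lambda>n. norm (f n))"

lemma summ_component: "summ f \<Longrightarrow> summable (\<lambda>n. cmod (f n $ i))"
  unfolding summ_def by (rule summable_comparison_test') (auto intro: Finite_Cartesian_Product.norm_nth_le)

lemma summ_bshift: "summ f \<Longrightarrow> summ (bshift f)"
  unfolding summ_def by (simp add: bshift_apply summable_Suc_iff[of "\<lambda>n. norm (f n)"])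
lemma summ_add: "summ f \<Longrightarrow> summ g \<Longrightarrow> summ (f + g)"
  unfolding summ_def
  by (rule summable_comparison_test'[of "\<lambda>n. norm (f n) + norm (g n)" 0])
    (auto simp: seq_apply norm_triangle_ineq intro: summable_add)
lemma summ_smult: "summ f \<Longrightarrow> summ (smult c f)"
  unfolding summ_def by (simp add: seq_apply norm_scale_vec summable_mult)
lemma summ_zero: "summ 0" by (simp add: summ_def seq_apply)
lemma summ_papp: "summ f \<Longrightarrow> summ (papp bshift p f)"
  by (induction p arbitrary: f) (auto simp: papp_pCons summ_zero intro: summ_add summ_smult summ_bshift)

lemma summ_decay: assumes "\<And>n. norm (f n) \<le> C * \<rho> ^ n" "0 < \<rho>" "\<rho> < 1" shows "summ f"
  unfolding summ_def
  by (rule summable_comparison_test'[OF summable_mult[OF summable_geometric]]) (use assms in auto)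

lemma summ_l2: assumes "summ f" shows "f \<in> l2"
proof -
  have "(\<lambda>n. norm (f n)) \<longlonglongrightarrow> 0" using assms unfolding summ_def by (rule summable_LIMSEQ_zero)
  then have "eventually (\<lambda>n. norm (f n) < 1) sequentially" by (rule order_tendstoD) simp
  then obtain N where N: "\<And>n. n \<ge> N \<Longrightarrow> norm (f n) < 1" by (auto simp: eventually_sequentially)
  show ?thesis
  proof (rule l2I, rule summable_comparison_test'[of _ N])
    show "summable (\<lambda>n. norm (f n))" using assms by (simp add: summ_def)
    show "norm ((norm (f n))^2) \<le> norm (f n)" if "n \<ge> N" for n
      using N[OF that] mult_left_le[of "norm (f n)" "norm (f n)"] by (simp add: power2_eq_square)
  qed
qed

definition coan :: "'n::finite seq \<Rightarrow> 'n \<Rightarrow> real \<Rightarrow> complex" where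
  "coan f i t = (\<Sum>k. f k $ i * ee (- int k - 1) t)"

lemma summable_coan: "summ f \<Longrightarrow> summable (\<lambda>k. f k $ i * ee (\<sigma> k) t)"
  by (rule summable_norm_cancel) (simp add: norm_mult summ_component)

lemma coan_bshift: assumes "summ f" shows "cis t * coan f i t = f 0 $ i + coan (bshift f) i t"
proof -
  have "cis t * coan f i t = (\<Sum>k. cis t * (f k $ i * ee (- int k - 1) t))"
    unfolding coan_def by (rule suminf_mult[symmetric, OF summable_coan[OF assms]])
  also have "\<dots> = (\<Sum>k. f k $ i * ee (- int k) t)"
  proof -
    have c: "cis t = ee 1 t" by (simp add: ee_def)
    have "cis t * (f k $ i * ee (- int k - 1) t) = f k $ i * ee (- int k) t" for k
      unfolding c mult.left_commute[of "ee 1 t"] ee_add by simp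
    then show ?thesis by (simp only:)
  qed
  also have "\<dots> = f 0 $ i + (\<Sum>k. f (Suc k) $ i * ee (- int k - 1) t)"
  proof -
    have "- int (Suc k) = - int k - 1" for k by simp
    then show ?thesis
      using suminf_split_head[OF summable_coan[OF assms], of i "\<lambda>k. - int k" t] by (simp only:) simp
  qed
  finally show ?thesis by (simp add: coan_def bshift_apply)
qed

lemma coan_add: "summ f \<Longrightarrow> summ g \<Longrightarrow> coan (f + g) i t = coan f i t + coan g i t"
  unfolding coan_def by (simp add: seq_apply distrib_right suminf_add summable_coan)
lemma coan_smult: "summ f \<Longrightarrow> coan (smult c f) i t = c * coan f i t"
  unfolding coan_def by (simp add: seq_apply mult.assoc suminf_mult summable_coan)
lemma coan_zero: "coan 0 i t = 0" by (simp add: coan_def seq_apply)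

lemma inj_coan: "inj (\<lambda>k. - int k - 1)" by (auto simp: inj_def)

lemma fc_coan: assumes "summ f"
  shows "integrable circ (coan f i)" "fc (coan f i) (- int k - 1) = f k $ i" "n \<ge> 0 \<Longrightarrow> fc (coan f i) n = 0"
  unfolding coan_def[abs_def]
proof -
  show "integrable circ (\<lambda>t. \<Sum>k. f k $ i * ee (- int k - 1) t)"
    "fc (\<lambda>t. \<Sum>k. f k $ i * ee (- int k - 1) t) (- int k - 1) = f k $ i"
    by (rule fc_series_alone[OF summ_component[OF assms, of i] inj_coan])+
  assume "n \<ge> 0"
  then have "n \<notin> range (\<lambda>k. - int k - 1)" by auto
  then show "fc (\<lambda>t. \<Sum>k. f k $ i * ee (- int k - 1) t) n = 0"
    by (rule fc_series_alone(3)[OF summ_component[OF assms, of i] inj_coan])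
qed

lemma coan_poly: "summ f \<Longrightarrow> \<exists>N. \<forall>t. poly p (cis t) * coan f i t = poly N (cis t) + coan (papp bshift p f) i t"
proof (induction p arbitrary: f)
  case 0
  show ?case by (intro exI[of _ 0]) (simp add: coan_zero)
next
  case (pCons a p)
  from pCons.IH[OF summ_bshift[OF pCons.prems]] obtain N where
    N: "\<And>t. poly p (cis t) * coan (bshift f) i t = poly N (cis t) + coan (papp bshift p (bshift f)) i t" by blast
  show ?case
  proof (intro exI[of _ "N + Polynomial.smult (f 0 $ i) p"] allI)
    fix t
    have "poly (pCons a p) (cis t) * coan f i t = a * coan f i t + poly p (cis t) * (cis t * coan f i t)"
      by (simp add: algebra_simps)
    also have "\<dots> = a * coan f i t + poly p (cis t) * f 0 $ i + (poly N (cis t) + coan (papp bshift p (bshift f)) i t)"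
      unfolding coan_bshift[OF pCons.prems] N[symmetric] by (simp add: algebra_simps)
    also have "\<dots> = poly (N + Polynomial.smult (f 0 $ i) p) (cis t) + coan (papp bshift (pCons a p) f) i t"
      unfolding papp_pCons using pCons.prems
      by (simp add: coan_add coan_smult summ_smult summ_papp summ_bshift)
    finally show "poly (pCons a p) (cis t) * coan f i t
      = poly (N + Polynomial.smult (f 0 $ i) p) (cis t) + coan (papp bshift (pCons a p) f) i t" .
  qed
qed

lemma coan_rational:
  assumes "summ f" "papp bshift p f = 0"
  shows "\<exists>N. \<forall>t. poly p (cis t) * coan f i t = poly N (cis t)"
  using coan_poly[OF assms(1), of p i] assms(2) by (simp add: coan_zero)

lemma poly_cis_ee: "poly P (cis t) = (\<Sum>m\<le>degree P. coeff P m * ee (int m) t)"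
  by (simp add: poly_altdef ee_nat)

lemma fc_poly_neg: assumes "n < 0" shows "fc (\<lambda>t. poly P (cis t)) n = 0"
proof -
  have "fc (\<lambda>t. poly P (cis t)) n = (\<Sum>m\<le>degree P. fc (\<lambda>t. coeff P m * ee (int m) t) n)"
    unfolding poly_cis_ee
    by (rule fc_sum) (intro integrable_mult_right continuous_integrable_circ continuous_ee)
  also have "\<dots> = 0" using assms by (intro sum.neutral) (auto simp: fc_cmult fc_of_ee)
  finally show ?thesis .
qed

lemma coan_poly_imp_zero:
  assumes "summ h" "\<And>i t. coan h i t = poly (P i) (cis t)" shows "h = 0"
proof
  fix k
  have "h k $ i = 0" for i
  proof -
    have "coan h i = (\<lambda>t. poly (P i) (cis t))" using assms(2) by blast
    then have "fc (coan h i) (- int k - 1) = 0" using fc_poly_neg[of "- int k - 1"] by simp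
    then show ?thesis using fc_coan(2)[OF assms(1)] by simp
  qed
  then show "h k = 0 k" by (simp add: vec_eq_iff seq_apply)
qed

definition hcol :: "(real \<Rightarrow> complex^'p^'q) \<Rightarrow> 'p \<Rightarrow> 'q::finite seq" where
  "hcol G j = (\<lambda>k. \<chi> i. fc (\<lambda>t. G t $ i $ j) (- int k - 1))"

lemma kronecker:
  fixes G :: "real \<Rightarrow> complex^'p::finite^'q::finite"
  assumes lim: "\<And>j. hcol G j \<longlonglongrightarrow> 0" and ann: "annihilates p0 (range (hcol G))"
  obtains d where "annihilates d (range (hcol G))" "\<And>a. poly d a = 0 \<Longrightarrow> cmod a < 1"
    "\<And>r a. poles_in G r \<Longrightarrow> poly d a = 0 \<Longrightarrow> cmod a < r"
proof -
  obtain d where d: "min_annihilator d (range (hcol G))" using min_annihilator_exists[OF ann] by blast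
  have da: "annihilates d (range (hcol G))" using d by (simp add: min_annihilator_def)
  have d0: "d \<noteq> 0" and dp: "papp bshift d (hcol G j) = 0" for j using da by (auto simp: annihilates_def)
  have rt: "cmod a < 1" if "poly d a = 0" for a
    by (rule min_annihilator_roots[OF d _ that]) (use lim in auto)
  obtain \<rho> where \<rho>: "0 < \<rho>" "\<rho> < 1" "\<And>a. poly d a = 0 \<Longrightarrow> cmod a < \<rho>"
    using roots_radius[OF d0 rt] by auto
  have sm: "summ (hcol G j)" for j
  proof -
    obtain C where "\<And>n. norm (hcol G j n) \<le> C * \<rho> ^ n"
      using decay_annihilated[OF \<rho>(1) d0 dp \<rho>(3)] by blast
    then show ?thesis by (rule summ_decay[OF _ \<rho>(1,2)])
  qed
  define N0 where "N0 i j = (SOME N. \<forall>t. poly d (cis t) * coan (hcol G j) i t = poly N (cis t))" for i j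
  have N0: "poly d (cis t) * coan (hcol G j) i t = poly (N0 i j) (cis t)" for i j t
    using someI_ex[OF coan_rational[where i = i, OF sm[of j] dp[of j]]] unfolding N0_def by blast
  define N :: "complex poly^'p^'q" where "N = (\<chi> i j. N0 i j)"
  have dc: "poly d (cis t) \<noteq> 0" for t using rt[of "cis t"] by auto
  have ND: "poly (N $ i $ j) (cis t) / poly d (cis t) = coan (hcol G j) i t" for i j t
    using N0[of t j i] dc[of t] by (simp add: N_def field_simps)
  have rep: "coanalytic_rep G N d"
    unfolding coanalytic_rep_def ND
  proof (intro conjI allI impI)
    show "poly d z \<noteq> 0" if "cmod z = 1" for z using rt[of z] that by auto
    fix n i j
    show "fc (coan (hcol G j) i) n = (if n < 0 then fc (\<lambda>t. G t $ i $ j) n else 0)"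
    proof (cases "n < 0")
      case True
      then have n: "n = - int (nat (- n - 1)) - 1" by simp
      have "fc (coan (hcol G j) i) n = hcol G j (nat (- n - 1)) $ i"
        by (subst n) (rule fc_coan(2)[OF sm])
      then show ?thesis using True by (simp add: hcol_def)
    qed (simp add: fc_coan(3)[OF sm])
  qed
  have pole: "cmod a < r" if pr: "poles_in G r" and a: "poly d a = 0" for a r
  proof -
    have "\<exists>i j. poly (N $ i $ j) a \<noteq> 0"
    proof (rule ccontr)
      assume "\<not> ?thesis"
      then have "[:- a, 1:] dvd N $ i $ j" for i j using poly_eq_0_iff_dvd by blast
      define M where "M i j = N $ i $ j div [:- a, 1:]" for i j
      have M: "N $ i $ j = [:- a, 1:] * M i j" for i j
        unfolding M_def using dvd_mult_div_cancel[OF \<open>[:- a, 1:] dvd N $ i $ j\<close>] by (rule sym)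
      from root_factor[OF a d0] obtain d' where
        d': "d = [:- a, 1:] * d'" "d' \<noteq> 0" "degree d = Suc (degree d')" .
      have "papp bshift d' (hcol G j) = 0" for j
      proof -
        define N2 where "N2 i = (SOME N2. \<forall>t. poly d' (cis t) * coan (hcol G j) i t
            = poly N2 (cis t) + coan (papp bshift d' (hcol G j)) i t)" for i
        have N2: "poly d' (cis t) * coan (hcol G j) i t
            = poly (N2 i) (cis t) + coan (papp bshift d' (hcol G j)) i t" for i t
          using someI_ex[OF coan_poly[where p = d' and i = i, OF sm[of j]]] unfolding N2_def by blast
        have "coan (papp bshift d' (hcol G j)) i t = poly (M i j - N2 i) (cis t)" for i t
        proof -
          have ca: "cis t - a \<noteq> 0" using rt[OF a] by auto
          have "(cis t - a) * (poly d' (cis t) * coan (hcol G j) i t) = (cis t - a) * poly (M i j) (cis t)"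
          proof -
            have e1: "poly d (cis t) = (cis t - a) * poly d' (cis t)"
              using arg_cong[OF d'(1), of "\<lambda>p. poly p (cis t)"] by (simp add: algebra_simps)
            have e2: "poly (N0 i j) (cis t) = (cis t - a) * poly (M i j) (cis t)"
              using arg_cong[OF M[of i j], of "\<lambda>p. poly p (cis t)"] by (simp add: N_def algebra_simps)
            show ?thesis using N0[of t j i] unfolding e1 e2 by (simp only: mult.assoc)
          qed
          then have "poly d' (cis t) * coan (hcol G j) i t = poly (M i j) (cis t)" using ca by simp
          then show ?thesis using N2[of t i] by (simp add: algebra_simps)
        qed
        then show ?thesis by (rule coan_poly_imp_zero[OF summ_papp[OF sm]])
      qed
      then have "annihilates d' (range (hcol G))" using d'(2) by (auto simp: annihilates_def)
      then have "degree d \<le> degree d'" using d unfolding min_annihilator_def by blast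
      then show False using d'(3) by simp
    qed
    then obtain i j where ij: "poly (N $ i $ j) a \<noteq> 0" by blast
    have "is_pole (\<lambda>w. poly (N $ i $ j) w / poly d w) a"
    proof (rule is_pole_divide)
      have "eventually (\<lambda>w. poly d w \<noteq> 0) (at a)"
        using islimpt_finite[OF poly_roots_finite[OF d0], of a] by (simp add: islimpt_iff_eventually)
      then show "filterlim (poly d) (at 0) (at a)"
        using poly_isCont[of a d] a by (intro filterlim_atI) (auto simp: isCont_def)
    qed (use ij poly_isCont in auto)
    then show "cmod a < r" using pr rep rt[OF a] unfolding poles_in_def by blast
  qed
  show ?thesis by (rule that[OF da rt pole])
qed

lemma bounded_linear_matrix: "bounded_linear (\<lambda>x. (A :: complex^'p::finite^'q::finite) *v x)"
proof -
  have "linear (\<lambda>x. A *v x)"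
    by (rule linearI) (simp_all add: matrix_vector_mult_def vec_eq_iff sum.distrib algebra_simps scaleR_sum_right)
  then show ?thesis by (simp add: linear_conv_bounded_linear)
qed

lemma norm_matrix_le: "norm (A *v x) \<le> mnorm A * norm x"
  unfolding mnorm_def by (rule onorm[OF bounded_linear_matrix])

lemma mnorm_le: "(\<And>x. norm (A *v x) \<le> b * norm x) \<Longrightarrow> mnorm A \<le> b"
  unfolding mnorm_def by (rule onorm_le)

lemma mnorm_nonneg: "0 \<le> mnorm A"
  unfolding mnorm_def by (rule onorm_pos_le[OF bounded_linear_matrix])

lemma matrix_vector_axis: "(A *v axis j (1::complex)) $ i = A $ i $ j"
  by (simp add: matrix_vector_mult_def axis_def if_distrib cong: if_cong)

lemma entry_le_mnorm: "cmod (A $ i $ j) \<le> mnorm (A :: complex^'p::finite^'q::finite)"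
proof -
  have "cmod (A $ i $ j) = cmod ((A *v axis j 1) $ i)" by (simp add: matrix_vector_axis)
  also have "\<dots> \<le> norm (A *v axis j 1)" by (rule Finite_Cartesian_Product.norm_nth_le)
  also have "\<dots> \<le> mnorm A * norm (axis j (1::complex))" by (rule norm_matrix_le)
  finally show ?thesis by simp
qed

lemma supnorm_AE:
  assumes "supnorm G \<le> ereal C" shows "AE t in circ. mnorm (G t) \<le> C"
proof -
  have "AE t in circ. ereal (mnorm (G t)) \<le> supnorm G"
    unfolding supnorm_def by (rule esssup_AE)
  then show ?thesis
  proof (rule eventually_mono)
    fix t assume "ereal (mnorm (G t)) \<le> supnorm G"
    then have "ereal (mnorm (G t)) \<le> ereal C" using assms by (rule order_trans)
    then show "mnorm (G t) \<le> C" by simp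
  qed
qed

lemma measurable_matrix_fun:
  fixes G :: "real \<Rightarrow> complex^'p::finite^'q::finite"
  assumes "\<And>i j. (\<lambda>t. G t $ i $ j) \<in> borel_measurable M"
  shows "(\<lambda>t. mnorm (G t)) \<in> borel_measurable M"
proof -
  have G: "G \<in> borel_measurable M"
  proof (subst borel_measurable_euclidean_space, intro ballI)
    fix b :: "complex^'p^'q" assume "b \<in> Basis"
    have "G t \<bullet> b = (\<Sum>i\<in>UNIV. \<Sum>j\<in>UNIV. G t $ i $ j \<bullet> b $ i $ j)" for t by (simp add: inner_vec_def)
    then show "(\<lambda>t. G t \<bullet> b) \<in> borel_measurable M" using assms by simp
  qed
  have lin: "norm (mnorm A - mnorm B) \<le> (\<Sum>i\<in>UNIV. \<Sum>j\<in>UNIV. cmod ((A - B) $ i $ j))" for A B :: "complex^'p^'q"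
  proof -
    have t: "mnorm (X + Y) \<le> mnorm X + mnorm Y" for X Y :: "complex^'p^'q"
      unfolding mnorm_def matrix_vector_mult_add_rdistrib
      by (rule onorm_triangle[OF bounded_linear_matrix bounded_linear_matrix])
    have s: "mnorm X \<le> (\<Sum>i\<in>UNIV. \<Sum>j\<in>UNIV. cmod (X $ i $ j))" for X :: "complex^'p^'q"
    proof (rule mnorm_le)
      fix x
      have "norm (X *v x) \<le> (\<Sum>i\<in>UNIV. cmod ((X *v x) $ i))"
        unfolding norm_vec_def by (rule L2_set_le_sum) simp
      also have "\<dots> \<le> (\<Sum>i\<in>UNIV. \<Sum>j\<in>UNIV. cmod (X $ i $ j) * norm x)"
        unfolding matrix_vector_mult_def
        by (auto intro!: sum_mono order_trans[OF norm_sum] mult_left_mono Finite_Cartesian_Product.norm_nth_le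
            simp: norm_mult)
      finally show "norm (X *v x) \<le> (\<Sum>i\<in>UNIV. \<Sum>j\<in>UNIV. cmod (X $ i $ j)) * norm x"
        by (simp add: sum_distrib_right)
    qed
    have m: "mnorm (B - A) = mnorm (A - B)"
    proof -
      have "(B - A) *v x = - ((A - B) *v x)" for x by (simp add: matrix_vector_mult_diff_rdistrib)
      then have "(\<lambda>x. (B - A) *v x) = (\<lambda>x. - ((A - B) *v x))" by blast
      then show ?thesis unfolding mnorm_def by (simp only: onorm_neg)
    qed
    show ?thesis using t[of "A - B" B] t[of "B - A" A] s[of "A - B"] m by (simp add: abs_le_iff)
  qed
  have "continuous_on UNIV (mnorm :: complex^'p^'q \<Rightarrow> real)"
    unfolding continuous_on_def
  proof
    fix A :: "complex^'p^'q"
    have "((\<lambda>B. \<Sum>i\<in>UNIV. \<Sum>j\<in>UNIV. cmod ((B - A) $ i $ j)) \<longlongrightarrow> (\<Sum>i\<in>UNIV. \<Sum>j\<in>UNIV. cmod ((A - A) $ i $ j))) (at A)"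
      by (intro tendsto_intros)
    then have "((\<lambda>B. mnorm B - mnorm A) \<longlongrightarrow> 0) (at A)"
      by (intro Lim_null_comparison[OF always_eventually[OF allI[OF lin]]]) simp
    then show "(mnorm \<longlongrightarrow> mnorm A) (at A within UNIV)" by (simp add: LIM_zero_iff)
  qed
  then show ?thesis by (rule measurable_compose[OF G borel_measurable_continuous_onI])
qed

lemma supnorm_le:
  fixes G :: "real \<Rightarrow> complex^'p::finite^'q::finite"
  assumes "\<And>i j. (\<lambda>t. G t $ i $ j) \<in> borel_measurable circ" "AE t in circ. mnorm (G t) \<le> C"
  shows "supnorm G \<le> ereal C"
  unfolding supnorm_def
  by (rule esssup_I) (use measurable_matrix_fun[OF assms(1)] assms(2) in auto)

lemma Linf_bounded:
  assumes "Linf G" obtains C where "AE t in circ. mnorm (G t) \<le> C"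
proof (cases "supnorm G")
  case (real r)
  then show ?thesis using that supnorm_AE[of G r] by simp
next
  case PInf then show ?thesis using assms by (simp add: Linf_def)
next
  case MInf
  then show ?thesis using that supnorm_AE[of G 0] by simp
qed

lemma Linf_measurable: "Linf G \<Longrightarrow> (\<lambda>t. G t $ i $ j) \<in> borel_measurable circ"
  by (simp add: Linf_def)

lemma Linf_integrable: assumes "Linf G" shows "integrable circ (\<lambda>t. G t $ i $ j)"
proof -
  obtain C where C: "AE t in circ. mnorm (G t) \<le> C" using Linf_bounded[OF assms] .
  have "AE t in circ. cmod (G t $ i $ j) \<le> C"
    using C by eventually_elim (rule order_trans[OF entry_le_mnorm])
  from integrable_times_bounded[OF integrable_one_circ Linf_measurable[OF assms] this] show ?thesis by simp
qed

lemma hcol_tendsto_0: assumes "Linf G" shows "hcol G j \<longlonglongrightarrow> 0"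
proof -
  obtain C where C: "AE t in circ. mnorm (G t) \<le> C" using Linf_bounded[OF assms] .
  have "AE t in circ. cmod (G t $ i $ j) \<le> C" for i
    using C by eventually_elim (rule order_trans[OF entry_le_mnorm])
  then have "(\<lambda>n. fc (\<lambda>t. G t $ i $ j) (- int n - 1)) \<longlonglongrightarrow> 0" for i
    by (rule fc_tendsto_0[OF Linf_measurable[OF assms]])
  then show ?thesis unfolding hcol_def by (intro vec_tendstoI) simp
qed

lemma hank_monomial: "hank G ((shift ^^ m) (Eop (axis j 1))) = (bshift ^^ m) (hcol G j)"
proof
  fix k
  have "hank G ((shift ^^ m) (Eop (axis j 1))) k
      = (\<Sum>l\<in>{m}. fcm G (- int k - 1 - int l) *v (shift ^^ m) (Eop (axis j 1)) l)"
    unfolding hank_def by (rule suminf_finite) (auto simp: shift_pow_Eop)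
  also have "\<dots> = fcm G (- int k - 1 - int m) *v axis j 1" by (simp add: shift_pow_Eop)
  also have "\<dots> = hcol G j (k + m)"
  proof -
    have e: "- int k - 1 - int m = - int (k + m) - 1" by simp
    show ?thesis unfolding e vec_eq_iff matrix_vector_axis by (simp add: hcol_def fcm_def)
  qed
  finally show "hank G ((shift ^^ m) (Eop (axis j 1))) k = (bshift ^^ m) (hcol G j) k"
    unfolding bshift_pow .
qed

lemma finite_rank_annihilator:
  fixes G :: "real \<Rightarrow> complex^'p::finite^'q::finite"
  assumes "finite B" "(hank G :: 'p seq \<Rightarrow> 'q seq) ` l2 \<subseteq> cspan B"
  shows "\<exists>p. annihilates p (range (hcol G))"
proof (rule annihilates_prod)
  fix j
  have "(bshift ^^ m) (hcol G j) \<in> sv.span B" for m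
    unfolding hank_monomial[symmetric] cspan_eq_span[symmetric]
    by (rule subsetD[OF assms(2) imageI]) (rule l2_pow[OF l2_shift l2_Eop])
  from annihilator_exists[OF assms(1) this]
  show "\<exists>p. p \<noteq> 0 \<and> papp bshift p (hcol G j) = 0" .
qed simp

section \<open>Hankel operators with geometrically decaying kernel\<close>

lemma suminf_geo: assumes "0 < r" "r < (1::real)" shows "(\<Sum>k. A * r ^ k) = A / (1 - r)"
  using suminf_mult[of "\<lambda>k. r ^ k" A] summable_geometric[of r] suminf_geometric[of r] assms by simp

lemma suminf_swap_geometric:
  fixes a :: "nat \<Rightarrow> nat \<Rightarrow> complex"
  assumes r: "0 < r" "r < 1" and a: "\<And>k m. cmod (a k m) \<le> M * r ^ (k + m)"
  shows "(\<Sum>k. \<Sum>m. a k m) = (\<Sum>m. \<Sum>k. a k m)"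
proof -
  have g: "summable (\<lambda>n. c * r ^ n)" for c using r by (intro summable_mult summable_geometric) simp
  have sm: "summable (\<lambda>m. cmod (a k m))" for k
    by (rule summable_comparison_test'[OF g[of "M * r ^ k"]]) (use a[of k] in \<open>simp add: power_add mult.assoc\<close>)
  have sk: "summable (\<lambda>k. a k m)" for m
    by (rule summable_norm_cancel, rule summable_comparison_test'[OF g[of "M * r ^ m"]])
      (use a[of _ m] in \<open>simp add: power_add mult_ac\<close>)
  have tail: "cmod ((\<Sum>m. a k m) - (\<Sum>m<N. a k m)) \<le> M * r ^ N / (1 - r) * r ^ k" for k N
  proof -
    have "(\<Sum>m. a k m) - (\<Sum>m<N. a k m) = (\<Sum>m. a k (m + N))"
      using suminf_minus_initial_segment[OF summable_norm_cancel[OF sm], of k N] by simp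
    also have "cmod \<dots> \<le> (\<Sum>m. M * r ^ (k + N) * r ^ m)"
    proof (rule norm_suminf_le)
      show "cmod (a k (m + N)) \<le> M * r ^ (k + N) * r ^ m" for m
        using a[of k "m + N"] by (simp add: power_add mult.assoc mult.left_commute mult.commute)
    qed (rule g)
    also have "\<dots> = M * r ^ N / (1 - r) * r ^ k"
      unfolding suminf_geo[OF r] by (simp add: power_add mult_ac)
    finally show ?thesis .
  qed
  have sS: "summable (\<lambda>k. \<Sum>m. a k m)"
  proof (rule summable_norm_cancel, rule summable_comparison_test'[OF g[of "M / (1 - r)"]])
    show "norm (cmod (\<Sum>m. a k m)) \<le> M / (1 - r) * r ^ k" for k using tail[of k 0] by simp
  qed
  have "(\<lambda>N. \<Sum>m<N. \<Sum>k. a k m) \<longlonglongrightarrow> (\<Sum>k. \<Sum>m. a k m)"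
  proof (rule LIM_zero_cancel, rule tendsto_norm_zero_cancel)
    have lim: "(\<lambda>N. M / (1 - r) / (1 - r) * r ^ N) \<longlonglongrightarrow> 0"
      by (rule tendsto_mult_right_zero[OF LIMSEQ_power_zero]) (use r in simp)
    have bound: "norm (cmod ((\<Sum>m<N. \<Sum>k. a k m) - (\<Sum>k. \<Sum>m. a k m))) \<le> M / (1 - r) / (1 - r) * r ^ N" for N
    proof -
      have "(\<Sum>m<N. \<Sum>k. a k m) = (\<Sum>k. \<Sum>m<N. a k m)"
        by (rule suminf_sum[symmetric]) (rule sk)
      then have "(\<Sum>m<N. \<Sum>k. a k m) - (\<Sum>k. \<Sum>m. a k m) = (\<Sum>k. (\<Sum>m<N. a k m) - (\<Sum>m. a k m))"
        using suminf_diff[OF summable_sum[of "{..<N}" "\<lambda>m k. a k m", OF sk] sS] by simp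
      also have "cmod \<dots> \<le> (\<Sum>k. M * r ^ N / (1 - r) * r ^ k)"
      proof (rule norm_suminf_le)
        show "cmod ((\<Sum>m<N. a k m) - (\<Sum>m. a k m)) \<le> M * r ^ N / (1 - r) * r ^ k" for k
          using tail[of k N] by (simp add: norm_minus_commute)
      qed (rule g)
      also have "\<dots> = M / (1 - r) / (1 - r) * r ^ N"
        unfolding suminf_geo[OF r] by simp
      finally show ?thesis by simp
    qed
    show "(\<lambda>N. cmod ((\<Sum>m<N. \<Sum>k. a k m) - (\<Sum>k. \<Sum>m. a k m))) \<longlonglongrightarrow> 0"
      by (rule Lim_null_comparison[OF always_eventually[OF allI[OF bound]] lim])
  qed
  then have "(\<lambda>m. \<Sum>k. a k m) sums (\<Sum>k. \<Sum>m. a k m)" by (simp add: sums_def)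
  then show ?thesis by (rule sums_unique)
qed

lemma nrm_le_l1: assumes "summ f" shows "nrm f \<le> (\<Sum>n. norm (f n))"
proof -
  let ?S = "\<Sum>n. norm (f n)"
  have s: "summable (\<lambda>n. norm (f n))" using assms by (simp add: summ_def)
  have S: "0 \<le> ?S" by (rule suminf_nonneg[OF s]) simp
  have le: "norm (f n) \<le> ?S" for n
    using sum_le_suminf[OF s, of "{n}"] by simp
  have l: "f \<in> l2" by (rule summ_l2[OF assms])
  have "(norm (f n))^2 \<le> ?S * norm (f n)" for n
    unfolding power2_eq_square by (rule mult_right_mono[OF le norm_ge_zero])
  then have "(nrm f)^2 \<le> (\<Sum>n. ?S * norm (f n))"
    unfolding nrm_sq[OF l] by (rule suminf_le[OF _ l2D[OF l] summable_mult[OF s]])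
  also have "\<dots> = ?S^2" by (simp add: suminf_mult[OF s] power2_eq_square)
  finally show ?thesis by (rule power2_le_imp_le[OF _ S])
qed

lemma tail_geometric:
  fixes f :: "'n::finite seq"
  assumes r: "0 < r" "r < 1" and f: "\<And>n. norm (f n) \<le> c * r ^ n"
  shows "summ ((bshift ^^ k) f)" "(\<Sum>n. norm (f (n + k))) \<le> c / (1 - r) * r ^ k"
proof -
  have g: "summable (\<lambda>n. c * r ^ k * r ^ n)" using r by (intro summable_mult summable_geometric) simp
  have b: "norm (f (n + k)) \<le> c * r ^ k * r ^ n" for n using f[of "n + k"] by (simp add: power_add mult_ac)
  have s: "summable (\<lambda>n. norm (f (n + k)))"
    by (rule summable_comparison_test'[OF g]) (use b in simp)
  then show "summ ((bshift ^^ k) f)" by (simp add: summ_def bshift_pow)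
  have "(\<Sum>n. norm (f (n + k))) \<le> (\<Sum>n. c * r ^ k * r ^ n)" by (rule suminf_le[OF b s g])
  also have "\<dots> = c / (1 - r) * r ^ k" unfolding suminf_geo[OF r] by simp
  finally show "(\<Sum>n. norm (f (n + k))) \<le> c / (1 - r) * r ^ k" .
qed

definition ctr :: "complex^'p^'q \<Rightarrow> complex^'q^'p" where
  "ctr A = (\<chi> j i. cnj (A $ i $ j))"

lemma vip_ctr: "vip (A *v x) y = vip x (ctr A *v y)"
proof -
  have "vip (A *v x) y = (\<Sum>i\<in>UNIV. \<Sum>j\<in>UNIV. A $ i $ j * x $ j * cnj (y $ i))"
    by (simp add: vip_def matrix_vector_mult_def sum_distrib_right)
  also have "\<dots> = (\<Sum>j\<in>UNIV. \<Sum>i\<in>UNIV. A $ i $ j * x $ j * cnj (y $ i))" by (rule sum.swap)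
  also have "\<dots> = vip x (ctr A *v y)"
    by (simp add: vip_def matrix_vector_mult_def ctr_def sum_distrib_left mult_ac)
  finally show ?thesis .
qed

lemma ctr_bound:
  fixes A :: "complex^'p::finite^'q::finite"
  assumes "\<And>x. norm (A *v x) \<le> c * norm x" shows "norm (ctr A *v y) \<le> c * norm y"
proof (cases "norm (ctr A *v y) = 0")
  case True
  have "0 \<le> c * norm (axis (undefined::'p) (1::complex))" by (rule order_trans[OF norm_ge_zero assms])
  then show ?thesis using True by simp
next
  case False
  let ?z = "ctr A *v y"
  have "of_real ((norm ?z)^2) = vip (A *v ?z) y" unfolding vip_ctr vip_self ..
  then have "(norm ?z)^2 = cmod (vip (A *v ?z) y)"
    using norm_of_real[of "(norm ?z)^2", where ?'a = complex] by simp
  also have "\<dots> \<le> (c * norm ?z) * norm y"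
    by (rule order_trans[OF cmod_vip_le mult_right_mono[OF assms norm_ge_zero]])
  finally have "norm ?z * norm ?z \<le> norm ?z * (c * norm y)" by (simp add: power2_eq_square mult_ac)
  moreover have "norm ?z > 0" using False by simp
  ultimately show ?thesis by (simp only: mult_le_cancel_left_pos)
qed

definition hk :: "(nat \<Rightarrow> complex^'p^'q) \<Rightarrow> 'p::finite seq \<Rightarrow> 'q::finite seq" where
  "hk K h = (\<lambda>k. \<Sum>m. K (k + m) *v h m)"

lemma mv_scale: "A *v (a *s x) = a *s (A *v (x :: complex^'n::finite))"
  by (simp add: vec_eq_iff matrix_vector_mult_def sum_distrib_left mult_ac)

lemma bounded_linear_vip_left: "bounded_linear (\<lambda>x. vip x y)"
proof (rule bounded_linear_intro[where K = "norm y"])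
  show "cmod (vip x y) \<le> norm x * norm y" for x by (rule cmod_vip_le)
  show "vip (x + x') y = vip x y + vip x' y" for x x' by (rule vip_add_left)
  show "vip (a *\<^sub>R x) y = a *\<^sub>R vip x y" for a x by (simp add: vip_def scaleR_sum_right)
qed

lemma bounded_linear_vip_right: "bounded_linear (\<lambda>y. vip x y)"
proof (rule bounded_linear_intro[where K = "norm x"])
  show "cmod (vip x y) \<le> norm y * norm x" for y using cmod_vip_le[of x y] by (simp add: mult.commute)
  show "vip x (y + y') = vip x y + vip x y'" for y y' by (simp add: vip_def distrib_left sum.distrib)
  show "vip x (a *\<^sub>R y) = a *\<^sub>R vip x y" for a y by (simp add: vip_def scaleR_sum_right)
qed

locale hankel_kernel =
  fixes K :: "nat \<Rightarrow> complex^'p::finite^'q::finite" and c r :: real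
  assumes r: "0 < r" "r < 1" and K: "\<And>n x. norm (K n *v x) \<le> c * r ^ n * norm x"
begin

lemma c_nonneg: "0 \<le> c"
proof -
  have "0 \<le> c * r ^ 0 * norm (axis (undefined::'p) (1::complex))" by (rule order_trans[OF norm_ge_zero K])
  then show ?thesis by simp
qed

lemma term_bound: assumes "f \<in> l2" shows "norm (K (k + m) *v f m) \<le> c * r ^ k * nrm f * r ^ m"
proof -
  have "norm (K (k + m) *v f m) \<le> c * r ^ (k + m) * norm (f m)" by (rule K)
  also have "\<dots> \<le> c * r ^ (k + m) * nrm f"
    using norm_le_nrm[OF assms] c_nonneg r by (intro mult_left_mono) auto
  finally show ?thesis by (simp add: power_add mult_ac)
qed

lemma geo: "summable (\<lambda>m. a * r ^ m)"
  using r by (intro summable_mult summable_geometric) simp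

lemma hk_summable: assumes "f \<in> l2"
  shows "summable (\<lambda>m. norm (K (k + m) *v f m))" "summable (\<lambda>m. K (k + m) *v f m)"
proof -
  show "summable (\<lambda>m. norm (K (k + m) *v f m))"
    by (rule summable_comparison_test'[OF geo]) (use term_bound[OF assms] in simp)
  then show "summable (\<lambda>m. K (k + m) *v f m)" by (rule summable_norm_cancel)
qed

lemma hk_decay: assumes "f \<in> l2" shows "norm (hk K f k) \<le> c / (1 - r) * nrm f * r ^ k"
proof -
  have "norm (hk K f k) \<le> (\<Sum>m. c * r ^ k * nrm f * r ^ m)"
    unfolding hk_def by (rule norm_suminf_le[OF term_bound[OF assms] geo])
  also have "\<dots> = c / (1 - r) * nrm f * r ^ k"
    unfolding suminf_geo[OF r] by simp
  finally show ?thesis .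
qed

lemma hk_summ: "f \<in> l2 \<Longrightarrow> summ (hk K f)"
  by (rule summ_decay[OF hk_decay r])

lemma hk_l1: assumes "f \<in> l2" shows "(\<Sum>n. norm (hk K f n)) \<le> c / (1 - r) / (1 - r) * nrm f"
  using tail_geometric(2)[OF r hk_decay[OF assms], of 0] by simp

lemma bop_hk: "is_bounded_op (hk K)"
proof (rule bopI)
  fix f g :: "'p seq" assume f: "f \<in> l2" and g: "g \<in> l2"
  show "hk K (f + g) = hk K f + hk K g"
    unfolding hk_def
    by (rule ext) (simp add: seq_apply matrix_vector_right_distrib suminf_add hk_summable f g)
next
  fix a and f :: "'p seq" assume f: "f \<in> l2"
  show "hk K (smult a f) = smult a (hk K f)"
  proof
    fix k
    have bl: "bounded_linear (\<lambda>x :: complex^'q. a *s x)"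
    proof (rule bounded_linear_intro[where K = "cmod a"])
      show "norm (a *s x) \<le> norm x * cmod a" for x :: "complex^'q" by (simp add: norm_scale_vec)
    qed (simp_all add: vec_eq_iff algebra_simps)
    have "(\<Sum>m. K (k + m) *v (a *s f m)) = (\<Sum>m. a *s (K (k + m) *v f m))"
      by (simp add: mv_scale)
    also have "\<dots> = a *s (\<Sum>m. K (k + m) *v f m)"
      by (rule bounded_linear.suminf[OF bl hk_summable(2)[OF f], symmetric])
    finally show "hk K (smult a f) k = smult a (hk K f) k" by (simp add: hk_def seq_apply)
  qed
next
  fix f :: "'p seq" assume f: "f \<in> l2"
  show "hk K f \<in> l2" by (rule summ_l2[OF hk_summ[OF f]])
  show "nrm (hk K f) \<le> (c / (1 - r) / (1 - r)) * nrm f"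
    by (rule order_trans[OF nrm_le_l1[OF hk_summ[OF f]] hk_l1[OF f]])
qed

lemma hk_shift: assumes "f \<in> l2" shows "hk K (shift f) = bshift (hk K f)"
proof
  fix k
  have "hk K (shift f) k = (\<Sum>m. K (k + Suc m) *v shift f (Suc m)) + K (k + 0) *v shift f 0"
    unfolding hk_def by (rule suminf_split_head[THEN eq_diff_eq[THEN iffD1], symmetric])
      (rule hk_summable(2)[OF l2_shift[OF assms]])
  then show "hk K (shift f) k = bshift (hk K f) k"
    by (simp add: bshift_apply hk_def)
qed

lemma kernel_ctr: "hankel_kernel (\<lambda>n. ctr (K n)) c r"
  by standard (use r in simp_all, rule ctr_bound, rule K)

lemma hk_adjoint: assumes f: "f \<in> l2" and g: "g \<in> l2"
  shows "ip (hk K f) g = ip f (hk (\<lambda>n. ctr (K n)) g)"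
proof -
  interpret c: hankel_kernel "\<lambda>n. ctr (K n)" c r by (rule kernel_ctr)
  have "ip (hk K f) g = (\<Sum>k. \<Sum>m. vip (K (k + m) *v f m) (g k))"
    unfolding ip_def hk_def using bounded_linear.suminf[OF bounded_linear_vip_left hk_summable(2)[OF f]] by simp
  also have "\<dots> = (\<Sum>m. \<Sum>k. vip (K (k + m) *v f m) (g k))"
  proof (rule suminf_swap_geometric[OF r])
    fix k m
    have "cmod (vip (K (k + m) *v f m) (g k)) \<le> norm (K (k + m) *v f m) * norm (g k)" by (rule cmod_vip_le)
    also have "\<dots> \<le> (c * r ^ k * nrm f * r ^ m) * nrm g"
      using term_bound[OF f] norm_le_nrm[OF g] c_nonneg r f by (intro mult_mono) auto
    finally show "cmod (vip (K (k + m) *v f m) (g k)) \<le> c * nrm f * nrm g * r ^ (k + m)"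
      by (simp add: power_add mult_ac)
  qed
  also have "\<dots> = (\<Sum>m. \<Sum>k. vip (f m) (ctr (K (m + k)) *v g k))"
    by (simp add: vip_ctr add.commute)
  also have "\<dots> = ip f (hk (\<lambda>n. ctr (K n)) g)"
    unfolding ip_def hk_def using bounded_linear.suminf[OF bounded_linear_vip_right c.hk_summable(2)[OF g]] by simp
  finally show ?thesis .
qed

end

lemma opnorm_on_props:
  assumes T: "is_bounded_op T" and A: "A \<subseteq> l2" and ne: "f0 \<in> A" "f0 \<noteq> 0"
  shows "f \<in> A \<Longrightarrow> nrm (T f) \<le> opnorm_on T A * nrm f" "0 \<le> opnorm_on T A"
    "(\<And>f. f \<in> A \<Longrightarrow> nrm (T f) \<le> b * nrm f) \<Longrightarrow> opnorm_on T A \<le> b"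
proof -
  let ?X = "{nrm (T f) / nrm f |f. f \<in> A \<and> f \<noteq> zs}"
  obtain C where C: "C > 0" "\<And>f. f \<in> l2 \<Longrightarrow> nrm (T f) \<le> C * nrm f" using bop_bound[OF T] by blast
  have pos: "0 < nrm f" if "f \<in> A" "f \<noteq> 0" for f
    using that A nrm_zero_iff[of f] nrm_nonneg[of f] by (metis less_eq_real_def subsetD)
  have bdd: "bdd_above ?X"
  proof (rule bdd_aboveI)
    fix x assume "x \<in> ?X"
    then obtain f where f: "x = nrm (T f) / nrm f" "f \<in> A" "f \<noteq> 0" by auto
    then show "x \<le> C" using C(2)[of f] A pos[OF f(2,3)] by (auto simp: divide_le_eq)
  qed
  have X0: "nrm (T f0) / nrm f0 \<in> ?X" using ne by auto
  have up: "nrm (T f) / nrm f \<le> opnorm_on T A" if "f \<in> A" "f \<noteq> 0" for f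
    unfolding opnorm_on_def by (rule cSup_upper[OF _ bdd]) (use that in auto)
  show "nrm (T f) \<le> opnorm_on T A * nrm f" if "f \<in> A"
  proof (cases "f = 0")
    case True then show ?thesis by (simp add: bop_zero[OF T])
  next
    case False
    then show ?thesis using up[OF that False] pos[OF that False] by (simp add: divide_le_eq)
  qed
  show "0 \<le> opnorm_on T A"
    by (rule order_trans[OF _ up[OF ne]]) (use A ne bop_l2[OF T] in auto)
  show "opnorm_on T A \<le> b" if b: "\<And>f. f \<in> A \<Longrightarrow> nrm (T f) \<le> b * nrm f"
    unfolding opnorm_on_def
  proof (rule cSup_least)
    show "?X \<noteq> {}" using X0 by blast
    fix x assume "x \<in> ?X"
    then obtain f where f: "x = nrm (T f) / nrm f" "f \<in> A" "f \<noteq> 0" by auto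
    then show "x \<le> b" using b[of f] pos[OF f(2,3)] by (simp add: divide_le_eq)
  qed
qed

lemma finite_rank_comp:
  fixes T :: "'a::finite seq \<Rightarrow> 'b::finite seq" and L :: "'b seq \<Rightarrow> 'c::finite seq"
  assumes B: "finite B" "T ` l2 \<subseteq> sv.span B" and T: "is_bounded_op T" and L: "is_bounded_op L"
  shows "\<exists>B'. finite B' \<and> (\<forall>f\<in>l2. L (T f) \<in> sv.span B')"
proof -
  obtain B0 where B0: "B0 \<subseteq> T ` l2" "sv.independent B0" "T ` l2 \<subseteq> sv.span B0"
    using sv.maximal_independent_subset[of "T ` l2"] by blast
  have fin: "finite B0" using sv.independent_span_bound[OF B(1) B0(2)] B0(1) B(2) by blast
  have B0l: "b \<in> l2" if "b \<in> B0" for b using that B0(1) bop_l2[OF T] by blast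
  have "L (T f) \<in> sv.span (L ` B0)" if f: "f \<in> l2" for f
  proof -
    have "T f \<in> sv.span B0" using B0(3) f by blast
    then obtain t u where t: "finite t" "t \<subseteq> B0" "T f = (\<Sum>b\<in>t. smult (u b) b)"
      unfolding sv.span_explicit by blast
    have "L (T f) = (\<Sum>b\<in>t. smult (u b) (L b))"
    proof -
      have tl: "b \<in> l2" if "b \<in> t" for b using that t(2) B0l by blast
      have "L (T f) = (\<Sum>b\<in>t. L (smult (u b) b))"
        unfolding t(3) by (rule bop_sum[OF L]) (rule l2_smult[OF tl])
      also have "\<dots> = (\<Sum>b\<in>t. smult (u b) (L b))"
        by (rule sum.cong[OF refl]) (rule bop_smult[OF L tl])
      finally show ?thesis .
    qed
    also have "\<dots> \<in> sv.span (L ` B0)"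
      by (intro sv.span_sum sv.span_scale sv.span_base imageI subsetD[OF t(2)])
    finally show ?thesis .
  qed
  then show ?thesis using fin by blast
qed

definition gmat :: "(real \<Rightarrow> complex^'p::finite^'q::finite) \<Rightarrow> nat \<Rightarrow> complex^'p^'q" where
  "gmat G n = fcm G (- int n - 1)"

lemma hank_hk: "hank G = hk (gmat G)"
proof (intro ext)
  fix h k
  have e: "- int k - 1 - int m = - int (k + m) - 1" for m by simp
  show "hank G h k = hk (gmat G) h k" unfolding hank_def hk_def gmat_def e ..
qed

lemma gmat_bound:
  assumes "\<And>j n. norm (hcol G j n) \<le> C * r ^ n"
  shows "norm (gmat G n *v x) \<le> (real CARD('p) * C) * r ^ n * norm (x :: complex^'p::finite)"
proof -
  have e: "gmat G n *v x = (\<Sum>j\<in>UNIV. x $ j *s hcol G j n)"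
    by (simp add: vec_eq_iff matrix_vector_mult_def gmat_def fcm_def hcol_def mult.commute)
  have "norm (gmat G n *v x) \<le> (\<Sum>j\<in>UNIV. cmod (x $ j) * norm (hcol G j n))"
    unfolding e by (rule order_trans[OF norm_sum]) (simp add: norm_scale_vec)
  also have "\<dots> \<le> (\<Sum>j\<in>(UNIV::'p set). norm x * (C * r ^ n))"
    by (intro sum_mono mult_mono Finite_Cartesian_Product.norm_nth_le assms) auto
  finally show ?thesis by (simp add: mult_ac)
qed

section \<open>Maximizing vectors of the Hankel operator\<close>

lemma ip_bshift_left: assumes "f \<in> l2" "g \<in> l2" shows "ip (bshift f) g = ip f (shift g)"
  using ip_cnj[of "shift g" f] ip_cnj[of g "bshift f"] ip_shift_left[OF assms(2,1)] assms by simp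

lemma specop_diff: "smult (of_real c) f - specop E 0 a f = specop E c (\<lambda>e. c - a e) f"
  by (simp add: specop_def sum_negf)

locale nehari =
  fixes G :: "real \<Rightarrow> complex^'p::finite^'q::finite" and C r :: real
  assumes GL: "Linf G" and r: "0 < r" "r < 1"
    and dec: "\<And>j n. norm (hcol G j n) \<le> C * r ^ n"
    and C1: "\<exists>B. finite B \<and> (hank G :: 'p seq \<Rightarrow> 'q seq) ` l2 \<subseteq> cspan B"
    and C2a: "\<And>h. maximizing G h \<Longrightarrow> h 0 \<noteq> 0"
    and C2b: "span_dim {h. maximizing G h} CARD('p)"
begin

definition H :: "'p seq \<Rightarrow> 'q seq" where "H = hank G"
definition H' :: "'q seq \<Rightarrow> 'p seq" where "H' = hk (\<lambda>n. ctr (gmat G n))"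
definition gam :: real where "gam = opnorm_on H l2"
definition c0 :: real where "c0 = real CARD('p) * C"

sublocale K: hankel_kernel "gmat G" c0 r
  unfolding c0_def by standard (use r in simp_all, rule gmat_bound[OF dec])

sublocale K': hankel_kernel "\<lambda>n. ctr (gmat G n)" c0 r
  by (rule K.kernel_ctr)

lemma H_hk: "H = hk (gmat G)" by (simp add: H_def hank_hk)
lemma bopH: "is_bounded_op H" unfolding H_hk by (rule K.bop_hk)
lemma bopH': "is_bounded_op H'" unfolding H'_def by (rule K'.bop_hk)
lemmas H_l2 [simp] = bop_l2[OF bopH] and H'_l2 [simp] = bop_l2[OF bopH']
lemma H_shift: "f \<in> l2 \<Longrightarrow> H (shift f) = bshift (H f)"
  unfolding H_hk by (rule K.hk_shift)
lemma H'_shift: "f \<in> l2 \<Longrightarrow> H' (shift f) = bshift (H' f)"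
  unfolding H'_def by (rule K'.hk_shift)
lemma H_adjoint: "f \<in> l2 \<Longrightarrow> g \<in> l2 \<Longrightarrow> ip (H f) g = ip f (H' g)"
  unfolding H_hk H'_def by (rule K.hk_adjoint)
lemma H'_adjoint: assumes "f \<in> l2" "g \<in> l2" shows "ip (H' g) f = ip g (H f)"
  using ip_cnj[of "H f" g] ip_cnj[of f "H' g"] H_adjoint[OF assms] assms by simp
lemma adj_hank: "g \<in> l2 \<Longrightarrow> adj (hank G :: 'p seq \<Rightarrow> 'q seq) g = H' g"
  by (rule adj_eqI) (simp_all add: H_def[symmetric] H_adjoint)
lemma H'_decay: "y \<in> l2 \<Longrightarrow> norm (H' y n) \<le> c0 / (1 - r) * nrm y * r ^ n"
  unfolding H'_def by (rule K'.hk_decay)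
lemma H'_summ: "y \<in> l2 \<Longrightarrow> summ (H' y)"
  unfolding H'_def by (rule K'.hk_summ)
lemma H_summ: "y \<in> l2 \<Longrightarrow> summ (H y)"
  unfolding H_hk by (rule K.hk_summ)
lemma H'_l1: "y \<in> l2 \<Longrightarrow> (\<Sum>n. norm (H' y n)) \<le> c0 / (1 - r) / (1 - r) * nrm y"
  unfolding H'_def by (rule K'.hk_l1)
lemma H_l1: "y \<in> l2 \<Longrightarrow> (\<Sum>n. norm (H y n)) \<le> c0 / (1 - r) / (1 - r) * nrm y"
  unfolding H_hk by (rule K.hk_l1)
lemma c0_nonneg: "0 \<le> c0" by (rule K.c_nonneg)

lemma axis_seq_nonzero: "Eop (axis (j::'p) (1::complex)) \<noteq> 0"
proof
  assume "Eop (axis j (1::complex)) = 0"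
  then have "Eop (axis j (1::complex)) 0 = (0 :: 'p seq) 0" by (simp only:)
  then show False by (simp add: seq_apply axis_eq_0_iff)
qed

lemmas gam_props = opnorm_on_props[OF bopH subset_refl l2_Eop axis_seq_nonzero, folded gam_def]

lemma gam_le: "f \<in> l2 \<Longrightarrow> nrm (H f) \<le> gam * nrm f" by (rule gam_props(1))
lemma gam_nonneg: "0 \<le> gam" by (rule gam_props(2))

lemma maximizing_iff: "maximizing G f \<longleftrightarrow> f \<in> l2 \<and> f \<noteq> 0 \<and> nrm (H f) = gam * nrm f"
  unfolding maximizing_def gam_def H_def by simp

lemma no_zero: assumes "f \<in> l2" "nrm (H f) = gam * nrm f" "f 0 = 0" shows "f = 0"
  using C2a[of f] assms by (auto simp: maximizing_iff)

lemma H'_gam_le: assumes y: "y \<in> l2" shows "nrm (H' y) \<le> gam * nrm y"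
proof (cases "nrm (H' y) = 0")
  case False
  have p: "nrm (H' y) > 0" using False nrm_nonneg[OF H'_l2[OF y]] by linarith
  have "of_real ((nrm (H' y))^2) = ip (H (H' y)) y"
    using H_adjoint[OF H'_l2[OF y] y] ip_self[OF H'_l2[OF y]] by simp
  then have "(nrm (H' y))^2 = cmod (ip (H (H' y)) y)"
    using norm_of_real[of "(nrm (H' y))^2", where ?'a = complex] by simp
  also have "\<dots> \<le> nrm (H (H' y)) * nrm y" by (rule cmod_ip_le) (use y in simp_all)
  also have "\<dots> \<le> (gam * nrm (H' y)) * nrm y"
    by (rule mult_right_mono[OF gam_le]) (use y in simp_all)
  finally have "nrm (H' y) * nrm (H' y) \<le> nrm (H' y) * (gam * nrm y)"
    by (simp add: power2_eq_square mult_ac)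
  then show ?thesis using p by (simp only: mult_le_cancel_left_pos)
next
  case True
  then show ?thesis using gam_nonneg y by simp
qed

lemma HH_l2: "f \<in> l2 \<Longrightarrow> H' (H f) \<in> l2" by simp

lemma ip_HH: assumes "f \<in> l2" shows "ip (H' (H f)) f = of_real ((nrm (H f))^2)"
  using H'_adjoint[of f "H f"] ip_self[of "H f"] assms by simp

lemma max_eig: assumes f: "f \<in> l2" and e: "nrm (H f) = gam * nrm f"
  shows "H' (H f) = smult (of_real (gam^2)) f"
proof -
  let ?a = "H' (H f)" and ?b = "smult (of_real (gam^2)) f"
  have l: "?a \<in> l2" "?b \<in> l2" using f by simp_all
  have b: "nrm ?b = gam^2 * nrm f" using nrm_smult[OF f, of "of_real (gam^2)"] by (simp add: norm_power)
  have a: "nrm ?a \<le> gam^2 * nrm f"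
    using H'_gam_le[OF H_l2[OF f]] unfolding e by (simp add: power2_eq_square mult.assoc)
  have ab: "Re (ip ?a ?b) = gam^4 * (nrm f)^2"
  proof -
    have "ip ?a ?b = of_real (gam^2 * (nrm (H f))^2)"
      using ip_smult_right[OF f l(1), of "of_real (gam^2)"] ip_HH[OF f] by simp
    then show ?thesis unfolding e by (simp add: power_mult_distrib power2_eq_square power4_eq_xxxx)
  qed
  have "(nrm (?a - ?b))^2 = (nrm ?a)^2 + (nrm ?b)^2 - 2 * Re (ip ?a ?b)" by (rule nrm_diff_sq[OF l])
  also have "\<dots> \<le> (gam^2 * nrm f)^2 + (gam^2 * nrm f)^2 - 2 * (gam^4 * (nrm f)^2)"
    unfolding b ab using power_mono[OF a nrm_nonneg[OF l(1)], of 2] by simp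
  also have "\<dots> = 0" by (simp add: power_mult_distrib)
  finally have "nrm (?a - ?b) = 0" by simp
  then show ?thesis using nrm_zero_iff[OF l2_diff[OF l]] by simp
qed

lemma eig_max: assumes f: "f \<in> l2" and e: "H' (H f) = smult (of_real (gam^2)) f"
  shows "nrm (H f) = gam * nrm f"
proof -
  have "complex_of_real ((nrm (H f))^2) = of_real (gam^2 * (nrm f)^2)"
    unfolding ip_HH[OF f, symmetric] e ip_smult_left[OF f f] ip_self[OF f] by simp
  then have "(nrm (H f))^2 = (gam * nrm f)^2" by (simp only: of_real_eq_iff power_mult_distrib)
  then show ?thesis using f gam_nonneg by (simp add: power2_eq_iff_nonneg)
qed

definition eigY :: "'p seq \<Rightarrow> bool" where
  "eigY f \<longleftrightarrow> f \<in> l2 \<and> H' (H f) = smult (of_real (gam^2)) f"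

lemma eigY_zero: "eigY f \<Longrightarrow> f 0 = 0 \<Longrightarrow> f = 0"
  unfolding eigY_def by (rule no_zero) (auto intro: eig_max)

lemma eigY_sum: assumes "\<And>a. a \<in> A \<Longrightarrow> eigY (f a)" shows "eigY (\<Sum>a\<in>A. smult (c a) (f a))"
proof -
  have l: "f a \<in> l2" if "a \<in> A" for a using assms[OF that] by (simp add: eigY_def)
  have l2: "(\<Sum>a\<in>A. smult (c a) (f a)) \<in> l2" by (intro l2_sum l2_smult l)
  have "H' (H (\<Sum>a\<in>A. smult (c a) (f a))) = (\<Sum>a\<in>A. H' (H (smult (c a) (f a))))"
    by (rule bop_sum[OF bop_comp[OF bopH' bopH]]) (intro l2_smult l)
  also have "\<dots> = (\<Sum>a\<in>A. smult (of_real (gam^2)) (smult (c a) (f a)))"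
  proof (rule sum.cong[OF refl])
    fix a assume a: "a \<in> A"
    have "H' (H (smult (c a) (f a))) = smult (c a) (H' (H (f a)))"
      by (rule bop_smult[OF bop_comp[OF bopH' bopH] l[OF a]])
    then show "H' (H (smult (c a) (f a))) = smult (of_real (gam^2)) (smult (c a) (f a))"
      using assms[OF a] by (simp add: eigY_def mult.commute)
  qed
  finally show ?thesis using l2 by (simp add: eigY_def sv.scale_sum_right)
qed

lemma gam_pos: "0 < gam"
proof (rule ccontr)
  assume "\<not> 0 < gam"
  then have g: "gam = 0" using gam_nonneg by simp
  let ?e = "Eop (axis (undefined::'p) (1::complex))"
  have l: "shift ?e \<in> l2" by simp
  have "nrm (H (shift ?e)) = gam * nrm (shift ?e)"
    using gam_le[OF l] nrm_nonneg[OF H_l2[OF l]] g by simp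
  then have "shift ?e = 0" by (rule no_zero[OF l]) simp
  then have "bshift (shift ?e) = bshift 0" by (simp only:)
  then show False using axis_seq_nonzero by simp
qed

text \<open>Evaluation at $0$ is injective on the eigenspace, whose dimension is $p$ by (C2).\<close>

lemma V_exists: "\<exists>v. eigY v \<and> v 0 = u"
proof -
  obtain B where B: "B \<subseteq> {h. maximizing G h}" "finite B" "card B = CARD('p)" "sv.independent B"
    using C2b unfolding span_dim_def cindep_iff by blast
  obtain b where b: "bij_betw b (UNIV :: 'p set) B"
    using B(2,3) finite_same_card_bij[of "UNIV :: 'p set" B] by auto
  have Y: "eigY (b j)" for j
  proof -
    have "maximizing G (b j)" using b B(1) by (auto simp: bij_betw_def)
    then show ?thesis unfolding eigY_def maximizing_iff using max_eig by blast
  qed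
  define A :: "complex^'p^'p" where "A = (\<chi> i j. b j 0 $ i)"
  have Ax: "A *v x = (\<Sum>j\<in>UNIV. smult (x $ j) (b j)) 0" for x
    by (simp add: A_def vec_eq_iff matrix_vector_mult_def seq_apply mult.commute)
  have "x = 0" if "A *v x = 0" for x
  proof -
    have "(\<Sum>j\<in>UNIV. smult (x $ j) (b j)) = 0"
      by (rule eigY_zero[OF eigY_sum[OF Y]]) (use that Ax in simp)
    moreover have inj: "inj b" and rng: "range b = B" using b by (auto simp: bij_betw_def)
    moreover have "(\<Sum>v\<in>range b. smult (x $ (inv b v)) v) = (\<Sum>j\<in>UNIV. smult (x $ j) (b j))"
      unfolding sum.reindex[OF inj] by (simp add: inv_f_f[OF inj])
    ultimately have s0: "(\<Sum>v\<in>B. smult (x $ (inv b v)) v) = 0" by simp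
    have "x $ j = 0" for j
    proof (rule ccontr)
      assume "x $ j \<noteq> 0"
      then have "x $ inv b (b j) \<noteq> 0" by (simp add: inv_f_f[OF inj])
      moreover have "b j \<in> B" using rng by blast
      ultimately have "sv.dependent B"
        unfolding sv.dependent_finite[OF B(2)] using s0 by (intro exI[of _ "\<lambda>v. x $ inv b v"]) blast
      then show False using B(4) by simp
    qed
    then show ?thesis by (simp add: vec_eq_iff)
  qed
  then obtain A' where "A' ** A = mat 1" using matrix_left_invertible_ker[of A] by blast
  then have "A ** A' = mat 1" by (simp add: matrix_left_right_inverse)
  then have "A *v (A' *v u) = u" by (simp add: matrix_vector_mul_assoc)
  then have "(\<Sum>j\<in>UNIV. smult ((A' *v u) $ j) (b j)) 0 = u" unfolding Ax .
  then show ?thesis using eigY_sum[where A = UNIV and f = b and c = "\<lambda>j. (A' *v u) $ j", OF Y] by blast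
qed

definition V :: "complex^'p \<Rightarrow> 'p seq" where
  "V u = (\<Sum>j\<in>UNIV. smult (u $ j) (SOME v. eigY v \<and> v 0 = axis j 1))"

lemma V_eig: "eigY (V u)" and V_0: "V u 0 = u"
proof -
  define w where "w j = (SOME v. eigY v \<and> v 0 = axis j 1)" for j :: 'p
  have w: "eigY (w j) \<and> w j 0 = axis j 1" for j unfolding w_def by (rule someI_ex[OF V_exists])
  have Vw: "V u = (\<Sum>j\<in>UNIV. smult (u $ j) (w j))" by (simp add: V_def w_def)
  show "eigY (V u)" unfolding Vw by (rule eigY_sum) (use w in blast)
  have w0: "w j 0 = axis j 1" for j using w by blast
  show "V u 0 = u" unfolding Vw seq_apply w0 by (rule basis_expansion)
qed

lemma V_l2: "V u \<in> l2" using V_eig by (simp add: eigY_def)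

lemma V_lin: "V u = (\<Sum>j\<in>UNIV. smult (u $ j) (V (axis j 1)))"
proof -
  have "eigY (\<Sum>j\<in>UNIV. smult (u $ j) (V (axis j 1)))" by (rule eigY_sum[OF V_eig])
  then have "eigY (\<Sum>k\<in>{True, False}. smult (if k then 1 else - 1) (if k then V u else (\<Sum>j\<in>UNIV. smult (u $ j) (V (axis j 1)))))"
    using V_eig by (intro eigY_sum) auto
  then have "eigY (V u - (\<Sum>j\<in>UNIV. smult (u $ j) (V (axis j 1))))" by simp
  then have "V u - (\<Sum>j\<in>UNIV. smult (u $ j) (V (axis j 1))) = 0"
    by (rule eigY_zero) (simp add: seq_apply V_0 basis_expansion)
  then show ?thesis by simp
qed

lemma eigY_decay: assumes "eigY f" shows "norm (f n) \<le> (c0 / (1 - r) * gam * nrm f / gam^2) * r ^ n"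
proof -
  have f: "f \<in> l2" using assms by (simp add: eigY_def)
  have "gam^2 * norm (f n) = norm (H' (H f) n)"
    using assms by (simp add: eigY_def seq_apply norm_scale_vec norm_power)
  also have "\<dots> \<le> c0 / (1 - r) * nrm (H f) * r ^ n" by (rule H'_decay[OF H_l2[OF f]])
  also have "nrm (H f) = gam * nrm f" using assms eig_max by (simp add: eigY_def)
  finally have "norm (f n) \<le> (c0 / (1 - r) * (gam * nrm f) * r ^ n) / gam^2"
    using gam_pos by (subst pos_le_divide_eq) (auto simp: mult.commute)
  then show ?thesis by (simp add: mult_ac)
qed

definition qf :: "'p seq \<Rightarrow> real" where "qf f = gam^2 * (nrm f)^2 - (nrm (H f))^2"
definition D2 :: "'p seq \<Rightarrow> 'p seq" where "D2 f = smult (of_real (gam^2)) f - H' (H f)"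

lemma bop_D2: "is_bounded_op D2"
  unfolding D2_def by (rule bop_lincomb[OF bop_id bop_comp[OF bopH' bopH]])

lemma ip_D2: assumes f: "f \<in> l2" and g: "g \<in> l2" shows "ip (D2 f) g = ip f (D2 g)"
proof -
  have "ip (H' (H f)) g = ip f (H' (H g))"
    using H'_adjoint[OF g H_l2[OF f]] H_adjoint[OF f H_l2[OF g]] by simp
  then show ?thesis unfolding D2_def
    using ip_diff_left[OF l2_smult[OF f] HH_l2[OF f] g] ip_diff_right[OF l2_smult[OF g] HH_l2[OF g] f]
      ip_smult_left[OF f g] ip_smult_right[OF g f] by simp
qed

lemma ip_D2_self: assumes f: "f \<in> l2" shows "ip (D2 f) f = of_real (qf f)"
  unfolding D2_def qf_def
  using ip_diff_left[OF l2_smult[OF f] HH_l2[OF f] f] ip_smult_left[OF f f] ip_self[OF f] ip_HH[OF f] by simp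

lemma qf_nonneg: assumes f: "f \<in> l2" shows "0 \<le> qf f"
proof -
  have "(nrm (H f))^2 \<le> (gam * nrm f)^2"
    by (rule power_mono[OF gam_le[OF f] nrm_nonneg[OF H_l2[OF f]]])
  then show ?thesis by (simp add: qf_def power_mult_distrib)
qed

lemma qf_shift: assumes f: "f \<in> l2" shows "qf (shift f) = qf f + (norm (H f 0))^2"
  unfolding qf_def H_shift[OF f] nrm_shift[OF f] using nrm_split[OF H_l2[OF f]] by simp

lemma qf_zero_shift: assumes f: "f \<in> l2" and q: "qf (shift f) = 0" shows "f = 0"
proof -
  have "(nrm (H (shift f)))^2 = (gam * nrm (shift f))^2" using q by (simp add: qf_def power_mult_distrib)
  then have "nrm (H (shift f)) = gam * nrm (shift f)" using f gam_nonneg by (simp add: power2_eq_iff_nonneg)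
  then have "shift f = 0" using f by (intro no_zero) simp_all
  then have "bshift (shift f) = bshift 0" by (simp only:)
  then show ?thesis by simp
qed

lemma V_no_zeros:
  assumes v: "eigY v" and \<mu>: "cmod \<mu> \<le> 1" and z: "(\<Sum>n. \<mu> ^ n *s v n) = 0"
  shows "v = 0"
proof -
  define c where "c = c0 / (1 - r) * gam * nrm v / gam^2"
  have c: "norm (v n) \<le> c * r ^ n" for n unfolding c_def by (rule eigY_decay[OF v])
  have vl: "v \<in> l2" using v by (simp add: eigY_def)
  have tm: "norm (\<mu> ^ j *s v (n + j)) \<le> c * r ^ n * r ^ j" for n j
  proof -
    have "norm (\<mu> ^ j *s v (n + j)) \<le> 1 * norm (v (n + j))"
      unfolding norm_scale_vec norm_power by (intro mult_right_mono power_le_one \<mu>) auto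
    then show ?thesis using c[of "n + j"] by (simp add: power_add mult_ac)
  qed
  have g: "summable (\<lambda>j. c * r ^ n * r ^ j)" for n using r by (intro summable_mult summable_geometric) simp
  have sm: "summable (\<lambda>j. \<mu> ^ j *s v (n + j))" for n
    by (rule summable_norm_cancel, rule summable_comparison_test'[OF g[of n]]) (use tm[of _ n] in simp)
  define x where "x n = (\<Sum>j. \<mu> ^ j *s v (Suc n + j))" for n
  have xd: "norm (x n) \<le> c * r / (1 - r) * r ^ n" for n
  proof -
    have "norm (x n) \<le> (\<Sum>j. c * r ^ Suc n * r ^ j)"
      unfolding x_def by (rule norm_suminf_le[OF tm g])
    then show ?thesis unfolding suminf_geo[OF r] by (simp add: mult_ac)
  qed
  have x: "x \<in> l2" by (rule summ_l2[OF summ_decay[OF xd r]])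
  define s where "s n = (\<Sum>j. \<mu> ^ j *s v (n + j))" for n
  have s0: "s 0 = 0" using z by (simp add: s_def)
  have sx: "s (Suc n) = x n" for n by (simp add: s_def x_def)
  have step: "s n = v n + \<mu> *s s (Suc n)" for n
  proof -
    have bl: "bounded_linear (\<lambda>y :: complex^'p. \<mu> *s y)"
    proof (rule bounded_linear_intro[where K = "cmod \<mu>"])
      show "norm (\<mu> *s y) \<le> norm y * cmod \<mu>" for y :: "complex^'p" by (simp add: norm_scale_vec)
    qed (simp_all add: vec_eq_iff algebra_simps)
    have "s n = (\<Sum>j. \<mu> ^ Suc j *s v (n + Suc j)) + \<mu> ^ 0 *s v (n + 0)"
      unfolding s_def using suminf_split_head[OF sm[of n]] by simp
    also have "(\<Sum>j. \<mu> ^ Suc j *s v (n + Suc j)) = (\<Sum>j. \<mu> *s (\<mu> ^ j *s v (Suc n + j)))"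
      by (simp add: vector_smult_assoc)
    also have "\<dots> = \<mu> *s s (Suc n)"
      unfolding s_def by (rule bounded_linear.suminf[OF bl sm, symmetric])
    finally show ?thesis by simp
  qed
  have eq: "shift x - smult \<mu> x = v"
  proof
    fix n
    show "(shift x - smult \<mu> x) n = v n"
    proof (cases n)
      case 0 then show ?thesis using step[of 0] s0 sx[of 0] by (simp add: seq_apply neg_eq_iff_add_eq_0 add.commute)
    next
      case (Suc m) then show ?thesis using step[of "Suc m"] sx[of m] sx[of "Suc m"] by (simp add: seq_apply)
    qed
  qed
  have sh: "shift x \<in> l2" using x by simp
  have D2v: "D2 v = 0" using v by (simp add: eigY_def D2_def)
  have "D2 (shift x) - smult \<mu> (D2 x) = D2 v"
    unfolding eq[symmetric] bop_diff[OF bop_D2 sh l2_smult[OF x]] bop_smult[OF bop_D2 x] ..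
  then have Da: "D2 (shift x) = smult \<mu> (D2 x)" unfolding D2v by simp
  have D2l: "D2 x \<in> l2" "D2 (shift x) \<in> l2" using bop_l2[OF bop_D2] x sh by blast+
  have "complex_of_real (qf (shift x)) = \<mu> * ip (D2 x) (shift x)"
    unfolding ip_D2_self[OF sh, symmetric] Da by (rule ip_smult_left[OF D2l(1) sh])
  also have "ip (D2 x) (shift x) = cnj \<mu> * ip x (D2 x)"
    unfolding ip_D2[OF x sh] Da by (rule ip_smult_right[OF D2l(1) x])
  also have "ip x (D2 x) = of_real (qf x)" using ip_D2[OF x x] ip_D2_self[OF x] by simp
  also have "\<mu> * (cnj \<mu> * of_real (qf x)) = of_real ((cmod \<mu>)^2 * qf x)"
    unfolding of_real_mult complex_norm_square by (simp add: mult_ac)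
  finally have q: "qf (shift x) = (cmod \<mu>)^2 * qf x" by (simp only: of_real_eq_iff)
  have q2: "qf x + (norm (H x 0))^2 = (cmod \<mu>)^2 * qf x" using q qf_shift[OF x] by simp
  have "qf (shift x) = 0"
  proof (cases "cmod \<mu> = 1")
    case False
    then have "cmod \<mu> < 1" using \<mu> by linarith
    then have m: "(cmod \<mu>)^2 < 1" using power_strict_mono[of "cmod \<mu>" 1 2] by simp
    have "qf x * (1 - (cmod \<mu>)^2) = - ((norm (H x 0))^2)" using q2 by (simp add: algebra_simps)
    then have "qf x * (1 - (cmod \<mu>)^2) \<le> 0" by simp
    then have "qf x \<le> 0" using m by (simp add: mult_le_0_iff)
    then have "qf x = 0" using qf_nonneg[OF x] by simp
    then show ?thesis using q by simp
  next
    case True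
    then have h0: "H x 0 = 0" using q2 by simp
    have "H (shift x) = bshift (H x)" by (rule H_shift[OF x])
    moreover have "shift (bshift (H x)) = H x" using Eop_shift_bshift[of "H x"] h0 by simp
    ultimately have "bshift (H' (H (shift x))) = H' (H x)"
      using H'_shift[of "bshift (H x)"] x by simp
    then have B: "bshift (D2 (shift x)) = D2 x"
      unfolding D2_def bshift_diff bshift_smult by simp
    let ?g = "D2 (shift x)"
    have gm: "?g n = \<mu> *s ?g (Suc n)" for n
      using arg_cong[OF Da, of "\<lambda>f. f n"] arg_cong[OF B, of "\<lambda>f. f n"] by (simp add: seq_apply bshift_apply)
    have gs: "norm (?g (Suc n)) = norm (?g n)" for n
      using arg_cong[OF gm[of n], of norm] unfolding norm_scale_vec True by simp
    have gn: "norm (?g n) = norm (?g 0)" for n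
    proof (induction n)
      case (Suc n) then show ?case by (simp only: gs)
    qed (rule refl)
    have lim: "(\<lambda>n. norm (?g n)) \<longlonglongrightarrow> 0" using tendsto_norm_zero[OF l2_tendsto_0[OF D2l(2)]] .
    have "(\<lambda>n. norm (?g n)) = (\<lambda>n. norm (?g 0))" using gn by blast
    then have "(\<lambda>n::nat. norm (?g 0)) \<longlonglongrightarrow> 0" using lim by (simp only:)
    then have "norm (?g 0) = 0" by (simp only: LIMSEQ_const_iff)
    then have "?g n = 0" for n using gn[of n] by simp
    then have "?g = 0" by (intro ext) (simp add: seq_apply)
    then show ?thesis using ip_D2_self[OF sh] by simp
  qed
  then have "x = 0" by (rule qf_zero_shift[OF x])
  then show ?thesis using eq by simp
qed

lemma A_finite_rank:
  fixes L :: "'q seq \<Rightarrow> 'p seq" and M :: "'p seq \<Rightarrow> 'p seq"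
  assumes "is_bounded_op L" "is_bounded_op M"
  shows "\<exists>B. finite B \<and> (\<forall>f\<in>l2. L (H (M f)) \<in> sv.span B)"
proof -
  obtain B where B: "finite B" "H ` l2 \<subseteq> sv.span B"
    using C1 unfolding cspan_eq_span H_def by blast
  obtain B' where B': "finite B' \<and> (\<forall>f\<in>l2. L (H f) \<in> sv.span B')"
    using finite_rank_comp[OF B bopH assms(1)] ..
  have "L (H (M f)) \<in> sv.span B'" if "f \<in> l2" for f
    using B' bop_l2[OF assms(2) that] by blast
  then show ?thesis using B' by (intro exI[of _ B']) blast
qed

lemma spectral_compression:
  fixes M M' :: "'p seq \<Rightarrow> 'p seq"
  assumes M: "is_bounded_op M" and M': "is_bounded_op M'"
    and adj: "\<And>f g. f \<in> l2 \<Longrightarrow> g \<in> l2 \<Longrightarrow> ip (M' f) g = ip f (M g)"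
  shows "\<exists>E a. finite E \<and> orthonormal E \<and> (\<forall>f\<in>l2. M' (H' (H (M f))) = specop E 0 a f)
     \<and> (\<forall>e\<in>E. a e = (nrm (H (M e)))^2)"
proof -
  let ?A = "\<lambda>f. M' (H' (H (M f)))"
  have b: "is_bounded_op ?A" by (intro bop_comp[OF M'] bop_comp[OF bopH'] bop_comp[OF bopH] M)
  have ipA: "ip (?A f) g = ip (H (M f)) (H (M g))" if "f \<in> l2" "g \<in> l2" for f g
  proof -
    have l: "M f \<in> l2" "M g \<in> l2" using that bop_l2[OF M] by blast+
    have "ip (?A f) g = ip (H' (H (M f))) (M g)" by (rule adj) (use l that in simp_all)
    also have "\<dots> = ip (H (M f)) (H (M g))" by (rule H'_adjoint) (use l in simp_all)
    finally show ?thesis .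
  qed
  have sa: "selfadj ?A" unfolding selfadj_def
  proof (intro ballI)
    fix f g :: "'p seq" assume f: "f \<in> l2" and g: "g \<in> l2"
    have l: "M f \<in> l2" "M g \<in> l2" using f g bop_l2[OF M] by blast+
    have "ip f (?A g) = cnj (ip (?A g) f)" using ip_cnj[OF bop_l2[OF b g] f] by simp
    also have "\<dots> = ip (H (M f)) (H (M g))" unfolding ipA[OF g f] by (rule ip_cnj) (use l in simp_all)
    finally show "ip (?A f) g = ip f (?A g)" unfolding ipA[OF f g] by simp
  qed
  obtain B where B: "finite B \<and> (\<forall>f\<in>l2. M' (H' (H (M f))) \<in> sv.span B)"
    using A_finite_rank[OF bop_comp[OF M' bopH'] M] ..
  have Bf: "?A f \<in> sv.span B" if "f \<in> l2" for f using B that by blast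
  have Bfin: "finite B" using B by blast
  obtain E where E: "finite E" "orthonormal E" "\<forall>f\<in>l2. ?A f = specop E 0 (\<lambda>e. Re (ip (?A e) e)) f"
    using spectral_finite_rank[OF b sa Bfin Bf] by blast
  have "Re (ip (?A e) e) = (nrm (H (M e)))^2" if "e \<in> E" for e
  proof -
    have e: "e \<in> l2" using that E(2) by (auto simp: orthonormal_def)
    show ?thesis unfolding ipA[OF e e] using ip_self[of "H (M e)"] bop_l2[OF M e] by simp
  qed
  then show ?thesis using E by blast
qed

lemma theta: "\<exists>\<theta>. 0 \<le> \<theta> \<and> \<theta> < gam^2 \<and> (\<forall>f\<in>l2. (nrm (H (shift f)))^2 \<le> \<theta> * (nrm f)^2)"
proof -
  obtain E a where E: "finite E" "orthonormal E"
    and A: "\<And>f. f \<in> l2 \<Longrightarrow> bshift (H' (H (shift f))) = specop E 0 a f"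
    and a: "\<And>e. e \<in> E \<Longrightarrow> a e = (nrm (H (shift e)))^2"
    using spectral_compression[OF bop_shift bop_bshift ip_bshift_left] by blast
  have lt: "a e < gam^2" if e: "e \<in> E" for e
  proof (rule ccontr)
    assume n: "\<not> a e < gam^2"
    have l: "e \<in> l2" by (rule on_l2[OF E(2,1) e])
    have n1: "nrm (shift e) = 1" using nrm_shift[OF l] on_nrm[OF E(2,1) e] by simp
    have sl: "shift e \<in> l2" using l by simp
    have le: "nrm (H (shift e)) \<le> gam" using gam_le[OF sl] n1 by simp
    have "gam^2 \<le> (nrm (H (shift e)))^2" using n a[OF e] by simp
    then have "gam \<le> nrm (H (shift e))" by (rule power2_le_imp_le) (use l in simp)
    then have "nrm (H (shift e)) = gam * nrm (shift e)" using le n1 by simp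
    then have "shift e = 0" by (rule no_zero[OF sl]) simp
    then show False using n1 by simp
  qed
  define \<theta> where "\<theta> = Max (insert 0 (a ` E))"
  have fin: "finite (insert 0 (a ` E))" using E(1) by simp
  have \<theta>in: "\<theta> \<in> insert 0 (a ` E)" unfolding \<theta>_def by (rule Max_in[OF fin]) simp
  have ge: "x \<le> \<theta>" if "x \<in> insert 0 (a ` E)" for x unfolding \<theta>_def using fin that by (rule Max_ge)
  have \<theta>0: "0 \<le> \<theta>" by (rule ge) simp
  have \<theta>1: "\<theta> < gam^2" using \<theta>in lt gam_pos by auto
  have "(nrm (H (shift f)))^2 \<le> \<theta> * (nrm f)^2" if f: "f \<in> l2" for f
  proof -
    let ?A = "bshift (H' (H (shift f)))"
    have l: "?A \<in> l2" using f by simp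
    have "ip ?A f = ip (H' (H (shift f))) (shift f)" by (rule ip_bshift_left) (use f in simp_all)
    then have 1: "ip ?A f = of_real ((nrm (H (shift f)))^2)" using ip_HH[of "shift f"] f by simp
    have "ip (smult (of_real \<theta>) f - specop E 0 a f) f = of_real (\<theta> * (nrm f)^2 - (nrm (H (shift f)))^2)"
      unfolding A[OF f, symmetric] ip_diff_left[OF l2_smult[OF f] l f] ip_smult_left[OF f f] 1 ip_self[OF f] by simp
    moreover have "ip (specop E \<theta> (\<lambda>e. \<theta> - a e) f) f
        = of_real ((nrm (specop E (sqrt \<theta>) (\<lambda>e. sqrt (\<theta> - a e)) f))^2)"
      by (rule specop_psd[OF E(2,1) \<theta>0 _ f]) (use ge in simp)
    ultimately have "\<theta> * (nrm f)^2 - (nrm (H (shift f)))^2 = (nrm (specop E (sqrt \<theta>) (\<lambda>e. sqrt (\<theta> - a e)) f))^2"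
      unfolding specop_diff by (simp only: of_real_eq_iff)
    then show ?thesis by (metis diff_ge_0_iff_ge zero_le_power2)
  qed
  then show ?thesis using \<theta>0 \<theta>1 by blast
qed

end

section \<open>The restricted problem on an invariant subspace\<close>

locale level = nehari G C r for G :: "real \<Rightarrow> complex^'p::finite^'q::finite" and C r +
  fixes M M1 :: "'p seq set" and \<theta> :: real
  assumes opM: "oproj M" and opM1: "oproj M1" and BM: "bshift ` M = M1" and M1M: "M1 \<subseteq> M"
    and SM: "\<And>m. m \<in> M1 \<Longrightarrow> shift m \<in> M" and EM: "\<And>u. Eop u \<in> M"
    and M_summ: "\<And>m. m \<in> M \<Longrightarrow> summ m"
    and th: "0 \<le> \<theta>" "\<And>f. f \<in> l2 \<Longrightarrow> (nrm (H (shift f)))^2 \<le> \<theta> * (nrm f)^2"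
    and thk: "\<theta> < (opnorm_on H M)^2"
begin

definition gk :: real where "gk = opnorm_on H M"

abbreviation "P \<equiv> proj M"
abbreviation "P1 \<equiv> proj M1"

lemmas bopP = bop_proj[OF opM] and bopP1 = bop_proj[OF opM1]
lemmas P_l2 [simp] = proj_l2[OF opM] and P1_l2 [simp] = proj_l2[OF opM1]
lemma M_l2: "m \<in> M \<Longrightarrow> m \<in> l2" by (rule oproj_sub[OF opM])
lemma M1_l2: "m \<in> M1 \<Longrightarrow> m \<in> l2" by (rule oproj_sub[OF opM1])
lemma M_sub: "M \<subseteq> l2" using M_l2 by blast

lemmas gk_props = opnorm_on_props[OF bopH M_sub EM axis_seq_nonzero, folded gk_def]
lemma gk_le: "m \<in> M \<Longrightarrow> nrm (H m) \<le> gk * nrm m" by (rule gk_props(1))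
lemma gk_nonneg: "0 \<le> gk" by (rule gk_props(2))
lemma gk_th: "\<theta> < gk^2" using thk by (simp add: gk_def)
lemma gk_sq_pos: "0 < gk^2" using gk_th th(1) by linarith
lemma gammaM: "gammaM G M = gk" unfolding gammaM_def gk_def H_def ..

lemma P_adj: "f \<in> l2 \<Longrightarrow> g \<in> l2 \<Longrightarrow> ip (P f) g = ip f (P g)"
  using selfadj_proj[OF opM] unfolding selfadj_def by blast
lemma P1_adj: "f \<in> l2 \<Longrightarrow> g \<in> l2 \<Longrightarrow> ip (P1 f) g = ip f (P1 g)"
  using selfadj_proj[OF opM1] unfolding selfadj_def by blast

lemma P1BP: assumes f: "f \<in> l2" shows "P1 (bshift (P f)) = P1 (bshift f)"
proof (rule oproj_unique[OF opM1])
  show "bshift (P f) \<in> l2" using f by simp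
  show "P1 (bshift f) \<in> M1" using proj_in[OF opM1] f by simp
  fix m assume m: "m \<in> M1"
  have ml: "m \<in> l2" by (rule M1_l2[OF m])
  have "ip (bshift (f - P f)) m = ip (f - P f) (shift m)"
    by (rule ip_bshift_left) (use f ml in simp_all)
  also have "\<dots> = 0" by (rule proj_perp[OF opM f SM[OF m]])
  finally have 1: "ip (bshift (f - P f)) m = 0" .
  have 2: "ip (bshift f - P1 (bshift f)) m = 0" by (rule proj_perp[OF opM1 _ m]) (use f in simp)
  have "bshift (P f) - P1 (bshift f) = (bshift f - P1 (bshift f)) - bshift (f - P f)"
    by (simp add: bshift_diff)
  moreover have l: "bshift f - P1 (bshift f) \<in> l2" "bshift (f - P f) \<in> l2" using f by simp_all
  ultimately show "ip (bshift (P f) - P1 (bshift f)) m = 0"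
    using ip_diff_left[OF l ml] unfolding 1 2 by (simp only:) simp
qed

definition D :: "'p seq \<Rightarrow> 'p seq" where "D = DM G M"

lemma D_exists: "\<exists>E \<phi>. finite E \<and> orthonormal E \<and> D = (\<lambda>f. if f \<in> l2 then specop E gk \<phi> f else 0)
  \<and> (\<forall>f\<in>l2. specop E gk \<phi> (specop E gk \<phi> f) = smult (of_real (gk^2)) f - P (H' (H (P f))))"
proof -
  obtain E a where E: "finite E" "orthonormal E"
    and A: "\<And>f. f \<in> l2 \<Longrightarrow> P (H' (H (P f))) = specop E 0 a f"
    and a: "\<And>e. e \<in> E \<Longrightarrow> a e = (nrm (H (P e)))^2"
    using spectral_compression[OF bopP bopP P_adj] by blast
  have ae: "0 \<le> gk^2 - a e" if e: "e \<in> E" for e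
  proof -
    have l: "e \<in> l2" by (rule on_l2[OF E(2,1) e])
    have "nrm (H (P e)) \<le> gk * nrm (P e)" by (rule gk_le[OF proj_in[OF opM l]])
    also have "\<dots> \<le> gk * nrm e" by (rule mult_left_mono[OF nrm_proj_le[OF opM l] gk_nonneg])
    finally have "nrm (H (P e)) \<le> gk" using on_nrm[OF E(2,1) e] by simp
    then have "(nrm (H (P e)))^2 \<le> gk^2" by (rule power_mono) (use l in simp)
    then show ?thesis using a[OF e] by simp
  qed
  let ?\<phi> = "\<lambda>e. sqrt (gk^2 - a e)"
  have sg: "sqrt (gk^2) = gk" using gk_nonneg by simp
  have T: "ssub (smult (of_real ((gammaM G M)^2)) f) (P (adj (hank G :: 'p seq \<Rightarrow> 'q seq) (hank G (P f))))
      = specop E (gk^2) (\<lambda>e. gk^2 - a e) f" if f: "f \<in> l2" for f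
  proof -
    have "adj (hank G :: 'p seq \<Rightarrow> 'q seq) (hank G (P f)) = H' (H (P f))"
      unfolding H_def[symmetric] by (rule adj_hank[unfolded H_def[symmetric]]) (use f in simp)
    then show ?thesis unfolding gammaM ssub_eq specop_diff[symmetric] by (simp only: A[OF f])
  qed
  have "D = (\<lambda>f. if f \<in> l2 then specop E gk ?\<phi> f else 0)"
    unfolding D_def DM_def by (rule psqrt_specop[OF E(2,1) _ ae T, unfolded sg]) simp_all
  moreover have "specop E gk ?\<phi> (specop E gk ?\<phi> f) = smult (of_real (gk^2)) f - P (H' (H (P f)))"
    if f: "f \<in> l2" for f
  proof -
    have "specop E gk ?\<phi> (specop E gk ?\<phi> f) = specop E (gk^2) (\<lambda>e. gk^2 - a e) f"
      unfolding specop_specop[OF E(2,1) f] power2_eq_square[of gk, symmetric]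
      by (rule specop_cong[OF E(2,1)]) (use ae in simp)
    then show ?thesis unfolding A[OF f] specop_diff .
  qed
  ultimately show ?thesis using E by blast
qed

lemma bopD: "is_bounded_op D"
  and D_out: "f \<notin> l2 \<Longrightarrow> D f = 0"
  and DD: "f \<in> l2 \<Longrightarrow> D (D f) = smult (of_real (gk^2)) f - P (H' (H (P f)))"
proof -
  obtain E \<phi> where E: "finite E" "orthonormal E" and De: "D = (\<lambda>f. if f \<in> l2 then specop E gk \<phi> f else 0)"
    and sq: "\<forall>f\<in>l2. specop E gk \<phi> (specop E gk \<phi> f) = smult (of_real (gk^2)) f - P (H' (H (P f)))"
    using D_exists by blast
  have Din: "D f = specop E gk \<phi> f" if "f \<in> l2" for f using that unfolding De by (rule if_P)
  have b: "is_bounded_op (specop E gk \<phi>)" by (rule bop_specop[OF E(2,1)])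
  show "is_bounded_op D"
    using b unfolding is_bounded_op_def by (simp add: Din)
  show "D f = 0" if "f \<notin> l2" using that unfolding De by (rule if_not_P)
  show "D (D f) = smult (of_real (gk^2)) f - P (H' (H (P f)))" if "f \<in> l2"
    using sq that bop_l2[OF b that] by (simp add: Din)
qed

lemmas D_l2 [simp] = bop_l2[OF bopD]

definition Del :: "'p seq \<Rightarrow> 'p seq" where
  "Del f = smult (of_real (gk^2)) f - P1 (bshift (H' (H (shift (P1 f)))))"

lemma Di_exists: "\<exists>Di. is_bounded_op Di \<and> (\<forall>f\<in>l2. Di (Del f) = f \<and> Del (Di f) = f)"
proof -
  have adj: "ip (P1 (bshift f)) g = ip f (shift (P1 g))" if "f \<in> l2" "g \<in> l2" for f g
    using P1_adj[of "bshift f" g] ip_bshift_left[of f "P1 g"] that by simp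
  obtain E a where E: "finite E" "orthonormal E"
    and A: "\<And>f. f \<in> l2 \<Longrightarrow> P1 (bshift (H' (H (shift (P1 f))))) = specop E 0 a f"
    and a: "\<And>e. e \<in> E \<Longrightarrow> a e = (nrm (H (shift (P1 e))))^2"
    using spectral_compression[OF bop_comp[OF bop_shift bopP1] bop_comp[OF bopP1 bop_bshift] adj] by blast
  have ae: "gk^2 - a e \<noteq> 0" if e: "e \<in> E" for e
  proof -
    have l: "e \<in> l2" by (rule on_l2[OF E(2,1) e])
    have "a e \<le> \<theta> * (nrm (P1 e))^2" unfolding a[OF e] by (rule th(2)) (use l in simp)
    also have "\<dots> \<le> \<theta> * (nrm e)^2"
      by (intro mult_left_mono power_mono nrm_proj_le[OF opM1 l] th) (use l in simp)
    finally have "a e \<le> \<theta>" using on_nrm[OF E(2,1) e] by simp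
    then show ?thesis using gk_th by linarith
  qed
  have Dl: "Del f = specop E (gk^2) (\<lambda>e. gk^2 - a e) f" if "f \<in> l2" for f
    unfolding Del_def A[OF that] specop_diff ..
  let ?Di = "specop E (1 / gk^2) (\<lambda>e. 1 / (gk^2 - a e))"
  have g: "gk^2 \<noteq> 0" using gk_sq_pos by linarith
  have "?Di (Del f) = f \<and> Del (?Di f) = f" if f: "f \<in> l2" for f
  proof
    have l: "?Di f \<in> l2" by (rule specop_l2[OF E(2,1) f])
    have "?Di (Del f) = specop E 1 (\<lambda>e. 1) f"
      unfolding Dl[OF f] specop_specop[OF E(2,1) f]
      using g by (simp, intro specop_cong[OF E(2,1)]) (use ae in simp)
    then show "?Di (Del f) = f" by (simp only: specop_one[OF E(2,1)])
    have "Del (?Di f) = specop E 1 (\<lambda>e. 1) f"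
      unfolding Dl[OF l] specop_specop[OF E(2,1) f]
      using g by (simp, intro specop_cong[OF E(2,1)]) (use ae in simp)
    then show "Del (?Di f) = f" by (simp only: specop_one[OF E(2,1)])
  qed
  then show ?thesis using bop_specop[OF E(2,1)] by (intro exI[of _ ?Di]) blast
qed

definition Di :: "'p seq \<Rightarrow> 'p seq" where
  "Di = (SOME Di. is_bounded_op Di \<and> (\<forall>f\<in>l2. Di (Del f) = f \<and> Del (Di f) = f))"

lemma bopDi: "is_bounded_op Di"
  and Di_Del: "f \<in> l2 \<Longrightarrow> Di (Del f) = f"
  and Del_Di: "f \<in> l2 \<Longrightarrow> Del (Di f) = f"
  using someI_ex[OF Di_exists] unfolding Di_def[symmetric] by blast+

lemmas Di_l2 [simp] = bop_l2[OF bopDi]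

lemma Di_M1: assumes f: "f \<in> M1" shows "Di f \<in> M1"
proof -
  let ?A = "P1 (bshift (H' (H (shift (P1 (Di f))))))"
  have l: "f \<in> l2" by (rule M1_l2[OF f])
  have A: "?A \<in> M1" by (rule proj_in[OF opM1]) (use l in simp)
  have s: "sv.subspace M1" by (rule oproj_subspace[OF opM1])
  have "smult (of_real (gk^2)) (Di f) = f + ?A"
    using Del_Di[OF l] unfolding Del_def by (metis diff_add_cancel)
  then have "smult (inverse (of_real (gk^2))) (smult (of_real (gk^2)) (Di f)) \<in> M1"
    using sv.subspace_scale[OF s sv.subspace_add[OF s f A]] by simp
  moreover have "of_real (gk^2) \<noteq> (0::complex)" using gk_sq_pos by (simp only: of_real_eq_0_iff)
  ultimately show ?thesis by simp
qed

lemma PBDDS: assumes x: "x \<in> M1" shows "P1 (bshift (D (D (shift x)))) = Del x"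
proof -
  have l: "x \<in> l2" by (rule M1_l2[OF x])
  have s: "shift x \<in> l2" using l by simp
  have h: "H' (H (shift x)) \<in> l2" using l by simp
  have "D (D (shift x)) = smult (of_real (gk^2)) (shift x) - P (H' (H (shift x)))"
    using DD[OF s] proj_id[OF opM SM[OF x]] by simp
  then have "P1 (bshift (D (D (shift x)))) = P1 (smult (of_real (gk^2)) x - bshift (P (H' (H (shift x)))))"
    by (simp add: bshift_diff bshift_smult)
  also have "\<dots> = smult (of_real (gk^2)) (P1 x) - P1 (bshift (P (H' (H (shift x)))))"
  proof -
    have 1: "smult (of_real (gk^2)) x \<in> l2" "bshift (P (H' (H (shift x)))) \<in> l2" using l h by simp_all
    show ?thesis unfolding bop_diff[OF bopP1 1] bop_smult[OF bopP1 l] ..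
  qed
  also have "\<dots> = Del x" unfolding P1BP[OF h] Del_def proj_id[OF opM1 x] ..
  finally show ?thesis .
qed

text \<open>Intertwines with the square root: $\omega_2 D = D T$. Hence the Taylor coefficients of the central
  solution are expressed by powers of $T$, without $D$.\<close>

definition T :: "'p seq \<Rightarrow> 'p seq" where "T v = Di (P1 (bshift (D (D v))))"

lemma bopT: "is_bounded_op T"
  unfolding T_def by (intro bop_comp[OF bopDi] bop_comp[OF bopP1] bop_comp[OF bop_bshift] bop_comp[OF bopD] bopD)

lemma T_shift: "x \<in> M1 \<Longrightarrow> T (shift x) = x"
  unfolding T_def by (simp only: PBDDS Di_Del M1_l2)

definition om :: "'p seq \<Rightarrow> 'p seq" where "om g = Di (P1 (bshift (D g)))"

lemma bop_om: "is_bounded_op om"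
  unfolding om_def by (intro bop_comp[OF bopDi] bop_comp[OF bopP1] bop_comp[OF bop_bshift] bopD)

lemma om_M1: "g \<in> l2 \<Longrightarrow> om g \<in> M1"
  unfolding om_def by (intro Di_M1 proj_in[OF opM1] l2_bshift D_l2)

lemma om_D: "om (D v) = T v" by (simp add: om_def T_def)

lemma RM_eq: "RM M = P1" unfolding RM_def BM ..

lemma adj_QM: assumes g: "g \<in> l2" shows "adj (QM M) g = P1 (bshift g)"
proof (rule adj_eqI[OF g])
  show "P1 (bshift g) \<in> l2" using g by simp
  fix h :: "'p seq" assume h: "h \<in> l2"
  have "ip (shift (P1 h)) g = ip (P1 h) (bshift g)" by (rule ip_shift_left) (use h g in simp_all)
  also have "\<dots> = ip h (P1 (bshift g))" by (rule P1_adj) (use h g in simp_all)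
  finally show "ip (QM M h) g = ip h (P1 (bshift g))" unfolding QM_def RM_eq .
qed

definition om0 :: "'p seq \<Rightarrow> (complex^'q) \<times> 'p seq" where
  "om0 g = (if g \<in> l2 then (H (om g) 0, D (om g)) else (0, 0))"

lemma om0_in: "g \<in> l2 \<Longrightarrow> om0 g = (H (om g) 0, D (om g))"
  unfolding om0_def by (rule if_P)

lemma om_l2 [simp]: "g \<in> l2 \<Longrightarrow> om g \<in> l2" by (rule bop_l2[OF bop_om])

lemma omega_eq: "omega G M = om0"
  unfolding omega_def D_def[symmetric] H_def[symmetric] RM_eq zs_eq sadd_eq
proof (rule the_equality)
  have bHo: "is_bounded_op (\<lambda>g. H (om g))" and bDo: "is_bounded_op (\<lambda>g. D (om g))"
    by (intro bop_comp[OF bopH bop_om] bop_comp[OF bopD bop_om])+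
  show "(\<forall>g. g \<notin> l2 \<longrightarrow> om0 g = (0, 0)) \<and> (\<forall>g\<in>l2. snd (om0 g) \<in> l2) \<and>
    (\<forall>f\<in>l2. \<forall>g\<in>l2. om0 (f + g) = (fst (om0 f) + fst (om0 g), snd (om0 f) + snd (om0 g))) \<and>
    (\<forall>c. \<forall>f\<in>l2. om0 (smult c f) = (c *s fst (om0 f), smult c (snd (om0 f)))) \<and>
    (\<exists>C. \<forall>g\<in>l2. (norm (fst (om0 g)))\<^sup>2 + (nrm (snd (om0 g)))\<^sup>2 \<le> C\<^sup>2 * (nrm g)\<^sup>2) \<and>
    (\<forall>h\<in>l2. om0 (D (QM M h)) = (H (P1 h) 0, D (P1 h))) \<and>
    (\<forall>g\<in>l2. adj (QM M) (D g) = 0 \<longrightarrow> om0 g = (0, 0))"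
  proof (intro conjI allI ballI impI)
    show "om0 g = (0, 0)" if "g \<notin> l2" for g using that unfolding om0_def by (rule if_not_P)
    show "snd (om0 g) \<in> l2" if "g \<in> l2" for g using that by (simp add: om0_in)
    show "om0 (f + g) = (fst (om0 f) + fst (om0 g), snd (om0 f) + snd (om0 g))"
      if f: "f \<in> l2" and g: "g \<in> l2" for f g
      unfolding om0_in[OF l2_add[OF f g]] om0_in[OF f] om0_in[OF g]
        bop_add[OF bHo f g] bop_add[OF bDo f g] by (simp add: plus_fun_apply)
    show "om0 (smult c f) = (c *s fst (om0 f), smult c (snd (om0 f)))" if f: "f \<in> l2" for c f
      unfolding om0_in[OF l2_smult[OF f]] om0_in[OF f] bop_smult[OF bHo f] bop_smult[OF bDo f]
      by (simp add: smult_apply)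
    obtain C1 where C1: "C1 > 0" "\<And>g. g \<in> l2 \<Longrightarrow> nrm (H (om g)) \<le> C1 * nrm g" using bop_bound[OF bHo] by blast
    obtain C2 where C2: "C2 > 0" "\<And>g. g \<in> l2 \<Longrightarrow> nrm (D (om g)) \<le> C2 * nrm g" using bop_bound[OF bDo] by blast
    show "\<exists>C. \<forall>g\<in>l2. (norm (fst (om0 g)))\<^sup>2 + (nrm (snd (om0 g)))\<^sup>2 \<le> C\<^sup>2 * (nrm g)\<^sup>2"
    proof (intro exI[of _ "C1 + C2"] ballI)
      fix g :: "'p seq" assume g: "g \<in> l2"
      have "norm (H (om g) 0) \<le> C1 * nrm g" using norm_le_nrm[of "H (om g)" 0] C1(2)[OF g] g by simp
      then have 1: "(norm (H (om g) 0))^2 \<le> (C1 * nrm g)^2" by (rule power_mono) simp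
      have 2: "(nrm (D (om g)))^2 \<le> (C2 * nrm g)^2" by (rule power_mono[OF C2(2)[OF g]]) (use g in simp)
      have "0 \<le> 2 * (C1 * C2) * (nrm g)^2" using C1(1) C2(1) by simp
      then show "(norm (fst (om0 g)))\<^sup>2 + (nrm (snd (om0 g)))\<^sup>2 \<le> (C1 + C2)\<^sup>2 * (nrm g)\<^sup>2"
        using 1 2 unfolding om0_in[OF g] by (simp add: power_mult_distrib power2_sum algebra_simps)
    qed
    show "om0 (D (QM M h)) = (H (P1 h) 0, D (P1 h))" if h: "h \<in> l2" for h
    proof -
      have q: "QM M h = shift (P1 h)" unfolding QM_def RM_eq ..
      have "om (D (QM M h)) = P1 h" unfolding om_D q by (rule T_shift[OF proj_in[OF opM1 h]])
      moreover have "D (QM M h) \<in> l2" unfolding q using h by simp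
      ultimately show ?thesis by (simp add: om0_in)
    qed
    show "om0 g = (0, 0)" if g: "g \<in> l2" and z: "adj (QM M) (D g) = 0" for g
    proof -
      have "om g = 0" using z unfolding adj_QM[OF D_l2[OF g]] om_def by (simp add: bop_zero[OF bopDi])
      then show ?thesis using g by (simp add: om0_in bop_zero[OF bopH] bop_zero[OF bopD] zero_fun_apply)
    qed
  qed
next
  fix w :: "'p seq \<Rightarrow> (complex^'q) \<times> 'p seq"
  assume w: "(\<forall>g. g \<notin> l2 \<longrightarrow> w g = (0, 0)) \<and> (\<forall>g\<in>l2. snd (w g) \<in> l2) \<and>
    (\<forall>f\<in>l2. \<forall>g\<in>l2. w (f + g) = (fst (w f) + fst (w g), snd (w f) + snd (w g))) \<and>
    (\<forall>c. \<forall>f\<in>l2. w (smult c f) = (c *s fst (w f), smult c (snd (w f)))) \<and>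
    (\<exists>C. \<forall>g\<in>l2. (norm (fst (w g)))\<^sup>2 + (nrm (snd (w g)))\<^sup>2 \<le> C\<^sup>2 * (nrm g)\<^sup>2) \<and>
    (\<forall>h\<in>l2. w (D (QM M h)) = (H (P1 h) 0, D (P1 h))) \<and>
    (\<forall>g\<in>l2. adj (QM M) (D g) = 0 \<longrightarrow> w g = (0, 0))"
  have wout: "w g = (0, 0)" if "g \<notin> l2" for g using w that by blast
  have wadd: "w (f + g) = (fst (w f) + fst (w g), snd (w f) + snd (w g))" if "f \<in> l2" "g \<in> l2" for f g
    using w that by blast
  have wQ: "w (D (QM M h)) = (H (P1 h) 0, D (P1 h))" if "h \<in> l2" for h using w that by blast
  have wker: "w g = (0, 0)" if "g \<in> l2" "adj (QM M) (D g) = 0" for g using w that by blast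
  show "w = om0"
  proof
    fix g
    show "w g = om0 g"
    proof (cases "g \<in> l2")
      case False
      then show ?thesis unfolding wout[OF False] om0_def by (simp only: if_False)
    next
      case g: True
      let ?x = "om g"
      have x: "?x \<in> M1" by (rule om_M1[OF g])
      have xl: "?x \<in> l2" by (rule M1_l2[OF x])
      have Q: "QM M ?x = shift ?x" unfolding QM_def RM_eq proj_id[OF opM1 x] ..
      let ?d = "D (QM M ?x)"
      have dl: "?d \<in> l2" unfolding Q using xl by simp
      have gd: "g - ?d \<in> l2" using g dl by (rule l2_diff)
      have 1: "D g \<in> l2" "D ?d \<in> l2" using g dl by simp_all
      have 2: "bshift (D g) \<in> l2" "bshift (D ?d) \<in> l2" using 1 by simp_all
      have "adj (QM M) (D (g - ?d)) = P1 (bshift (D (g - ?d)))" by (rule adj_QM[OF D_l2[OF gd]])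
      also have "\<dots> = P1 (bshift (D g)) - P1 (bshift (D ?d))"
        unfolding bop_diff[OF bopD g dl] bop_diff[OF bop_bshift 1] bop_diff[OF bopP1 2] ..
      also have "P1 (bshift (D g)) - P1 (bshift (D ?d)) = 0"
      proof -
        have "Del ?x = P1 (bshift (D g))" unfolding om_def by (rule Del_Di) (use g in simp)
        then show ?thesis unfolding Q PBDDS[OF x] by simp
      qed
      finally have k: "w (g - ?d) = (0, 0)" by (rule wker[OF gd])
      have "w g = w (?d + (g - ?d))" by simp
      also have "\<dots> = (H (P1 ?x) 0, D (P1 ?x))"
        unfolding wadd[OF dl gd] k wQ[OF xl] by simp
      finally show ?thesis unfolding om0_in[OF g] proj_id[OF opM1 x] .
    qed
  qed
qed

lemma resol_series:
  fixes u :: "complex^'p"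
  shows "\<exists>R>0. \<forall>z. cmod z < R \<longrightarrow>
    (\<lambda>n. z ^ n * (H ((T ^^ Suc n) (Eop u)) 0 $ i)) sums (fst (omega G M (resol G M z u)) $ i)"
proof -
  define W where "W g = D (om g)" for g
  have bW: "is_bounded_op W" unfolding W_def by (rule bop_comp[OF bopD bop_om])
  obtain c where c: "c > 0" "\<And>g. g \<in> l2 \<Longrightarrow> nrm (W g) \<le> c * nrm g" using bop_bound[OF bW] by blast
  define y where "y n = D ((T ^^ n) (Eop u))" for n
  have Tl: "(T ^^ n) (Eop u) \<in> l2" for n by (rule l2_pow[OF bop_l2[OF bopT] l2_Eop])
  have yl: "y n \<in> l2" for n unfolding y_def using Tl by simp
  have Wy: "W (y n) = y (Suc n)" for n unfolding W_def y_def om_D by simp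
  have oy: "om (y n) = (T ^^ Suc n) (Eop u)" for n unfolding y_def om_D by simp
  have ny: "nrm (y n) \<le> c ^ n * nrm (y 0)" for n
  proof (induction n)
    case (Suc n)
    have "nrm (y (Suc n)) \<le> c * nrm (y n)" using c(2)[OF yl[of n]] unfolding Wy .
    also have "\<dots> \<le> c * (c ^ n * nrm (y 0))" using Suc c(1) by simp
    finally show ?case by (simp add: mult.assoc)
  qed simp
  show ?thesis
  proof (intro exI[of _ "1 / c"] conjI allI impI)
    show "1 / c > 0" using c by simp
    fix z :: complex assume "cmod z < 1 / c"
    then have lc: "cmod z * c < 1" using c(1) by (simp add: field_simps)
    have lc0: "0 \<le> cmod z * c" using c(1) by simp
    define f where "f n = smult (z ^ n) (y n)" for n
    have fl: "f n \<in> l2" for n unfolding f_def using yl by simp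
    have nf: "nrm (f n) \<le> nrm (y 0) * (cmod z * c) ^ n" for n
    proof -
      have "nrm (f n) = cmod z ^ n * nrm (y n)" unfolding f_def nrm_smult[OF yl] norm_power ..
      also have "\<dots> \<le> cmod z ^ n * (c ^ n * nrm (y 0))" by (rule mult_left_mono[OF ny]) simp
      finally show ?thesis by (simp add: power_mult_distrib mult_ac)
    qed
    have sf: "summable (\<lambda>n. nrm (f n))"
    proof (rule summable_comparison_test')
      show "summable (\<lambda>n. nrm (y 0) * (cmod z * c) ^ n)"
        by (intro summable_mult summable_geometric) (use lc lc0 in simp)
      show "norm (nrm (f n)) \<le> nrm (y 0) * (cmod z * c) ^ n" for n using nf[of n] nrm_nonneg[OF fl[of n]] by simp
    qed
    define s where "s = (\<lambda>j. \<Sum>n. f n j)"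
    have sl: "s \<in> l2" unfolding s_def by (rule l2_suminf(1)[OF fl sf])
    have sfj: "summable (\<lambda>n. f n j)" for j
      by (rule summable_comparison_test'[OF sf]) (rule norm_le_nrm[OF fl])
    have Wf: "W (f n) = smult (z ^ n) (y (Suc n))" for n
      unfolding f_def bop_smult[OF bW yl] Wy ..
    have eq: "s - smult z (W s) = D (Eop u)"
    proof
      fix j
      have "z *s W s j = z *s (\<Sum>n. W (f n) j)"
        unfolding s_def bop_suminf(1)[OF bW fl sf] ..
      also have "\<dots> = (\<Sum>n. z *s W (f n) j)"
      proof (rule bounded_linear.suminf[OF _ bop_suminf(2)[OF bW fl sf]])
        show "bounded_linear (\<lambda>y :: complex^'p. z *s y)"
        proof (rule bounded_linear_intro[where K = "cmod z"])
          show "norm (z *s y) \<le> norm y * cmod z" for y :: "complex^'p" by (simp add: norm_scale_vec)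
        qed (simp_all add: vec_eq_iff algebra_simps)
      qed
      also have "\<dots> = (\<Sum>n. f (Suc n) j)"
        unfolding Wf by (simp add: f_def smult_apply vector_smult_assoc)
      finally have "z *s W s j = s j - f 0 j" using suminf_split_head[OF sfj[of j]] by (simp add: s_def)
      then show "(s - smult z (W s)) j = D (Eop u) j" by (simp add: seq_apply f_def y_def)
    qed
    have sndW: "snd (omega G M x :: (complex^'q) \<times> 'p seq) = W x" if "x \<in> l2" for x
      unfolding omega_eq om0_in[OF that] W_def by simp
    have "resol G M z u = s"
      unfolding resol_def ssub_eq D_def[symmetric]
    proof (rule the_equality)
      show "s \<in> l2 \<and> s - smult z (snd (omega G M s)) = D (Eop u)" using sl eq sndW by simp
      fix x assume x: "x \<in> l2 \<and> x - smult z (snd (omega G M x)) = D (Eop u)"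
      then have xl: "x \<in> l2" and xe: "x - smult z (W x) = D (Eop u)" using sndW by auto
      have dl: "x - s \<in> l2" using xl sl by (rule l2_diff)
      have "x - smult z (W x) = s - smult z (W s)" using xe eq by simp
      then have "x - s = smult z (W x) - smult z (W s)" by (simp add: algebra_simps)
      also have "\<dots> = smult z (W (x - s))"
        unfolding bop_diff[OF bW xl sl] sv.scale_right_diff_distrib ..
      finally have "nrm (x - s) = cmod z * nrm (W (x - s))"
        using nrm_smult[OF bop_l2[OF bW dl], of z] by simp
      also have "\<dots> \<le> cmod z * (c * nrm (x - s))" by (rule mult_left_mono[OF c(2)[OF dl]]) simp
      finally have "nrm (x - s) * (1 - cmod z * c) \<le> 0" by (simp add: algebra_simps)
      then have "nrm (x - s) \<le> 0" using lc by (simp add: mult_le_0_iff)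
      then have "nrm (x - s) = 0" using nrm_nonneg[OF dl] by linarith
      then show "x = s" using nrm_zero_iff[OF dl] by simp
    qed
    then have "fst (omega G M (resol G M z u)) = H (om s) 0" unfolding omega_eq by (simp add: om0_in sl)
    also have "\<dots> = (\<Sum>n. H (om (f n)) 0)"
      unfolding s_def by (rule bop_suminf(1)[OF bop_comp[OF bopH bop_om] fl sf])
    finally have "(\<lambda>n. H (om (f n)) 0) sums fst (omega G M (resol G M z u))"
      using bop_suminf(2)[OF bop_comp[OF bopH bop_om] fl sf, of 0] by (simp add: sums_iff)
    then have "(\<lambda>n. H (om (f n)) 0 $ i) sums (fst (omega G M (resol G M z u)) $ i)"
      by (rule bounded_linear.sums[OF bounded_linear_vec_nth])
    moreover have "H (om (f n)) 0 $ i = z ^ n * (H ((T ^^ Suc n) (Eop u)) 0 $ i)" for n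
      unfolding f_def bop_smult[OF bop_comp[OF bopH bop_om] yl] oy by (simp add: smult_apply)
    ultimately show "(\<lambda>n. z ^ n * (H ((T ^^ Suc n) (Eop u)) 0 $ i)) sums (fst (omega G M (resol G M z u)) $ i)"
      by (simp only:)
  qed
qed

definition Vk :: "complex^'p \<Rightarrow> 'p seq" where
  "Vk u = Eop u + shift (Di (P1 (bshift (H' (H (Eop u))))))"

lemma xk_M1: "Di (P1 (bshift (H' (H (Eop u))))) \<in> M1"
  by (intro Di_M1 proj_in[OF opM1]) simp

lemma Vk_M: "Vk u \<in> M"
  unfolding Vk_def by (intro sv.subspace_add[OF oproj_subspace[OF opM]] EM SM xk_M1)

lemma T_Vk: "T (Vk u) = 0"
proof -
  let ?x = "Di (P1 (bshift (H' (H (Eop u)))))"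
  have xl: "shift ?x \<in> l2" using M1_l2[OF xk_M1] by simp
  have e: "Eop u \<in> l2" by simp
  have h: "H' (H (Eop u)) \<in> l2" by simp
  have 1: "smult (of_real (gk^2)) (Eop u) \<in> l2" "P (H' (H (Eop u))) \<in> l2" by simp_all
  have 2: "bshift (P (H' (H (Eop u)))) \<in> l2" by simp
  have "P1 (bshift (D (D (Eop u)))) = P1 (0 - bshift (P (H' (H (Eop u)))))"
    unfolding DD[OF e] proj_id[OF opM EM] bshift_diff bshift_smult by simp
  also have "\<dots> = - P1 (bshift (H' (H (Eop u))))"
    unfolding bop_diff[OF bopP1 l2_zero 2] P1BP[OF h] bop_zero[OF bopP1] by simp
  finally have E: "T (Eop u) = - ?x"
    unfolding T_def using bop_diff[OF bopDi l2_zero, of "P1 (bshift (H' (H (Eop u))))"]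
    by (simp add: bop_zero[OF bopDi])
  have "T (Vk u) = T (Eop u) + T (shift ?x)" unfolding Vk_def by (rule bop_add[OF bopT e xl])
  then show ?thesis unfolding E T_shift[OF xk_M1] by simp
qed

lemma bshift_Vk_M1: "(bshift ^^ Suc n) (Vk u) \<in> M1"
proof (induction n)
  case 0
  show ?case using BM Vk_M by auto
next
  case (Suc n)
  then have "bshift ((bshift ^^ Suc n) (Vk u)) \<in> bshift ` M" using M1M by blast
  then show ?case unfolding BM by simp
qed

lemma Vk_l2: "Vk u \<in> l2" by (rule M_l2[OF Vk_M])

text \<open>Compared with the Taylor coefficients of the central solution, this is what cancels the nonnegative
  Fourier coefficients of $\Phi_k V_k$.\<close>

lemma Vk_recursion:
  "(bshift ^^ Suc n) (Vk u) = - (\<Sum>m\<le>n. (T ^^ (Suc n - m)) (Eop (Vk u m)))"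
proof -
  define b where "b n = (bshift ^^ n) (Vk u)" for n
  have bl: "b n \<in> l2" for n unfolding b_def by (rule l2_pow[OF l2_bshift Vk_l2])
  have bM: "b (Suc n) \<in> M1" for n unfolding b_def by (rule bshift_Vk_M1)
  have b0: "b n 0 = Vk u n" for n by (simp add: b_def bshift_pow)
  have bS: "bshift (b n) = b (Suc n)" for n by (simp add: b_def)
  have step: "b (Suc n) = T (b n) - T (Eop (Vk u n))" for n
  proof -
    have "b n = Eop (Vk u n) + shift (b (Suc n))"
      using Eop_shift_bshift[of "b n"] unfolding b0 bS .
    then have "T (b n) = T (Eop (Vk u n) + shift (b (Suc n)))" by (rule arg_cong)
    also have "\<dots> = T (Eop (Vk u n)) + b (Suc n)"
      unfolding bop_add[OF bopT l2_Eop l2_shift[OF bl]] T_shift[OF bM] ..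
    finally show ?thesis by simp
  qed
  have "b (Suc n) = - (\<Sum>m\<le>n. (T ^^ (Suc n - m)) (Eop (Vk u m)))"
  proof (induction n)
    case 0
    have "b 0 = Vk u" by (simp add: b_def)
    then have "b (Suc 0) = - T (Eop (Vk u 0))" using step[of 0] T_Vk by simp
    then show ?case by simp
  next
    case (Suc n)
    have l: "(T ^^ k) (Eop (Vk u m)) \<in> l2" for k m by (rule l2_pow[OF bop_l2[OF bopT] l2_Eop])
    have ls: "(\<Sum>m\<le>n. (T ^^ (Suc n - m)) (Eop (Vk u m))) \<in> l2" by (intro l2_sum l)
    have "T (b (Suc n)) = - T (\<Sum>m\<le>n. (T ^^ (Suc n - m)) (Eop (Vk u m)))"
      unfolding Suc using bop_diff[OF bopT l2_zero ls] by (simp add: bop_zero[OF bopT])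
    also have "T (\<Sum>m\<le>n. (T ^^ (Suc n - m)) (Eop (Vk u m))) = (\<Sum>m\<le>n. (T ^^ (Suc (Suc n) - m)) (Eop (Vk u m)))"
      unfolding bop_sum[OF bopT l]
    proof (rule sum.cong[OF refl])
      fix m assume "m \<in> {..n}"
      then have "Suc (Suc n) - m = Suc (Suc n - m)" by auto
      then show "T ((T ^^ (Suc n - m)) (Eop (Vk u m))) = (T ^^ (Suc (Suc n) - m)) (Eop (Vk u m))"
        by (simp only: funpow.simps comp_apply)
    qed
    finally show ?case unfolding step[of "Suc n"] by simp
  qed
  then show ?thesis by (simp only: b_def)
qed

end

section \<open>The central solution and its rate of approximation\<close>

definition anal :: "'n::finite seq \<Rightarrow> 'n \<Rightarrow> real \<Rightarrow> complex" where
  "anal f i t = (\<Sum>m. f m $ i * ee (int m) t)"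

lemma fc_bound: assumes "integrable circ f" shows "cmod (fc f n) \<le> (1 / (2*pi)) * integral\<^sup>L circ (\<lambda>t. cmod (f t))"
proof -
  have "cmod (integral\<^sup>L circ (\<lambda>t. f t * ee (- n) t)) \<le> integral\<^sup>L circ (\<lambda>t. cmod (f t * ee (- n) t))"
    by (rule integral_norm_bound)
  then have le: "cmod (integral\<^sup>L circ (\<lambda>t. f t * ee (- n) t)) \<le> integral\<^sup>L circ (\<lambda>t. cmod (f t))"
    by (simp add: norm_mult)
  have "cmod (fc f n) = (1 / (2*pi)) * cmod (integral\<^sup>L circ (\<lambda>t. f t * ee (- n) t))"
    unfolding fc_ee norm_mult norm_of_real by simp
  also have "\<dots> \<le> (1 / (2*pi)) * integral\<^sup>L circ (\<lambda>t. cmod (f t))" by (rule mult_left_mono[OF le]) simp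
  finally show ?thesis .
qed

lemma product_coefficients:
  fixes \<Phi> :: "real \<Rightarrow> complex^'p::finite^'q::finite"
  assumes \<Phi>: "\<And>i j. integrable circ (\<lambda>t. \<Phi> t $ i $ j)" and w: "summ w"
  shows "integrable circ (\<lambda>t. \<Sum>j\<in>UNIV. \<Phi> t $ i $ j * anal w j t)"
    "summable (\<lambda>m. (fcm \<Phi> (n - int m) *v w m) $ i)"
    "fc (\<lambda>t. \<Sum>j\<in>UNIV. \<Phi> t $ i $ j * anal w j t) n = (\<Sum>m. (fcm \<Phi> (n - int m) *v w m) $ i)"
proof -
  have int: "integrable circ (\<lambda>t. \<Phi> t $ i $ j * anal w j t)" for j
    unfolding anal_def by (rule integrable_series[OF \<Phi> summ_component[OF w]])
  then show "integrable circ (\<lambda>t. \<Sum>j\<in>UNIV. \<Phi> t $ i $ j * anal w j t)" by simp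
  have sm: "summable (\<lambda>m. w m $ j * fc (\<lambda>t. \<Phi> t $ i $ j) (n - int m))" for j
  proof (rule summable_norm_cancel, rule summable_comparison_test')
    let ?B = "(1 / (2*pi)) * integral\<^sup>L circ (\<lambda>t. cmod (\<Phi> t $ i $ j))"
    show "summable (\<lambda>m. cmod (w m $ j) * ?B)" by (intro summable_mult2 summ_component[OF w])
    show "norm (cmod (w m $ j * fc (\<lambda>t. \<Phi> t $ i $ j) (n - int m))) \<le> cmod (w m $ j) * ?B" for m
      using mult_left_mono[OF fc_bound[OF \<Phi>[of i j], of "n - int m"] norm_ge_zero[of "w m $ j"]]
      by (simp add: norm_mult)
  qed
  have e: "(fcm \<Phi> (n - int m) *v w m) $ i = (\<Sum>j\<in>UNIV. w m $ j * fc (\<lambda>t. \<Phi> t $ i $ j) (n - int m))" for m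
    by (simp add: matrix_vector_mult_def fcm_def mult.commute)
  show "summable (\<lambda>m. (fcm \<Phi> (n - int m) *v w m) $ i)" unfolding e by (intro summable_sum sm)
  have "fc (\<lambda>t. \<Sum>j\<in>UNIV. \<Phi> t $ i $ j * anal w j t) n = (\<Sum>j\<in>UNIV. fc (\<lambda>t. \<Phi> t $ i $ j * anal w j t) n)"
    by (rule fc_sum) (rule int)
  also have "\<dots> = (\<Sum>j\<in>UNIV. \<Sum>m. w m $ j * fc (\<lambda>t. \<Phi> t $ i $ j) (n - int m))"
    unfolding anal_def fc_series[OF \<Phi> summ_component[OF w]] ..
  also have "\<dots> = (\<Sum>m. \<Sum>j\<in>UNIV. w m $ j * fc (\<lambda>t. \<Phi> t $ i $ j) (n - int m))"
    by (rule suminf_sum[symmetric]) (rule sm)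
  finally show "fc (\<lambda>t. \<Sum>j\<in>UNIV. \<Phi> t $ i $ j * anal w j t) n = (\<Sum>m. (fcm \<Phi> (n - int m) *v w m) $ i)"
    unfolding e .
qed

lemma L2m_integrable: assumes "L2m \<Phi>" shows "integrable circ (\<lambda>t. \<Phi> t $ i $ j)"
proof (rule Bochner_Integration.integrable_bound)
  have "integrable circ (\<lambda>t. 1 :: real)" by (rule continuous_integrable_circ) simp
  then show "integrable circ (\<lambda>t. 1 + (cmod (\<Phi> t $ i $ j))^2)" using assms by (simp add: L2m_def)
  show "(\<lambda>t. \<Phi> t $ i $ j) \<in> borel_measurable circ" using assms by (simp add: L2m_def)
  have "x \<le> 1 + x^2" for x :: real using zero_le_power2[of "x - 1/2"] by (simp add: power2_eq_square algebra_simps)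
  show "AE t in circ. norm (\<Phi> t $ i $ j) \<le> norm (1 + (cmod (\<Phi> t $ i $ j))^2)"
    by (intro AE_I2) (use \<open>\<And>x. x \<le> 1 + x^2\<close> in \<open>simp add: order_trans[OF _ abs_ge_self]\<close>)
qed

lemma bop_pow: assumes "is_bounded_op (T :: 'n::finite seq \<Rightarrow> 'n seq)" shows "is_bounded_op (T ^^ n)"
proof (induction n)
  case 0 show ?case using bop_id by (simp add: id_def)
next
  case (Suc n) then show ?case using bop_comp[OF assms Suc] by (simp add: comp_def)
qed

context nehari
begin

lemma H_apply_component:
  assumes w: "w \<in> l2" shows "(\<lambda>m. (gmat G (k + m) *v w m) $ i) sums (H w k $ i)"
proof -
  have s: "summable (\<lambda>m. gmat G (k + m) *v w m)" by (rule K.hk_summable(2)[OF w])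
  have "(\<lambda>m. gmat G (k + m) *v w m) sums H w k"
    unfolding H_hk hk_def using summable_sums[OF s] .
  then show ?thesis by (rule bounded_linear.sums[OF bounded_linear_vec_nth])
qed

lemma neg_coefficients:
  fixes \<Phi> :: "real \<Rightarrow> complex^'p^'q"
  assumes neg: "\<And>n. n < 0 \<Longrightarrow> fcm \<Phi> n = fcm G n" and w: "w \<in> l2"
  shows "(\<Sum>m. (fcm \<Phi> (- int k - 1 - int m) *v w m) $ i) = H w k $ i"
proof -
  have "fcm \<Phi> (- int k - 1 - int m) = gmat G (k + m)" for m
  proof -
    have e: "- int (k + m) - 1 = - int k - 1 - int m" by simp
    show ?thesis unfolding gmat_def e by (rule neg) simp
  qed
  then show ?thesis using sums_unique[OF H_apply_component[OF w, of k i]] by simp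
qed

definition cV :: "complex^'p \<Rightarrow> real" where "cV u = c0 / (1 - r) * gam * nrm (V u) / gam^2"
text \<open>Up to the factor $\kappa$, \<open>est1\<close> bounds $V_k u - V u$ in $\ell^2$ and \<open>est2\<close> bounds it in $\ell^1$.\<close>

definition est1 :: "complex^'p \<Rightarrow> real \<Rightarrow> real \<Rightarrow> real" where
  "est1 u \<epsilon> c1 = (c1 * nrm (bshift (V u)) + gam^2 * cV u) / \<epsilon> + cV u"
definition est2 :: "complex^'p \<Rightarrow> real \<Rightarrow> real \<Rightarrow> real" where
  "est2 u \<epsilon> c1 = (c0 / (1 - r) * gam * ((1 + gam^2 / \<epsilon>) * norm u)
     + c0 / (1 - r) / (1 - r) * gam * est1 u \<epsilon> c1 + c1 * (\<Sum>n. norm (bshift (V u) n))) / \<epsilon>"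

lemma V_decay: "norm (V u n) \<le> cV u * r ^ n"
  unfolding cV_def by (rule eigY_decay[OF V_eig])

lemma cV_nonneg: "0 \<le> cV u" using order_trans[OF norm_ge_zero V_decay[of u 0]] by simp

lemma V_summ: "summ (V u)" by (rule summ_decay[OF V_decay r])

lemma nrm_HH_le: assumes "f \<in> l2" shows "nrm (H' (H f)) \<le> gam^2 * nrm f"
proof -
  have "nrm (H' (H f)) \<le> gam * nrm (H f)" by (rule H'_gam_le) (use assms in simp)
  also have "\<dots> \<le> gam * (gam * nrm f)" by (rule mult_left_mono[OF gam_le[OF assms] gam_nonneg])
  finally show ?thesis by (simp add: power2_eq_square mult.assoc)
qed

end

lemma l1_bshift_le: assumes "summ f" shows "(\<Sum>n. norm (bshift f n)) \<le> (\<Sum>n. norm (f n))"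
proof -
  have s: "summable (\<lambda>n. norm (f n))" using assms by (simp add: summ_def)
  show ?thesis using suminf_split_head[OF s] by (simp add: bshift_apply)
qed

lemma l1_add_le: assumes "summ f" "summ g" shows "(\<Sum>n. norm ((f + g) n)) \<le> (\<Sum>n. norm (f n)) + (\<Sum>n. norm (g n))"
proof -
  have s: "summable (\<lambda>n. norm (f n))" "summable (\<lambda>n. norm (g n))" "summable (\<lambda>n. norm ((f + g) n))"
    using assms summ_add[OF assms] by (simp_all add: summ_def)
  have "(\<Sum>n. norm ((f + g) n)) \<le> (\<Sum>n. norm (f n) + norm (g n))"
    by (rule suminf_le[OF _ s(3) summable_add[OF s(1,2)]]) (simp add: plus_fun_apply norm_triangle_ineq)
  then show ?thesis by (simp add: suminf_add[OF s(1,2)])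
qed

lemma l1_smult: "summ f \<Longrightarrow> (\<Sum>n. norm (smult c f n)) = cmod c * (\<Sum>n. norm (f n))"
  unfolding summ_def by (simp add: smult_apply norm_scale_vec suminf_mult)

context level
begin

lemma taylor_coefficient:
  "(deriv ^^ n) (\<lambda>z. Phiplus G M z $ i $ j) 0 / fact n = H ((T ^^ Suc n) (Eop (axis j 1))) 0 $ i"
proof -
  let ?a = "\<lambda>n. H ((T ^^ Suc n) (Eop (axis j 1))) 0 $ i"
  obtain R where R: "R > 0" "\<And>z. cmod z < R \<Longrightarrow>
    (\<lambda>n. z ^ n * ?a n) sums (fst (omega G M (resol G M z (axis j 1))) $ i)"
    using resol_series[of "axis j 1" i] by blast
  have "(\<lambda>z. Phiplus G M z $ i $ j) has_fps_expansion Abs_fps ?a"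
  proof (rule has_fps_expansionI)
    have "eventually (\<lambda>z. z \<in> ball 0 R) (nhds (0::complex))"
      using R(1) by (intro eventually_nhds_in_open) auto
    then show "eventually (\<lambda>z. (\<lambda>n. fps_nth (Abs_fps ?a) n * z ^ n) sums (Phiplus G M z $ i $ j)) (nhds 0)"
    proof (rule eventually_mono)
      fix z :: complex assume "z \<in> ball 0 R"
      then have "(\<lambda>n. z ^ n * ?a n) sums (fst (omega G M (resol G M z (axis j 1))) $ i)" by (intro R(2)) simp
      then show "(\<lambda>n. fps_nth (Abs_fps ?a) n * z ^ n) sums (Phiplus G M z $ i $ j)"
        by (simp add: Phiplus_def mult.commute)
    qed
  qed
  from fps_nth_fps_expansion[OF this, of n] show ?thesis by simp
qed

lemma central_nonneg:
  assumes "central_sol G M \<Phi>" shows "fcm \<Phi> (int n) *v u = H ((T ^^ Suc n) (Eop u)) 0"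
proof -
  have b: "is_bounded_op (\<lambda>f. H ((T ^^ Suc n) f))" by (rule bop_comp[OF bopH bop_pow[OF bopT]])
  have e: "Eop u = (\<Sum>j\<in>UNIV. smult (u $ j) (Eop (axis j 1)))"
  proof
    fix k show "Eop u k = (\<Sum>j\<in>UNIV. smult (u $ j) (Eop (axis j 1))) k"
      by (cases k) (simp_all add: seq_apply basis_expansion)
  qed
  have "H ((T ^^ Suc n) (Eop u)) = (\<Sum>j\<in>UNIV. H ((T ^^ Suc n) (smult (u $ j) (Eop (axis j 1)))))"
    unfolding e by (rule bop_sum[OF b]) simp
  also have "\<dots> = (\<Sum>j\<in>UNIV. smult (u $ j) (H ((T ^^ Suc n) (Eop (axis j 1)))))"
    by (rule sum.cong[OF refl]) (rule bop_smult[OF b l2_Eop])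
  finally have h: "H ((T ^^ Suc n) (Eop u)) 0 $ i = (\<Sum>j\<in>UNIV. u $ j * H ((T ^^ Suc n) (Eop (axis j 1))) 0 $ i)" for i
    by (simp only: sum_seq_apply smult_apply sum_component vector_smult_component)
  have "fcm \<Phi> (int n) $ i $ j = H ((T ^^ Suc n) (Eop (axis j 1))) 0 $ i" for i j
  proof -
    have "fcm \<Phi> (int n) $ i $ j = (deriv ^^ n) (\<lambda>z. Phiplus G M z $ i $ j) 0 / fact n"
      using assms by (simp add: central_sol_def fcm_def)
    then show ?thesis unfolding taylor_coefficient .
  qed
  then show ?thesis unfolding vec_eq_iff h by (simp only: matrix_vector_mult_def vec_lambda_beta mult.commute) simp
qed

lemma central_neg:
  assumes "central_sol G M \<Phi>" "n < 0" shows "fcm \<Phi> n = fcm G n"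
  using assms by (simp add: central_sol_def fcm_def)

lemma Vk_summ: "summ (Vk u)" by (rule M_summ[OF Vk_M])

lemma central_product:
  assumes c: "central_sol G M \<Phi>"
  shows "AE t in circ. (\<Sum>j\<in>UNIV. \<Phi> t $ i $ j * anal (Vk u) j t) = coan (H (Vk u)) i t"
proof (rule fc_eq_imp_AE_eq)
  have int: "integrable circ (\<lambda>t. \<Phi> t $ i $ j)" for i j
    by (rule L2m_integrable) (use c in \<open>simp add: central_sol_def\<close>)
  note pc = product_coefficients[OF int Vk_summ[of u], where i = i]
  show "integrable circ (\<lambda>t. \<Sum>j\<in>UNIV. \<Phi> t $ i $ j * anal (Vk u) j t)" by (rule pc(1))
  show "integrable circ (coan (H (Vk u)) i)" by (rule fc_coan(1)[OF H_summ[OF Vk_l2]])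
  fix n
  show "fc (\<lambda>t. \<Sum>j\<in>UNIV. \<Phi> t $ i $ j * anal (Vk u) j t) n = fc (coan (H (Vk u)) i) n"
  proof (cases "n < 0")
    case True
    then have n: "n = - int (nat (- n - 1)) - 1" by simp
    show ?thesis
      unfolding pc(3) by (subst (1 2) n)
        (simp only: neg_coefficients[OF central_neg[OF c] Vk_l2] fc_coan(2)[OF H_summ[OF Vk_l2]])
  next
    case False
    then obtain N where n: "n = int N" by (metis int_nat_eq nonneg_int_cases not_less)
    let ?a = "\<lambda>m. (fcm \<Phi> (n - int m) *v Vk u m) $ i"
    have t: "?a m = H ((T ^^ (Suc N - m)) (Eop (Vk u m))) 0 $ i" if "m \<le> N" for m
    proof -
      have "n - int m = int (N - m)" "Suc N - m = Suc (N - m)" using that n by auto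
      then show ?thesis by (simp only: central_nonneg[OF c])
    qed
    have l: "(T ^^ k) (Eop y) \<in> l2" for k y by (rule l2_pow[OF bop_l2[OF bopT] l2_Eop])
    have Bl: "(bshift ^^ Suc N) (Vk u) \<in> l2" by (rule l2_pow[OF l2_bshift Vk_l2])
    have tail: "(\<Sum>m. ?a (m + Suc N)) = H ((bshift ^^ Suc N) (Vk u)) 0 $ i"
    proof -
      have "?a (m + Suc N) = (gmat G (0 + m) *v (bshift ^^ Suc N) (Vk u) m) $ i" for m
      proof -
        have e: "n - int (m + Suc N) = - int m - 1" using n by simp
        have "fcm \<Phi> (n - int (m + Suc N)) = gmat G m"
          unfolding gmat_def e by (rule central_neg[OF c]) simp
        then show ?thesis by (simp only: bshift_pow add_0)
      qed
      then show ?thesis using sums_unique[OF H_apply_component[OF Bl, of 0 i]] by simp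
    qed
    have "H ((bshift ^^ Suc N) (Vk u)) = - (\<Sum>m\<le>N. H ((T ^^ (Suc N - m)) (Eop (Vk u m))))"
    proof -
      have s: "(\<Sum>m\<le>N. (T ^^ (Suc N - m)) (Eop (Vk u m))) \<in> l2" by (intro l2_sum l)
      have "H ((bshift ^^ Suc N) (Vk u)) = H (0 - (\<Sum>m\<le>N. (T ^^ (Suc N - m)) (Eop (Vk u m))))"
        unfolding Vk_recursion by simp
      then show ?thesis unfolding bop_diff[OF bopH l2_zero s] bop_sum[OF bopH l] bop_zero[OF bopH] by simp
    qed
    then have s1: "H ((bshift ^^ Suc N) (Vk u)) 0 $ i = - (\<Sum>m\<le>N. H ((T ^^ (Suc N - m)) (Eop (Vk u m))) 0 $ i)"
      by (simp only: uminus_apply sum_seq_apply vector_uminus_component sum_component)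
    have s2: "(\<Sum>m<Suc N. ?a m) = (\<Sum>m\<le>N. H ((T ^^ (Suc N - m)) (Eop (Vk u m))) 0 $ i)"
      unfolding lessThan_Suc_atMost by (rule sum.cong[OF refl]) (rule t, simp)
    have "(\<Sum>m. ?a m) = 0"
      unfolding suminf_split_initial_segment[OF pc(2)[where n = n], of "Suc N"] tail s1 s2 by (rule left_minus)
    then show ?thesis unfolding pc(3) using fc_coan(3)[OF H_summ[OF Vk_l2], of n] False by simp
  qed
qed

definition xk :: "complex^'p \<Rightarrow> 'p seq" where "xk u = Di (P1 (bshift (H' (H (Eop u)))))"

lemma xk_in: "xk u \<in> M1" unfolding xk_def by (rule xk_M1)
lemma xk_l2: "xk u \<in> l2" by (rule M1_l2[OF xk_in])
lemma Vk_xk: "Vk u = Eop u + shift (xk u)" by (simp add: Vk_def xk_def)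

lemma V_x: "V u = Eop u + shift (bshift (V u))"
  using Eop_shift_bshift[of "V u"] by (simp add: V_0)

lemma Del_lower: assumes d: "d \<in> M1" and \<epsilon>: "\<theta> + \<epsilon> \<le> gk^2" shows "\<epsilon> * nrm d \<le> nrm (Del d)"
proof (cases "nrm d = 0")
  case False
  have l: "d \<in> l2" by (rule M1_l2[OF d])
  have p: "nrm d > 0" using False nrm_nonneg[OF l] by linarith
  let ?A = "P1 (bshift (H' (H (shift d))))"
  have Dl: "Del d \<in> l2" unfolding Del_def proj_id[OF opM1 d] using l by simp
  have "ip ?A d = ip (bshift (H' (H (shift d)))) (P1 d)" by (rule P1_adj) (use l in simp_all)
  also have "\<dots> = ip (H' (H (shift d))) (shift d)"
    unfolding proj_id[OF opM1 d] by (rule ip_bshift_left) (use l in simp_all)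
  finally have A: "ip ?A d = of_real ((nrm (H (shift d)))^2)" using ip_HH[of "shift d"] l by simp
  have "ip (Del d) d = of_real (gk^2 * (nrm d)^2 - (nrm (H (shift d)))^2)"
    unfolding Del_def proj_id[OF opM1 d]
    using ip_diff_left[of "smult (of_real (gk^2)) d" ?A d] ip_smult_left[OF l l] ip_self[OF l] A l by simp
  then have "gk^2 * (nrm d)^2 - (nrm (H (shift d)))^2 \<le> cmod (ip (Del d) d)"
    by (simp only: norm_of_real abs_ge_self)
  also have "\<dots> \<le> nrm (Del d) * nrm d" by (rule cmod_ip_le[OF Dl l])
  finally have 1: "gk^2 * (nrm d)^2 - (nrm (H (shift d)))^2 \<le> nrm (Del d) * nrm d" .
  have "(\<theta> + \<epsilon>) * (nrm d)^2 \<le> gk^2 * (nrm d)^2" by (rule mult_right_mono[OF \<epsilon>]) simp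
  then have "\<epsilon> * (nrm d)^2 \<le> nrm (Del d) * nrm d" using 1 th(2)[OF l] by (simp add: distrib_right)
  then have "(\<epsilon> * nrm d) * nrm d \<le> nrm (Del d) * nrm d" by (simp add: power2_eq_square mult.assoc)
  then show ?thesis using p by (rule mult_right_le_imp_le)
next
  case True
  have l: "d \<in> l2" by (rule M1_l2[OF d])
  have "Del d \<in> l2" unfolding Del_def using l by simp
  then show ?thesis using True by simp
qed

lemma xk_bound:
  assumes \<epsilon>: "\<theta> + \<epsilon> \<le> gk^2" "0 < \<epsilon>" shows "nrm (xk u) \<le> gam^2 / \<epsilon> * norm u"
proof -
  have "\<epsilon> * nrm (xk u) \<le> nrm (Del (xk u))" by (rule Del_lower[OF xk_in \<epsilon>(1)])
  also have "Del (xk u) = P1 (bshift (H' (H (Eop u))))" unfolding xk_def by (rule Del_Di) simp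
  also have "nrm \<dots> \<le> nrm (bshift (H' (H (Eop u))))" by (rule nrm_proj_le[OF opM1]) simp
  also have "\<dots> \<le> nrm (H' (H (Eop u)))" by (rule nrm_bshift_le) simp
  also have "\<dots> \<le> gam^2 * norm u" using nrm_HH_le[OF l2_Eop[of u]] by simp
  finally show ?thesis using \<epsilon>(2) by (simp add: field_simps)
qed

lemma xk_eq: "smult (of_real (gk^2)) (xk u) = P1 (bshift (H' (H (Vk u))))"
proof -
  have s: "shift (xk u) \<in> l2" using xk_l2 by simp
  have 1: "H' (H (Vk u)) = H' (H (Eop u)) + H' (H (shift (xk u)))"
    unfolding Vk_xk by (rule bop_add[OF bop_comp[OF bopH' bopH] l2_Eop s])
  have 2: "bshift (H' (H (Eop u))) \<in> l2" "bshift (H' (H (shift (xk u)))) \<in> l2" using s by simp_all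
  have "Del (xk u) = P1 (bshift (H' (H (Eop u))))" unfolding xk_def by (rule Del_Di) simp
  then show ?thesis
    unfolding 1 bshift_add bop_add[OF bopP1 2] Del_def proj_id[OF opM1 xk_in] by (simp add: diff_eq_eq)
qed

lemma estimate:
  assumes \<epsilon>: "\<theta> + \<epsilon> \<le> gk^2" "0 < \<epsilon>"
    and \<kappa>: "\<And>y c. y \<in> l2 \<Longrightarrow> (\<And>n. norm (y n) \<le> c * r ^ n) \<Longrightarrow>
        summ (y - P1 y) \<and> (\<Sum>n. norm ((y - P1 y) n)) \<le> \<kappa> * c"
    and gd: "gk \<le> gam" "gam^2 - gk^2 \<le> \<kappa> * c1" and \<kappa>0: "0 \<le> \<kappa>"
  shows "summ (Vk u - V u) \<and> (\<Sum>n. norm ((Vk u - V u) n)) \<le> \<kappa> * est2 u \<epsilon> c1"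
proof -
  define x where "x = bshift (V u)"
  have xl: "x \<in> l2" unfolding x_def using V_l2 by simp
  have xs: "summ x" unfolding x_def by (rule summ_bshift[OF V_summ])
  have xd: "norm (x n) \<le> cV u * r ^ n" for n
  proof -
    have "norm (x n) \<le> cV u * r ^ Suc n" unfolding x_def bshift_apply by (rule V_decay)
    also have "\<dots> \<le> cV u * r ^ n" using cV_nonneg r by (intro mult_left_mono power_decreasing) auto
    finally show ?thesis .
  qed
  have Vx: "V u = Eop u + shift x" unfolding x_def by (rule V_x)
  have sxl: "shift x \<in> l2" using xl by simp
  let ?K = "\<lambda>f. bshift (H' (H f))"
  have bK: "is_bounded_op ?K" by (intro bop_comp[OF bop_bshift] bop_comp[OF bopH'] bopH)
  have Kl: "?K f \<in> l2" if "f \<in> l2" for f using that by simp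
  have Kn: "nrm (?K f) \<le> gam^2 * nrm f" if "f \<in> l2" for f
    using order_trans[OF nrm_bshift_le[OF HH_l2[OF that]] nrm_HH_le[OF that]] .
  have fe: "smult (of_real (gam^2)) x = ?K (V u)"
    using V_eig[of u] unfolding eigY_def x_def by (simp add: bshift_smult)
  have KV: "?K (V u) = ?K (Eop u) + ?K (shift x)"
    using bop_add[OF bK l2_Eop sxl, of u] unfolding Vx[symmetric] .
  define e where "e = x - P1 x"
  have el: "e \<in> l2" unfolding e_def using xl by simp
  have es: "summ e" "(\<Sum>n. norm (e n)) \<le> \<kappa> * cV u" unfolding e_def using \<kappa>[OF xl xd] by blast+
  have en: "nrm e \<le> \<kappa> * cV u" by (rule order_trans[OF nrm_le_l1[OF es(1)] es(2)])
  have gg: "0 \<le> gam^2 - gk^2" using power_mono[OF gd(1) gk_nonneg, of 2] by simp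
  define d where "d = xk u - P1 x"
  have dM: "d \<in> M1" unfolding d_def
    by (rule sv.subspace_diff[OF oproj_subspace[OF opM1] xk_in proj_in[OF opM1 xl]])
  have dl: "d \<in> l2" by (rule M1_l2[OF dM])
  have P1x: "P1 (P1 x) = P1 x" by (rule proj_id[OF opM1 proj_in[OF opM1 xl]])
  have Deld: "Del d = smult (of_real (gam^2 - gk^2)) (P1 x) - P1 (?K (shift e))"
  proof -
    have lin: "Del (f - g) = Del f - Del g" if "f \<in> l2" "g \<in> l2" for f g
      unfolding Del_def
      by (rule bop_diff[OF bop_lincomb[OF bop_id bop_comp[OF bopP1 bop_comp[OF bK bop_comp[OF bop_shift bopP1]]]] that])
    have 1: "Del (xk u) = P1 (?K (Eop u))" unfolding xk_def by (rule Del_Di) simp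
    have 2: "Del (P1 x) = smult (of_real (gk^2)) (P1 x) - P1 (?K (shift (P1 x)))"
      unfolding Del_def P1x ..
    have s2: "shift (P1 x) \<in> l2" using xl by simp
    have 3: "?K (shift e) = ?K (shift x) - ?K (shift (P1 x))"
      unfolding e_def shift_diff by (rule bop_diff[OF bK sxl s2])
    have 4: "P1 (?K (shift e)) = P1 (?K (shift x)) - P1 (?K (shift (P1 x)))"
      unfolding 3 by (rule bop_diff[OF bopP1 Kl[OF sxl] Kl[OF s2]])
    have "P1 (?K (V u)) = P1 (?K (Eop u)) + P1 (?K (shift x))"
      unfolding KV by (rule bop_add[OF bopP1 Kl[OF l2_Eop] Kl[OF sxl]])
    moreover have "P1 (?K (V u)) = smult (of_real (gam^2)) (P1 x)"
      unfolding fe[symmetric] by (rule bop_smult[OF bopP1 xl])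
    ultimately have 5: "P1 (?K (Eop u)) = smult (of_real (gam^2)) (P1 x) - P1 (?K (shift x))"
      by (simp add: eq_diff_eq)
    show ?thesis unfolding d_def lin[OF xk_l2 P1_l2[OF xl]] 1 2 4 5
      by (simp add: sv.scale_left_diff_distrib algebra_simps)
  qed
  have "nrm (Del d) \<le> nrm (smult (of_real (gam^2 - gk^2)) (P1 x)) + nrm (P1 (?K (shift e)))"
    unfolding Deld by (rule nrm_triangle_diff) (use xl el in simp_all)
  also have "nrm (smult (of_real (gam^2 - gk^2)) (P1 x)) \<le> \<kappa> * c1 * nrm x"
  proof -
    have "nrm (smult (of_real (gam^2 - gk^2)) (P1 x)) = (gam^2 - gk^2) * nrm (P1 x)"
      unfolding nrm_smult[OF P1_l2[OF xl]] norm_of_real using gg by simp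
    also have "\<dots> \<le> (\<kappa> * c1) * nrm x"
      by (rule mult_mono[OF gd(2) nrm_proj_le[OF opM1 xl]]) (use gg gd(2) xl in simp_all)
    finally show ?thesis .
  qed
  also have "nrm (P1 (?K (shift e))) \<le> gam^2 * (\<kappa> * cV u)"
  proof -
    have "nrm (P1 (?K (shift e))) \<le> nrm (?K (shift e))" by (rule nrm_proj_le[OF opM1]) (use el in simp)
    also have "\<dots> \<le> gam^2 * nrm (shift e)" by (rule Kn) (use el in simp)
    also have "\<dots> \<le> gam^2 * (\<kappa> * cV u)" unfolding nrm_shift[OF el] by (rule mult_left_mono[OF en]) simp
    finally show ?thesis .
  qed
  finally have "\<epsilon> * nrm d \<le> \<kappa> * (c1 * nrm x + gam^2 * cV u)"
    using Del_lower[OF dM \<epsilon>(1)] by (simp add: algebra_simps)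
  then have nd: "nrm d \<le> \<kappa> * (c1 * nrm x + gam^2 * cV u) / \<epsilon>"
    using \<epsilon>(2) by (simp add: pos_le_divide_eq mult.commute)
  define D where "D = xk u - x"
  have Dl: "D \<in> l2" unfolding D_def using xk_l2 xl by (rule l2_diff)
  have "D = d - e" by (simp add: D_def d_def e_def)
  then have "nrm D \<le> nrm d + nrm e" using nrm_triangle_diff[OF dl el] by simp
  also have "\<dots> \<le> \<kappa> * est1 u \<epsilon> c1"
    using nd en unfolding est1_def x_def by (simp add: algebra_simps)
  finally have nD: "nrm D \<le> \<kappa> * est1 u \<epsilon> c1" .
  define fk where "fk = ?K (Vk u)"
  have fkl: "fk \<in> l2" unfolding fk_def by (rule Kl[OF Vk_l2])
  define ck where "ck = c0 / (1 - r) * gam * ((1 + gam^2 / \<epsilon>) * norm u)"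
  have nVk: "nrm (Vk u) \<le> (1 + gam^2 / \<epsilon>) * norm u"
  proof -
    have "nrm (Vk u) \<le> nrm (Eop u) + nrm (shift (xk u))"
      unfolding Vk_xk by (rule nrm_triangle) (use xk_l2 in simp_all)
    then show ?thesis using xk_bound[OF \<epsilon>, of u] nrm_shift[OF xk_l2] by (simp add: algebra_simps)
  qed
  have c01: "0 \<le> c0 / (1 - r)" using c0_nonneg r by simp
  have fkd: "norm (fk n) \<le> ck * r ^ n" for n
  proof -
    have "norm (fk n) \<le> c0 / (1 - r) * nrm (H (Vk u)) * r ^ Suc n"
      unfolding fk_def bshift_apply by (rule H'_decay) (use Vk_l2 in simp)
    also have "\<dots> \<le> c0 / (1 - r) * (gam * ((1 + gam^2 / \<epsilon>) * norm u)) * r ^ n"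
    proof (intro mult_mono order_refl)
      show "nrm (H (Vk u)) \<le> gam * ((1 + gam\<^sup>2 / \<epsilon>) * norm u)"
        by (rule order_trans[OF gam_le[OF Vk_l2] mult_left_mono[OF nVk gam_nonneg]])
      show "r ^ Suc n \<le> r ^ n" using r by (intro power_decreasing) auto
      show "0 \<le> c0 / (1 - r) * (gam * ((1 + gam\<^sup>2 / \<epsilon>) * norm u))"
        by (intro mult_nonneg_nonneg c01 gam_nonneg add_nonneg_nonneg) (use \<epsilon>(2) in simp_all)
    qed (use c01 r Vk_l2 in simp_all)
    finally show ?thesis by (simp add: ck_def mult.assoc)
  qed
  define g where "g = P1 fk - fk"
  have g: "summ g" "(\<Sum>n. norm (g n)) \<le> \<kappa> * ck"
  proof -
    have h: "summ (fk - P1 fk)" "(\<Sum>n. norm ((fk - P1 fk) n)) \<le> \<kappa> * ck" using \<kappa>[OF fkl fkd] by blast+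
    have "norm (g n) = norm ((fk - P1 fk) n)" for n unfolding g_def by (simp add: minus_apply norm_minus_commute)
    then show "summ g" "(\<Sum>n. norm (g n)) \<le> \<kappa> * ck" using h by (simp_all add: summ_def)
  qed
  define h where "h = ?K (shift D)"
  have hs: "summ h" "(\<Sum>n. norm (h n)) \<le> c0 / (1 - r) / (1 - r) * gam * (\<kappa> * est1 u \<epsilon> c1)"
  proof -
    have sD: "shift D \<in> l2" using Dl by simp
    have s: "summ (H' (H (shift D)))" by (rule H'_summ) (use sD in simp)
    show "summ h" unfolding h_def by (rule summ_bshift[OF s])
    have "(\<Sum>n. norm (h n)) \<le> (\<Sum>n. norm (H' (H (shift D)) n))" unfolding h_def by (rule l1_bshift_le[OF s])
    also have "\<dots> \<le> c0 / (1 - r) / (1 - r) * nrm (H (shift D))" by (rule H'_l1) (use sD in simp)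
    also have "\<dots> \<le> c0 / (1 - r) / (1 - r) * (gam * (\<kappa> * est1 u \<epsilon> c1))"
    proof (rule mult_left_mono)
      have "nrm (H (shift D)) \<le> gam * nrm D" using gam_le[OF sD] nrm_shift[OF Dl] by simp
      also have "\<dots> \<le> gam * (\<kappa> * est1 u \<epsilon> c1)" by (rule mult_left_mono[OF nD gam_nonneg])
      finally show "nrm (H (shift D)) \<le> gam * (\<kappa> * est1 u \<epsilon> c1)" .
      show "0 \<le> c0 / (1 - r) / (1 - r)" by (rule divide_nonneg_nonneg[OF c01]) (use r in simp)
    qed
    finally show "(\<Sum>n. norm (h n)) \<le> c0 / (1 - r) / (1 - r) * gam * (\<kappa> * est1 u \<epsilon> c1)" by (simp add: mult.assoc)
  qed
  have gkp: "\<epsilon> \<le> gk^2" "0 < gk^2" using \<epsilon> th(1) gk_sq_pos by linarith+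
  have eqD: "smult (of_real (gk^2)) D = g + (h + smult (of_real (gam^2 - gk^2)) x)"
  proof -
    have fk: "fk = ?K (V u) + h"
    proof -
      have "Vk u = V u + shift D" unfolding Vk_xk Vx D_def shift_diff by simp
      then show ?thesis unfolding fk_def h_def using bop_add[OF bK V_l2 l2_shift[OF Dl]] by simp
    qed
    have "smult (of_real (gk^2)) D = P1 fk - smult (of_real (gk^2)) x"
      unfolding D_def sv.scale_right_diff_distrib xk_eq fk_def ..
    also have "\<dots> = g + (h + (smult (of_real (gam^2)) x - smult (of_real (gk^2)) x))"
      unfolding fe g_def using fk by simp
    finally show ?thesis unfolding of_real_diff sv.scale_left_diff_distrib .
  qed
  have xs': "summ (smult (of_real (gam^2 - gk^2)) x)" by (rule summ_smult[OF xs])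
  have Ds: "summ D"
  proof -
    have "D = smult (of_real (1 / gk^2)) (smult (of_real (gk^2)) D)" using gkp(2) by simp
    moreover have "summ (smult (of_real (gk^2)) D)" unfolding eqD by (intro summ_add g hs xs')
    ultimately show ?thesis using summ_smult by metis
  qed
  have "gk^2 * (\<Sum>n. norm (D n)) = (\<Sum>n. norm (smult (of_real (gk^2)) D n))"
    unfolding l1_smult[OF Ds] by (simp add: norm_power)
  also have "\<dots> \<le> (\<Sum>n. norm (g n)) + ((\<Sum>n. norm (h n)) + (\<Sum>n. norm (smult (of_real (gam^2 - gk^2)) x n)))"
    unfolding eqD
    by (rule order_trans[OF l1_add_le[OF g(1) summ_add[OF hs(1) xs']] add_left_mono[OF l1_add_le[OF hs(1) xs']]])
  also have "\<dots> \<le> \<kappa> * ck + (c0 / (1 - r) / (1 - r) * gam * (\<kappa> * est1 u \<epsilon> c1) + (\<kappa> * c1) * (\<Sum>n. norm (x n)))"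
  proof (intro add_mono g(2) hs(2))
    have "0 \<le> (\<Sum>n. norm (x n))" using xs unfolding summ_def by (rule suminf_nonneg) simp
    moreover have "cmod (of_real (gam^2 - gk^2)) = gam^2 - gk^2" unfolding norm_of_real using gg by simp
    ultimately show "(\<Sum>n. norm (smult (of_real (gam^2 - gk^2)) x n)) \<le> (\<kappa> * c1) * (\<Sum>n. norm (x n))"
      unfolding l1_smult[OF xs] using mult_right_mono[OF gd(2)] by simp
  qed
  also have "\<dots> = \<kappa> * (\<epsilon> * est2 u \<epsilon> c1)"
  proof -
    have "\<epsilon> * est2 u \<epsilon> c1 = ck + c0 / (1 - r) / (1 - r) * gam * est1 u \<epsilon> c1 + c1 * (\<Sum>n. norm (x n))"
      unfolding est2_def ck_def x_def using \<epsilon>(2) by simp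
    then show ?thesis by (simp only: distrib_left mult_ac add_ac)
  qed
  finally have 1: "gk^2 * (\<Sum>n. norm (D n)) \<le> \<kappa> * (\<epsilon> * est2 u \<epsilon> c1)" .
  have D0: "0 \<le> (\<Sum>n. norm (D n))" using Ds unfolding summ_def by (rule suminf_nonneg) simp
  have "\<epsilon> * (\<Sum>n. norm (D n)) \<le> \<epsilon> * (\<kappa> * est2 u \<epsilon> c1)"
    using order_trans[OF mult_right_mono[OF gkp(1) D0] 1] by (simp add: mult_ac)
  then have 2: "(\<Sum>n. norm (D n)) \<le> \<kappa> * est2 u \<epsilon> c1" using \<epsilon>(2) by (rule mult_left_le_imp_le)
  have VD: "Vk u - V u = shift D" unfolding Vk_xk Vx D_def shift_diff by simp
  have ss: "summable (\<lambda>n. norm (shift D n))"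
    using Ds summable_Suc_iff[of "\<lambda>n. norm (shift D n)"] by (simp add: summ_def)
  then have "(\<Sum>n. norm (shift D n)) = (\<Sum>n. norm (D n))" using suminf_split_head[OF ss] by simp
  then show ?thesis using ss 2 unfolding VD summ_def by simp
qed

end

section \<open>Boundary values and rationality\<close>

lemma fc_anal: assumes "summ f"
  shows "integrable circ (anal f i)" "fc (anal f i) (int k) = f k $ i" "n < 0 \<Longrightarrow> fc (anal f i) n = 0"
proof -
  have inj: "inj (\<lambda>m. int m)" by (auto simp: inj_def)
  show "integrable circ (anal f i)" "fc (anal f i) (int k) = f k $ i"
    unfolding anal_def[abs_def] by (rule fc_series_alone[OF summ_component[OF assms, of i] inj])+
  assume "n < 0"
  then have "n \<notin> range (\<lambda>m. int m)" by auto
  then show "fc (anal f i) n = 0"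
    unfolding anal_def[abs_def] by (rule fc_series_alone(3)[OF summ_component[OF assms, of i] inj])
qed

lemma continuous_anal: "summ f \<Longrightarrow> continuous_on A (anal f i)"
  unfolding anal_def[abs_def] by (rule continuous_series[OF summ_component])
lemma continuous_coan: "summ f \<Longrightarrow> continuous_on A (coan f i)"
  unfolding coan_def[abs_def] by (rule continuous_series[OF summ_component])

lemma series_bound:
  assumes "summ f" shows "cmod (\<Sum>m. f m $ i * ee (\<sigma> m) t) \<le> (\<Sum>n. norm (f n))"
  by (rule norm_suminf_le)
    (use assms in \<open>auto simp: norm_mult summ_def intro: Finite_Cartesian_Product.norm_nth_le\<close>)

lemma anal_bound: "summ f \<Longrightarrow> cmod (anal f i t) \<le> (\<Sum>n. norm (f n))"
  unfolding anal_def by (rule series_bound)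
lemma coan_bound: "summ f \<Longrightarrow> cmod (coan f i t) \<le> (\<Sum>n. norm (f n))"
  unfolding coan_def by (rule series_bound)

lemma anal_add: "summ f \<Longrightarrow> summ g \<Longrightarrow> anal (f + g) i t = anal f i t + anal g i t"
  unfolding anal_def by (simp add: plus_fun_apply distrib_right suminf_add summable_coan)
lemma anal_smult: "summ f \<Longrightarrow> anal (smult c f) i t = c * anal f i t"
  unfolding anal_def by (simp add: smult_apply mult.assoc suminf_mult summable_coan)
lemma anal_zero: "anal 0 i t = 0" by (simp add: anal_def zero_fun_apply)

lemma summ_sum: "(\<And>a. a \<in> A \<Longrightarrow> summ (f a)) \<Longrightarrow> summ (\<Sum>a\<in>A. f a)"
proof (induction A rule: infinite_finite_induct)
  case (insert x F)
  then show ?case unfolding sum.insert[OF insert.hyps] by (intro summ_add) blast+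
qed (simp_all add: summ_zero)

lemma anal_lincomb: "(\<And>a. a \<in> A \<Longrightarrow> summ (f a)) \<Longrightarrow> anal (\<Sum>a\<in>A. smult (c a) (f a)) i t = (\<Sum>a\<in>A. c a * anal (f a) i t)"
proof (induction A rule: infinite_finite_induct)
  case (insert x F)
  have "summ (smult (c x) (f x))" "summ (\<Sum>a\<in>F. smult (c a) (f a))"
    using insert.prems by (auto intro: summ_sum summ_smult)
  then show ?case using insert by (simp add: anal_add anal_smult)
qed (simp_all add: anal_zero)

lemma anal_diff: assumes "summ f" "summ g" shows "anal (f - g) i t = anal f i t - anal g i t"
  using anal_add[OF assms(1) summ_smult[OF assms(2), of "-1"]] anal_smult[OF assms(2), of "-1"] by simp
lemma coan_diff: assumes "summ f" "summ g" shows "coan (f - g) i t = coan f i t - coan g i t"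
  using coan_add[OF assms(1) summ_smult[OF assms(2), of "-1"]] coan_smult[OF assms(2), of "-1"] by simp

lemma norm_le_sum_components: "norm (x :: complex^'n) \<le> (\<Sum>i\<in>UNIV. cmod (x $ i))"
  unfolding norm_vec_def by (rule L2_set_le_sum) simp

lemma matrix_column_bound:
  fixes A :: "complex^'p::finite^'q::finite"
  assumes "\<And>i j. cmod (A $ i $ j) \<le> a j"
  shows "norm (A *v u) \<le> (real CARD('q) * (\<Sum>j\<in>UNIV. a j)) * norm u"
proof -
  have "cmod ((A *v u) $ i) \<le> (\<Sum>j\<in>UNIV. a j) * norm u" for i
  proof -
    have "cmod ((A *v u) $ i) \<le> (\<Sum>j\<in>UNIV. cmod (A $ i $ j) * cmod (u $ j))"
      unfolding matrix_vector_mult_def by (simp, rule order_trans[OF norm_sum]) (simp add: norm_mult)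
    also have "\<dots> \<le> (\<Sum>j\<in>UNIV. a j * norm u)"
      by (intro sum_mono mult_mono assms Finite_Cartesian_Product.norm_nth_le)
        (use order_trans[OF norm_ge_zero assms] in auto)
    finally show ?thesis by (simp add: sum_distrib_right)
  qed
  then have "(\<Sum>i\<in>UNIV. cmod ((A *v u) $ i)) \<le> (\<Sum>i\<in>(UNIV::'q set). (\<Sum>j\<in>UNIV. a j) * norm u)"
    by (rule sum_mono)
  then show ?thesis using norm_le_sum_components[of "A *v u"] by simp
qed

definition ratc :: "(real \<Rightarrow> complex) \<Rightarrow> bool" where
  "ratc f \<longleftrightarrow> (\<exists>N d. d \<noteq> 0 \<and> (AE t in circ. f t = poly N (cis t) / poly d (cis t)))"

lemma AE_poly_nonzero: assumes "d \<noteq> 0" shows "AE t in circ. poly d (cis t) \<noteq> 0"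
proof -
  let ?S = "{t \<in> {0..<2*pi}. poly d (cis t) = 0}"
  have "inj_on cis ?S"
  proof (rule inj_onI)
    fix s t assume st: "s \<in> ?S" "t \<in> ?S" "cis s = cis t"
    then have "sin s = sin t \<and> cos s = cos t" by (simp add: complex_eq_iff)
    then obtain n where n: "s = t + 2 * pi * of_int n" using sin_cos_eq_iff[of s t] by (auto simp: mult.commute mult.left_commute)
    have "\<bar>2 * pi * of_int n\<bar> < 2 * pi" using n st by auto
    then have "\<bar>of_int n :: real\<bar> < 1" by (simp add: abs_mult)
    then have "n = 0" by linarith
    then show "s = t" using n by simp
  qed
  moreover have "cis ` ?S \<subseteq> {z. poly d z = 0}" by auto
  then have "finite (cis ` ?S)" using poly_roots_finite[OF assms] finite_subset by blast
  ultimately have "finite ?S" using finite_imageD by blast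
  then have "finite (insert (2*pi) ?S)" by simp
  then have "insert (2*pi) ?S \<in> null_sets lebesgue" using negligible_finite negligible_iff_null_sets by blast
  then have "AE t in lebesgue. t \<notin> insert (2*pi) ?S" by (rule AE_not_in)
  then have "AE t in circ. t \<in> {0..2*pi} \<longrightarrow> t \<notin> insert (2*pi) ?S"
    unfolding circ_def by (subst AE_restrict_space_iff) (auto elim: eventually_mono)
  moreover have "AE t in circ. t \<in> {0..2*pi}" by (rule AE_I2) simp
  ultimately show ?thesis by eventually_elim auto
qed

lemma ratc_poly: "ratc (\<lambda>t. poly p (cis t))"
  unfolding ratc_def by (intro exI[of _ p] exI[of _ 1]) simp

lemma ratc_const: "ratc (\<lambda>t. c)" using ratc_poly[of "[:c:]"] by simp

lemma ratc_binary:
  assumes "ratc f" "ratc g"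
    and op: "\<And>N1 d1 N2 d2. d1 \<noteq> 0 \<Longrightarrow> d2 \<noteq> 0 \<Longrightarrow> \<exists>N d. d \<noteq> 0 \<and> (\<forall>z. poly d1 z \<noteq> 0 \<longrightarrow> poly d2 z \<noteq> 0 \<longrightarrow>
      h (poly N1 z / poly d1 z) (poly N2 z / poly d2 z) = poly N z / poly d z)"
  shows "ratc (\<lambda>t. h (f t) (g t))"
proof -
  obtain N1 d1 where 1: "d1 \<noteq> 0" "AE t in circ. f t = poly N1 (cis t) / poly d1 (cis t)"
    using assms(1) unfolding ratc_def by blast
  obtain N2 d2 where 2: "d2 \<noteq> 0" "AE t in circ. g t = poly N2 (cis t) / poly d2 (cis t)"
    using assms(2) unfolding ratc_def by blast
  obtain N d where d: "d \<noteq> 0" "\<forall>z. poly d1 z \<noteq> 0 \<longrightarrow> poly d2 z \<noteq> 0 \<longrightarrow>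
      h (poly N1 z / poly d1 z) (poly N2 z / poly d2 z) = poly N z / poly d z"
    using op[OF 1(1) 2(1)] by blast
  have "AE t in circ. h (f t) (g t) = poly N (cis t) / poly d (cis t)"
    using 1(2) 2(2) AE_poly_nonzero[OF 1(1)] AE_poly_nonzero[OF 2(1)]
  proof eventually_elim
    case (elim t)
    then show ?case using d(2) by simp
  qed
  then show ?thesis unfolding ratc_def using d(1) by blast
qed

lemma ratc_add: "ratc f \<Longrightarrow> ratc g \<Longrightarrow> ratc (\<lambda>t. f t + g t)"
proof (erule (1) ratc_binary)
  fix N1 d1 N2 d2 :: "complex poly" assume "d1 \<noteq> 0" "d2 \<noteq> 0"
  then show "\<exists>N d. d \<noteq> 0 \<and> (\<forall>z. poly d1 z \<noteq> 0 \<longrightarrow> poly d2 z \<noteq> 0 \<longrightarrow>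
      poly N1 z / poly d1 z + poly N2 z / poly d2 z = poly N z / poly d z)"
    by (intro exI[of _ "N1 * d2 + N2 * d1"] exI[of _ "d1 * d2"]) (simp add: add_frac_eq mult.commute)
qed

lemma ratc_mult: "ratc f \<Longrightarrow> ratc g \<Longrightarrow> ratc (\<lambda>t. f t * g t)"
proof (erule (1) ratc_binary)
  fix N1 d1 N2 d2 :: "complex poly" assume "d1 \<noteq> 0" "d2 \<noteq> 0"
  then show "\<exists>N d. d \<noteq> 0 \<and> (\<forall>z. poly d1 z \<noteq> 0 \<longrightarrow> poly d2 z \<noteq> 0 \<longrightarrow>
      poly N1 z / poly d1 z * (poly N2 z / poly d2 z) = poly N z / poly d z)"
    by (intro exI[of _ "N1 * N2"] exI[of _ "d1 * d2"]) simp
qed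

lemma ratc_divide: "ratc f \<Longrightarrow> ratc g \<Longrightarrow> ratc (\<lambda>t. f t / g t)"
proof (erule (1) ratc_binary)
  fix N1 d1 N2 d2 :: "complex poly" assume d: "d1 \<noteq> 0" "d2 \<noteq> 0"
  show "\<exists>N d. d \<noteq> 0 \<and> (\<forall>z. poly d1 z \<noteq> 0 \<longrightarrow> poly d2 z \<noteq> 0 \<longrightarrow>
      poly N1 z / poly d1 z / (poly N2 z / poly d2 z) = poly N z / poly d z)"
  proof (cases "N2 = 0")
    case True
    then show ?thesis by (intro exI[of _ 0] exI[of _ 1]) simp
  next
    case False
    then show ?thesis using d by (intro exI[of _ "N1 * d2"] exI[of _ "d1 * N2"]) simp
  qed
qed

lemma ratc_sum: "(\<And>a. a \<in> A \<Longrightarrow> ratc (f a)) \<Longrightarrow> ratc (\<lambda>t. \<Sum>a\<in>A. f a t)"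
  by (induction A rule: infinite_finite_induct) (simp_all add: ratc_const ratc_add)

lemma ratc_prod: "(\<And>a. a \<in> A \<Longrightarrow> ratc (f a)) \<Longrightarrow> ratc (\<lambda>t. \<Prod>a\<in>A. f a t)"
  by (induction A rule: infinite_finite_induct) (simp_all add: ratc_const ratc_mult)

lemma ratc_AE: "ratc f \<Longrightarrow> AE t in circ. g t = f t \<Longrightarrow> ratc g"
proof -
  assume "ratc f" and e: "AE t in circ. g t = f t"
  then obtain N d where N: "d \<noteq> 0" "AE t in circ. f t = poly N (cis t) / poly d (cis t)"
    unfolding ratc_def by blast
  have "AE t in circ. g t = poly N (cis t) / poly d (cis t)" using e N(2) by eventually_elim simp
  then show "ratc g" unfolding ratc_def using N(1) by blast
qed

lemma ratc_poly_inverse: "ratc (\<lambda>t. poly p (inverse (cis t)))"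
proof (induction p)
  case 0 show ?case using ratc_const[of 0] by simp
next
  case (pCons a p)
  have "ratc (\<lambda>t. 1 / poly [:0, 1:] (cis t))" by (rule ratc_divide[OF ratc_const ratc_poly])
  then have i: "ratc (\<lambda>t. inverse (cis t))" by (simp add: inverse_eq_divide)
  show ?case using ratc_add[OF ratc_const[of a] ratc_mult[OF i pCons.IH]] by simp
qed

lemma AE_poly_inverse_nonzero: assumes "d \<noteq> 0" shows "AE t in circ. poly d (inverse (cis t)) \<noteq> 0"
proof -
  have "reflect_poly d \<noteq> 0" using assms by simp
  from AE_poly_nonzero[OF this] show ?thesis
  proof eventually_elim
    case (elim t)
    have "poly (reflect_poly d) (cis t) = cis t ^ degree d * poly d (inverse (cis t))"
      by (rule poly_reflect_poly_nz) simp
    then show ?case using elim by simp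
  qed
qed

lemma ratc_coan: assumes "summ f" "p \<noteq> 0" "papp bshift p f = 0" shows "ratc (coan f i)"
proof -
  obtain N where N: "\<forall>t. poly p (cis t) * coan f i t = poly N (cis t)" using coan_rational[OF assms(1,3)] by blast
  have "AE t in circ. coan f i t = poly N (cis t) / poly p (cis t)"
    using AE_poly_nonzero[OF assms(2)]
  proof eventually_elim
    case (elim t) then show ?case using N[rule_format, of t] by (simp add: eq_divide_eq mult.commute)
  qed
  then show ?thesis by (rule ratc_AE[OF ratc_divide[OF ratc_poly ratc_poly]])
qed

lemma anal_coan: assumes "summ f" shows "anal f i t = ee (-1) t * coan f i (- t)"
proof -
  have tm: "ee (-1) t * (f k $ i * ee (- int k - 1) (- t)) = f k $ i * ee (int k) t" for k
  proof -
    have "ee (- int k - 1) (- t) = ee (int k + 1) t" by (simp add: ee_def algebra_simps)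
    moreover have "ee (-1) t * ee (int k + 1) t = ee (int k) t" by (simp add: ee_add)
    ultimately show ?thesis by (simp add: mult.left_commute[of "ee (-1) t"])
  qed
  have "ee (-1) t * coan f i (- t) = (\<Sum>k. ee (-1) t * (f k $ i * ee (- int k - 1) (- t)))"
    unfolding coan_def by (rule suminf_mult[symmetric, OF summable_coan[OF assms]])
  then show ?thesis unfolding tm by (simp add: anal_def)
qed

lemma ratc_anal: assumes "summ f" "p \<noteq> 0" "papp bshift p f = 0" shows "ratc (anal f i)"
proof -
  obtain N where N: "\<forall>t. poly p (cis t) * coan f i t = poly N (cis t)" using coan_rational[OF assms(1,3)] by blast
  have ci: "cis (- t) = inverse (cis t)" for t by simp
  have "AE t in circ. anal f i t = ee (-1) t * (poly N (inverse (cis t)) / poly p (inverse (cis t)))"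
    using AE_poly_inverse_nonzero[OF assms(2)]
  proof eventually_elim
    case (elim t)
    then have "coan f i (- t) = poly N (inverse (cis t)) / poly p (inverse (cis t))"
      using N[rule_format, of "- t"] unfolding ci[symmetric] by (simp add: nonzero_eq_divide_eq mult.commute)
    then show ?case unfolding anal_coan[OF assms(1)] by (rule arg_cong)
  qed
  moreover have "ratc (ee (-1))"
  proof -
    have "ee (-1) = (\<lambda>t. poly [:0, 1:] (inverse (cis t)))" using ee_neg[of 1] by (auto simp: fun_eq_iff)
    then show ?thesis using ratc_poly_inverse[of "[:0, 1:]"] by simp
  qed
  ultimately show ?thesis
    by (rule ratc_AE[OF ratc_mult[OF _ ratc_divide[OF ratc_poly_inverse ratc_poly_inverse]], rotated])
qed

lemma ratc_det:
  assumes "\<And>i j. ratc (\<lambda>t. A t $ i $ j)" shows "ratc (\<lambda>t. det (A t :: complex^'n::finite^'n))"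
  unfolding det_def by (intro ratc_sum ratc_mult ratc_const ratc_prod assms)

lemma rational_on_circleI:
  fixes \<Phi> :: "real \<Rightarrow> complex^'p::finite^'q::finite"
  assumes "\<And>i j. ratc (\<lambda>t. \<Phi> t $ i $ j)" shows "rational_on_circle \<Phi>"
proof -
  define Nd where "Nd = (\<lambda>i j. SOME Nd. snd Nd \<noteq> 0 \<and>
    (AE t in circ. \<Phi> t $ i $ j = poly (fst Nd) (cis t) / poly (snd Nd) (cis t)))"
  have "snd (Nd i j) \<noteq> 0 \<and> (AE t in circ. \<Phi> t $ i $ j = poly (fst (Nd i j)) (cis t) / poly (snd (Nd i j)) (cis t))" for i j
  proof -
    obtain N d where "d \<noteq> 0" "AE t in circ. \<Phi> t $ i $ j = poly N (cis t) / poly d (cis t)"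
      using assms[of i j] unfolding ratc_def by blast
    then have "\<exists>Nd. snd Nd \<noteq> 0 \<and> (AE t in circ. \<Phi> t $ i $ j = poly (fst Nd) (cis t) / poly (snd Nd) (cis t))"
      by (intro exI[of _ "(N, d)"]) simp
    then show ?thesis unfolding Nd_def by (rule someI_ex)
  qed
  then have Nd: "\<And>i j. snd (Nd i j) \<noteq> 0"
    "\<And>i j. AE t in circ. \<Phi> t $ i $ j = poly (fst (Nd i j)) (cis t) / poly (snd (Nd i j)) (cis t)" by simp_all
  define I where "I = (UNIV :: ('q \<times> 'p) set)"
  define d where "d = (\<Prod>(i, j)\<in>I. snd (Nd i j))"
  have fin: "finite I" by (simp add: I_def)
  define W where "W = (\<lambda>i j. \<Prod>(a, b)\<in>I - {(i, j)}. snd (Nd a b))"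
  define N :: "complex poly^'p^'q" where
    "N = (\<chi> i j. fst (Nd i j) * W i j)"
  have d0: "d \<noteq> 0" unfolding d_def prod_zero_iff[OF fin] using Nd(1) by (simp add: case_prod_beta)
  have dd: "d = snd (Nd i j) * W i j" for i j
    unfolding d_def W_def using prod.remove[OF fin, of "(i, j)" "\<lambda>(a, b). snd (Nd a b)"] by (simp add: I_def)
  have "AE t in circ. \<forall>i j. \<Phi> t $ i $ j = poly (fst (Nd i j)) (cis t) / poly (snd (Nd i j)) (cis t)"
    by (intro eventually_all_finite Nd(2))
  then have "AE t in circ. \<forall>i j. \<Phi> t $ i $ j = poly (N $ i $ j) (cis t) / poly d (cis t)"
    using AE_poly_nonzero[OF d0]
  proof eventually_elim
    case (elim t)
    show ?case
    proof (intro allI)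
      fix i j
      have e: "poly d (cis t) = poly (snd (Nd i j)) (cis t) * poly (W i j) (cis t)"
        unfolding dd[of i j] by (rule poly_mult)
      then have w: "poly (W i j) (cis t) \<noteq> 0" using elim(2) by auto
      have "\<Phi> t $ i $ j = poly (fst (Nd i j)) (cis t) / poly (snd (Nd i j)) (cis t)" using elim(1) by blast
      also have "\<dots> = poly (fst (Nd i j) * W i j) (cis t) / poly d (cis t)"
        unfolding e poly_mult using w by simp
      finally show "\<Phi> t $ i $ j = poly (N $ i $ j) (cis t) / poly d (cis t)" unfolding N_def vec_lambda_beta .
    qed
  qed
  then show ?thesis unfolding rational_on_circle_def using d0 by blast
qed

lemma matrix_solve_right:
  fixes A :: "complex^'p::finite^'p" and X :: "complex^'p^'q::finite"
  assumes "det A \<noteq> 0" "X ** A = B"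
  shows "X $ i $ k = det (\<chi> a b. if b = k then B $ i $ a else A $ b $ a) / det A"
proof -
  have e: "transpose A *v (X $ i) = B $ i"
    unfolding assms(2)[symmetric] vec_eq_iff matrix_vector_mult_def matrix_matrix_mult_def Finite_Cartesian_Product.transpose_def
    by (simp add: mult.commute)
  have d: "det (transpose A) \<noteq> 0" unfolding det_transpose by (rule assms(1))
  have "X $ i = (\<chi> k. det (\<chi> a b. if b = k then B $ i $ a else transpose A $ a $ b) / det (transpose A))"
    using cramer[OF d, of "X $ i" "B $ i"] e by blast
  from arg_cong[OF this, of "\<lambda>v. v $ k"]
  show ?thesis unfolding det_transpose unfolding vec_lambda_beta Finite_Cartesian_Product.transpose_def .
qed

lemma rational_solve:
  fixes \<Phi> :: "real \<Rightarrow> complex^'p::finite^'q::finite"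
  assumes A: "\<And>i j. ratc (\<lambda>t. A t $ i $ j)" and B: "\<And>i j. ratc (\<lambda>t. B t $ i $ j)"
    and AB: "AE t in circ. det (A t) \<noteq> 0 \<and> \<Phi> t ** A t = B t"
  shows "rational_on_circle \<Phi>"
proof (rule rational_on_circleI)
  fix i k
  have 1: "ratc (\<lambda>t. (\<chi> a b. if b = k then B t $ i $ a else A t $ b $ a) $ a $ b)" for a b
    using A B by (cases "b = k") simp_all
  show "ratc (\<lambda>t. \<Phi> t $ i $ k)"
  proof (rule ratc_AE[OF ratc_divide[OF ratc_det[OF 1] ratc_det[OF A]]])
    show "AE t in circ. \<Phi> t $ i $ k = det (\<chi> a b. if b = k then B t $ i $ a else A t $ b $ a) / det (A t)"
      using AB by eventually_elim (rule matrix_solve_right, auto)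
  qed
qed

context nehari
begin

definition vm :: "(complex^'p \<Rightarrow> 'p seq) \<Rightarrow> real \<Rightarrow> complex^'p^'p" where
  "vm w t = (\<chi> i j. anal (w (axis j 1)) i t)"
definition wm :: "(complex^'p \<Rightarrow> 'p seq) \<Rightarrow> real \<Rightarrow> complex^'p^'q" where
  "wm w t = (\<chi> i j. coan (H (w (axis j 1))) i t)"

lemma vmV: "(vm V t *v u) $ i = anal (V u) i t"
proof -
  have "anal (V u) i t = (\<Sum>j\<in>UNIV. u $ j * anal (V (axis j 1)) i t)"
    by (subst V_lin) (rule anal_lincomb[OF V_summ])
  then show ?thesis by (simp add: vm_def matrix_vector_mult_def mult.commute)
qed

lemma V_circle_injective: assumes "vm V t *v u = 0" shows "u = 0"
proof -
  have sm: "summable (\<lambda>n. cis t ^ n *s V u n)"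
  proof (rule summable_norm_cancel)
    show "summable (\<lambda>n. norm (cis t ^ n *s V u n))"
      using V_summ[of u] by (simp add: norm_scale_vec norm_power summ_def)
  qed
  have "(\<Sum>n. cis t ^ n *s V u n) = 0"
  proof (subst vec_eq_iff, intro allI)
    fix i
    have "(\<Sum>n. cis t ^ n *s V u n) $ i = (\<Sum>n. (cis t ^ n *s V u n) $ i)"
      by (rule bounded_linear.suminf[OF bounded_linear_vec_nth sm])
    also have "\<dots> = anal (V u) i t" unfolding anal_def by (simp add: ee_nat mult.commute)
    also have "\<dots> = 0" using assms vmV[of t u i] by simp
    finally show "(\<Sum>n. cis t ^ n *s V u n) $ i = 0 $ i" by simp
  qed
  then have "V u = 0" by (rule V_no_zeros[OF V_eig, rotated]) simp
  then show ?thesis using V_0[of u] by (simp add: zero_fun_apply)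
qed

lemma lower_bound: "\<exists>c>0. \<forall>t\<in>{0..2*pi}. \<forall>u. c * norm u \<le> norm (vm V t *v u)"
proof -
  let ?f = "\<lambda>x. norm (vm V (fst x) *v snd x)"
  let ?S = "{0..2*pi} \<times> sphere (0 :: complex^'p) 1"
  have ca: "continuous_on ?S (\<lambda>x. anal (V (axis j 1)) i (fst x))" for i j
    by (rule continuous_on_compose2[OF continuous_anal[OF V_summ, of UNIV] continuous_on_fst[OF continuous_on_id]]) simp
  have c: "continuous_on ?S ?f"
    unfolding vm_def matrix_vector_mult_def
    by (intro continuous_on_norm continuous_on_vec_lambda continuous_on_sum) (simp, intro continuous_on_mult ca continuous_intros)
  have cp: "compact ?S" by (intro compact_Times compact_sphere) simp
  have ne: "?S \<noteq> {}"
  proof -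
    have "(0, axis undefined 1) \<in> ?S" by simp
    then show ?thesis by blast
  qed
  obtain x where x: "x \<in> ?S" "\<And>y. y \<in> ?S \<Longrightarrow> ?f x \<le> ?f y" using continuous_attains_inf[OF cp ne c] by blast
  have "?f x > 0"
  proof (rule ccontr)
    assume "\<not> ?f x > 0"
    then have "vm V (fst x) *v snd x = 0" by simp
    then have "snd x = 0" by (rule V_circle_injective)
    then show False using x(1) by (auto simp: mem_Times_iff)
  qed
  moreover have "?f x * norm u \<le> norm (vm V t *v u)" if t: "t \<in> {0..2*pi}" for t u
  proof (cases "u = 0")
    case False
    let ?w = "complex_of_real (1 / norm u) *s u"
    have "norm ?w = 1" using False by (simp add: norm_scale_vec norm_divide)
    then have "?f x \<le> norm (vm V t *v ?w)" using x(2)[of "(t, ?w)"] t by simp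
    also have "vm V t *v ?w = complex_of_real (1 / norm u) *s (vm V t *v u)" by (rule mv_scale)
    finally show ?thesis using False by (simp add: norm_scale_vec norm_divide field_simps)
  qed simp
  ultimately show ?thesis by blast
qed

lemma vmV_det: "det (vm V t) \<noteq> 0"
proof -
  obtain B where "B ** vm V t = mat 1"
    using matrix_left_invertible_ker[of "vm V t"] V_circle_injective by blast
  then have "det B * det (vm V t) = 1" using det_mul[of B "vm V t"] by simp
  then show ?thesis by auto
qed

end

section \<open>The optimal solution\<close>

lemma fc_cnj: "fc (\<lambda>t. cnj (f t)) n = cnj (fc f (- n))"
proof -
  have "cnj (fc f (- n)) = (1 / (2*pi)) * cnj (integral\<^sup>L circ (\<lambda>t. f t * ee n t))"
    unfolding fc_ee by simp
  also have "cnj (integral\<^sup>L circ (\<lambda>t. f t * ee n t)) = integral\<^sup>L circ (\<lambda>t. cnj (f t) * ee (- n) t)"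
    by (subst Bochner_Integration.integral_cnj[symmetric]) (simp add: cnj_ee)
  finally show ?thesis unfolding fc_ee by simp
qed

lemma cnj_anal: "cnj (anal f i t) = (\<Sum>k. cnj (f k $ i) * ee (- int k) t)"
  if "summ f"
proof -
  have "(\<lambda>k. f k $ i * ee (int k) t) sums anal f i t"
    unfolding anal_def by (rule summable_sums[OF summable_coan[OF that]])
  then have "(\<lambda>k. cnj (f k $ i * ee (int k) t)) sums cnj (anal f i t)" by (simp only: sums_cnj)
  then show ?thesis by (simp add: cnj_ee sums_unique)
qed

lemma cnj_coan: "cnj (coan f i t) = (\<Sum>k. cnj (f k $ i) * ee (int k + 1) t)"
  if "summ f"
proof -
  have "(\<lambda>k. f k $ i * ee (- int k - 1) t) sums coan f i t"
    unfolding coan_def by (rule summable_sums[OF summable_coan[OF that]])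
  then have "(\<lambda>k. cnj (f k $ i * ee (- int k - 1) t)) sums cnj (coan f i t)" by (simp only: sums_cnj)
  then show ?thesis by (simp add: cnj_ee sums_iff add.commute)
qed

lemma summ_vip_component: assumes "summ g" "\<And>n. cmod (f n) \<le> C" shows "summable (\<lambda>k. f k * cnj (g k $ i))"
proof (rule summable_comparison_test')
  show "summable (\<lambda>k. C * cmod (g k $ i))" by (rule summable_mult[OF summ_component[OF assms(1)]])
  show "norm (f k * cnj (g k $ i)) \<le> C * cmod (g k $ i)" for k
    using mult_right_mono[OF assms(2)[of k] norm_ge_zero[of "g k $ i"]] by (simp add: norm_mult)
qed

lemma suminf_vip:
  assumes "\<And>i. summable (\<lambda>k. x k $ i * cnj (y k $ i))"
  shows "(\<Sum>i\<in>UNIV. \<Sum>k. x k $ i * cnj (y k $ i)) = (\<Sum>k. vip (x k) (y k))"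
  unfolding vip_def using suminf_sum[of UNIV "\<lambda>i k. x k $ i * cnj (y k $ i)"] assms by simp

lemma summ_bounded: assumes "summ f" shows "norm (f n) \<le> (\<Sum>n. norm (f n))"
  using sum_le_suminf[of "\<lambda>n. norm (f n)" "{n}"] assms by (simp add: summ_def)

lemma summ_component_bounded: assumes "summ f" shows "cmod (f n $ i) \<le> (\<Sum>n. norm (f n))"
  by (rule order_trans[OF Finite_Cartesian_Product.norm_nth_le summ_bounded[OF assms]])

lemma fc_anal_ip:
  assumes f: "summ f" and g: "summ g"
  shows "integrable circ (\<lambda>t. \<Sum>i\<in>UNIV. anal f i t * cnj (anal g i t))"
    "fc (\<lambda>t. \<Sum>i\<in>UNIV. anal f i t * cnj (anal g i t)) (int N) = ip ((bshift ^^ N) f) g"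
proof -
  have gs: "summable (\<lambda>k. cmod (cnj (g k $ i)))" for i using summ_component[OF g, of i] by simp
  have int: "integrable circ (\<lambda>t. anal f i t * cnj (anal g i t))" for i
    unfolding cnj_anal[OF g] by (rule integrable_series[OF fc_anal(1)[OF f] gs])
  then show "integrable circ (\<lambda>t. \<Sum>i\<in>UNIV. anal f i t * cnj (anal g i t))" by simp
  have tm: "fc (\<lambda>t. anal f i t * cnj (anal g i t)) (int N) = (\<Sum>k. (bshift ^^ N) f k $ i * cnj (g k $ i))" for i
  proof -
    have "fc (anal f i) (int N - - int k) = (bshift ^^ N) f k $ i" for k
      using fc_anal(2)[OF f, of i "k + N"] by (simp add: bshift_pow add.commute)
    then show ?thesis
      unfolding cnj_anal[OF g] fc_series[OF fc_anal(1)[OF f] gs] by (simp add: mult.commute)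
  qed
  have "fc (\<lambda>t. \<Sum>i\<in>UNIV. anal f i t * cnj (anal g i t)) (int N) = (\<Sum>i\<in>UNIV. \<Sum>k. (bshift ^^ N) f k $ i * cnj (g k $ i))"
    by (subst fc_sum) (auto simp: int tm)
  also have "\<dots> = ip ((bshift ^^ N) f) g"
    unfolding ip_def
    by (rule suminf_vip, rule summ_vip_component[OF g]) (simp only: bshift_pow, rule summ_component_bounded[OF f])
  finally show "fc (\<lambda>t. \<Sum>i\<in>UNIV. anal f i t * cnj (anal g i t)) (int N) = ip ((bshift ^^ N) f) g" .
qed

lemma fc_neg_ip:
  assumes f: "\<And>i. integrable circ (f i)" "\<And>i k. fc (f i) (- int k - 1) = h k $ i"
    and h: "summ h" and g: "summ g"
  shows "integrable circ (\<lambda>t. \<Sum>i\<in>UNIV. f i t * cnj (coan g i t))"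
    "fc (\<lambda>t. \<Sum>i\<in>UNIV. f i t * cnj (coan g i t)) (- int N) = ip ((bshift ^^ N) h) g"
proof -
  have gs: "summable (\<lambda>k. cmod (cnj (g k $ i)))" for i using summ_component[OF g, of i] by simp
  have int: "integrable circ (\<lambda>t. f i t * cnj (coan g i t))" for i
    unfolding cnj_coan[OF g] by (rule integrable_series[OF f(1) gs])
  then show "integrable circ (\<lambda>t. \<Sum>i\<in>UNIV. f i t * cnj (coan g i t))" by simp
  have tm: "fc (\<lambda>t. f i t * cnj (coan g i t)) (- int N) = (\<Sum>k. (bshift ^^ N) h k $ i * cnj (g k $ i))" for i
  proof -
    have "fc (f i) (- int N - (int k + 1)) = (bshift ^^ N) h k $ i" for k
      using f(2)[of i "k + N"] by (simp add: bshift_pow algebra_simps)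
    then show ?thesis
      unfolding cnj_coan[OF g] fc_series[OF f(1) gs] by (simp add: mult.commute)
  qed
  have "fc (\<lambda>t. \<Sum>i\<in>UNIV. f i t * cnj (coan g i t)) (- int N) = (\<Sum>i\<in>UNIV. \<Sum>k. (bshift ^^ N) h k $ i * cnj (g k $ i))"
    by (subst fc_sum) (auto simp: int tm)
  also have "\<dots> = ip ((bshift ^^ N) h) g"
    unfolding ip_def
    by (rule suminf_vip, rule summ_vip_component[OF g]) (simp only: bshift_pow, rule summ_component_bounded[OF h])
  finally show "fc (\<lambda>t. \<Sum>i\<in>UNIV. f i t * cnj (coan g i t)) (- int N) = ip ((bshift ^^ N) h) g" .
qed

lemma fc_coan_ip:
  assumes "summ f" "summ g"
  shows "integrable circ (\<lambda>t. \<Sum>i\<in>UNIV. coan f i t * cnj (coan g i t))"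
    "fc (\<lambda>t. \<Sum>i\<in>UNIV. coan f i t * cnj (coan g i t)) (- int N) = ip ((bshift ^^ N) f) g"
  by (rule fc_neg_ip[OF fc_coan(1,2)[OF assms(1)] assms])+

lemma vip_matrix:
  "vip (A *v u) (A *v u) = (\<Sum>j\<in>UNIV. \<Sum>l\<in>UNIV. u $ j * cnj (u $ l) * (\<Sum>i\<in>UNIV. A $ i $ j * cnj (A $ i $ l)))"
proof -
  have "vip (A *v u) (A *v u) = (\<Sum>i\<in>UNIV. \<Sum>j\<in>UNIV. \<Sum>l\<in>UNIV. u $ j * cnj (u $ l) * (A $ i $ j * cnj (A $ i $ l)))"
    unfolding vip_def matrix_vector_mult_def by (simp add: sum_product mult.assoc mult.left_commute mult.commute)
  also have "\<dots> = (\<Sum>j\<in>UNIV. \<Sum>i\<in>UNIV. \<Sum>l\<in>UNIV. u $ j * cnj (u $ l) * (A $ i $ j * cnj (A $ i $ l)))"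
    by (rule sum.swap)
  also have "\<dots> = (\<Sum>j\<in>UNIV. \<Sum>l\<in>UNIV. u $ j * cnj (u $ l) * (\<Sum>i\<in>UNIV. A $ i $ j * cnj (A $ i $ l)))"
    unfolding sum_distrib_left by (rule sum.cong[OF refl], rule sum.swap)
  finally show ?thesis .
qed

lemma bounded_linear_scale_vec: "bounded_linear (\<lambda>x :: complex^'n::finite. c *s x)"
proof -
  have "c *s x = mat c *v x" for x :: "complex^'n"
    by (simp add: vec_eq_iff matrix_vector_mult_def mat_def if_distrib[of "\<lambda>a. a * _"] cong: if_cong)
  then show ?thesis using bounded_linear_matrix[of "mat c :: complex^'n^'n"] by simp
qed

lemmas summable_scale_vec = bounded_linear.summable[OF bounded_linear_scale_vec]
  and suminf_scale_vec = bounded_linear.suminf[OF bounded_linear_scale_vec]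

lemma papp_bshift_smult: "papp bshift p (smult c f) = smult c (papp bshift p f)"
  by (simp add: fun_eq_iff papp_bshift_apply smult_apply vec.scale_sum_right mult.commute)

lemma mnorm_diff: "mnorm (A - B) \<le> mnorm A + mnorm (B :: complex^'p::finite^'q::finite)"
proof (rule mnorm_le)
  fix x :: "complex^'p"
  have "norm ((A - B) *v x) \<le> norm (A *v x) + norm (B *v x)"
    unfolding matrix_vector_mult_diff_rdistrib by (rule norm_triangle_ineq4)
  also have "\<dots> \<le> mnorm A * norm x + mnorm B * norm x" by (intro add_mono norm_matrix_le)
  finally show "norm ((A - B) *v x) \<le> (mnorm A + mnorm B) * norm x" by (simp add: distrib_right)
qed

lemma LinfI:
  assumes "\<And>i j. (\<lambda>t. \<Phi> t $ i $ j) \<in> borel_measurable circ" "AE t in circ. mnorm (\<Phi> t) \<le> C"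
  shows "Linf (\<Phi> :: real \<Rightarrow> complex^'p::finite^'q::finite)"
proof -
  have "supnorm \<Phi> < \<infinity>" using supnorm_le[OF assms] by (rule le_less_trans) simp
  then show ?thesis unfolding Linf_def using assms(1) by blast
qed

lemma Linf_diff:
  assumes "Linf A" "Linf B" shows "Linf (\<lambda>t. A t - B t :: complex^'p::finite^'q::finite)"
proof -
  obtain a where a: "AE t in circ. mnorm (A t) \<le> a" using Linf_bounded[OF assms(1)] .
  obtain b where b: "AE t in circ. mnorm (B t) \<le> b" using Linf_bounded[OF assms(2)] .
  show ?thesis
  proof (rule LinfI)
    show "(\<lambda>t. (A t - B t) $ i $ j) \<in> borel_measurable circ" for i j
      using borel_measurable_diff[OF Linf_measurable[OF assms(1), of i j] Linf_measurable[OF assms(2), of i j]] by simp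
    show "AE t in circ. mnorm (A t - B t) \<le> a + b"
      using a b
    proof eventually_elim
      case (elim t) then show ?case using mnorm_diff[of "A t" "B t"] by linarith
    qed
  qed
qed

lemma ip_shift_pow: assumes "d \<in> l2" "m \<in> l2" shows "ip ((shift ^^ k) d) m = ip d ((bshift ^^ k) m)"
  using assms(2)
proof (induction k arbitrary: m)
  case (Suc k)
  have 1: "(shift ^^ k) d \<in> l2" by (rule bop_l2[OF bop_pow[OF bop_shift] assms(1)])
  have 2: "bshift m \<in> l2" by (rule bop_l2[OF bop_bshift Suc.prems])
  have "ip ((shift ^^ Suc k) d) m = ip ((shift ^^ k) d) (bshift m)" using ip_shift_left[OF 1 Suc.prems] by simp
  also have "\<dots> = ip d ((bshift ^^ k) (bshift m))" by (rule Suc.IH[OF 2])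
  finally show ?case by (simp add: funpow_swap1)
qed simp

context nehari
begin

lemma pointwise_isometry:
  "AE t in circ. \<forall>u. norm (wm V t *v u) = gam * norm (vm V t *v u)"
proof -
  let ?a = "\<lambda>j i t. anal (V (axis j 1)) i t" and ?b = "\<lambda>j i t. coan (H (V (axis j 1))) i t"
  let ?q = "\<lambda>j l t. \<Sum>i\<in>UNIV. ?a j i t * cnj (?a l i t)"
  let ?p = "\<lambda>j l t. \<Sum>i\<in>UNIV. ?b j i t * cnj (?b l i t)"
  note hs = H_summ[OF V_l2]
  have intq: "integrable circ (?q j l)" for j l by (rule fc_anal_ip(1)[OF V_summ V_summ])
  have intp: "integrable circ (?p j l)" for j l by (rule fc_coan_ip(1)[OF hs hs])
  have cq: "?q l j = (\<lambda>t. cnj (?q j l t))" for j l by (simp add: mult.commute)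
  have cp: "?p l j = (\<lambda>t. cnj (?p j l t))" for j l by (simp add: mult.commute)
  have neg: "fc (?p j l) (- int N) = of_real (gam^2) * fc (?q j l) (- int N)" for j l N
  proof -
    have sl: "(shift ^^ N) f \<in> l2" "H ((shift ^^ N) f) = (bshift ^^ N) (H f)"
      "g \<in> l2 \<Longrightarrow> ip ((shift ^^ N) f) g = ip f ((bshift ^^ N) g)" if "f \<in> l2" for f g :: "'p seq"
    proof -
      have 1: "(shift ^^ n) f \<in> l2" for n by (rule bop_l2[OF bop_pow[OF bop_shift] that])
      show "(shift ^^ N) f \<in> l2" by (rule 1)
      show "H ((shift ^^ N) f) = (bshift ^^ N) (H f)" by (induction N) (simp_all add: H_shift 1)
      show "g \<in> l2 \<Longrightarrow> ip ((shift ^^ N) f) g = ip f ((bshift ^^ N) g)" by (rule ip_shift_pow[OF that])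
    qed
    let ?v = "V (axis j 1)" and ?w = "V (axis l 1)"
    have eig: "H' (H ?w) = smult (of_real (gam^2)) ?w" using V_eig[of "axis l 1"] by (simp add: eigY_def)
    have "fc (?p j l) (- int N) = ip ((bshift ^^ N) (H ?v)) (H ?w)" by (rule fc_coan_ip(2)[OF hs hs])
    also have "\<dots> = ip (H ((shift ^^ N) ?v)) (H ?w)" by (simp only: sl(2)[OF V_l2])
    also have "\<dots> = ip ((shift ^^ N) ?v) (H' (H ?w))" by (rule H_adjoint[OF sl(1)[OF V_l2] H_l2[OF V_l2]])
    also have "\<dots> = of_real (gam^2) * ip ((shift ^^ N) ?v) ?w"
      unfolding eig by (subst ip_smult_right[OF V_l2 sl(1)[OF V_l2]]) simp
    also have "ip ((shift ^^ N) ?v) ?w = ip ?v ((bshift ^^ N) ?w)" by (rule sl(3)[OF V_l2 V_l2])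
    also have "\<dots> = cnj (ip ((bshift ^^ N) ?w) ?v)"
      by (rule ip_cnj[symmetric]) (simp_all add: V_l2 bop_l2[OF bop_pow[OF bop_bshift]])
    also have "\<dots> = cnj (fc (?q l j) (int N))" unfolding fc_anal_ip(2)[OF V_summ V_summ] ..
    also have "\<dots> = fc (?q j l) (- int N)" unfolding cq[of j l] using fc_cnj[of "?q l j" "- int N"] by simp
    finally show ?thesis .
  qed
  have "fc (?p j l) n = of_real (gam^2) * fc (?q j l) n" for j l n
  proof (cases "n \<le> 0")
    case True
    then show ?thesis using neg[of j l "nat (- n)"] by simp
  next
    case False
    have "fc (?p j l) n = cnj (fc (?p l j) (- n))" unfolding cp[of j l] by (rule fc_cnj)
    also have "fc (?p l j) (- n) = of_real (gam^2) * fc (?q l j) (- n)" using neg[of l j "nat n"] False by simp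
    also have "cnj \<dots> = of_real (gam^2) * fc (?q j l) n" unfolding cq[of j l] fc_cnj by simp
    finally show ?thesis .
  qed
  then have "fc (\<lambda>t. ?p j l t - of_real (gam^2) * ?q j l t) n = 0" for j l n
    by (subst fc_diff) (use intp intq in \<open>simp_all only: integrable_mult_right fc_cmult diff_self\<close>)
  then have "AE t in circ. ?p j l t - of_real (gam^2) * ?q j l t = 0" for j l
    by (intro fc_zero_imp_AE Bochner_Integration.integrable_diff intp integrable_mult_right intq)
  then have "AE t in circ. \<forall>j l. ?p j l t - of_real (gam^2) * ?q j l t = 0"
    by (intro eventually_all_finite)
  then show ?thesis
  proof eventually_elim
    case (elim t)
    show ?case
    proof
      fix u
      have pq: "?p j l t = of_real (gam^2) * ?q j l t" for j l using elim by simp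
      have "vip (wm V t *v u) (wm V t *v u) = of_real (gam^2) * vip (vm V t *v u) (vm V t *v u)"
        unfolding vip_matrix wm_def vm_def vec_lambda_beta pq
        by (simp add: sum_distrib_left mult.left_commute)
      then have "(norm (wm V t *v u))^2 = gam^2 * (norm (vm V t *v u))^2"
        unfolding vip_self by (simp only: of_real_mult[symmetric] of_real_eq_iff)
      then have "(norm (wm V t *v u))^2 = (gam * norm (vm V t *v u))^2" by (simp add: power_mult_distrib)
      then show "norm (wm V t *v u) = gam * norm (vm V t *v u)"
        by (rule power2_eq_imp_eq) (simp_all add: gam_nonneg)
    qed
  qed
qed

definition iv :: "real \<Rightarrow> complex^'p^'p" where "iv t = (SOME B. B ** vm V t = mat 1)"

lemma iv: "iv t ** vm V t = mat 1" "vm V t ** iv t = mat 1"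
proof -
  have "\<exists>B. B ** vm V t = mat 1"
    using matrix_left_invertible_ker[of "vm V t"] V_circle_injective by blast
  then show 1: "iv t ** vm V t = mat 1" unfolding iv_def by (rule someI_ex)
  then show "vm V t ** iv t = mat 1" using matrix_left_right_inverse[of "iv t" "vm V t"] by blast
qed

definition Vz :: "complex \<Rightarrow> complex^'p^'p" where
  "Vz z = (\<chi> i j. \<Sum>m. V (axis j 1) m $ i * z ^ m)"

lemma Vz_sums: assumes "cmod z < 1 / r" shows "(\<lambda>m. V u m $ i * z ^ m) sums (\<Sum>m. V u m $ i * z ^ m)"
proof (rule summable_sums, rule summable_comparison_test')
  have "r * cmod z < 1" using assms r by (simp add: field_simps)
  then show "summable (\<lambda>m. cV u * (r * cmod z) ^ m)" using r by (intro summable_mult summable_geometric) simp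
  show "norm (V u m $ i * z ^ m) \<le> cV u * (r * cmod z) ^ m" for m
  proof -
    have "cmod (V u m $ i) \<le> cV u * r ^ m" by (rule order_trans[OF Finite_Cartesian_Product.norm_nth_le V_decay])
    then have "cmod (V u m $ i) * cmod z ^ m \<le> cV u * r ^ m * cmod z ^ m" by (rule mult_right_mono) simp
    then show ?thesis by (simp add: norm_mult norm_power power_mult_distrib mult.assoc)
  qed
qed

lemma Vz_circle: "Vz (cis t) = vm V t"
  unfolding Vz_def vm_def anal_def ee_nat ..

lemma Vz_holomorphic: "(\<lambda>z. Vz z $ i $ j) holomorphic_on ball 0 (1 / r)"
  unfolding Vz_def vec_lambda_beta
  by (rule power_series_holomorphic[where a = "\<lambda>m. V (axis j 1) m $ i"]) (use Vz_sums in simp)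

lemma det_holomorphic:
  assumes "\<And>i j. (\<lambda>z. A z $ i $ j) holomorphic_on S" shows "(\<lambda>z. det (A z :: complex^'n::finite^'n)) holomorphic_on S"
  unfolding det_def by (intro holomorphic_on_sum holomorphic_on_mult holomorphic_on_prod holomorphic_on_const assms)

lemma Vz_det: assumes "cmod z \<le> 1" shows "det (Vz z) \<noteq> 0"
proof -
  have "u = 0" if u: "Vz z *v u = 0" for u
  proof -
    have "r * cmod z < 1" using mult_left_mono[OF assms less_imp_le[OF r(1)]] r(2) by linarith
    then have z: "cmod z < 1 / r" using r(1) by (simp add: field_simps)
    have sm: "summable (\<lambda>n. z ^ n *s V u n)"
    proof (rule summable_norm_cancel, rule summable_comparison_test')
      show "summable (\<lambda>n. norm (V u n))" using V_summ[of u] by (simp add: summ_def)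
      show "norm (norm (z ^ n *s V u n)) \<le> norm (V u n)" for n
        using mult_right_mono[OF power_le_one[OF norm_ge_zero assms] norm_ge_zero[of "V u n"]]
        by (simp add: norm_scale_vec norm_power)
    qed
    have "(\<Sum>n. z ^ n *s V u n) = Vz z *v u"
    proof (subst vec_eq_iff, intro allI)
      fix i
      have "(\<Sum>n. z ^ n *s V u n) $ i = (\<Sum>n. (z ^ n *s V u n) $ i)"
        by (rule bounded_linear.suminf[OF bounded_linear_vec_nth sm])
      also have "\<dots> = (\<Sum>n. \<Sum>j\<in>UNIV. u $ j * (V (axis j 1) n $ i * z ^ n))"
        by (subst V_lin) (simp add: sum_seq_apply smult_apply sum_distrib_left mult.commute mult.left_commute)
      also have "\<dots> = (\<Sum>j\<in>UNIV. \<Sum>n. u $ j * (V (axis j 1) n $ i * z ^ n))"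
        by (rule suminf_sum) (rule summable_mult[OF sums_summable[OF Vz_sums[OF z]]])
      also have "\<dots> = (\<Sum>j\<in>UNIV. u $ j * (\<Sum>n. V (axis j 1) n $ i * z ^ n))"
        by (subst suminf_mult[OF sums_summable[OF Vz_sums[OF z]]]) simp
      finally show "(\<Sum>n. z ^ n *s V u n) $ i = (Vz z *v u) $ i"
        by (simp add: Vz_def matrix_vector_mult_def mult.commute)
    qed
    then have "(\<Sum>n. z ^ n *s V u n) = 0" unfolding u .
    then have "V u = 0" by (rule V_no_zeros[OF V_eig assms])
    then show ?thesis using V_0[of u] by (simp add: zero_fun_apply)
  qed
  then obtain B where "B ** Vz z = mat 1" using matrix_left_invertible_ker[of "Vz z"] by blast
  then have "det B * det (Vz z) = 1" using det_mul[of B "Vz z"] by simp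
  then show ?thesis by auto
qed

lemma Vz_radius: "\<exists>R>1. R \<le> 1 / r \<and> (\<forall>z. cmod z < R \<longrightarrow> det (Vz z) \<noteq> 0)"
proof -
  have h: "(\<lambda>z. det (Vz z)) holomorphic_on ball 0 (1 / r)" by (rule det_holomorphic[OF Vz_holomorphic])
  have r1: "1 < 1 / r" using r by simp
  let ?S = "{z \<in> ball 0 (1 / r). det (Vz z) \<in> - {0}}"
  have op: "open ?S"
    using continuous_open_preimage[OF holomorphic_on_imp_continuous_on[OF h] open_ball, of "- {0}"]
    by (simp add: vimage_def Int_def open_Compl)
  have sub: "cball 0 1 \<subseteq> ?S"
  proof
    fix z :: complex assume "z \<in> cball 0 1"
    then have "cmod z \<le> 1" by simp
    then show "z \<in> ?S" using r1 Vz_det[of z] by (simp add: le_less_trans[OF _ r1])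
  qed
  obtain e where e: "e > 0" "(\<Union>x\<in>cball 0 1. ball x e) \<subseteq> ?S"
    by (rule compact_subset_open_imp_ball_epsilon_subset[OF compact_cball op sub])
  have "det (Vz z) \<noteq> 0" if z: "cmod z < 1 + e" for z
  proof -
    have "z \<in> (\<Union>x\<in>cball 0 1. ball x e)"
    proof (cases "cmod z \<le> 1")
      case True
      then show ?thesis using e(1) by (intro UN_I[of z]) auto
    next
      case False
      then have zz: "of_real (cmod z) * sgn z = z" by (auto simp: sgn_eq)
      have "z - sgn z = of_real (cmod z - 1) * sgn z"
        unfolding of_real_diff left_diff_distrib zz by simp
      then have "cmod (z - sgn z) = \<bar>cmod z - 1\<bar> * cmod (sgn z)" by (simp only: norm_mult norm_of_real)
      also have "\<dots> = cmod z - 1" using False by (auto simp: norm_sgn)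
      finally have "z \<in> ball (sgn z) e" using z by (simp add: dist_norm norm_minus_commute)
      moreover have "sgn z \<in> cball 0 1" by (simp add: norm_sgn)
      ultimately show ?thesis by blast
    qed
    then have "z \<in> ?S" by (rule subsetD[OF e(2)])
    then show ?thesis by simp
  qed
  then show ?thesis using e(1) r1 by (intro exI[of _ "min (1 + e) (1 / r)"]) simp
qed

lemma iv_series:
  "\<exists>U. summable (\<lambda>m. cmod (U m)) \<and> (\<forall>t. iv t $ j $ k = (\<Sum>m. U m * ee (int m) t))"
proof -
  obtain R where R: "R > 1" "R \<le> 1 / r" "\<And>z. cmod z < R \<Longrightarrow> det (Vz z) \<noteq> 0" using Vz_radius by blast
  let ?X = "\<lambda>z. det (\<chi> a b. if b = k then (mat 1 :: complex^'p^'p) $ j $ a else Vz z $ b $ a) / det (Vz z)"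
  have Vh: "(\<lambda>z. Vz z $ a $ b) holomorphic_on ball 0 R" for a b
    by (rule holomorphic_on_subset[OF Vz_holomorphic]) (use R in auto)
  have "(\<lambda>z. (\<chi> a b. if b = k then (mat 1 :: complex^'p^'p) $ j $ a else Vz z $ b $ a) $ a $ b) holomorphic_on ball 0 R" for a b
    using Vh by (cases "b = k") simp_all
  then have hol: "?X holomorphic_on ball 0 R"
    by (intro holomorphic_on_divide det_holomorphic) (use Vh R in auto)
  define U where "U = (\<lambda>n. (deriv ^^ n) ?X 0 / fact n)"
  have U: "(\<lambda>n. U n * z ^ n) sums ?X z" if "cmod z < R" for z
    using holomorphic_power_series[OF hol, of z] that unfolding U_def by simp
  have "summable (\<lambda>n. U n * of_real ((1 + R) / 2) ^ n)"
    by (rule sums_summable[OF U]) (use R(1) in \<open>simp only: norm_of_real, simp\<close>)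
  then have "summable (\<lambda>n. norm (U n * 1 ^ n))" by (rule powser_insidea) (use R(1) in \<open>simp only: norm_of_real, simp\<close>)
  then have "summable (\<lambda>n. cmod (U n))" by simp
  moreover have "iv t $ j $ k = (\<Sum>m. U m * ee (int m) t)" for t
  proof -
    have "iv t $ j $ k = ?X (cis t)"
      by (rule matrix_solve_right) (simp_all add: Vz_circle vmV_det iv(1))
    also have "\<dots> = (\<Sum>m. U m * cis t ^ m)" by (rule sums_unique[OF U]) (use R in simp)
    finally show ?thesis by (simp add: ee_nat)
  qed
  ultimately show ?thesis by blast
qed

definition \<Phi>0 :: "real \<Rightarrow> complex^'p^'q" where "\<Phi>0 t = wm V t ** iv t"

lemma \<Phi>0_eq: "\<Phi>0 t ** vm V t = wm V t"
  unfolding \<Phi>0_def by (simp add: matrix_mul_assoc[symmetric] iv)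

lemma \<Phi>0_unique: assumes "X ** vm V t = wm V t" shows "X = \<Phi>0 t"
proof -
  have "X ** (vm V t ** iv t) = wm V t ** iv t" unfolding matrix_mul_assoc assms ..
  then show ?thesis by (simp add: iv \<Phi>0_def)
qed

lemma \<Phi>0_measurable: "(\<lambda>t. \<Phi>0 t $ i $ k) \<in> borel_measurable circ"
proof (rule continuous_measurable_circ)
  have "continuous_on {0..2*pi} (\<lambda>t. iv t $ j $ k)" for j
  proof -
    obtain U where U: "summable (\<lambda>m. cmod (U m))" "\<And>t. iv t $ j $ k = (\<Sum>m. U m * ee (int m) t)"
      using iv_series by blast
    show ?thesis unfolding U(2) by (rule continuous_series[OF U(1)])
  qed
  then show "continuous_on {0..2*pi} (\<lambda>t. \<Phi>0 t $ i $ k)"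
    unfolding \<Phi>0_def wm_def matrix_matrix_mult_def vec_lambda_beta
    by (intro continuous_on_sum continuous_on_mult continuous_coan H_summ V_l2)
qed

lemma \<Phi>0_le: "AE t in circ. mnorm (\<Phi>0 t) \<le> gam"
  using pointwise_isometry
proof eventually_elim
  case (elim t)
  show ?case
  proof (rule mnorm_le)
    fix x
    have x: "vm V t *v (iv t *v x) = x" by (simp add: matrix_vector_mul_assoc iv)
    have "norm (\<Phi>0 t *v x) = norm (wm V t *v (iv t *v x))" by (simp add: \<Phi>0_def matrix_vector_mul_assoc)
    also have "\<dots> = gam * norm x" using elim x by simp
    finally show "norm (\<Phi>0 t *v x) \<le> gam * norm x" by simp
  qed
qed

lemma \<Phi>0_Linf: "Linf \<Phi>0" by (rule LinfI[OF \<Phi>0_measurable \<Phi>0_le])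

lemma F0_Hinf: "Hinf (\<lambda>t. G t - \<Phi>0 t)"
proof -
  have L: "Linf (\<lambda>t. G t - \<Phi>0 t)" by (rule Linf_diff[OF GL \<Phi>0_Linf])
  have "fc (\<lambda>t. (G t - \<Phi>0 t) $ i $ k) n = 0" if n: "n < 0" for n i k
  proof -
    let ?v = "\<lambda>l. V (axis l 1)"
    define h where "h = (\<lambda>l t. (\<Sum>j\<in>UNIV. G t $ i $ j * anal (?v l) j t) - coan (H (?v l)) i t)"
    note hs = H_summ[OF V_l2]
    have Gi: "\<And>i j. integrable circ (\<lambda>t. G t $ i $ j)" by (rule Linf_integrable[OF GL])
    have hi: "integrable circ (h l)" for l
      unfolding h_def by (intro Bochner_Integration.integrable_diff product_coefficients(1)[OF Gi V_summ] fc_coan(1) hs)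
    have h0: "fc (h l) m = 0" if m: "m < 0" for l m
    proof -
      define k where "k = nat (- m - 1)"
      have k: "m = - int k - 1" using m by (simp add: k_def)
      have "fc (h l) m = fc (\<lambda>t. \<Sum>j\<in>UNIV. G t $ i $ j * anal (?v l) j t) m - fc (coan (H (?v l)) i) m"
        unfolding h_def by (intro fc_diff product_coefficients(1)[OF Gi V_summ] fc_coan(1) hs)
      also have "fc (\<lambda>t. \<Sum>j\<in>UNIV. G t $ i $ j * anal (?v l) j t) m = H (?v l) k $ i"
        unfolding product_coefficients(3)[OF Gi V_summ] k by (rule neg_coefficients[OF refl V_l2])
      also have "fc (coan (H (?v l)) i) m = H (?v l) k $ i" unfolding k by (rule fc_coan(2)[OF hs])
      finally show ?thesis by simp
    qed
    have e: "(G t - \<Phi>0 t) $ i $ k = (\<Sum>l\<in>UNIV. h l t * iv t $ l $ k)" for t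
    proof -
      have "(G t ** vm V t - wm V t) ** iv t = G t - \<Phi>0 t"
      proof -
        have "(G t ** vm V t - wm V t) ** iv t = (G t ** vm V t) ** iv t - wm V t ** iv t"
          by (simp add: vec_eq_iff matrix_matrix_mult_def left_diff_distrib sum_subtractf)
        then show ?thesis by (simp add: matrix_mul_assoc[symmetric] iv \<Phi>0_def)
      qed
      then have "(G t - \<Phi>0 t) $ i $ k = ((G t ** vm V t - wm V t) ** iv t) $ i $ k" by simp
      also have "\<dots> = (\<Sum>l\<in>UNIV. h l t * iv t $ l $ k)"
        by (simp add: matrix_matrix_mult_def vm_def wm_def h_def)
      finally show ?thesis .
    qed
    have tm: "integrable circ (\<lambda>t. h l t * iv t $ l $ k)" "fc (\<lambda>t. h l t * iv t $ l $ k) n = 0" for l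
    proof -
      obtain U where U: "summable (\<lambda>m. cmod (U m))" "\<And>t. iv t $ l $ k = (\<Sum>m. U m * ee (int m) t)"
        using iv_series by blast
      show "integrable circ (\<lambda>t. h l t * iv t $ l $ k)" unfolding U(2) by (rule integrable_series[OF hi U(1)])
      show "fc (\<lambda>t. h l t * iv t $ l $ k) n = 0"
        unfolding U(2) fc_series[OF hi U(1)] using n by (simp add: h0)
    qed
    show ?thesis unfolding e by (subst fc_sum[OF tm(1)]) (simp add: tm(2))
  qed
  then show ?thesis unfolding Hinf_def fcm_def using L by (simp add: vec_eq_iff)
qed

lemma optimal_unique:
  assumes "nehari_optimal G F" shows "AE t in circ. G t - F t = \<Phi>0 t" "Linf (\<lambda>t. G t - F t)"
proof -
  have FH: "Hinf F" using assms by (simp add: nehari_optimal_def)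
  then have FL: "Linf F" by (simp add: Hinf_def)
  define \<Phi>1 where "\<Phi>1 = (\<lambda>t. G t - F t)"
  have L1: "Linf \<Phi>1" unfolding \<Phi>1_def by (rule Linf_diff[OF GL FL])
  then show "Linf (\<lambda>t. G t - F t)" by (simp add: \<Phi>1_def)
  have "supnorm \<Phi>1 \<le> supnorm (\<lambda>t. G t - (G t - \<Phi>0 t))"
    using assms F0_Hinf unfolding nehari_optimal_def \<Phi>1_def by blast
  also have "\<dots> \<le> ereal gam" using supnorm_le[OF \<Phi>0_measurable \<Phi>0_le] by simp
  finally have le: "AE t in circ. mnorm (\<Phi>1 t) \<le> gam" by (rule supnorm_AE)
  have i1: "\<And>i j. integrable circ (\<lambda>t. \<Phi>1 t $ i $ j)" by (rule Linf_integrable[OF L1])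
  have neg: "fcm \<Phi>1 n = fcm G n" if "n < 0" for n
  proof -
    have "fc (\<lambda>t. F t $ i $ j) n = 0" for i j
    proof -
      have "fcm F n = 0" using FH that by (simp add: Hinf_def)
      then have "fcm F n $ i $ j = 0" by simp
      then show ?thesis by (simp add: fcm_def)
    qed
    then show ?thesis unfolding fcm_def \<Phi>1_def
      by (simp add: vec_eq_iff fc_diff Linf_integrable[OF GL] Linf_integrable[OF FL])
  qed
  have key: "AE t in circ. \<forall>i. (\<Sum>j\<in>UNIV. \<Phi>1 t $ i $ j * anal (V u) j t) = coan (H (V u)) i t" for u
  proof -
    note hs = H_summ[OF V_l2]
    let ?f = "\<lambda>i t. \<Sum>j\<in>UNIV. \<Phi>1 t $ i $ j * anal (V u) j t"
    let ?b = "\<lambda>i. coan (H (V u)) i"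
    let ?q = "\<lambda>t. \<Sum>i\<in>UNIV. anal (V u) i t * cnj (anal (V u) i t)"
    let ?s = "\<lambda>t. \<Sum>i\<in>UNIV. ?f i t * cnj (?b i t)"
    let ?p = "\<lambda>t. \<Sum>i\<in>UNIV. ?b i t * cnj (?b i t)"
    have fi: "integrable circ (?f i)" for i by (rule product_coefficients(1)[OF i1 V_summ])
    have ff: "fc (?f i) (- int k - 1) = H (V u) k $ i" for i k
      unfolding product_coefficients(3)[OF i1 V_summ] by (rule neg_coefficients[OF neg V_l2])
    have q: "integrable circ ?q" "fc ?q 0 = of_real ((nrm (V u))^2)"
      using fc_anal_ip(2)[OF V_summ[of u] V_summ[of u], of 0]
      by (simp_all only: fc_anal_ip(1)[OF V_summ V_summ] of_nat_0 funpow_0 ip_self[OF V_l2])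
    have s: "integrable circ ?s" "fc ?s 0 = of_real ((nrm (H (V u)))^2)"
      using fc_neg_ip(2)[OF fi ff hs hs[of u], where N = 0]
      by (simp_all only: fc_neg_ip(1)[OF fi ff hs hs] of_nat_0 minus_zero funpow_0 ip_self[OF H_l2[OF V_l2]])
    have p: "integrable circ ?p" "fc ?p 0 = of_real ((nrm (H (V u)))^2)"
      using fc_coan_ip(2)[OF hs[of u] hs[of u], of 0]
      by (simp_all only: fc_coan_ip(1)[OF hs hs] of_nat_0 minus_zero funpow_0 ip_self[OF H_l2[OF V_l2]])
    define g where "g = (\<lambda>t. of_real (gam^2) * ?q t - 2 * ?s t + ?p t)"
    have gi: "integrable circ g" unfolding g_def
      by (intro Bochner_Integration.integrable_add Bochner_Integration.integrable_diff integrable_mult_right q s p)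
    have "fc g 0 = of_real (gam^2) * fc ?q 0 - 2 * fc ?s 0 + fc ?p 0"
    proof -
      have "fc g 0 = fc (\<lambda>t. of_real (gam^2) * ?q t - 2 * ?s t) 0 + fc ?p 0" unfolding g_def
        by (intro fc_add Bochner_Integration.integrable_diff integrable_mult_right q s p)
      also have "fc (\<lambda>t. of_real (gam^2) * ?q t - 2 * ?s t) 0 = fc (\<lambda>t. of_real (gam^2) * ?q t) 0 - fc (\<lambda>t. 2 * ?s t) 0"
        by (intro fc_diff integrable_mult_right q s)
      finally show ?thesis by (simp only: fc_cmult)
    qed
    also have "\<dots> = of_real (gam^2 * (nrm (V u))^2 - (nrm (H (V u)))^2)"
      unfolding q(2) s(2) p(2) by simp
    also have "nrm (H (V u)) = gam * nrm (V u)" using eig_max[OF V_l2] V_eig[of u] by (simp add: eigY_def)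
    finally have "fc g 0 = 0" by (simp add: power_mult_distrib)
    then have "integral\<^sup>L circ g = 0" unfolding fc_ee by simp
    then have Rg: "integral\<^sup>L circ (\<lambda>t. Re (g t)) = 0" using integral_Re[OF gi] by simp
    have bd: "AE t in circ. (\<Sum>i\<in>UNIV. (cmod (?f i t - ?b i t))^2) \<le> Re (g t)"
      using le
    proof eventually_elim
      case (elim t)
      define x where "x = (\<chi> j. anal (V u) j t)"
      define y where "y = (\<chi> i. ?b i t)"
      have fx: "\<Phi>1 t *v x = (\<chi> i. ?f i t)" by (simp add: x_def matrix_vector_mult_def)
      have "norm (\<Phi>1 t *v x) \<le> gam * norm x"
        by (rule order_trans[OF norm_matrix_le mult_right_mono[OF elim norm_ge_zero]])
      then have n: "(norm (\<Phi>1 t *v x))^2 \<le> gam^2 * (norm x)^2"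
        using power_mono[of "norm (\<Phi>1 t *v x)" "gam * norm x" 2] by (simp add: power_mult_distrib)
      have v: "vip (\<Phi>1 t *v x - y) (\<Phi>1 t *v x - y) = vip (\<Phi>1 t *v x) (\<Phi>1 t *v x) - vip (\<Phi>1 t *v x) y - cnj (vip (\<Phi>1 t *v x) y) + vip y y"
        unfolding vip_cnj by (simp add: vip_def algebra_simps sum.distrib sum_subtractf)
      have "(norm (\<Phi>1 t *v x - y))^2 = (norm (\<Phi>1 t *v x))^2 - 2 * Re (vip (\<Phi>1 t *v x) y) + (norm y)^2"
        using arg_cong[OF v, of Re] unfolding vip_self by simp
      also have "\<dots> \<le> gam^2 * (norm x)^2 - 2 * Re (vip (\<Phi>1 t *v x) y) + (norm y)^2" using n by simp
      also have "\<dots> = Re (g t)"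
      proof -
        have "g t = of_real (gam^2) * vip x x - 2 * vip (\<Phi>1 t *v x) y + vip y y"
          unfolding g_def fx by (simp add: vip_def x_def y_def)
        then show ?thesis unfolding vip_self by simp
      qed
      finally have "(norm (\<Phi>1 t *v x - y))^2 \<le> Re (g t)" .
      moreover have "(norm (\<Phi>1 t *v x - y))^2 = (\<Sum>i\<in>UNIV. (cmod (?f i t - ?b i t))^2)"
        unfolding fx y_def norm_vec_def L2_set_def by (simp add: sum_nonneg)
      ultimately show ?case by simp
    qed
    have "AE t in circ. Re (g t) = 0"
    proof (subst integral_nonneg_eq_0_iff_AE[symmetric])
      show "AE t in circ. 0 \<le> Re (g t)"
        using bd
      proof eventually_elim
        case (elim t)
        have "0 \<le> (\<Sum>i\<in>UNIV. (cmod (?f i t - ?b i t))^2)" by (simp add: sum_nonneg)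
        then show ?case using elim by linarith
      qed
    qed (use gi Rg in simp_all)
    with bd show ?thesis
    proof eventually_elim
      case (elim t)
      then have "(\<Sum>i\<in>UNIV. (cmod (?f i t - ?b i t))^2) = 0"
        by (intro antisym sum_nonneg) simp_all
      then show ?case by (simp add: sum_nonneg_eq_0_iff)
    qed
  qed
  have "AE t in circ. \<forall>l i. (\<Sum>j\<in>UNIV. \<Phi>1 t $ i $ j * anal (V (axis l 1)) j t) = coan (H (V (axis l 1))) i t"
    by (rule eventually_all_finite, rule key)
  then show "AE t in circ. G t - F t = \<Phi>0 t"
  proof eventually_elim
    case (elim t)
    then have "\<Phi>1 t ** vm V t = wm V t"
      by (simp add: vec_eq_iff matrix_matrix_mult_def vm_def wm_def)
    then show ?case using \<Phi>0_unique[of "\<Phi>1 t" t] by (simp add: \<Phi>1_def)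
  qed
qed

lemma H_annihilated: assumes "y \<in> l2" shows "\<exists>p. p \<noteq> 0 \<and> papp bshift p (H y) = 0"
proof -
  obtain B where B: "finite B" "H ` l2 \<subseteq> sv.span B" using C1 unfolding H_def cspan_eq_span by blast
  have 1: "(shift ^^ n) y \<in> l2" for n by (rule bop_l2[OF bop_pow[OF bop_shift] assms])
  have "(bshift ^^ n) (H y) = H ((shift ^^ n) y)" for n by (induction n) (simp_all add: H_shift 1)
  then have "(bshift ^^ n) (H y) \<in> sv.span B" for n using B(2) 1[of n] by auto
  then show ?thesis by (rule annihilator_exists[OF B(1)])
qed

lemma papp_hk:
  assumes p: "\<And>n x. (\<Sum>i\<le>degree p. coeff p i *s (K (n + i) *v x)) = 0" and y: "y \<in> l2"
    and K: "hankel_kernel K c r"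
  shows "papp bshift p (hk K y) = (0 :: 'n::finite seq)"
proof
  fix k
  interpret hankel_kernel K c r by fact
  have s: "summable (\<lambda>m. coeff p i *s (K (k + i + m) *v y m))" for i
    by (rule summable_scale_vec[OF hk_summable(2)[OF y]])
  have "papp bshift p (hk K y) k = (\<Sum>i\<le>degree p. \<Sum>m. coeff p i *s (K (k + i + m) *v y m))"
    unfolding papp_bshift_apply hk_def by (simp add: suminf_scale_vec[OF hk_summable(2)[OF y]])
  also have "\<dots> = (\<Sum>m. \<Sum>i\<le>degree p. coeff p i *s (K (k + i + m) *v y m))"
    by (rule suminf_sum[symmetric]) (rule s)
  also have "\<dots> = (\<Sum>m. 0)"
  proof (rule arg_cong[of _ _ suminf], rule ext)
    fix m
    show "(\<Sum>i\<le>degree p. coeff p i *s (K (k + i + m) *v y m)) = 0"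
      using p[of "k + m" "y m"] by (simp only: ac_simps)
  qed
  finally show "papp bshift p (hk K y) k = 0 k" by (simp add: zero_fun_apply)
qed

lemma H'_annihilated: assumes "y \<in> l2" shows "\<exists>p. p \<noteq> 0 \<and> papp bshift p (H' y) = 0"
proof -
  obtain p where p: "annihilates p (range (hcol G))" using C1 finite_rank_annihilator by blast
  have z: "(\<Sum>i\<le>degree p. coeff p i * gmat G (n + i) $ a $ b) = 0" for n a b
  proof -
    have "papp bshift p (hcol G b) n $ a = 0" using p by (simp add: annihilates_def zero_fun_apply)
    then show ?thesis by (simp add: papp_bshift_apply hcol_def gmat_def fcm_def)
  qed
  let ?p = "map_poly cnj p"
  have d: "degree ?p = degree p" by (rule degree_map_poly) simp
  have c: "coeff ?p i = cnj (coeff p i)" for i by (rule coeff_map_poly) simp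
  have "(\<Sum>i\<le>degree ?p. coeff ?p i *s (ctr (gmat G (n + i)) *v x)) = 0" for n x
  proof (subst vec_eq_iff, intro allI)
    fix j
    have "(\<Sum>i\<le>degree ?p. coeff ?p i *s (ctr (gmat G (n + i)) *v x)) $ j
        = (\<Sum>i\<le>degree p. \<Sum>k\<in>UNIV. cnj (coeff p i * gmat G (n + i) $ k $ j) * x $ k)"
      by (simp add: d c ctr_def matrix_vector_mult_def sum_distrib_left mult.assoc)
    also have "\<dots> = (\<Sum>k\<in>UNIV. cnj (\<Sum>i\<le>degree p. coeff p i * gmat G (n + i) $ k $ j) * x $ k)"
      by (subst sum.swap) (simp add: sum_distrib_right)
    finally show "(\<Sum>i\<le>degree ?p. coeff ?p i *s (ctr (gmat G (n + i)) *v x)) $ j = 0 $ j" by (simp add: z)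
  qed
  then have "papp bshift ?p (H' y) = 0" unfolding H'_def by (rule papp_hk[OF _ assms K'.hankel_kernel_axioms])
  moreover have "?p \<noteq> 0" using p d c by (auto simp: annihilates_def poly_eq_iff)
  ultimately show ?thesis by blast
qed

lemma V_annihilated: "\<exists>p. p \<noteq> 0 \<and> papp bshift p (V u) = 0"
proof -
  obtain p where p: "p \<noteq> 0" "papp bshift p (H' (H (V u))) = 0" using H'_annihilated[OF H_l2[OF V_l2]] by blast
  have "H' (H (V u)) = smult (of_real (gam^2)) (V u)" using V_eig[of u] by (simp add: eigY_def)
  then have "papp bshift p (smult (of_real (gam^2)) (V u)) = 0" using p(2) by simp
  then have "papp bshift (Polynomial.smult (of_real (gam^2)) p) (V u) = 0"
    unfolding papp_smult by (simp add: papp_bshift_smult)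
  then show ?thesis using p(1) gam_pos by (intro exI[of _ "Polynomial.smult (of_real (gam^2)) p"]) simp
qed

lemma rational_quotient:
  assumes "\<And>u. summ (w u)" "\<And>u. \<exists>p. p \<noteq> 0 \<and> papp bshift p (w u) = 0"
    and AE: "AE t in circ. det (vm w t) \<noteq> 0 \<and> \<Phi> t ** vm w t = wm w t"
  shows "rational_on_circle \<Phi>"
proof (rule rational_solve[OF _ _ AE])
  show "ratc (\<lambda>t. vm w t $ i $ j)" for i j
  proof -
    obtain p where "p \<noteq> 0" "papp bshift p (w (axis j 1)) = 0" using assms(2) by blast
    from ratc_anal[OF assms(1) this] show ?thesis by (simp add: vm_def)
  qed
  show "ratc (\<lambda>t. wm w t $ i $ j)" for i j
  proof -
    have l: "w (axis j 1) \<in> l2" by (rule summ_l2[OF assms(1)])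
    obtain p where "p \<noteq> 0" "papp bshift p (H (w (axis j 1))) = 0" using H_annihilated[OF l] by blast
    from ratc_coan[OF H_summ[OF l] this] show ?thesis by (simp add: wm_def)
  qed
qed

lemma optimal_rational:
  assumes "nehari_optimal G F" shows "rational_on_circle (\<lambda>t. G t - F t)"
proof (rule rational_quotient[OF V_summ V_annihilated])
  show "AE t in circ. det (vm V t) \<noteq> 0 \<and> (G t - F t) ** vm V t = wm V t"
    using optimal_unique(1)[OF assms] by eventually_elim (simp add: vmV_det \<Phi>0_eq)
qed

end

section \<open>Convergence of the central solutions\<close>

lemma annihilated_summ:
  assumes f: "f \<in> l2" and p: "p \<noteq> 0" "papp bshift p f = 0" shows "summ f"
proof -
  have "annihilates p {f}" using p by (simp add: annihilates_def)
  then obtain d where d: "min_annihilator d {f}" using min_annihilator_exists by blast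
  then have ann: "d \<noteq> 0" "papp bshift d f = 0" by (simp_all add: min_annihilator_def annihilates_def)
  have "cmod a < 1" if "poly d a = 0" for a
    by (rule min_annihilator_roots[OF d _ that]) (use l2_tendsto_0[OF f] in simp)
  then obtain \<rho> where \<rho>: "0 < \<rho>" "\<rho> < 1" "\<And>a. poly d a = 0 \<Longrightarrow> cmod a < \<rho>"
    using roots_radius[OF ann(1), of 1] by auto
  obtain c where "\<And>n. norm (f n) \<le> c * \<rho> ^ n" using decay_annihilated[OF \<rho>(1) ann \<rho>(3)] by blast
  then show ?thesis by (rule summ_decay[OF _ \<rho>(1,2)])
qed

lemma shift_l1: assumes "summ d"
  shows "summ (shift d)" "(\<Sum>n. norm (shift d n)) = (\<Sum>n. norm (d n))"
proof -
  have e: "(\<lambda>n. norm (shift d (Suc n))) = (\<lambda>n. norm (d n))" by (simp add: shift_def)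
  have "summable (\<lambda>n. norm (shift d (Suc n)))" unfolding e using assms by (simp add: summ_def)
  then have s: "summable (\<lambda>n. norm (shift d n))" by (rule iffD1[OF summable_Suc_iff])
  then show "summ (shift d)" by (simp add: summ_def)
  show "(\<Sum>n. norm (shift d n)) = (\<Sum>n. norm (d n))"
    using suminf_split_head[OF s] unfolding e by (simp add: shift_def)
qed

lemma shift_pow_l1: assumes "summ d"
  shows "summ ((shift ^^ k) d) \<and> (\<Sum>n. norm ((shift ^^ k) d n)) = (\<Sum>n. norm (d n))"
proof (induction k)
  case (Suc k)
  then show ?case using shift_l1[of "(shift ^^ k) d"] by simp
qed (simp add: assms)

lemma bshift_pow_shift: "(bshift ^^ k) ((shift ^^ k) d) = d"
proof (induction k)
  case (Suc k)
  have "bshift (shift f) = f" for f :: "'a seq" by (simp add: bshift_def shift_def)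
  then show ?case using Suc by (simp add: funpow_swap1[of bshift])
qed simp

lemma Mseq_iff: "g \<in> Mseq M k \<longleftrightarrow> (bshift ^^ k) g \<in> M"
proof (induction k arbitrary: g)
  case (Suc k)
  have "g \<in> Mseq M (Suc k) \<longleftrightarrow> bshift g \<in> Mseq M k"
  proof
    assume "g \<in> Mseq M (Suc k)"
    then obtain u m where m: "g = sadd (Eop u) (shift m)" "m \<in> Mseq M k" by auto
    have "bshift g = m" unfolding m(1) by (simp add: fun_eq_iff bshift_def sadd_def Eop_def shift_def plus_fun_apply)
    then show "bshift g \<in> Mseq M k" using m(2) by simp
  next
    assume b: "bshift g \<in> Mseq M k"
    have "g = sadd (Eop (g 0)) (shift (bshift g))"
      by (simp add: fun_eq_iff bshift_def sadd_def Eop_def shift_def plus_fun_apply)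
    then show "g \<in> Mseq M (Suc k)" using b by auto
  qed
  also have "\<dots> \<longleftrightarrow> (bshift ^^ Suc k) g \<in> M" unfolding Suc.IH by (simp add: funpow_swap1)
  finally show ?case .
qed simp

lemma matrix_minus_vec: "(A - B) *v x = A *v x - B *v (x :: complex^'n::finite)"
  by (rule matrix_vector_mult_diff_rdistrib)

lemma mnorm_minus: "mnorm (- A) \<le> mnorm (A :: complex^'p::finite^'q::finite)"
proof (rule mnorm_le)
  fix x
  have "(- A) *v x = - (A *v x)" using matrix_minus_vec[of 0 A x] by simp
  then show "norm (- A *v x) \<le> mnorm A * norm x" using norm_matrix_le[of A x] by simp
qed

lemma perturbed_quotient:
  fixes A A' :: "complex^'p::finite^'p" and B B' X Y :: "complex^'p^'q::finite"
  assumes XY: "X ** A' = B'" "Y ** A = B" and c: "0 < c" "\<And>u. c * norm u \<le> norm (A *v u)"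
    and d: "\<And>u. norm ((A' - A) *v u) \<le> \<delta>1 * norm u" "\<And>u. norm ((B' - B) *v u) \<le> \<delta>2 * norm u"
    and s: "\<delta>1 \<le> c / 2" and g: "mnorm Y \<le> g" and nn: "0 \<le> \<delta>1" "0 \<le> \<delta>2"
  shows "det A' \<noteq> 0 \<and> mnorm (X - Y) \<le> (\<delta>2 + g * \<delta>1) * (2 / c)"
proof -
  have low: "c / 2 * norm u \<le> norm (A' *v u)" for u
  proof -
    have "c * norm u \<le> norm (A *v u)" by (rule c)
    also have "A *v u = A' *v u - (A' - A) *v u" by (simp add: matrix_minus_vec)
    also have "norm (A' *v u - (A' - A) *v u) \<le> norm (A' *v u) + \<delta>1 * norm u"
      using norm_triangle_ineq4[of "A' *v u" "(A' - A) *v u"] d(1)[of u] by linarith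
    also have "\<delta>1 * norm u \<le> c / 2 * norm u" by (rule mult_right_mono[OF s]) simp
    finally show ?thesis by simp
  qed
  have "u = 0" if "A' *v u = 0" for u
    using low[of u] that c(1) by (simp add: mult_le_0_iff)
  then obtain J where J: "J ** A' = mat 1" using matrix_left_invertible_ker[of A'] by blast
  then have "det J * det A' = 1" using det_mul[of J A'] by simp
  then have "det A' \<noteq> 0" by auto
  moreover have "mnorm (X - Y) \<le> (\<delta>2 + g * \<delta>1) * (2 / c)"
  proof (rule mnorm_le)
    fix x
    define u where "u = J *v x"
    have "A' ** J = mat 1" using J matrix_left_right_inverse[of A' J] by blast
    then have x: "A' *v u = x" unfolding u_def by (simp add: matrix_vector_mul_assoc)
    have "X *v x = B' *v u" unfolding x[symmetric] XY(1)[symmetric] by (simp add: matrix_vector_mul_assoc)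
    moreover have "Y *v x = B *v u + Y *v ((A' - A) *v u)"
    proof -
      have "x = A *v u + (A' - A) *v u" unfolding x[symmetric] by (simp add: matrix_minus_vec)
      then have "Y *v x = Y *v (A *v u) + Y *v ((A' - A) *v u)" by (metis matrix_vector_right_distrib)
      then show ?thesis unfolding XY(2)[symmetric] by (simp add: matrix_vector_mul_assoc)
    qed
    ultimately have "(X - Y) *v x = (B' - B) *v u - Y *v ((A' - A) *v u)" by (simp add: matrix_minus_vec)
    also have "norm \<dots> \<le> norm ((B' - B) *v u) + norm (Y *v ((A' - A) *v u))" by (rule norm_triangle_ineq4)
    also have "\<dots> \<le> \<delta>2 * norm u + g * (\<delta>1 * norm u)"
    proof (rule add_mono[OF d(2)])
      have "norm (Y *v ((A' - A) *v u)) \<le> mnorm Y * norm ((A' - A) *v u)" by (rule norm_matrix_le)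
      also have "\<dots> \<le> g * (\<delta>1 * norm u)"
        by (rule mult_mono[OF g d(1)]) (use mnorm_nonneg[of Y] g in auto)
      finally show "norm (Y *v ((A' - A) *v u)) \<le> g * (\<delta>1 * norm u)" .
    qed
    also have "\<dots> = (\<delta>2 + g * \<delta>1) * norm u" by (simp add: algebra_simps)
    also have "\<dots> \<le> (\<delta>2 + g * \<delta>1) * (2 / c * norm x)"
    proof (rule mult_left_mono)
      show "norm u \<le> 2 / c * norm x" using low[of u] c(1) unfolding x by (simp add: field_simps)
      show "0 \<le> \<delta>2 + g * \<delta>1" using nn g mnorm_nonneg[of Y] by simp
    qed
    finally show "norm ((X - Y) *v x) \<le> (\<delta>2 + g * \<delta>1) * (2 / c) * norm x" by (simp only: mult.assoc)
  qed
  ultimately show ?thesis by blast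
qed

locale base =
  fixes M0 E0 :: "'p::finite seq set"
  assumes E0: "finite E0" "orthonormal E0" "E0 \<subseteq> M0" and op0: "oproj M0"
    and P0: "\<And>f. f \<in> l2 \<Longrightarrow> proj M0 f = (\<Sum>e\<in>E0. smult (ip f e) e)"
    and inv: "bshift ` M0 \<subseteq> M0"
begin

lemma M0_l2: "m \<in> M0 \<Longrightarrow> m \<in> l2" by (rule oproj_sub[OF op0])

lemma M0_bshift: "m \<in> M0 \<Longrightarrow> (bshift ^^ n) m \<in> M0"
  by (induction n) (use inv in auto)

lemma M0_annihilated: assumes "m \<in> M0" shows "\<exists>p. p \<noteq> 0 \<and> papp bshift p m = 0"
proof (rule annihilator_exists[OF E0(1)])
  fix i
  have m: "(bshift ^^ i) m \<in> M0" by (rule M0_bshift[OF assms])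
  have "proj M0 ((bshift ^^ i) m) \<in> sv.span E0"
    unfolding P0[OF M0_l2[OF m]] by (intro sv.span_sum sv.span_scale sv.span_base)
  then show "(bshift ^^ i) m \<in> sv.span E0" unfolding proj_id[OF op0 m] .
qed

lemma Mseq_annihilated: assumes "m \<in> Mseq M0 k" shows "\<exists>p. p \<noteq> 0 \<and> papp bshift p m = 0"
proof -
  obtain p where p: "p \<noteq> 0" "papp bshift p ((bshift ^^ k) m) = 0"
    using M0_annihilated assms unfolding Mseq_iff by blast
  have "papp bshift (p * monom 1 k) m = papp bshift p (papp bshift (monom 1 k) m)" by (rule papp_bshift_mult)
  also have "\<dots> = 0" unfolding papp_monom using p(2) by simp
  finally show ?thesis using p(1) by (intro exI[of _ "p * monom 1 k"]) simp
qed

lemma M0_summ: assumes "m \<in> M0" shows "summ m"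
  using M0_annihilated[OF assms] annihilated_summ[OF M0_l2[OF assms]] by blast

lemma Mseq_summ: assumes "m \<in> Mseq M0 k" shows "summ m"
proof -
  have "summ ((bshift ^^ k) m)" using assms unfolding Mseq_iff by (rule M0_summ)
  then show ?thesis unfolding summ_def bshift_pow by (subst (asm) summable_iff_shift)
qed

lemma Mseq_proj:
  "oproj (Mseq M0 k)"
  "f \<in> l2 \<Longrightarrow> f - proj (Mseq M0 k) f = (shift ^^ k) ((bshift ^^ k) f - proj M0 ((bshift ^^ k) f))"
proof -
  have sub: "sv.subspace (Mseq M0 k)"
  proof -
    note s = oproj_subspace[OF op0]
    have "(bshift ^^ k) (0 :: 'p seq) = 0" by (simp add: fun_eq_iff bshift_pow zero_fun_apply)
    moreover have "(bshift ^^ k) (x + y) = (bshift ^^ k) x + (bshift ^^ k) y" for x y :: "'p seq"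
      by (simp add: fun_eq_iff bshift_pow plus_fun_apply)
    moreover have "(bshift ^^ k) (smult c x) = smult c ((bshift ^^ k) x)" for c and x :: "'p seq"
      by (simp add: fun_eq_iff bshift_pow smult_apply)
    ultimately show ?thesis unfolding sv.subspace_def
      using sv.subspace_0[OF s] sv.subspace_add[OF s] sv.subspace_scale[OF s] by (simp add: Ball_def Mseq_iff)
  qed
  have bl: "(bshift ^^ k) f \<in> l2" if "f \<in> l2" for f :: "'p seq" by (rule bop_l2[OF bop_pow[OF bop_bshift] that])
  have main: "\<exists>g \<in> Mseq M0 k. f - g = (shift ^^ k) ((bshift ^^ k) f - proj M0 ((bshift ^^ k) f)) \<and>
      (\<forall>m\<in>Mseq M0 k. ip (f - g) m = 0)" if f: "f \<in> l2" "\<And>m. m \<in> Mseq M0 k \<Longrightarrow> m \<in> l2" for f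
  proof -
    let ?y = "(bshift ^^ k) f"
    let ?d = "?y - proj M0 ?y"
    let ?g = "f - (shift ^^ k) ?d"
    have d: "?d \<in> l2" by (intro l2_diff bl f proj_l2[OF op0])
    have "(bshift ^^ k) ?g = ?y - (bshift ^^ k) ((shift ^^ k) ?d)"
      by (simp add: fun_eq_iff bshift_pow minus_apply)
    also have "\<dots> = proj M0 ?y" unfolding bshift_pow_shift by simp
    finally have "?g \<in> Mseq M0 k" unfolding Mseq_iff using proj_in[OF op0 bl[OF f(1)]] by simp
    moreover have "ip ((shift ^^ k) ?d) m = 0" if m: "m \<in> Mseq M0 k" for m
      unfolding ip_shift_pow[OF d f(2)[OF m]]
      by (rule proj_perp[OF op0 bl[OF f(1)]]) (use m in \<open>simp add: Mseq_iff\<close>)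
    ultimately show ?thesis by (intro bexI[of _ ?g]) simp_all
  qed
  have l2: "m \<in> l2" if "m \<in> Mseq M0 k" for m by (rule summ_l2[OF Mseq_summ[OF that]])
  show op: "oproj (Mseq M0 k)"
    unfolding oproj_def using sub l2 main[OF _ l2] by blast
  assume f: "f \<in> l2"
  obtain g where g: "g \<in> Mseq M0 k" "f - g = (shift ^^ k) ((bshift ^^ k) f - proj M0 ((bshift ^^ k) f))"
    "\<And>m. m \<in> Mseq M0 k \<Longrightarrow> ip (f - g) m = 0" using main[OF f l2] by blast
  have "proj (Mseq M0 k) f = g" by (rule oproj_unique[OF op f g(1,3)])
  then show "f - proj (Mseq M0 k) f = (shift ^^ k) ((bshift ^^ k) f - proj M0 ((bshift ^^ k) f))" using g(2) by simp
qed

definition C00 :: real where "C00 = (\<Sum>e\<in>E0. \<Sum>n. norm (e n))"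

lemma E0_summ: "e \<in> E0 \<Longrightarrow> summ e" using M0_summ E0(3) by blast

lemma C00_nonneg: "0 \<le> C00"
  unfolding C00_def by (intro sum_nonneg suminf_nonneg) (use E0_summ in \<open>auto simp: summ_def\<close>)

lemma P0_l1: assumes y: "summ y" shows "summ (proj M0 y)" "(\<Sum>n. norm (proj M0 y n)) \<le> C00 * (\<Sum>n. norm (y n))"
proof -
  note yl = summ_l2[OF y]
  have "summ (\<Sum>e\<in>A. smult (ip y e) e) \<and> (\<Sum>n. norm ((\<Sum>e\<in>A. smult (ip y e) e) n))
      \<le> (\<Sum>e\<in>A. \<Sum>n. norm (e n)) * (\<Sum>n. norm (y n))" if "A \<subseteq> E0" for A
    using finite_subset[OF that E0(1)] that
  proof (induction A rule: finite_induct)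
    case empty
    show ?case by (simp add: summ_def zero_fun_apply)
  next
    case (insert e A)
    let ?S = "\<Sum>e\<in>A. smult (ip y e) e"
    have e: "e \<in> E0" using insert.prems by simp
    have IH: "summ ?S" "(\<Sum>n. norm (?S n)) \<le> (\<Sum>e\<in>A. \<Sum>n. norm (e n)) * (\<Sum>n. norm (y n))"
      using insert.IH insert.prems by auto
    have se: "summ (smult (ip y e) e)" by (rule summ_smult[OF E0_summ[OF e]])
    have "cmod (ip y e) \<le> nrm y * nrm e" by (rule cmod_ip_le[OF yl on_l2[OF E0(2,1) e]])
    also have "\<dots> \<le> (\<Sum>n. norm (y n))" using nrm_le_l1[OF y] on_nrm[OF E0(2,1) e] by simp
    finally have c: "cmod (ip y e) \<le> (\<Sum>n. norm (y n))" .
    have en: "0 \<le> (\<Sum>n. norm (e n))" using E0_summ[OF e] by (intro suminf_nonneg) (simp_all add: summ_def)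
    have "(\<Sum>n. norm ((smult (ip y e) e + ?S) n)) \<le> (\<Sum>n. norm (smult (ip y e) e n)) + (\<Sum>n. norm (?S n))"
      by (rule l1_add_le[OF se IH(1)])
    also have "(\<Sum>n. norm (smult (ip y e) e n)) = cmod (ip y e) * (\<Sum>n. norm (e n))" by (rule l1_smult[OF E0_summ[OF e]])
    also have "\<dots> \<le> (\<Sum>n. norm (e n)) * (\<Sum>n. norm (y n))"
      using mult_right_mono[OF c en] by (simp only: mult.commute)
    finally have "(\<Sum>n. norm ((smult (ip y e) e + ?S) n)) \<le> ((\<Sum>n. norm (e n)) + (\<Sum>e\<in>A. \<Sum>n. norm (e n))) * (\<Sum>n. norm (y n))"
      using IH(2) unfolding distrib_right by linarith
    then show ?case unfolding sum.insert[OF insert.hyps] using summ_add[OF se IH(1)] by blast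
  qed
  from this[OF subset_refl]
  show "summ (proj M0 y)" "(\<Sum>n. norm (proj M0 y n)) \<le> C00 * (\<Sum>n. norm (y n))"
    unfolding P0[OF yl] C00_def by auto
qed

lemma tail_estimate:
  fixes r :: real
  assumes r: "0 < r" "r < 1" and f: "f \<in> l2" "\<And>n. norm (f n) \<le> c * r ^ n"
  shows "summ (f - proj (Mseq M0 k) f) \<and> (\<Sum>n. norm ((f - proj (Mseq M0 k) f) n)) \<le> (1 + C00) / (1 - r) * r ^ k * c"
proof -
  let ?y = "(bshift ^^ k) f"
  have y: "summ ?y" "(\<Sum>n. norm (?y n)) \<le> c / (1 - r) * r ^ k"
    using tail_geometric[OF r f(2), of k] by (simp_all add: bshift_pow)
  have nn: "?y - proj M0 ?y = ?y + smult (-1) (proj M0 ?y)" by (simp add: fun_eq_iff seq_apply)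
  have sp: "summ (smult (-1) (proj M0 ?y))" by (rule summ_smult[OF P0_l1(1)[OF y(1)]])
  have s: "summ (?y - proj M0 ?y)" unfolding nn by (rule summ_add[OF y(1) sp])
  have "(\<Sum>n. norm ((?y - proj M0 ?y) n)) \<le> (\<Sum>n. norm (?y n)) + (\<Sum>n. norm (smult (-1) (proj M0 ?y) n))"
    unfolding nn by (rule l1_add_le[OF y(1) sp])
  also have "(\<Sum>n. norm (smult (-1) (proj M0 ?y) n)) = (\<Sum>n. norm (proj M0 ?y n))"
    using l1_smult[OF P0_l1(1)[OF y(1)], of "-1"] by simp
  also have "\<dots> \<le> C00 * (\<Sum>n. norm (?y n))" by (rule P0_l1(2)[OF y(1)])
  also have "(\<Sum>n. norm (?y n)) + C00 * (\<Sum>n. norm (?y n)) = (1 + C00) * (\<Sum>n. norm (?y n))" by (simp add: distrib_right)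
  also have "\<dots> \<le> (1 + C00) * (c / (1 - r) * r ^ k)" by (rule mult_left_mono[OF y(2)]) (use C00_nonneg in simp)
  finally have "(\<Sum>n. norm ((?y - proj M0 ?y) n)) \<le> (1 + C00) / (1 - r) * r ^ k * c" by (simp add: mult_ac)
  then show ?thesis unfolding Mseq_proj(2)[OF f(1)] using shift_pow_l1[OF s, of k] by simp
qed

end

locale tower = nehari G C r + base M0 E0
  for G :: "real \<Rightarrow> complex^'p::finite^'q::finite" and C r and M0 E0 :: "'p seq set"
begin

definition kap :: "nat \<Rightarrow> real" where "kap k = (1 + C00) / (1 - r) * r ^ k"

lemma kap_nonneg: "0 \<le> kap k" unfolding kap_def using C00_nonneg r by simp

lemma kap_Suc: "kap (Suc k) \<le> kap k"
proof -
  have "r ^ Suc k \<le> r ^ k" by (rule power_decreasing) (use r in auto)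
  then show ?thesis unfolding kap_def by (rule mult_left_mono) (use C00_nonneg r in simp)
qed

lemma kap_tendsto: "(\<lambda>k. kap k * a) \<longlonglongrightarrow> 0"
proof -
  have "(\<lambda>k. (1 + C00) / (1 - r) * r ^ k * a) \<longlonglongrightarrow> (1 + C00) / (1 - r) * 0 * a"
    by (intro tendsto_mult tendsto_const LIMSEQ_power_zero) (use r in simp)
  then show ?thesis by (simp add: kap_def)
qed

lemma kap_eventually: assumes "0 < b" shows "\<exists>K. \<forall>k\<ge>K. kap k * a \<le> b"
proof -
  have "\<forall>\<^sub>F k in sequentially. kap k * a < b" by (rule order_tendstoD(2)[OF kap_tendsto assms])
  then show ?thesis unfolding eventually_sequentially by (meson less_imp_le)
qed

lemma kap_tail:
  assumes "y \<in> l2" "\<And>n. norm (y n) \<le> c * r ^ n"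
  shows "summ (y - proj (Mseq M0 k) y) \<and> (\<Sum>n. norm ((y - proj (Mseq M0 k) y) n)) \<le> kap k * c"
  unfolding kap_def by (rule tail_estimate[OF r assms])

abbreviation gk' :: "nat \<Rightarrow> real" where "gk' k \<equiv> opnorm_on H (Mseq M0 (Suc k))"

lemma Mseq_sub: "Mseq M0 k \<subseteq> l2" using oproj_sub[OF Mseq_proj(1)] by blast

lemma Mseq_E: "Eop u \<in> Mseq M0 (Suc k)"
proof -
  have "(bshift ^^ Suc k) (Eop u) = 0" by (rule ext) (simp only: bshift_pow, simp add: Eop_def zero_fun_apply)
  then show ?thesis unfolding Mseq_iff using sv.subspace_0[OF oproj_subspace[OF op0]] by simp
qed

lemmas gk'_props = opnorm_on_props[OF bopH Mseq_sub Mseq_E axis_seq_nonzero]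

lemma gk'_le: "gk' k \<le> gam"
proof (rule gk'_props(3))
  fix f assume "f \<in> Mseq M0 (Suc k)"
  then show "nrm (H f) \<le> gam * nrm f" using Mseq_sub gam_le by blast
qed

lemma gk'_approx: "\<exists>c1. \<forall>k. gam^2 - (gk' k)^2 \<le> kap k * c1"
proof -
  obtain j :: 'p where True by simp
  let ?v = "V (axis j 1)" and ?c = "cV (axis j 1)"
  have "?v \<noteq> 0"
  proof
    assume "?v = 0"
    then have "axis j (1::complex) = 0" using V_0[of "axis j 1"] by (simp add: zero_fun_apply)
    then show False by (simp add: axis_eq_0_iff)
  qed
  then have "nrm ?v \<noteq> 0" using nrm_zero_iff[OF V_l2] by simp
  then have v: "0 < nrm ?v" using nrm_nonneg[OF V_l2[of "axis j 1"]] by linarith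
  have "gam^2 - (gk' k)^2 \<le> kap k * (2 * gam * (gam * ?c / nrm ?v))" for k
  proof -
    let ?P = "proj (Mseq M0 (Suc k))"
    note op = Mseq_proj(1)[of "Suc k"]
    have Pl: "?P ?v \<in> l2" by (rule proj_l2[OF op V_l2])
    have t: "summ (?v - ?P ?v)" "(\<Sum>n. norm ((?v - ?P ?v) n)) \<le> kap (Suc k) * ?c"
      using kap_tail[OF V_l2 V_decay, of "axis j 1" "Suc k"] by blast+
    have "nrm (?v - ?P ?v) \<le> kap (Suc k) * ?c" using nrm_le_l1[OF t(1)] t(2) by linarith
    also have "\<dots> \<le> kap k * ?c" by (rule mult_right_mono[OF kap_Suc cV_nonneg])
    finally have d: "nrm (?v - ?P ?v) \<le> kap k * ?c" .
    have "gam * nrm ?v = nrm (H ?v)" using eig_max[OF V_l2] V_eig[of "axis j 1"] by (simp add: eigY_def)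
    also have "H ?v = H (?P ?v) + H (?v - ?P ?v)" using bop_diff[OF bopH V_l2 Pl] by simp
    also have "nrm \<dots> \<le> nrm (H (?P ?v)) + nrm (H (?v - ?P ?v))"
      by (rule nrm_triangle) (intro H_l2 Pl l2_diff V_l2)+
    also have "nrm (H (?P ?v)) \<le> gk' k * nrm (?P ?v)" by (rule gk'_props(1)[OF proj_in[OF op V_l2]])
    also have "\<dots> \<le> gk' k * nrm ?v" by (rule mult_left_mono[OF nrm_proj_le[OF op V_l2] gk'_props(2)])
    also have "nrm (H (?v - ?P ?v)) \<le> gam * nrm (?v - ?P ?v)" by (intro gam_le l2_diff V_l2 Pl)
    also have "\<dots> \<le> gam * (kap k * ?c)" by (rule mult_left_mono[OF d gam_nonneg])
    finally have "(gam - gk' k) * nrm ?v \<le> gam * (kap k * ?c)" by (simp add: left_diff_distrib)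
    then have 1: "gam - gk' k \<le> kap k * (gam * ?c / nrm ?v)" using v by (simp add: pos_le_divide_eq mult_ac)
    have "gam^2 - (gk' k)^2 = (gam + gk' k) * (gam - gk' k)" by (simp add: power2_eq_square algebra_simps)
    also have "\<dots> \<le> (2 * gam) * (kap k * (gam * ?c / nrm ?v))"
      by (rule mult_mono) (use 1 gk'_le[of k] gam_nonneg in simp_all)
    finally show ?thesis by (simp add: mult_ac)
  qed
  then show ?thesis by blast
qed

lemma Mseq_Suc: "Mseq M0 k \<subseteq> Mseq M0 (Suc k)"
proof
  fix g assume "g \<in> Mseq M0 k"
  then have "(bshift ^^ k) g \<in> M0" by (simp only: Mseq_iff)
  then have "bshift ((bshift ^^ k) g) \<in> M0" using inv by blast
  then show "g \<in> Mseq M0 (Suc k)" by (simp only: Mseq_iff funpow.simps o_apply)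
qed

lemma Mseq_shift: "m \<in> Mseq M0 k \<Longrightarrow> shift m \<in> Mseq M0 (Suc k)"
proof -
  have "(bshift ^^ Suc k) (shift m) = (bshift ^^ k) m"
    by (rule ext) (simp only: bshift_pow, simp add: shift_def)
  then show "m \<in> Mseq M0 k \<Longrightarrow> shift m \<in> Mseq M0 (Suc k)" by (simp only: Mseq_iff)
qed

lemma Mseq_bshift: "bshift ` Mseq M0 (Suc k) = Mseq M0 k"
proof
  have "(bshift ^^ k) (bshift g) = (bshift ^^ Suc k) g" for g :: "'p seq" by (simp add: funpow_swap1)
  then show "bshift ` Mseq M0 (Suc k) \<subseteq> Mseq M0 k" by (auto simp only: Mseq_iff)
  show "Mseq M0 k \<subseteq> bshift ` Mseq M0 (Suc k)"
  proof
    fix m assume "m \<in> Mseq M0 k"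
    from Mseq_shift[OF this] have "bshift (shift m) \<in> bshift ` Mseq M0 (Suc k)" by (rule imageI)
    moreover have "bshift (shift m) = m" by (simp add: fun_eq_iff bshift_def shift_def)
    ultimately show "m \<in> bshift ` Mseq M0 (Suc k)" by simp
  qed
qed

lemma central_close:
  "\<exists>K L. 0 \<le> L \<and> (\<forall>k\<ge>K. \<forall>\<Phi>. central_sol G (Mseq M0 (Suc k)) \<Phi> \<longrightarrow>
    rational_on_circle \<Phi> \<and> Linf \<Phi> \<and> (AE t in circ. mnorm (\<Phi> t - \<Phi>0 t) \<le> L * r ^ k))"
proof -
  obtain \<theta> where \<theta>: "0 \<le> \<theta>" "\<theta> < gam^2" "\<And>f. f \<in> l2 \<Longrightarrow> (nrm (H (shift f)))^2 \<le> \<theta> * (nrm f)^2"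
    using theta by blast
  obtain c1 where c1: "\<And>k. gam^2 - (gk' k)^2 \<le> kap k * c1" using gk'_approx by blast
  obtain c where c: "c > 0" "\<And>t u. t \<in> {0..2*pi} \<Longrightarrow> c * norm u \<le> norm (vm V t *v u)"
    using lower_bound by blast
  define \<epsilon> where "\<epsilon> = (gam^2 - \<theta>) / 2"
  have \<epsilon>: "0 < \<epsilon>" using \<theta>(2) by (simp add: \<epsilon>_def)
  obtain K1 where K1: "\<And>k. k \<ge> K1 \<Longrightarrow> kap k * c1 \<le> \<epsilon>" using kap_eventually[OF \<epsilon>] by blast
  define e where "e = (\<lambda>j. est2 (axis (j::'p) 1) \<epsilon> c1)"
  define c2 where "c2 = c0 / (1 - r) / (1 - r)"
  define E1 where "E1 = real CARD('p) * (\<Sum>j\<in>UNIV. e j)"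
  define E2 where "E2 = real CARD('q) * (\<Sum>j\<in>UNIV. c2 * e j)"
  have "0 < c / 2" using c(1) by simp
  then obtain K2 where K2: "\<And>k. k \<ge> K2 \<Longrightarrow> kap k * E1 \<le> c / 2" using kap_eventually by blast
  define L where "L = \<bar>(1 + C00) / (1 - r) * ((E2 + gam * E1) * (2 / c))\<bar>"
  have c20: "0 \<le> c2" unfolding c2_def using c0_nonneg r by simp
  have "rational_on_circle \<Phi> \<and> Linf \<Phi> \<and> (AE t in circ. mnorm (\<Phi> t - \<Phi>0 t) \<le> L * r ^ k)"
    if k: "k \<ge> max K1 K2" and cs: "central_sol G (Mseq M0 (Suc k)) \<Phi>" for k \<Phi>
  proof -
    have tek: "\<theta> + \<epsilon> \<le> (gk' k)^2" using c1[of k] K1[of k] k unfolding \<epsilon>_def by (simp add: field_simps)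
    interpret L: level G C r "Mseq M0 (Suc k)" "Mseq M0 k" \<theta>
    proof (unfold_locales)
      show "oproj (Mseq M0 (Suc k))" "oproj (Mseq M0 k)" by (rule Mseq_proj(1))+
      show "bshift ` Mseq M0 (Suc k) = Mseq M0 k" by (rule Mseq_bshift)
      show "Mseq M0 k \<subseteq> Mseq M0 (Suc k)" by (rule Mseq_Suc)
      show "\<And>m. m \<in> Mseq M0 k \<Longrightarrow> shift m \<in> Mseq M0 (Suc k)" by (rule Mseq_shift)
      show "\<And>u. Eop u \<in> Mseq M0 (Suc k)" by (rule Mseq_E)
      show "\<And>m. m \<in> Mseq M0 (Suc k) \<Longrightarrow> summ m" by (rule Mseq_summ)
      show "0 \<le> \<theta>" by (rule \<theta>(1))
      show "\<And>f. f \<in> l2 \<Longrightarrow> (nrm (H (shift f)))^2 \<le> \<theta> * (nrm f)^2" by (rule \<theta>(3))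
      show "\<theta> < (gk' k)^2" using tek \<epsilon> by linarith
    qed
    have est: "summ (L.Vk u - V u)" "(\<Sum>n. norm ((L.Vk u - V u) n)) \<le> kap k * est2 u \<epsilon> c1" for u
      using L.estimate[of \<epsilon> "kap k" c1 u] tek \<epsilon> kap_tail gk'_le[of k] c1[of k] kap_nonneg[of k]
      unfolding L.gk_def by blast+
    have ej: "0 \<le> kap k * e j" for j
    proof -
      have "0 \<le> (\<Sum>n. norm ((L.Vk (axis j 1) - V (axis j 1)) n))"
        by (rule suminf_nonneg) (use est(1)[of "axis j 1"] in \<open>simp_all add: summ_def\<close>)
      then show ?thesis using est(2)[of "axis j 1"] unfolding e_def by linarith
    qed
    have d1: "norm ((vm L.Vk t - vm V t) *v u) \<le> (kap k * E1) * norm u" for t u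
    proof -
      have "cmod ((vm L.Vk t - vm V t) $ i $ j) \<le> kap k * e j" for i j
      proof -
        have eq: "(vm L.Vk t - vm V t) $ i $ j = anal (L.Vk (axis j 1) - V (axis j 1)) i t"
          by (simp add: vm_def anal_diff[OF L.Vk_summ V_summ] del: Mseq.simps)
        show ?thesis unfolding eq e_def by (rule order_trans[OF anal_bound[OF est(1)] est(2)])
      qed
      from matrix_column_bound[OF this] show ?thesis
        unfolding E1_def sum_distrib_left[symmetric] by (simp only: mult.left_commute)
    qed
    have d2: "norm ((wm L.Vk t - wm V t) *v u) \<le> (kap k * E2) * norm u" for t u
    proof -
      have "cmod ((wm L.Vk t - wm V t) $ i $ j) \<le> kap k * (c2 * e j)" for i j
      proof -
        let ?d = "L.Vk (axis j 1) - V (axis j 1)"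
        have dl: "?d \<in> l2" by (rule summ_l2[OF est(1)])
        have "(wm L.Vk t - wm V t) $ i $ j = coan (H ?d) i t"
          by (simp add: wm_def bop_diff[OF bopH L.Vk_l2 V_l2] coan_diff[OF H_summ[OF L.Vk_l2] H_summ[OF V_l2]] del: Mseq.simps)
        then have "cmod ((wm L.Vk t - wm V t) $ i $ j) \<le> (\<Sum>n. norm (H ?d n))"
          using coan_bound[OF H_summ[OF dl], of i t] by (simp only:)
        also have "\<dots> \<le> c2 * nrm ?d" unfolding c2_def by (rule H_l1[OF dl])
        also have "\<dots> \<le> c2 * (kap k * e j)"
          by (rule mult_left_mono[OF _ c20])
            (use nrm_le_l1[OF est(1)[of "axis j 1"]] est(2)[of "axis j 1"] in \<open>simp add: e_def\<close>)
        finally show ?thesis by (simp only: mult.left_commute)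
      qed
      from matrix_column_bound[OF this] show ?thesis
        unfolding E2_def sum_distrib_left[symmetric] by (simp only: mult.left_commute)
    qed
    have E1n: "0 \<le> kap k * E1"
      unfolding E1_def using ej by (simp add: sum_distrib_left mult.left_commute sum_nonneg)
    have E2n: "0 \<le> kap k * E2"
    proof -
      have "kap k * E2 = real CARD('q) * (\<Sum>j\<in>UNIV. c2 * (kap k * e j))"
        unfolding E2_def by (simp add: sum_distrib_left mult.left_commute)
      also have "\<dots> \<ge> 0" by (intro mult_nonneg_nonneg sum_nonneg c20 ej) simp
      finally show ?thesis .
    qed
    have s: "kap k * E1 \<le> c / 2" using K2 k by simp
    have "AE t in circ. \<forall>j i. (\<Sum>l\<in>UNIV. \<Phi> t $ i $ l * anal (L.Vk (axis j 1)) l t) = coan (H (L.Vk (axis j 1))) i t"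
      by (rule eventually_all_finite, rule eventually_all_finite, rule L.central_product[OF cs])
    then have prod: "AE t in circ. \<Phi> t ** vm L.Vk t = wm L.Vk t"
      by eventually_elim (simp add: vec_eq_iff matrix_matrix_mult_def vm_def wm_def)
    have "AE t in circ. t \<in> {0..2*pi}" by (rule AE_I2) simp
    with prod \<Phi>0_le have main: "AE t in circ. det (vm L.Vk t) \<noteq> 0 \<and> \<Phi> t ** vm L.Vk t = wm L.Vk t \<and> mnorm (\<Phi>0 t) \<le> gam \<and>
        mnorm (\<Phi> t - \<Phi>0 t) \<le> L * r ^ k"
    proof eventually_elim
      case (elim t)
      have pq: "det (vm L.Vk t) \<noteq> 0 \<and> mnorm (\<Phi> t - \<Phi>0 t) \<le> (kap k * E2 + gam * (kap k * E1)) * (2 / c)"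
        by (rule perturbed_quotient[OF elim(1) \<Phi>0_eq c(1) c(2)[OF elim(3)] d1 d2 s elim(2) E1n E2n])
      have "(kap k * E2 + gam * (kap k * E1)) * (2 / c) = (1 + C00) / (1 - r) * ((E2 + gam * E1) * (2 / c)) * r ^ k"
      proof -
        have "(x * E2 + gam * (x * E1)) * y = x * ((E2 + gam * E1) * y)" for x y by (simp add: algebra_simps)
        note gen = this[of "kap k" "2 / c"]
        show ?thesis unfolding gen unfolding kap_def by (simp only: mult_ac)
      qed
      also have "\<dots> \<le> L * r ^ k" unfolding L_def by (rule mult_right_mono[OF abs_ge_self]) (use r in simp)
      finally show ?case using pq elim by simp
    qed
    have "rational_on_circle \<Phi>"
    proof (rule rational_quotient[OF L.Vk_summ Mseq_annihilated[OF L.Vk_M]])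
      show "AE t in circ. det (vm L.Vk t) \<noteq> 0 \<and> \<Phi> t ** vm L.Vk t = wm L.Vk t"
        using main by eventually_elim blast
    qed
    moreover have "Linf \<Phi>"
    proof (rule LinfI)
      show "(\<lambda>t. \<Phi> t $ i $ j) \<in> borel_measurable circ" for i j using cs by (simp add: central_sol_def L2m_def)
      show "AE t in circ. mnorm (\<Phi> t) \<le> L * r ^ k + gam"
        using main
      proof eventually_elim
        case (elim t)
        have "mnorm (\<Phi> t) = mnorm ((\<Phi> t - \<Phi>0 t) - (0 - \<Phi>0 t))" by simp
        also have "\<dots> \<le> mnorm (\<Phi> t - \<Phi>0 t) + mnorm (0 - \<Phi>0 t)" by (rule mnorm_diff)
        also have "mnorm (0 - \<Phi>0 t) \<le> mnorm (\<Phi>0 t)"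
          using mnorm_minus[of "\<Phi>0 t"] by simp
        finally show ?case using elim by linarith
      qed
    qed
    moreover have "AE t in circ. mnorm (\<Phi> t - \<Phi>0 t) \<le> L * r ^ k" using main by eventually_elim blast
    ultimately show ?thesis by blast
  qed
  moreover have "0 \<le> L" by (simp add: L_def)
  ultimately show ?thesis by blast
qed

lemma supnorm_close:
  "\<exists>K L. 0 \<le> L \<and> (\<forall>k\<ge>K. \<forall>F \<Phi>. nehari_optimal G F \<longrightarrow> central_sol G (Mseq M0 (Suc k)) \<Phi> \<longrightarrow>
    supnorm (\<lambda>t. (G t - \<Phi> t) - F t) \<le> ereal (L * r ^ k))"
proof -
  obtain K L where KL: "0 \<le> L" "\<And>k \<Phi>. k \<ge> K \<Longrightarrow> central_sol G (Mseq M0 (Suc k)) \<Phi> \<Longrightarrow>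
      AE t in circ. mnorm (\<Phi> t - \<Phi>0 t) \<le> L * r ^ k"
    using central_close by blast
  have "supnorm (\<lambda>t. (G t - \<Phi> t) - F t) \<le> ereal (L * r ^ k)"
    if k: "k \<ge> K" and F: "nehari_optimal G F" and cs: "central_sol G (Mseq M0 (Suc k)) \<Phi>" for k F \<Phi>
  proof (rule supnorm_le)
    fix i j
    have "Linf F" using F by (simp add: nehari_optimal_def Hinf_def)
    then have "(\<lambda>t. F t $ i $ j) \<in> borel_measurable circ" by (rule Linf_measurable)
    moreover have "(\<lambda>t. \<Phi> t $ i $ j) \<in> borel_measurable circ" using cs by (simp add: central_sol_def L2m_def)
    ultimately show "(\<lambda>t. (G t - \<Phi> t - F t) $ i $ j) \<in> borel_measurable circ"
      using Linf_measurable[OF GL, of i j] by simp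
  next
    show "AE t in circ. mnorm (G t - \<Phi> t - F t) \<le> L * r ^ k"
      using optimal_unique(1)[OF F] KL(2)[OF k cs]
    proof eventually_elim
      case (elim t)
      have e: "G t - \<Phi> t - F t = - (\<Phi> t - \<Phi>0 t)" unfolding elim(1)[symmetric] by simp
      show ?case unfolding e by (rule order_trans[OF mnorm_minus elim(2)])
    qed
  qed
  then show ?thesis using KL(1) by blast
qed

end

lemma supnorm_nonneg: "0 \<le> supnorm (\<Phi> :: real \<Rightarrow> complex^'p::finite^'q::finite)"
proof (rule ccontr)
  assume "\<not> 0 \<le> supnorm \<Phi>"
  then have "supnorm \<Phi> < 0" by simp
  then obtain b where b: "supnorm \<Phi> < ereal b" "ereal b < 0" using ereal_dense2 by blast
  have "AE t in circ. mnorm (\<Phi> t) \<le> b" by (rule supnorm_AE[OF less_imp_le[OF b(1)]])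
  then have "AE t in circ. (1::complex) = 0"
  proof eventually_elim
    case (elim t)
    then show ?case using mnorm_nonneg[of "\<Phi> t"] b(2) by simp
  qed
  then have "fc (\<lambda>t. 1) 0 = fc (\<lambda>t. 0) 0" by (intro fc_cong_AE) simp_all
  then show False unfolding fc_one by (simp add: fc_ee)
qed

lemma nehari_intro:
  fixes G :: "real \<Rightarrow> complex^'p::finite^'q::finite"
  assumes "Linf G" "\<exists>B. finite B \<and> (hank G :: 'p seq \<Rightarrow> 'q seq) ` l2 \<subseteq> cspan B"
    "\<forall>h. maximizing G h \<longrightarrow> h 0 \<noteq> 0" "span_dim {h. maximizing G h} CARD('p)"
    and d: "annihilates d (range (hcol G))" and r: "0 < r" "r < 1" "\<And>a. poly d a = 0 \<Longrightarrow> cmod a < r"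
  shows "\<exists>C. nehari G C r"
proof -
  have "\<exists>C. \<forall>n. norm (hcol G j n) \<le> C * r ^ n" for j
    by (rule decay_annihilated[OF r(1) _ _ r(3)]) (use d in \<open>auto simp: annihilates_def\<close>)
  then have ex: "\<forall>j. \<exists>c. \<forall>n. norm (hcol G j n) \<le> c * r ^ n" by blast
  obtain C where "\<forall>j n. norm (hcol G j n) \<le> C j * r ^ n" using choice[OF ex] by blast
  then have C: "\<And>j n. norm (hcol G j n) \<le> C j * r ^ n" by blast
  have "norm (hcol G j n) \<le> (\<Sum>j\<in>UNIV. \<bar>C j\<bar>) * r ^ n" for j n
  proof -
    have "C j \<le> (\<Sum>j\<in>UNIV. \<bar>C j\<bar>)" using member_le_sum[of j UNIV "\<lambda>j. \<bar>C j\<bar>"] by simp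
    then have "C j * r ^ n \<le> (\<Sum>j\<in>UNIV. \<bar>C j\<bar>) * r ^ n" by (rule mult_right_mono) (use r in simp)
    then show ?thesis using C[of j n] by linarith
  qed
  then have "nehari G (\<Sum>j\<in>UNIV. \<bar>C j\<bar>) r" using assms by (intro nehari.intro) blast+
  then show ?thesis by blast
qed

theorem theorem3p1:
  fixes G :: "real \<Rightarrow> complex^'p::finite^'q::finite" and M0 :: "'p seq set"
  assumes G: "Linf G"
    and C1: "\<exists>B. finite B \<and> (hank G :: 'p seq \<Rightarrow> 'q seq) ` l2 \<subseteq> cspan B"
    and C2a: "\<forall>h. maximizing G h \<longrightarrow> h 0 \<noteq> 0"
    and C2b: "span_dim {h. maximizing G h} CARD('p)"
    and M0: "fin_dim_subspace M0"
    and M0inv: "bshift ` M0 \<subseteq> M0"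
  shows "(\<forall>F. nehari_optimal G F \<longrightarrow>
             rational_on_circle (\<lambda>t. G t - F t) \<and> Linf (\<lambda>t. G t - F t))
       \<and> (\<exists>K. \<forall>k\<ge>K. \<forall>\<Phi>. central_sol G (Mseq M0 k) \<Phi> \<longrightarrow> rational_on_circle \<Phi> \<and> Linf \<Phi>)
       \<and> (\<forall>F \<Phi>s. nehari_optimal G F \<longrightarrow> (\<forall>k\<ge>1. central_sol G (Mseq M0 k) (\<Phi>s k)) \<longrightarrow>
             (\<lambda>k. supnorm (\<lambda>t. (G t - \<Phi>s k t) - F t)) \<longlonglongrightarrow> 0)
       \<and> (\<forall>F r. nehari_optimal G F \<longrightarrow> 0 < r \<longrightarrow> r < 1 \<longrightarrow> poles_in G r \<longrightarrow>
             (\<exists>L>0. \<exists>K. \<forall>k\<ge>K. \<forall>\<Phi>. central_sol G (Mseq M0 k) \<Phi> \<longrightarrow>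
                supnorm (\<lambda>t. (G t - \<Phi> t) - F t) < ereal (L * r ^ k)))"
proof -
  obtain E0 where E0: "base M0 E0"
  proof (rule fin_dim_onb[OF M0])
    fix E
    assume "finite E" "orthonormal E" "E \<subseteq> M0" "oproj M0"
      "\<And>f. f \<in> l2 \<Longrightarrow> proj M0 f = (\<Sum>e\<in>E. smult (ip f e) e)"
    then have "base M0 E" using M0inv by (rule base.intro)
    then show thesis by (rule that)
  qed
  obtain p where p: "annihilates p (range (hcol G))" using finite_rank_annihilator C1 by blast
  obtain d where d: "annihilates d (range (hcol G))" "\<And>a. poly d a = 0 \<Longrightarrow> cmod a < 1"
    "\<And>r a. poles_in G r \<Longrightarrow> poly d a = 0 \<Longrightarrow> cmod a < r"
    by (rule kronecker[OF hcol_tendsto_0[OF G] p]) blast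
  have tower: "\<exists>C. tower G C r M0 E0" if r: "0 < r" "r < 1" "\<And>a. poly d a = 0 \<Longrightarrow> cmod a < r" for r
  proof -
    obtain C where "nehari G C r" using nehari_intro[OF G C1 C2a C2b d(1) r] by blast
    then have "tower G C r M0 E0" using E0 by (rule tower.intro)
    then show ?thesis by blast
  qed
  have "d \<noteq> 0" using d(1) by (simp add: annihilates_def)
  then obtain \<rho> where \<rho>: "0 < \<rho>" "\<rho> < 1" "\<And>a. poly d a = 0 \<Longrightarrow> cmod a < \<rho>"
    using roots_radius[of d 1] d(2) by auto
  obtain C where "tower G C \<rho> M0 E0" using tower[OF \<rho>] by blast
  then interpret tower G C \<rho> M0 E0 .
  obtain K0 L0 where KL0: "\<And>k \<Phi>. k \<ge> K0 \<Longrightarrow> central_sol G (Mseq M0 (Suc k)) \<Phi> \<Longrightarrow> rational_on_circle \<Phi> \<and> Linf \<Phi>"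
    using central_close by blast
  have 2: "rational_on_circle \<Phi> \<and> Linf \<Phi>" if "k \<ge> Suc K0" "central_sol G (Mseq M0 k) \<Phi>" for k \<Phi>
    using that KL0[of "k - 1"] by (cases k) (simp_all del: Mseq.simps)
  have 3: "(\<lambda>k. supnorm (\<lambda>t. (G t - \<Phi>s k t) - F t)) \<longlonglongrightarrow> 0"
    if F: "nehari_optimal G F" and cs: "\<And>k. k \<ge> 1 \<Longrightarrow> central_sol G (Mseq M0 k) (\<Phi>s k)" for F \<Phi>s
  proof -
    obtain K L where KL: "\<And>k F \<Phi>. k \<ge> K \<Longrightarrow> nehari_optimal G F \<Longrightarrow> central_sol G (Mseq M0 (Suc k)) \<Phi> \<Longrightarrow>
        supnorm (\<lambda>t. (G t - \<Phi> t) - F t) \<le> ereal (L * \<rho> ^ k)"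
      using supnorm_close by blast
    have le: "supnorm (\<lambda>t. (G t - \<Phi>s (Suc k) t) - F t) \<le> ereal (L * \<rho> ^ k)" if "k \<ge> K" for k
      by (rule KL[OF that F]) (rule cs, simp)
    have "(\<lambda>k. L * \<rho> ^ k) \<longlonglongrightarrow> L * 0"
      by (intro tendsto_mult tendsto_const LIMSEQ_power_zero) (use \<rho> in simp)
    then have "(\<lambda>k. ereal (L * \<rho> ^ k)) \<longlonglongrightarrow> ereal (L * 0)" by (rule tendsto_ereal)
    then have lim: "(\<lambda>k. ereal (L * \<rho> ^ k)) \<longlonglongrightarrow> 0" by (simp add: zero_ereal_def)
    have "(\<lambda>k. supnorm (\<lambda>t. (G t - \<Phi>s (Suc k) t) - F t)) \<longlonglongrightarrow> 0"
    proof (rule tendsto_sandwich[OF _ _ tendsto_const lim])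
      show "\<forall>\<^sub>F k in sequentially. 0 \<le> supnorm (\<lambda>t. (G t - \<Phi>s (Suc k) t) - F t)"
        by (simp add: supnorm_nonneg)
      show "\<forall>\<^sub>F k in sequentially. supnorm (\<lambda>t. (G t - \<Phi>s (Suc k) t) - F t) \<le> ereal (L * \<rho> ^ k)"
        unfolding eventually_sequentially using le by blast
    qed
    then show ?thesis by (rule LIMSEQ_imp_Suc)
  qed
  have 4: "\<exists>L>0. \<exists>K. \<forall>k\<ge>K. \<forall>\<Phi>. central_sol G (Mseq M0 k) \<Phi> \<longrightarrow>
                supnorm (\<lambda>t. (G t - \<Phi> t) - F t) < ereal (L * s ^ k)"
    if F: "nehari_optimal G F" and s: "0 < s" "s < 1" "poles_in G s" for F s
  proof -
    obtain C' where t: "tower G C' s M0 E0" using tower[OF s(1,2)] d(3)[OF s(3)] by blast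
    obtain K L where L: "0 \<le> L" and KL: "\<And>k F \<Phi>. k \<ge> K \<Longrightarrow> nehari_optimal G F \<Longrightarrow> central_sol G (Mseq M0 (Suc k)) \<Phi> \<Longrightarrow>
        supnorm (\<lambda>t. (G t - \<Phi> t) - F t) \<le> ereal (L * s ^ k)"
      using tower.supnorm_close[OF t] by blast
    have "supnorm (\<lambda>t. (G t - \<Phi> t) - F t) < ereal ((L / s + 1) * s ^ k)"
      if k: "k \<ge> Suc K" and cs: "central_sol G (Mseq M0 k) \<Phi>" for k \<Phi>
    proof -
      obtain k' where k': "k = Suc k'" "k' \<ge> K" using k by (cases k) simp_all
      have "supnorm (\<lambda>t. (G t - \<Phi> t) - F t) \<le> ereal (L * s ^ k')"
        by (rule KL[OF k'(2) F]) (use cs k'(1) in \<open>simp only:\<close>)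
      also have "\<dots> < ereal ((L / s + 1) * s ^ k)" using s by (simp add: k'(1) field_simps)
      finally show ?thesis .
    qed
    moreover have "0 < L / s + 1" using L s(1) by (simp add: add_nonneg_pos)
    ultimately show ?thesis by blast
  qed
  show ?thesis
  proof (intro conjI allI impI)
    fix F assume F: "nehari_optimal G F"
    show "rational_on_circle (\<lambda>t. G t - F t)" by (rule optimal_rational[OF F])
    show "Linf (\<lambda>t. G t - F t)" by (rule optimal_unique(2)[OF F])
  next
    show "\<exists>K. \<forall>k\<ge>K. \<forall>\<Phi>. central_sol G (Mseq M0 k) \<Phi> \<longrightarrow> rational_on_circle \<Phi> \<and> Linf \<Phi>"
      using 2 by blast
  next
    fix F \<Phi>s assume "nehari_optimal G F" "\<forall>k\<ge>1. central_sol G (Mseq M0 k) (\<Phi>s k)"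
    then show "(\<lambda>k. supnorm (\<lambda>t. (G t - \<Phi>s k t) - F t)) \<longlonglongrightarrow> 0" by (intro 3) blast+
  next
    fix F r assume "nehari_optimal G F" "0 < r" "r < 1" "poles_in G r"
    then show "\<exists>L>0. \<exists>K. \<forall>k\<ge>K. \<forall>\<Phi>. central_sol G (Mseq M0 k) \<Phi> \<longrightarrow>
                supnorm (\<lambda>t. (G t - \<Phi> t) - F t) < ereal (L * r ^ k)" by (rule 4)
  qed
qed

end
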